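(* Let $(M,\mathfrak g)$ be an $(n+1)$-dimensional semi-Riemannian manifold of index $\nu$ and let $\gamma:[0,T]\to M$ be a closed non-lightlike geodesic with spectral index $\iota_{\mathrm{spec}}(\gamma)$. If either (OR) $\gamma$ is oriented and $\iota_{\mathrm{spec}}(\gamma)+n$ is odd, or (NOR) $\gamma$ is non-oriented and $\iota_{\mathrm{spec}}(\gamma)+n$ is even, then $\gamma$ is linearly unstable.
   Context: **Setting.** $(M,\mathfrak g)$ is a semi-Riemannian manifold of dimension $n+1$ and index $\nu$ (number of negative directions), with Levi-Civita connection $\nabla$ and curvature $\mathcal R(X,Y)=[\nabla_X,\nabla_Y]-\nabla_{[X,Y]}$. A closed geodesic is a smooth $\gamma:[0,T]\to M$ with $\frac{D}{dt}\dot\gamma=0$, $\gamma(0)=\gamma(T)$, $\dot\gamma(0)=\dot\gamma(T)$. It is non-lightlike if the constant $\mathfrak g(\dot\gamma,\dot\gamma)$ is nonzero; spacelike if it is positive, timelike if negative. Let $e_1,\dots,e_n$ be a parallel $\mathfrak g$-orthonormal frame along $\gamma$ of the $\mathfrak g$-orthogonal complement of $\dot\gamma$, with the vectors of positive square first. Put $G=\mathrm{diag}(I_{n-\kappa},-I_\kappa)$ with $\kappa=\nu$ if $\gamma$ is spacelike and $\kappa=\nu-1$ if timelike. Let $A=[a_{ij}]$ be defined by $e_j(T)=\sum_i a_{ij}e_i(0)$ (so $\xi=\sum u_ie_i$ satisfies $\xi(0)=\xi(T)$ iff $u(0)=Au(T)$); it satisfies $A^{\mathsf T}GA=G$. Let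 $\widehat R_{ij}(t)=\mathfrak g(\mathcal R(\dot\gamma,e_i)\dot\gamma,e_j)$, a symmetric matrix. **Orientation.** $\gamma$ is oriented if $\det A=1$, non-oriented if $\det A=-1$. **Linear stability.** Let $N=\{v\in T_{\gamma(0)}M:\mathfrak g(v,\dot\gamma(0))=0\}$ and let the linearized Poincaré map $\mathfrak P:N\oplus N\to N\oplus N$ be $\mathfrak P(v,v')=(\xi(T),\frac{D}{dt}\xi(T))$, where $\xi$ is the solution of the Jacobi equation $-\frac{D^2}{dt^2}\xi+\mathcal R(\dot\gamma,\xi)\dot\gamma=0$ with $\xi(0)=v$, $\frac{D}{dt}\xi(0)=v'$. $\gamma$ is linearly stable if $\mathfrak P$ is semisimple (diagonalizable over $\mathbf C$) with spectrum contained in the unit circle; otherwise it is linearly unstable. **Spectral index.** For $s\ge0$, let $\mathcal A_{1,s}=-G\frac{d^2}{dt^2}+\widehat R(t)+sG$, a selfadjoint Fredholm operator in $L^2([0,T],\mathbf C^n)$ with domain $\{u\in W^{2,2}([0,T],\mathbf C^n):u(0)=Au(T),\ \dot u(0)=A\dot u(T)\}$. There is $s_0>0$ such that $\mathcal A_{1,s}$ has trivial kernel for all $s\ge s_0$; set $\iota_{\mathrm{spec}}(\gamma)=\mathrm{sf}(\mathcal A_{1,s};s\in[0,s_0])$ (independent of such $s_0$). The spectral flow of a continuous path $(\mathcal A_t)_{t\in[c,d]}$ of selfadjoint Fredholm operators is $\sum_{i=1}^N\big(\dim E_{[0,a_i]}(\mathcal A_{t_i})-\dim E_{[0,a_i]}(\mathcal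 A_{t_{i-1}})\big)$, where $c=t_0<\dots<t_N=d$ and $a_i>0$ are chosen so that, for $t\in[t_{i-1},t_i]$, $\pm a_i\notin\sigma(\mathcal A_t)$ and the spectrum of $\mathcal A_t$ in $[-a_i,a_i]$ consists of eigenvalues of finite total multiplicity independent of $t$; $E_{[0,a]}$ is the sum of eigenspaces for eigenvalues in $[0,a]$. *)

theory Defs
  imports
    "HOL-Analysis.Analysis"
    "HOL-Library.Function_Algebras"
    "Jordan_Normal_Form.Determinant"
begin

section \<open>Smooth maps\<close>

text \<open>The set \<open>S\<close> is meant to be open; \<open>Ck_on k S f\<close> says that all iterated partial
  derivatives of \<open>f\<close> of order at most \<open>k\<close> exist and are continuous on \<open>S\<close>.\<close>

primrec Ck_on :: "nat \<Rightarrow> 'e::euclidean_space set \<Rightarrow> ('e \<Rightarrow> 'b::real_normed_vector) \<Rightarrow> bool" where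
  "Ck_on 0 S f \<longleftrightarrow> continuous_on S f"
| "Ck_on (Suc k) S f \<longleftrightarrow>
     f differentiable_on S \<and> (\<forall>b\<in>Basis. Ck_on k S (\<lambda>x. frechet_derivative f (at x) b))"

definition smooth_on :: "'e::euclidean_space set \<Rightarrow> ('e \<Rightarrow> 'b::real_normed_vector) \<Rightarrow> bool" where
  "smooth_on S f \<longleftrightarrow> (\<forall>k. Ck_on k S f)"

text \<open>Smoothness of a curve on a relatively open subset \<open>J\<close> of a compact interval, with one-sided
  derivatives at the end points; \<open>D k\<close> is the \<open>k\<close>-th derivative.\<close>

definition smooth_curve_on :: "real set \<Rightarrow> (real \<Rightarrow> 'b::real_normed_vector) \<Rightarrow> bool" where
  "smooth_curve_on J x \<longleftrightarrow>
     (\<exists>D :: nat \<Rightarrow> real \<Rightarrow> 'b.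
        (\<forall>t\<in>J. D 0 t = x t) \<and>
        (\<forall>k. \<forall>t\<in>J. (D k has_vector_derivative D (Suc k) t) (at t within J)))"

section \<open>Semi-Riemannian manifolds\<close>

text \<open>A chart is a pair of its domain and its coordinate map. The points of the manifold are the
  elements of the type \<open>'a\<close>; the model space is the Euclidean space \<open>'e\<close>.\<close>

type_synonym ('a, 'e) chart = "'a set \<times> ('a \<Rightarrow> 'e)"

abbreviation chart_inv :: "('a, 'e) chart \<Rightarrow> 'e \<Rightarrow> 'a" where
  "chart_inv c \<equiv> inv_into (fst c) (snd c)"

definition smooth_atlas ::
  "('a::{t2_space,second_countable_topology}, 'e::euclidean_space) chart set \<Rightarrow> bool" where
  "smooth_atlas \<A> \<longleftrightarrow>
     (\<forall>c\<in>\<A>. open (fst c) \<and> open (snd c ` fst c) \<and>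
        homeomorphism (fst c) (snd c ` fst c) (snd c) (chart_inv c)) \<and>
     (\<Union>c\<in>\<A>. fst c) = UNIV \<and>
     (\<forall>c\<in>\<A>. \<forall>d\<in>\<A>. smooth_on (snd c ` (fst c \<inter> fst d)) (snd d \<circ> chart_inv c))"

text \<open>Every point \<open>p\<close> has a preferred chart, and the tangent space at \<open>p\<close> is \<open>'e\<close>, a vector
  standing for the tangent vector whose components in the preferred chart at \<open>p\<close> it lists.
  Components in other charts are obtained by applying the derivative of the transition map.\<close>

definition chart_at :: "('a, 'e) chart set \<Rightarrow> 'a \<Rightarrow> ('a, 'e) chart" where
  "chart_at \<A> p = (SOME c. c \<in> \<A> \<and> p \<in> fst c)"

definition transition_deriv ::
  "('a, 'e::euclidean_space) chart \<Rightarrow> ('a, 'e) chart \<Rightarrow> 'a \<Rightarrow> 'e \<Rightarrow> 'e" where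
  "transition_deriv c d p = frechet_derivative (snd d \<circ> chart_inv c) (at (snd c p))"

definition components ::
  "('a, 'e::euclidean_space) chart set \<Rightarrow> ('a, 'e) chart \<Rightarrow> 'a \<Rightarrow> 'e \<Rightarrow> 'e" where
  "components \<A> c p v = transition_deriv (chart_at \<A> p) c p v"

text \<open>A \<open>(0,2)\<close>-tensor field assigns to \<open>p\<close> a form on the tangent space at \<open>p\<close>. The next
  definition is its coordinate representation in the chart \<open>c\<close>, at the coordinate point \<open>x\<close>.\<close>

definition metric_in ::
  "('a, 'e::euclidean_space) chart set \<Rightarrow> ('a \<Rightarrow> 'e \<Rightarrow> 'e \<Rightarrow> real) \<Rightarrow> ('a, 'e) chart \<Rightarrow>
     'e \<Rightarrow> 'e \<Rightarrow> 'e \<Rightarrow> real" where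
  "metric_in \<A> g c x v w =
     (let p = chart_inv c x; d = chart_at \<A> p
      in g p (transition_deriv c d p v) (transition_deriv c d p w))"

definition form_index :: "('e::euclidean_space \<Rightarrow> 'e \<Rightarrow> real) \<Rightarrow> nat" where
  "form_index b = Max {dim W | W. subspace W \<and> (\<forall>v\<in>W. v \<noteq> 0 \<longrightarrow> b v v < 0)}"

definition semi_riemannian_manifold ::
  "('a::{t2_space,second_countable_topology}, 'e::euclidean_space) chart set \<Rightarrow>
     ('a \<Rightarrow> 'e \<Rightarrow> 'e \<Rightarrow> real) \<Rightarrow> nat \<Rightarrow> bool" where
  "semi_riemannian_manifold \<A> g \<nu> \<longleftrightarrow>
     smooth_atlas \<A> \<and>
     (\<forall>p. bilinear (g p) \<and> (\<forall>v w. g p v w = g p w v) \<and>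
          (\<forall>v. (\<forall>w. g p v w = 0) \<longrightarrow> v = 0) \<and> form_index (g p) = \<nu>) \<and>
     (\<forall>c\<in>\<A>. \<forall>v w. smooth_on (snd c ` fst c) (\<lambda>x. metric_in \<A> g c x v w))"

text \<open>The Levi-Civita connection in the chart \<open>c\<close> is \<open>\<nabla>\<^sub>v w = Dw v + \<Gamma> v w\<close>, where \<open>\<Gamma>\<close> is
  determined by being torsion-free (symmetric) and metric.\<close>

definition christoffel ::
  "('a, 'e::euclidean_space) chart set \<Rightarrow> ('a \<Rightarrow> 'e \<Rightarrow> 'e \<Rightarrow> real) \<Rightarrow> ('a, 'e) chart \<Rightarrow>
     'e \<Rightarrow> 'e \<Rightarrow> 'e \<Rightarrow> 'e" where
  "christoffel \<A> g c x =
     (THE \<Gamma>. bilinear \<Gamma> \<and> (\<forall>v w. \<Gamma> v w = \<Gamma> w v) \<and>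
        (\<forall>z v w. frechet_derivative (\<lambda>y. metric_in \<A> g c y v w) (at x) z =
                  metric_in \<A> g c x (\<Gamma> z v) w + metric_in \<A> g c x v (\<Gamma> z w)))"

text \<open>\<open>\<R>(v,w)z = \<nabla>\<^sub>v\<nabla>\<^sub>w z - \<nabla>\<^sub>w\<nabla>\<^sub>v z - \<nabla>\<^sub>[\<^sub>v\<^sub>,\<^sub>w\<^sub>] z\<close>, evaluated on the fields with constant components in
  the preferred chart at \<open>p\<close> (so that the bracket vanishes).\<close>

definition curvature ::
  "('a, 'e::euclidean_space) chart set \<Rightarrow> ('a \<Rightarrow> 'e \<Rightarrow> 'e \<Rightarrow> real) \<Rightarrow>
     'a \<Rightarrow> 'e \<Rightarrow> 'e \<Rightarrow> 'e \<Rightarrow> 'e" where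
  "curvature \<A> g p v w z =
     (let c = chart_at \<A> p; x = snd c p; \<Gamma> = christoffel \<A> g c
      in frechet_derivative (\<lambda>y. \<Gamma> y w z) (at x) v - frechet_derivative (\<lambda>y. \<Gamma> y v z) (at x) w
         + \<Gamma> x v (\<Gamma> x w z) - \<Gamma> x w (\<Gamma> x v z))"

section \<open>Closed geodesics\<close>

definition smooth_path ::
  "('a::topological_space, 'e::euclidean_space) chart set \<Rightarrow> real \<Rightarrow> (real \<Rightarrow> 'a) \<Rightarrow> bool" where
  "smooth_path \<A> T \<gamma> \<longleftrightarrow>
     continuous_on {0..T} \<gamma> \<and>
     (\<forall>c\<in>\<A>. smooth_curve_on {t\<in>{0..T}. \<gamma> t \<in> fst c} (\<lambda>t. snd c (\<gamma> t)))"

definition velocity ::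
  "('a, 'e::euclidean_space) chart set \<Rightarrow> real \<Rightarrow> (real \<Rightarrow> 'a) \<Rightarrow> real \<Rightarrow> 'e" where
  "velocity \<A> T \<gamma> t =
     vector_derivative (\<lambda>s. snd (chart_at \<A> (\<gamma> t)) (\<gamma> s)) (at t within {0..T})"

text \<open>A vector field along \<open>\<gamma>\<close> is a function \<open>\<xi>\<close> on \<open>[0,T]\<close>, with \<open>\<xi> t\<close> in the tangent space at
  \<open>\<gamma> t\<close>. Near a given \<open>t\<close> it is differentiated through its components in the fixed chart
  preferred at \<open>\<gamma> t\<close>.\<close>

definition smooth_along ::
  "('a, 'e::euclidean_space) chart set \<Rightarrow> real \<Rightarrow> (real \<Rightarrow> 'a) \<Rightarrow> (real \<Rightarrow> 'e) \<Rightarrow> bool" where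
  "smooth_along \<A> T \<gamma> \<xi> \<longleftrightarrow>
     (\<forall>c\<in>\<A>. smooth_curve_on {t\<in>{0..T}. \<gamma> t \<in> fst c} (\<lambda>t. components \<A> c (\<gamma> t) (\<xi> t)))"

definition differentiable_along ::
  "('a, 'e::euclidean_space) chart set \<Rightarrow> real \<Rightarrow> (real \<Rightarrow> 'a) \<Rightarrow> (real \<Rightarrow> 'e) \<Rightarrow> bool" where
  "differentiable_along \<A> T \<gamma> \<xi> \<longleftrightarrow>
     (\<forall>t\<in>{0..T}. (\<lambda>s. components \<A> (chart_at \<A> (\<gamma> t)) (\<gamma> s) (\<xi> s))
        differentiable (at t within {0..T}))"

definition cov_deriv ::
  "('a, 'e::euclidean_space) chart set \<Rightarrow> ('a \<Rightarrow> 'e \<Rightarrow> 'e \<Rightarrow> real) \<Rightarrow> real \<Rightarrow> (real \<Rightarrow> 'a) \<Rightarrow>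
     (real \<Rightarrow> 'e) \<Rightarrow> real \<Rightarrow> 'e" where
  "cov_deriv \<A> g T \<gamma> \<xi> t =
     (let c = chart_at \<A> (\<gamma> t)
      in vector_derivative (\<lambda>s. components \<A> c (\<gamma> s) (\<xi> s)) (at t within {0..T})
         + christoffel \<A> g c (snd c (\<gamma> t)) (velocity \<A> T \<gamma> t) (\<xi> t))"

definition closed_geodesic ::
  "('a::topological_space, 'e::euclidean_space) chart set \<Rightarrow> ('a \<Rightarrow> 'e \<Rightarrow> 'e \<Rightarrow> real) \<Rightarrow>
     real \<Rightarrow> (real \<Rightarrow> 'a) \<Rightarrow> bool" where
  "closed_geodesic \<A> g T \<gamma> \<longleftrightarrow>
     T > 0 \<and> smooth_path \<A> T \<gamma> \<and>
     (\<forall>t\<in>{0..T}. cov_deriv \<A> g T \<gamma> (velocity \<A> T \<gamma>) t = 0) \<and>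
     \<gamma> 0 = \<gamma> T \<and> velocity \<A> T \<gamma> 0 = velocity \<A> T \<gamma> T"

definition speed_square ::
  "('a, 'e::euclidean_space) chart set \<Rightarrow> ('a \<Rightarrow> 'e \<Rightarrow> 'e \<Rightarrow> real) \<Rightarrow> real \<Rightarrow> (real \<Rightarrow> 'a) \<Rightarrow>
     real \<Rightarrow> real" where
  "speed_square \<A> g T \<gamma> t = g (\<gamma> t) (velocity \<A> T \<gamma> t) (velocity \<A> T \<gamma> t)"

definition non_lightlike ::
  "('a, 'e::euclidean_space) chart set \<Rightarrow> ('a \<Rightarrow> 'e \<Rightarrow> 'e \<Rightarrow> real) \<Rightarrow> real \<Rightarrow> (real \<Rightarrow> 'a) \<Rightarrow> bool"
  where "non_lightlike \<A> g T \<gamma> \<longleftrightarrow> (\<forall>t\<in>{0..T}. speed_square \<A> g T \<gamma> t \<noteq> 0)"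

definition spacelike ::
  "('a, 'e::euclidean_space) chart set \<Rightarrow> ('a \<Rightarrow> 'e \<Rightarrow> 'e \<Rightarrow> real) \<Rightarrow> real \<Rightarrow> (real \<Rightarrow> 'a) \<Rightarrow> bool"
  where "spacelike \<A> g T \<gamma> \<longleftrightarrow> (\<forall>t\<in>{0..T}. speed_square \<A> g T \<gamma> t > 0)"

text \<open>The number \<open>\<kappa>\<close> of negative directions orthogonal to a non-lightlike geodesic (which is
  timelike when it is not spacelike), and the diagonal entries of \<open>G\<close>.\<close>

definition normal_index ::
  "('a, 'e::euclidean_space) chart set \<Rightarrow> ('a \<Rightarrow> 'e \<Rightarrow> 'e \<Rightarrow> real) \<Rightarrow> nat \<Rightarrow> real \<Rightarrow> (real \<Rightarrow> 'a) \<Rightarrow>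
     nat" where
  "normal_index \<A> g \<nu> T \<gamma> = (if spacelike \<A> g T \<gamma> then \<nu> else \<nu> - 1)"

definition sig :: "nat \<Rightarrow> nat \<Rightarrow> nat \<Rightarrow> real" where
  "sig n \<kappa> i = (if i < n - \<kappa> then 1 else -1)"

text \<open>Frames and matrices are indexed by \<open>0, \<dots>, n - 1\<close>.\<close>

definition parallel_orthonormal_frame ::
  "('a, 'e::euclidean_space) chart set \<Rightarrow> ('a \<Rightarrow> 'e \<Rightarrow> 'e \<Rightarrow> real) \<Rightarrow> nat \<Rightarrow> nat \<Rightarrow> real \<Rightarrow>
     (real \<Rightarrow> 'a) \<Rightarrow> (nat \<Rightarrow> real \<Rightarrow> 'e) \<Rightarrow> bool" where
  "parallel_orthonormal_frame \<A> g n \<kappa> T \<gamma> e \<longleftrightarrow>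
     (\<forall>i<n. smooth_along \<A> T \<gamma> (e i) \<and> (\<forall>t\<in>{0..T}. cov_deriv \<A> g T \<gamma> (e i) t = 0)) \<and>
     (\<forall>t\<in>{0..T}.
        (\<forall>i<n. \<forall>j<n. g (\<gamma> t) (e i t) (e j t) = (if i = j then sig n \<kappa> i else 0)) \<and>
        span ((\<lambda>i. e i t) ` {..<n}) = {v. g (\<gamma> t) v (velocity \<A> T \<gamma> t) = 0})"

definition holonomy_matrix ::
  "nat \<Rightarrow> real \<Rightarrow> (nat \<Rightarrow> real \<Rightarrow> 'e::real_vector) \<Rightarrow> real mat \<Rightarrow> bool" where
  "holonomy_matrix n T e A \<longleftrightarrow>
     A \<in> carrier_mat n n \<and> (\<forall>j<n. e j T = (\<Sum>i<n. A $$ (i, j) *\<^sub>R e i 0))"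

definition oriented :: "real mat \<Rightarrow> bool" where
  "oriented A \<longleftrightarrow> Determinant.det A = 1"

definition non_oriented :: "real mat \<Rightarrow> bool" where
  "non_oriented A \<longleftrightarrow> Determinant.det A = -1"

definition curvature_matrix ::
  "('a, 'e::euclidean_space) chart set \<Rightarrow> ('a \<Rightarrow> 'e \<Rightarrow> 'e \<Rightarrow> real) \<Rightarrow> real \<Rightarrow> (real \<Rightarrow> 'a) \<Rightarrow>
     (nat \<Rightarrow> real \<Rightarrow> 'e) \<Rightarrow> real \<Rightarrow> nat \<Rightarrow> nat \<Rightarrow> real" where
  "curvature_matrix \<A> g T \<gamma> e t i j =
     g (\<gamma> t) (curvature \<A> g (\<gamma> t) (velocity \<A> T \<gamma> t) (e i t) (velocity \<A> T \<gamma> t)) (e j t)"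

section \<open>Linear stability\<close>

definition jacobi_field ::
  "('a, 'e::euclidean_space) chart set \<Rightarrow> ('a \<Rightarrow> 'e \<Rightarrow> 'e \<Rightarrow> real) \<Rightarrow> real \<Rightarrow> (real \<Rightarrow> 'a) \<Rightarrow>
     (real \<Rightarrow> 'e) \<Rightarrow> bool" where
  "jacobi_field \<A> g T \<gamma> \<xi> \<longleftrightarrow>
     differentiable_along \<A> T \<gamma> \<xi> \<and>
     differentiable_along \<A> T \<gamma> (cov_deriv \<A> g T \<gamma> \<xi>) \<and>
     (\<forall>t\<in>{0..T}.
        - cov_deriv \<A> g T \<gamma> (cov_deriv \<A> g T \<gamma> \<xi>) t
        + curvature \<A> g (\<gamma> t) (velocity \<A> T \<gamma> t) (\<xi> t) (velocity \<A> T \<gamma> t) = 0)"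

definition poincare_map ::
  "('a, 'e::euclidean_space) chart set \<Rightarrow> ('a \<Rightarrow> 'e \<Rightarrow> 'e \<Rightarrow> real) \<Rightarrow> real \<Rightarrow> (real \<Rightarrow> 'a) \<Rightarrow>
     'e \<times> 'e \<Rightarrow> 'e \<times> 'e" where
  "poincare_map \<A> g T \<gamma> q =
     (THE r. \<exists>\<xi>. jacobi_field \<A> g T \<gamma> \<xi> \<and> q = (\<xi> 0, cov_deriv \<A> g T \<gamma> \<xi> 0) \<and>
                 r = (\<xi> T, cov_deriv \<A> g T \<gamma> \<xi> T))"

text \<open>Let \<open>P\<close> be a linear endomorphism of the real subspace \<open>V\<close>. The pair \<open>(x, y)\<close> stands for the
  vector \<open>x + \<i> y\<close> of the complexification of \<open>V\<close>. The set of all eigenvectors is stable under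
  multiplication by \<open>\<i>\<close>, so its real span in the complexification is its complex span.\<close>

definition cplx_eigenspace ::
  "('v::real_vector \<Rightarrow> 'v) \<Rightarrow> 'v set \<Rightarrow> complex \<Rightarrow> ('v \<times> 'v) set" where
  "cplx_eigenspace P V \<mu> =
     {(x, y). x \<in> V \<and> y \<in> V \<and> P x = Re \<mu> *\<^sub>R x - Im \<mu> *\<^sub>R y \<and> P y = Im \<mu> *\<^sub>R x + Re \<mu> *\<^sub>R y}"

definition cplx_diagonalizable :: "('v::real_vector \<Rightarrow> 'v) \<Rightarrow> 'v set \<Rightarrow> bool" where
  "cplx_diagonalizable P V \<longleftrightarrow> span (\<Union>\<mu>. cplx_eigenspace P V \<mu>) = V \<times> V"

definition cplx_spectrum :: "('v::real_vector \<Rightarrow> 'v) \<Rightarrow> 'v set \<Rightarrow> complex set" where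
  "cplx_spectrum P V = {\<mu>. \<exists>z\<in>cplx_eigenspace P V \<mu>. z \<noteq> 0}"

definition linearly_stable ::
  "('a, 'e::euclidean_space) chart set \<Rightarrow> ('a \<Rightarrow> 'e \<Rightarrow> 'e \<Rightarrow> real) \<Rightarrow> real \<Rightarrow> (real \<Rightarrow> 'a) \<Rightarrow> bool"
  where
  "linearly_stable \<A> g T \<gamma> \<longleftrightarrow>
     (let N = {v. g (\<gamma> 0) v (velocity \<A> T \<gamma> 0) = 0}; P = poincare_map \<A> g T \<gamma>
      in cplx_diagonalizable P (N \<times> N) \<and> cplx_spectrum P (N \<times> N) \<subseteq> sphere 0 1)"

section \<open>Unbounded operators in \<open>L\<^sup>2([0,T], \<complex>\<^sup>n)\<close> and spectral flow\<close>

text \<open>A \<open>\<complex>\<^sup>n\<close>-valued function is \<open>u :: real \<Rightarrow> nat \<Rightarrow> complex\<close>, only the components \<open>u t i\<close> with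
  \<open>i < n\<close> and \<open>0 \<le> t \<le> T\<close> being relevant. Equality in \<open>L\<^sup>2\<close> is vanishing of the seminorm of the
  difference.\<close>

type_synonym cfun = "real \<Rightarrow> nat \<Rightarrow> complex"

definition L2 :: "real \<Rightarrow> (real \<Rightarrow> complex) set" where
  "L2 T = {f. f \<in> borel_measurable (lebesgue_on {0..T}) \<and>
              integrable (lebesgue_on {0..T}) (\<lambda>t. (cmod (f t))\<^sup>2)}"

definition L2n :: "nat \<Rightarrow> real \<Rightarrow> cfun set" where
  "L2n n T = {f. \<forall>i<n. (\<lambda>t. f t i) \<in> L2 T}"

definition L2norm :: "nat \<Rightarrow> real \<Rightarrow> cfun \<Rightarrow> real" where
  "L2norm n T f = sqrt (\<Sum>i<n. integral\<^sup>L (lebesgue_on {0..T}) (\<lambda>t. (cmod (f t i))\<^sup>2))"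

definition cscale :: "complex \<Rightarrow> cfun \<Rightarrow> cfun" where
  "cscale \<mu> u = (\<lambda>t i. \<mu> * u t i)"

global_interpretation cfun: vector_space cscale
  defines cfun_span = cfun.span and cfun_dim = cfun.dim
  by unfold_locales (auto simp: cscale_def fun_eq_iff algebra_simps)

text \<open>An operator is given by its graph. In a pair \<open>(u, f)\<close> of the graph, \<open>f\<close> is any
  representative of the image of \<open>u\<close>, whereas each element \<open>u\<close> of the domain is given by one
  distinguished representative; eigenspaces are thus honest subspaces of \<^typ>\<open>cfun\<close>.\<close>

type_synonym op_graph = "(cfun \<times> cfun) set"

definition op_spectrum :: "nat \<Rightarrow> real \<Rightarrow> op_graph \<Rightarrow> complex set" where
  "op_spectrum n T \<G> = - {\<mu>.
     (\<forall>f\<in>L2n n T. \<exists>(u, h)\<in>\<G>. L2norm n T (h - cscale \<mu> u - f) = 0) \<and>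
     (\<exists>C. \<forall>(u, h)\<in>\<G>. L2norm n T u \<le> C * L2norm n T (h - cscale \<mu> u))}"

definition op_eigenspace :: "op_graph \<Rightarrow> complex \<Rightarrow> cfun set" where
  "op_eigenspace \<G> \<mu> = {u. (u, cscale \<mu> u) \<in> \<G>}"

text \<open>The sum of the eigenspaces for the eigenvalues in a real set \<open>I\<close>.\<close>

definition eigen_sum :: "op_graph \<Rightarrow> real set \<Rightarrow> cfun set" where
  "eigen_sum \<G> I = cfun_span (\<Union>a\<in>I. op_eigenspace \<G> (of_real a))"

definition fin_dim :: "cfun set \<Rightarrow> bool" where
  "fin_dim V \<longleftrightarrow> (\<exists>B. finite B \<and> V \<subseteq> cfun_span B)"

text \<open>On the parameter interval \<open>[c,d]\<close>, \<open>\<plusminus>a\<close> avoid the spectrum, and the spectrum in \<open>[-a,a]\<close>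
  consists of eigenvalues of constant finite total multiplicity.\<close>

definition spectral_gap :: "nat \<Rightarrow> real \<Rightarrow> (real \<Rightarrow> op_graph) \<Rightarrow> real \<Rightarrow> real \<Rightarrow> real \<Rightarrow> bool" where
  "spectral_gap n T \<G> c d a \<longleftrightarrow>
     a > 0 \<and>
     (\<exists>m. \<forall>s\<in>{c..d}.
        of_real a \<notin> op_spectrum n T (\<G> s) \<and> of_real (-a) \<notin> op_spectrum n T (\<G> s) \<and>
        (\<forall>b\<in>{-a..a}. of_real b \<in> op_spectrum n T (\<G> s) \<longrightarrow>
            (\<exists>u\<in>op_eigenspace (\<G> s) (of_real b). u \<noteq> 0)) \<and>
        fin_dim (eigen_sum (\<G> s) {-a..a}) \<and> cfun_dim (eigen_sum (\<G> s) {-a..a}) = m)"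

text \<open>For a continuous path of selfadjoint Fredholm operators such subdivisions exist and the sum
  does not depend on them, so that there is exactly one \<open>k\<close> as below.\<close>

definition has_spectral_flow ::
  "nat \<Rightarrow> real \<Rightarrow> (real \<Rightarrow> op_graph) \<Rightarrow> real \<Rightarrow> real \<Rightarrow> int \<Rightarrow> bool" where
  "has_spectral_flow n T \<G> c d k \<longleftrightarrow>
     (\<exists>(N::nat) \<tau> a.
        \<tau> 0 = c \<and> \<tau> N = d \<and>
        (\<forall>i<N. \<tau> i < \<tau> (Suc i) \<and> spectral_gap n T \<G> (\<tau> i) (\<tau> (Suc i)) (a i)) \<and>
        k = (\<Sum>i<N. int (cfun_dim (eigen_sum (\<G> (\<tau> (Suc i))) {0..a i}))
                    - int (cfun_dim (eigen_sum (\<G> (\<tau> i)) {0..a i}))))"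

section \<open>The spectral index\<close>

text \<open>\<open>x\<close> is the continuously differentiable representative of an element of
  \<open>W\<^sup>2\<^sup>,\<^sup>2([0,T], \<complex>)\<close>, \<open>x'\<close> is its absolutely continuous derivative and \<open>x''\<close> its weak second
  derivative.\<close>

definition sobolev2 ::
  "real \<Rightarrow> (real \<Rightarrow> complex) \<Rightarrow> (real \<Rightarrow> complex) \<Rightarrow> (real \<Rightarrow> complex) \<Rightarrow> bool" where
  "sobolev2 T x x' x'' \<longleftrightarrow>
     x'' \<in> L2 T \<and>
     (\<forall>t\<in>{0..T}. (x'' has_integral (x' t - x' 0)) {0..t} \<and> (x' has_integral (x t - x 0)) {0..t})"

text \<open>The graph of \<open>-G d\<^sup>2/dt\<^sup>2 + R(t) + s G\<close> with the boundary conditions \<open>u(0) = A u(T)\<close> and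
  \<open>u'(0) = A u'(T)\<close>. Elements of the domain are normalised to vanish at the irrelevant
  arguments.\<close>

definition index_operator ::
  "nat \<Rightarrow> nat \<Rightarrow> real \<Rightarrow> real mat \<Rightarrow> (real \<Rightarrow> nat \<Rightarrow> nat \<Rightarrow> real) \<Rightarrow> real \<Rightarrow> op_graph" where
  "index_operator n \<kappa> T A R s =
     {(u, f). f \<in> L2n n T \<and>
        (\<forall>t i. t \<notin> {0..T} \<or> i \<ge> n \<longrightarrow> u t i = 0) \<and>
        (\<exists>u' u'' :: cfun.
           (\<forall>i<n. sobolev2 T (\<lambda>t. u t i) (\<lambda>t. u' t i) (\<lambda>t. u'' t i)) \<and>
           (\<forall>i<n. u 0 i = (\<Sum>j<n. of_real (A $$ (i, j)) * u T j)) \<and>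
           (\<forall>i<n. u' 0 i = (\<Sum>j<n. of_real (A $$ (i, j)) * u' T j)) \<and>
           (\<forall>i<n. AE t in lebesgue_on {0..T}.
              f t i = - of_real (sig n \<kappa> i) * u'' t i + (\<Sum>j<n. of_real (R t i j) * u t j)
                      + of_real (s * sig n \<kappa> i) * u t i))}"

definition has_spectral_index ::
  "('a, 'e::euclidean_space) chart set \<Rightarrow> ('a \<Rightarrow> 'e \<Rightarrow> 'e \<Rightarrow> real) \<Rightarrow> nat \<Rightarrow> nat \<Rightarrow> real \<Rightarrow>
     (real \<Rightarrow> 'a) \<Rightarrow> (nat \<Rightarrow> real \<Rightarrow> 'e) \<Rightarrow> real mat \<Rightarrow> int \<Rightarrow> bool" where
  "has_spectral_index \<A> g n \<kappa> T \<gamma> e A k \<longleftrightarrow>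
     (let \<G> = index_operator n \<kappa> T A (curvature_matrix \<A> g T \<gamma> e)
      in \<exists>s\<^sub>0>0. (\<forall>s\<ge>s\<^sub>0. op_eigenspace (\<G> s) 0 = {0}) \<and> has_spectral_flow n T \<G> 0 s\<^sub>0 k)"

end

theory Submission imports Defs begin

text \<open>In the parallel frame the Jacobi equation is a linear Hamiltonian system, and the linearized
  Poincare map is \<open>P\<^sub>0\<^sub>,\<^sub>0\<close>, where \<open>P\<^sub>s\<^sub>,\<^sub>l\<close> is the return map of the eigenvalue equation with parameter
  \<open>s\<close> and eigenvalue \<open>l\<close>. The Evans function \<open>E s l = det (P\<^sub>s\<^sub>,\<^sub>l - 1)\<close> vanishes exactly at the
  eigenvalues. By the Wronskian identity, the derivative in \<open>l\<close> of the symplectic pairing of kernel vectors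
  is, up to sign, their \<open>L\<^sup>2\<close> product, so \<open>E s\<close> vanishes at an eigenvalue exactly to the order of its
  multiplicity. Hence the parity of the spectral flow is the product of the signs of \<open>E s\<close> just below
  \<open>l = 0\<close> at the two ends.

  For large \<open>s\<close> the zero order term \<open>R\<close> can be deformed to \<open>0\<close> without creating a kernel, and the sign at
  the upper end is that of \<open>det (exp (sqrt s T) A - 1) det (exp (- sqrt s T) A - 1)\<close>, which is
  \<open>(-1) ^ n det A\<close>. At \<open>s = 0\<close>, stability gives the sign \<open>+1\<close>: \<open>det (c P - 1) > 0\<close> for \<open>0 \<le> c < 1\<close>, and by
  semisimplicity the symplectic form is nondegenerate on the kernel of \<open>P - 1\<close>, which transfers the sign to
  \<open>l < 0\<close>. So stability forces \<open>(-1) ^ \<iota> = (-1) ^ n det A\<close>.\<close>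

section \<open>Determinants\<close>

text \<open>When \<open>G\<close> is indefinite, the operators are unbounded on both sides and the
  path moves in the direction of the indefinite form \<open>G\<close>: crossings in \<open>s\<close>
  may be degenerate, and no Morse index is available. The parity is therefore read off in the
  direction of \<open>l\<close>, where the crossing form is the definite \<open>L2\<close> product.
  On one interval of the subdivision the edge \<open>a\<close> is never an eigenvalue, so the sign
  of \<open>E s a\<close> is the same at both ends; moving from \<open>a\<close> down past 0 picks
  up one sign per eigenvalue in \<open>[0,a]\<close>. As this count includes 0, signs are compared
  just below 0 and not at 0. At \<open>s = 0\<close> two perturbations of \<open>P\<close> compete
  on \<open>ker (P - 1)\<close>: lowering \<open>l\<close> produces the \<open>L2\<close> product,
  shrinking \<open>P\<close> produces \<open>- omega\<close>. A convex combination with positive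
  weight on the product is nonsingular because a skew form vanishes on the diagonal; only the end
  \<open>- omega\<close> itself calls for semisimplicity. On the geometric side, tangent vectors are
  recorded in a chart that depends on the point. Differentiating along a curve requires one fixed
  chart, which is why the transformation laws of connection and curvature are established.\<close>

definition fdet :: "nat \<Rightarrow> (nat \<Rightarrow> nat \<Rightarrow> real) \<Rightarrow> real" where
  "fdet m M = Determinant.det (Matrix.mat m m (\<lambda>(i, j). M i j))"

lemma fdet_expand:
  "fdet m M = (\<Sum>p | p permutes {0..<m}. signof p * (\<Prod>i = 0..<m. M i (p i)))"
proof -
  have "(\<Prod>i = 0..<m. Matrix.mat m m (\<lambda>(i, j). M i j) $$ (i, p i)) = (\<Prod>i = 0..<m. M i (p i))"
    if "p permutes {0..<m}" for p
    by (rule prod.cong) (use that permutes_in_image[OF that] in \<open>auto simp: index_mat\<close>)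
  then show ?thesis
    unfolding fdet_def Determinant.det_def by simp
qed

lemma fdet_cong:
  assumes "\<And>i j. i < m \<Longrightarrow> j < m \<Longrightarrow> M i j = N i j"
  shows "fdet m M = fdet m N"
  unfolding fdet_def using assms by (intro arg_cong[where f = Determinant.det]) (auto intro!: eq_matI)

lemma fdet_transpose: "fdet m (\<lambda>i j. M j i) = fdet m M"
proof -
  have "Matrix.mat m m (\<lambda>(i, j). M j i) = Matrix.transpose_mat (Matrix.mat m m (\<lambda>(i, j). M i j))"
    by (auto intro!: eq_matI)
  then show ?thesis
    unfolding fdet_def using Determinant.det_transpose[of "Matrix.mat m m (\<lambda>(i, j). M i j)" m] by simp
qed

lemma fdet_one: "fdet m (\<lambda>i j. of_bool (i = j)) = 1"
proof -
  have "Matrix.mat m m (\<lambda>(i, j). of_bool (i = j)) = (1\<^sub>m m :: real mat)"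
    by (auto intro!: eq_matI)
  then show ?thesis by (simp add: fdet_def)
qed

lemma fdet_mult:
  "fdet m (\<lambda>i j. \<Sum>k<m. M i k * N k j) = fdet m M * fdet m N"
proof -
  have "Matrix.mat m m (\<lambda>(i, j). \<Sum>k<m. M i k * N k j) =
     Matrix.mat m m (\<lambda>(i, j). M i j) * Matrix.mat m m (\<lambda>(i, j). N i j)"
    by (auto intro!: eq_matI sum.cong simp: scalar_prod_def atLeast0LessThan)
  then show ?thesis
    unfolding fdet_def
    using Determinant.det_mult[of "Matrix.mat m m (\<lambda>(i, j). M i j)" m "Matrix.mat m m (\<lambda>(i, j). N i j)"]
    by simp
qed

lemma fdet_eq_0_iff:
  "fdet m M = 0 \<longleftrightarrow> (\<exists>x. (\<exists>i<m. x i \<noteq> 0) \<and> (\<forall>i<m. (\<Sum>j<m. M i j * x j) = 0))"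
proof -
  let ?M = "Matrix.mat m m (\<lambda>(i, j). M i j)"
  have "fdet m M = 0 \<longleftrightarrow> (\<exists>v. v \<in> carrier_vec m \<and> v \<noteq> 0\<^sub>v m \<and> ?M *\<^sub>v v = 0\<^sub>v m)"
    unfolding fdet_def by (rule det_0_iff_vec_prod_zero) simp
  also have "\<dots> \<longleftrightarrow> (\<exists>x. (\<exists>i<m. x i \<noteq> 0) \<and> (\<forall>i<m. (\<Sum>j<m. M i j * x j) = 0))"
  proof
    assume "\<exists>v. v \<in> carrier_vec m \<and> v \<noteq> 0\<^sub>v m \<and> ?M *\<^sub>v v = 0\<^sub>v m"
    then obtain v where v: "v \<in> carrier_vec m" "v \<noteq> 0\<^sub>v m" "?M *\<^sub>v v = 0\<^sub>v m" by blast
    have "\<exists>i<m. vec_index v i \<noteq> 0"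
    proof (rule ccontr)
      assume "\<not> ?thesis"
      then have "v = 0\<^sub>v m" using v(1) by (intro eq_vecI) auto
      then show False using v(2) by simp
    qed
    moreover have "(\<Sum>j<m. M i j * vec_index v j) = 0" if "i < m" for i
    proof -
      have "vec_index (?M *\<^sub>v v) i = 0" using v(3) that by simp
      then show ?thesis using that v(1) by (auto simp: scalar_prod_def atLeast0LessThan)
    qed
    ultimately show "\<exists>x. (\<exists>i<m. x i \<noteq> 0) \<and> (\<forall>i<m. (\<Sum>j<m. M i j * x j) = 0)"
      by (intro exI[of _ "\<lambda>i. vec_index v i"]) auto
  next
    assume "\<exists>x. (\<exists>i<m. x i \<noteq> 0) \<and> (\<forall>i<m. (\<Sum>j<m. M i j * x j) = 0)"
    then obtain x i where x: "i < m" "x i \<noteq> 0" "\<forall>i<m. (\<Sum>j<m. M i j * x j) = 0" by blast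
    have "Matrix.vec m x \<noteq> 0\<^sub>v m"
    proof
      assume "Matrix.vec m x = 0\<^sub>v m"
      then have "vec_index (Matrix.vec m x) i = vec_index (0\<^sub>v m) i" by simp
      then show False using x by simp
    qed
    moreover have "?M *\<^sub>v Matrix.vec m x = 0\<^sub>v m"
      using x(3) by (intro eq_vecI) (auto simp: scalar_prod_def atLeast0LessThan)
    ultimately show "\<exists>v. v \<in> carrier_vec m \<and> v \<noteq> 0\<^sub>v m \<and> ?M *\<^sub>v v = 0\<^sub>v m"
      by (intro exI[of _ "Matrix.vec m x"]) auto
  qed
  finally show ?thesis .
qed

lemma fdet_injD:
  assumes "fdet m M \<noteq> 0" "\<And>i. i < m \<Longrightarrow> (\<Sum>j<m. M i j * x j) = 0" "i < m"
  shows "x i = 0"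
  using assms fdet_eq_0_iff by blast

lemma fdet_nonzeroI:
  assumes "\<And>x i. (\<And>i. i < m \<Longrightarrow> (\<Sum>j<m. M i j * x j) = 0) \<Longrightarrow> i < m \<Longrightarrow> x i = 0"
  shows "fdet m M \<noteq> 0"
  using assms fdet_eq_0_iff by metis

lemma fdet_surj:
  assumes "fdet m M \<noteq> 0"
  obtains x where "\<And>i. i < m \<Longrightarrow> (\<Sum>j<m. M i j * x j) = y i"
proof -
  let ?M = "Matrix.mat m m (\<lambda>(i, j). M i j)"
  have M: "?M \<in> carrier_mat m m" by simp
  obtain B where B: "inverts_mat ?M B" "B \<in> carrier_mat m m"
    using det_non_zero_imp_unit[OF M] assms unfolding fdet_def Units_def ring_mat_def
    by (auto simp: inverts_mat_def)
  define x where "x = B *\<^sub>v Matrix.vec m y"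
  have "?M *\<^sub>v x = (?M * B) *\<^sub>v Matrix.vec m y"
    unfolding x_def by (rule assoc_mult_mat_vec[symmetric, OF M B(2)]) simp
  also have "\<dots> = Matrix.vec m y" using B M by (simp add: inverts_mat_def)
  finally have eq: "?M *\<^sub>v x = Matrix.vec m y" .
  have x: "x \<in> carrier_vec m" unfolding x_def using B(2) by simp
  have "(\<Sum>j<m. M i j * vec_index x j) = y i" if "i < m" for i
  proof -
    have "vec_index (?M *\<^sub>v x) i = y i" using eq that by simp
    then show ?thesis using that x
      by (simp add: scalar_prod_def atLeast0LessThan)
  qed
  then show ?thesis by (rule that)
qed

lemma tendsto_fdet:
  assumes "\<And>i j. i < m \<Longrightarrow> j < m \<Longrightarrow> ((\<lambda>x. M x i j) \<longlongrightarrow> L i j) F"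
  shows "((\<lambda>x. fdet m (M x)) \<longlongrightarrow> fdet m L) F"
proof -
  have "((\<lambda>x. M x i (p i)) \<longlongrightarrow> L i (p i)) F" if "p permutes {0..<m}" "i \<in> {0..<m}" for p i
    using that permutes_in_image[OF that(1), of i] by (intro assms) auto
  then show ?thesis
    unfolding fdet_expand by (intro tendsto_intros) auto
qed

lemma continuous_on_fdet:
  assumes "\<And>i j. i < m \<Longrightarrow> j < m \<Longrightarrow> continuous_on S (\<lambda>x. M x i j)"
  shows "continuous_on S (\<lambda>x. fdet m (M x))"
  using assms unfolding continuous_on_def by (blast intro: tendsto_fdet)

lemma fdet_scale_rows:
  assumes "K \<subseteq> {..<m}"
  shows "fdet m (\<lambda>i j. if i \<in> K then c * M i j else M i j) = c ^ card K * fdet m M"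
proof -
  have "(\<Prod>i = 0..<m. if i \<in> K then c * M i (p i) else M i (p i)) =
      c ^ card K * (\<Prod>i = 0..<m. M i (p i))" for p
  proof -
    have "(\<Prod>i = 0..<m. if i \<in> K then c * M i (p i) else M i (p i)) =
       (\<Prod>i = 0..<m. (if i \<in> K then c else 1) * M i (p i))"
      by (rule prod.cong) auto
    also have "\<dots> = (\<Prod>i = 0..<m. if i \<in> K then c else 1) * (\<Prod>i = 0..<m. M i (p i))"
      by (rule prod.distrib)
    also have "(\<Prod>i = 0..<m. if i \<in> K then c else 1) = c ^ card ({0..<m} \<inter> K)"
      by (simp add: prod.If_cases)
    also have "{0..<m} \<inter> K = K" using assms by auto
    finally show ?thesis .
  qed
  then show ?thesis
    unfolding fdet_expand by (simp add: sum_distrib_left algebra_simps)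
qed

text \<open>Each row in \<open>K\<close> is of order \<open>c\<close>, so the determinant is of
  order \<open>c ^ card K\<close>, with the determinant of the rescaled limit as leading
  coefficient. Vanishing orders of \<open>evans\<close> are computed this way, without expanding
  determinants.\<close>

lemma tendsto_fdet_scaled:
  assumes K: "K \<subseteq> {..<m}" and F: "\<forall>\<^sub>F x in F. c x \<noteq> 0"
    and 1: "\<And>i j. i \<in> K \<Longrightarrow> j < m \<Longrightarrow> ((\<lambda>x. M x i j / c x) \<longlongrightarrow> L i j) F"
    and 2: "\<And>i j. i < m \<Longrightarrow> i \<notin> K \<Longrightarrow> j < m \<Longrightarrow> ((\<lambda>x. M x i j) \<longlongrightarrow> L i j) F"
  shows "((\<lambda>x. fdet m (M x) / c x ^ card K) \<longlongrightarrow> fdet m L) F"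
proof -
  have "((\<lambda>x. fdet m (\<lambda>i j. if i \<in> K then inverse (c x) * M x i j else M x i j)) \<longlongrightarrow> fdet m L) F"
  proof (rule tendsto_fdet)
    fix i j assume "i < m" "j < m"
    then show "((\<lambda>x. if i \<in> K then inverse (c x) * M x i j else M x i j) \<longlongrightarrow> L i j) F"
      using 1[of i j] 2[of i j] by (cases "i \<in> K") (auto simp: field_simps)
  qed
  then show ?thesis
    by (simp add: fdet_scale_rows[OF K] field_simps)
qed

text \<open>A matrix \<open>Q\<close> as below, with as many vanishing columns of \<open>M Q\<close> as possible, has the property
  that the corresponding columns of \<open>Q\<close> span the kernel of \<open>M\<close>: a further kernel vector could
  replace another column of \<open>Q\<close>.\<close>

lemma kernel_adapted_basis:
  fixes M :: "nat \<Rightarrow> nat \<Rightarrow> real"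
  obtains Q K where "K \<subseteq> {..<m}" "fdet m Q \<noteq> 0"
    "\<And>i k. i < m \<Longrightarrow> k \<in> K \<Longrightarrow> (\<Sum>j<m. M i j * Q j k) = 0"
    "\<And>x i. (\<And>i. i < m \<Longrightarrow> (\<Sum>j<m. M i j * (\<Sum>k<m. Q j k * x k)) = 0) \<Longrightarrow> i < m \<Longrightarrow> i \<notin> K
        \<Longrightarrow> x i = 0"
proof -
  define good where "good c \<longleftrightarrow> (\<exists>Q K. K \<subseteq> {..<m} \<and> card K = c \<and> fdet m Q \<noteq> 0 \<and>
    (\<forall>i<m. \<forall>k\<in>K. (\<Sum>j<m. M i j * Q j k) = 0))" for c
  have "fdet m (\<lambda>i j. of_bool (i = j)) \<noteq> 0"
    by (rule fdet_nonzeroI) (simp add: of_bool_def if_distrib[where f = "\<lambda>a. a * _"] cong: if_cong)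
  then have "good 0" unfolding good_def by (metis card.empty empty_iff empty_subsetI)
  moreover have bd: "c \<le> m" if "good c" for c
    using that unfolding good_def by (metis card_lessThan card_mono finite_lessThan)
  ultimately obtain c where c: "good c" "\<And>d. good d \<Longrightarrow> d \<le> c"
    using Greatest_le_nat[of good _ m] GreatestI_nat[of good 0 m] by blast
  then obtain Q K where QK: "K \<subseteq> {..<m}" "card K = c" "fdet m Q \<noteq> 0"
    "\<And>i k. i < m \<Longrightarrow> k \<in> K \<Longrightarrow> (\<Sum>j<m. M i j * Q j k) = 0"
    unfolding good_def by blast
  have ker: "x i = 0" if x: "\<And>i. i < m \<Longrightarrow> (\<Sum>j<m. M i j * (\<Sum>k<m. Q j k * x k)) = 0"
    and i: "i < m" "i \<notin> K" for x i
  proof (rule ccontr)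
    assume xi: "x i \<noteq> 0"
    \<comment> \<open>\<open>E\<close> is the identity with column \<open>i\<close> replaced by
      \<open>x\<close>, so \<open>Q' = Q E\<close> is \<open>Q\<close> with column \<open>i\<close>
      replaced by the kernel vector \<open>Q x\<close>. It is invertible because
      \<open>x i \<noteq> 0\<close>.\<close>
    define E where "E j k = (if k = i then x j else of_bool (j = k))" for j k
    define Q' where "Q' j k = (\<Sum>l<m. Q j l * E l k)" for j k
    have "fdet m E \<noteq> 0"
    proof (rule fdet_nonzeroI)
      fix y k assume y: "\<And>j. j < m \<Longrightarrow> (\<Sum>k<m. E j k * y k) = 0" and k: "k < m"
      have eq: "(\<Sum>k<m. E j k * y k) = x j * y i + (if j = i then 0 else y j)" if "j < m" for j
      proof -
        have "(\<Sum>k<m. E j k * y k) = E j i * y i + (\<Sum>k\<in>{..<m} - {i}. E j k * y k)"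
          using i by (simp add: sum.remove)
        also have "(\<Sum>k\<in>{..<m} - {i}. E j k * y k) = (\<Sum>k\<in>{..<m} - {i}. if k = j then y j else 0)"
          by (rule sum.cong) (auto simp: E_def)
        also have "\<dots> = (if j = i then 0 else y j)" using that by simp
        finally show ?thesis by (simp add: E_def)
      qed
      have "y i = 0" using y[OF i(1)] eq[OF i(1)] xi by simp
      then show "y k = 0" using y[OF k] eq[OF k] by (auto split: if_splits)
    qed
    then have det: "fdet m Q' \<noteq> 0" unfolding Q'_def using QK(3) by (simp add: fdet_mult)
    have Q'i: "Q' j i = (\<Sum>k<m. Q j k * x k)" for j by (simp add: Q'_def E_def)
    have Q'k: "Q' j k = Q j k" if "k \<noteq> i" "k < m" for j k
      using that by (simp add: Q'_def E_def of_bool_def if_distrib cong: if_cong)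
    have "(\<Sum>l<m. M j l * Q' l k) = 0" if j: "j < m" and k: "k \<in> insert i K" for j k
    proof (cases "k = i")
      case True
      show ?thesis unfolding True Q'i by (rule x[OF j])
    next
      case False
      then have k: "k \<in> K" "k < m" using k QK(1) by auto
      show ?thesis unfolding Q'k[OF False k(2)] by (rule QK(4)[OF j k(1)])
    qed
    then have "good (card (insert i K))"
      unfolding good_def using QK(1) i det by (intro exI[of _ Q'] exI[of _ "insert i K"]) auto
    moreover have "card (insert i K) = Suc c"
      using QK i finite_subset[OF QK(1)] by simp
    ultimately show False using c(2) by fastforce
  qed
  show ?thesis
  proof (rule that[of K Q])
    show "(\<Sum>j<m. M i j * Q j k) = 0" if "i < m" "k \<in> K" for i k using that by (rule QK(4))
    show "x i = 0" if "\<And>i. i < m \<Longrightarrow> (\<Sum>j<m. M i j * (\<Sum>k<m. Q j k * x k)) = 0" "i < m" "i \<notin> K"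
      for x i using that by (rule ker)
  qed (use QK in auto)
qed

section \<open>Linear systems of differential equations\<close>

lemma le_of_deriv_le:
  fixes f g :: "real \<Rightarrow> real"
  assumes "a \<le> b"
    and "\<And>t. t \<in> {a..b} \<Longrightarrow> (f has_real_derivative f' t) (at t within {a..b})"
    and "\<And>t. t \<in> {a..b} \<Longrightarrow> (g has_real_derivative g' t) (at t within {a..b})"
    and "\<And>t. t \<in> {a..b} \<Longrightarrow> f' t \<le> g' t"
  shows "f b - f a \<le> g b - g a"
proof -
  have "\<exists>x\<in>{a..b}. (g b - f b) - (g a - f a) = (g' x - f' x) * (b - a)"
    using assms(1) by (rule mvt_very_simple)
      (use assms(2,3) in \<open>auto simp flip: has_field_derivative_def intro!: DERIV_diff\<close>)
  then obtain x where "x \<in> {a..b}" "(g b - f b) - (g a - f a) = (g' x - f' x) * (b - a)" by blast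
  moreover from this have "(g' x - f' x) * (b - a) \<ge> 0" using assms(1,4) by simp
  ultimately show ?thesis by simp
qed

lemma has_real_derivative_subinterval:
  assumes "(f has_real_derivative D) (at t within {a..b})" "{c..d} \<subseteq> {a..b}"
  shows "(f has_real_derivative D) (at t within {c..d})"
  using assms by (rule DERIV_subset)

text \<open>Gronwall's inequality for the squared norm. The rate \<open>2 * m * |L| + 1\<close>
  comes from \<open>2ab <= a^2 + b^2\<close>, applied to the products with \<open>B\<close> and, for
  the final 1, to the inhomogeneity. With \<open>\<epsilon> = 0\<close> it gives uniqueness, with
  small \<open>\<epsilon>\<close> continuous dependence on the coefficients.\<close>

lemma energy_bound:
  fixes w :: "real \<Rightarrow> nat \<Rightarrow> real"
  assumes w: "\<And>t i. t \<in> {0..T} \<Longrightarrow> i < m \<Longrightarrow>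
      ((\<lambda>t. w t i) has_real_derivative (\<Sum>j<m. B t i j * w t j) + r t i) (at t within {0..T})"
    and B: "\<And>t i j. t \<in> {0..T} \<Longrightarrow> i < m \<Longrightarrow> j < m \<Longrightarrow> \<bar>B t i j\<bar> \<le> L"
    and r: "\<And>t i. t \<in> {0..T} \<Longrightarrow> i < m \<Longrightarrow> \<bar>r t i\<bar> \<le> \<epsilon>"
    and 0: "\<And>i. i < m \<Longrightarrow> w 0 i = 0" and t: "t \<in> {0..T}"
  shows "(\<Sum>i<m. (w t i)\<^sup>2) \<le> m * \<epsilon>\<^sup>2 * T * exp ((2 * m * \<bar>L\<bar> + 1) * T)"
proof -
  define c where "c = 2 * m * \<bar>L\<bar> + 1"
  have c: "c > 0" by (simp add: c_def add_nonneg_pos)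
  define e where "e t = (\<Sum>i<m. (w t i)\<^sup>2)" for t
  define e' where "e' t = (\<Sum>i<m. 2 * (w t i * ((\<Sum>j<m. B t i j * w t j) + r t i)))" for t
  have e: "(e has_real_derivative e' s) (at s within {0..T})" if "s \<in> {0..T}" for s
    unfolding e_def e'_def power2_eq_square
    by (rule DERIV_sum) (use w[OF that] in \<open>auto intro!: derivative_eq_intros simp: algebra_simps\<close>)
  have e'_le: "e' s \<le> c * e s + m * \<epsilon>\<^sup>2" if s: "s \<in> {0..T}" for s
  proof -
    have "2 * (w s i * ((\<Sum>j<m. B s i j * w s j) + r s i)) \<le>
        (\<Sum>j<m. \<bar>L\<bar> * ((w s i)\<^sup>2 + (w s j)\<^sup>2)) + ((w s i)\<^sup>2 + \<epsilon>\<^sup>2)" if i: "i < m" for i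
    proof -
      have "2 * (w s i * (B s i j * w s j)) \<le> \<bar>L\<bar> * ((w s i)\<^sup>2 + (w s j)\<^sup>2)" if "j < m" for j
      proof -
        have "2 * (w s i * (B s i j * w s j)) \<le> \<bar>B s i j\<bar> * (2 * \<bar>w s i * w s j\<bar>)"
          by (metis (no_types, opaque_lifting) abs_ge_self abs_mult abs_numeral mult.assoc mult.commute mult.left_commute)
        also have "\<dots> \<le> \<bar>L\<bar> * ((w s i)\<^sup>2 + (w s j)\<^sup>2)"
        proof (rule mult_mono)
          show "\<bar>B s i j\<bar> \<le> \<bar>L\<bar>" using B[OF s i that] by simp
          show "2 * \<bar>w s i * w s j\<bar> \<le> (w s i)\<^sup>2 + (w s j)\<^sup>2"
            using sum_squares_bound[of "\<bar>w s i\<bar>" "\<bar>w s j\<bar>"] by (simp add: abs_mult)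
        qed auto
        finally show ?thesis .
      qed
      then have "(\<Sum>j<m. 2 * (w s i * (B s i j * w s j))) \<le> (\<Sum>j<m. \<bar>L\<bar> * ((w s i)\<^sup>2 + (w s j)\<^sup>2))"
        by (intro sum_mono) auto
      moreover have "2 * (w s i * r s i) \<le> (w s i)\<^sup>2 + \<epsilon>\<^sup>2"
      proof -
        have "2 * (w s i * r s i) \<le> (w s i)\<^sup>2 + (r s i)\<^sup>2"
          using sum_squares_bound[of "w s i" "r s i"] by simp
        moreover have "(r s i)\<^sup>2 \<le> \<epsilon>\<^sup>2" using r[OF s i] abs_le_square_iff[of "r s i" \<epsilon>] by simp
        ultimately show ?thesis by simp
      qed
      ultimately show ?thesis by (simp add: algebra_simps sum_distrib_left)
    qed
    then have "e' s \<le> (\<Sum>i<m. (\<Sum>j<m. \<bar>L\<bar> * ((w s i)\<^sup>2 + (w s j)\<^sup>2)) + ((w s i)\<^sup>2 + \<epsilon>\<^sup>2))"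
      unfolding e'_def by (intro sum_mono) auto
    also have "\<dots> = c * e s + m * \<epsilon>\<^sup>2"
      by (simp add: c_def e_def sum.distrib sum_distrib_left[symmetric] algebra_simps)
    finally show ?thesis .
  qed
  have "exp (- c * t) * e t - exp (- c * 0) * e 0 \<le> m * \<epsilon>\<^sup>2 * t - m * \<epsilon>\<^sup>2 * 0"
  proof (rule le_of_deriv_le)
    fix s assume "s \<in> {0..t}"
    then have s: "s \<in> {0..T}" using t by auto
    have sub: "{0..t} \<subseteq> {0..T}" using t by auto
    show "((\<lambda>s. exp (- c * s) * e s) has_real_derivative exp (- c * s) * (e' s - c * e s)) (at s within {0..t})"
      by (rule derivative_eq_intros has_real_derivative_subinterval[OF e[OF s] sub] refl)+
        (simp add: algebra_simps)
    show "((\<lambda>s. m * \<epsilon>\<^sup>2 * s) has_real_derivative m * \<epsilon>\<^sup>2) (at s within {0..t})"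
      by (auto intro!: derivative_eq_intros)
    have "exp (- c * s) * (e' s - c * e s) \<le> exp (- c * s) * (m * \<epsilon>\<^sup>2)"
      using e'_le[OF s] by (intro mult_left_mono) auto
    also have "\<dots> \<le> 1 * (m * \<epsilon>\<^sup>2)"
      using c s by (intro mult_right_mono) auto
    finally show "exp (- c * s) * (e' s - c * e s) \<le> m * \<epsilon>\<^sup>2" by simp
  qed (use t in auto)
  moreover have "e 0 = 0" using 0 by (simp add: e_def)
  ultimately have "exp (- c * t) * e t \<le> m * \<epsilon>\<^sup>2 * t" by simp
  then have "exp (c * t) * (exp (- c * t) * e t) \<le> exp (c * t) * (m * \<epsilon>\<^sup>2 * t)"
    by (rule mult_left_mono) simp
  then have "e t \<le> exp (c * t) * (m * \<epsilon>\<^sup>2 * t)"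
    by (simp add: mult.assoc[symmetric] exp_add[symmetric])
  also have "\<dots> \<le> exp (c * T) * (m * \<epsilon>\<^sup>2 * T)"
    using t c by (intro mult_mono) auto
  finally show ?thesis by (simp add: e_def c_def mult.commute)
qed

section \<open>Existence, uniqueness and continuous dependence of solutions\<close>

definition lin_sol :: "nat \<Rightarrow> real \<Rightarrow> (real \<Rightarrow> nat \<Rightarrow> nat \<Rightarrow> real) \<Rightarrow> (real \<Rightarrow> nat \<Rightarrow> real) \<Rightarrow> bool" where
  "lin_sol m T B y \<longleftrightarrow> (\<forall>t\<in>{0..T}. \<forall>i<m.
     ((\<lambda>t. y t i) has_real_derivative (\<Sum>j<m. B t i j * y t j)) (at t within {0..T}))"

lemma lin_solD:
  "lin_sol m T B y \<Longrightarrow> t \<in> {0..T} \<Longrightarrow> i < m \<Longrightarrow>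
    ((\<lambda>t. y t i) has_real_derivative (\<Sum>j<m. B t i j * y t j)) (at t within {0..T})"
  by (simp add: lin_sol_def)

lemma lin_sol_continuous_on:
  "lin_sol m T B y \<Longrightarrow> i < m \<Longrightarrow> continuous_on {0..T} (\<lambda>t. y t i)"
  by (rule DERIV_continuous_on[OF lin_solD]) auto

lemma lin_sol_lincomb:
  assumes "\<And>k. k \<in> S \<Longrightarrow> lin_sol m T B (y k)"
  shows "lin_sol m T B (\<lambda>t i. \<Sum>k\<in>S. c k * y k t i)"
  unfolding lin_sol_def
proof (intro ballI allI impI)
  fix t i assume ti: "t \<in> {0..T}" "i < m"
  have "((\<lambda>t. \<Sum>k\<in>S. c k * y k t i) has_real_derivative (\<Sum>k\<in>S. c k * (\<Sum>j<m. B t i j * y k t j)))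
     (at t within {0..T})"
    by (rule DERIV_sum) (use lin_solD[OF assms ti] in \<open>auto intro!: DERIV_cmult\<close>)
  also have "(\<Sum>k\<in>S. c k * (\<Sum>j<m. B t i j * y k t j)) = (\<Sum>j<m. B t i j * (\<Sum>k\<in>S. c k * y k t j))"
    by (simp add: sum_distrib_left sum.swap[of _ _ S] algebra_simps)
  finally show "((\<lambda>t. \<Sum>k\<in>S. c k * y k t i) has_real_derivative
     (\<Sum>j<m. B t i j * (\<Sum>k\<in>S. c k * y k t j))) (at t within {0..T})" .
qed

definition bounded_coeff ::
  "nat \<Rightarrow> real \<Rightarrow> (real \<Rightarrow> nat \<Rightarrow> nat \<Rightarrow> real) \<Rightarrow> real \<Rightarrow> bool" where
  "bounded_coeff m T B L \<longleftrightarrow> (\<forall>t\<in>{0..T}. \<forall>i<m. \<forall>j<m. \<bar>B t i j\<bar> \<le> L)"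

lemma bounded_coeff_exists:
  assumes "\<And>i j. i < m \<Longrightarrow> j < m \<Longrightarrow> continuous_on {0..T::real} (\<lambda>t. B t i j :: real)"
  obtains L where "bounded_coeff m T B L" "L \<ge> 0"
proof -
  have "\<exists>b. \<forall>t\<in>{0..T}. \<bar>B t i j\<bar> \<le> b" if "i < m" "j < m" for i j
  proof -
    have "bounded ((\<lambda>t. B t i j) ` {0..T})"
      by (intro compact_imp_bounded compact_continuous_image assms that compact_Icc)
    then show ?thesis by (auto simp: bounded_iff)
  qed
  then obtain b where b: "\<And>i j t. i < m \<Longrightarrow> j < m \<Longrightarrow> t \<in> {0..T} \<Longrightarrow> \<bar>B t i j\<bar> \<le> b i j" by metis
  have "\<bar>B t i j\<bar> \<le> (\<Sum>i<m. \<Sum>j<m. \<bar>b i j\<bar>)" if "i < m" "j < m" "t \<in> {0..T}" for i j t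
  proof -
    have "\<bar>B t i j\<bar> \<le> \<bar>b i j\<bar>" using b[OF that] by simp
    also have "\<dots> \<le> (\<Sum>j<m. \<bar>b i j\<bar>)" using that by (intro member_le_sum) auto
    also have "\<dots> \<le> (\<Sum>i<m. \<Sum>j<m. \<bar>b i j\<bar>)"
      using that by (intro member_le_sum[of i _ "\<lambda>i. \<Sum>j<m. \<bar>b i j\<bar>"]) (auto intro: sum_nonneg)
    finally show ?thesis .
  qed
  then show ?thesis
    by (intro that[of "\<Sum>i<m. \<Sum>j<m. \<bar>b i j\<bar>"]) (auto simp: bounded_coeff_def intro!: sum_nonneg)
qed

lemma lin_sol_unique:
  assumes "lin_sol m T B y" "lin_sol m T B z" "bounded_coeff m T B L"
    and "\<And>i. i < m \<Longrightarrow> y 0 i = z 0 i" "t \<in> {0..T}" "i < m"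
  shows "y t i = z t i"
proof -
  let ?w = "\<lambda>t i. y t i - z t i"
  have "(\<Sum>i<m. (?w t i)\<^sup>2) \<le> real m * 0\<^sup>2 * T * exp ((2 * real m * \<bar>L\<bar> + 1) * T)"
  proof (rule energy_bound[where r = "\<lambda>_ _. 0"])
    show "((\<lambda>t. ?w t i) has_real_derivative (\<Sum>j<m. B t i j * ?w t j) + 0) (at t within {0..T})"
      if "t \<in> {0..T}" "i < m" for t i
      using DERIV_diff[OF lin_solD[OF assms(1) that] lin_solD[OF assms(2) that]]
      by (simp add: algebra_simps sum_subtractf)
  qed (use assms in \<open>auto simp: bounded_coeff_def\<close>)
  then have "(\<Sum>i<m. (?w t i)\<^sup>2) = 0" by (simp add: sum_nonneg antisym)
  then show ?thesis using assms(6) by (simp add: sum_nonneg_eq_0_iff)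
qed

text \<open>These are the terms of the Picard series and not its partial sums, which makes the
  factorial estimate a direct induction; the solution is their sum.\<close>

primrec picard :: "nat \<Rightarrow> (real \<Rightarrow> nat \<Rightarrow> nat \<Rightarrow> real) \<Rightarrow> (nat \<Rightarrow> real) \<Rightarrow> nat \<Rightarrow> real \<Rightarrow> nat \<Rightarrow> real" where
  "picard m B z 0 t i = z i"
| "picard m B z (Suc k) t i = integral {0..t} (\<lambda>s. \<Sum>j<m. B s i j * picard m B z k s j)"

text \<open>The terms are dominated by those of an exponential series, and so are their derivatives,
  which are \<open>B\<close> applied to the preceding terms. Hence the series may be differentiated
  term by term.\<close>

lemma lin_sol_exists:
  assumes T: "T \<ge> 0" and B: "\<And>i j. i < m \<Longrightarrow> j < m \<Longrightarrow> continuous_on {0..T} (\<lambda>t. B t i j)"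
  shows "\<exists>y. lin_sol m T B y \<and> (\<forall>i<m. y 0 i = z i)"
proof -
  let ?p = "picard m B z"
  obtain L where L: "bounded_coeff m T B L" "L \<ge> 0" using bounded_coeff_exists[OF B] .
  define C where "C = (\<Sum>i<m. \<bar>z i\<bar>)"
  have C: "C \<ge> 0" "\<And>i. i < m \<Longrightarrow> \<bar>z i\<bar> \<le> C"
    by (auto simp: C_def intro: sum_nonneg member_le_sum[of _ "{..<m}" "\<lambda>i. \<bar>z i\<bar>"])
  have cont: "continuous_on {0..T} (\<lambda>t. ?p k t i)" if "i < m" for k i
    using that
  proof (induction k arbitrary: i)
    case (Suc k)
    have "continuous_on {0..T} (\<lambda>s. \<Sum>j<m. B s i j * ?p k s j)"
      using Suc B by (intro continuous_intros) auto
    then show ?case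
      by (simp add: indefinite_integral_continuous_1 integrable_continuous_real)
  qed simp
  \<comment> \<open>The derivative of term \<open>Suc k\<close> involves term \<open>k\<close>, and
    term 0 is constant. The shift is undone by \<open>sums_Suc_iff\<close> at the end.\<close>
  define q where "q k t i = (case k of 0 \<Rightarrow> 0 | Suc k \<Rightarrow> \<Sum>j<m. B t i j * ?p k t j)" for k t i
  have deriv: "((\<lambda>t. ?p k t i) has_real_derivative q k t i) (at t within {0..T})"
    if "t \<in> {0..T}" "i < m" for k t i
  proof (cases k)
    case (Suc k')
    have "continuous_on {0..T} (\<lambda>s. \<Sum>j<m. B s i j * ?p k' s j)"
      using that B cont by (intro continuous_intros) auto
    from integral_has_real_derivative[OF this that(1)] show ?thesis by (simp add: Suc q_def)
  qed (simp add: q_def)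
  \<comment> \<open>The majorant is chosen so that the derivative of \<open>M (Suc k)\<close> is
    \<open>m * L * M k\<close>; the induction then compares derivatives instead of estimating
    integrals.\<close>
  define M where "M k t = C * ((m * L) ^ k * t ^ k / fact k)" for k and t :: real
  have bound: "\<bar>?p k t i\<bar> \<le> M k t" if "t \<in> {0..T}" "i < m" for k t i
    using that
  proof (induction k arbitrary: t i)
    case (Suc k)
    have d: "((\<lambda>t. M (Suc k) t) has_real_derivative m * L * M k s) (at s within {0..t})" for s
    proof -
      have "C * ((m * L) ^ Suc k * (Suc k * s ^ k) / fact (Suc k)) = m * L * M k s"
        by (simp add: M_def field_simps del: of_nat_Suc)
      then show ?thesis unfolding M_def
        by (auto intro!: derivative_eq_intros simp: field_simps simp del: power_Suc fact_Suc of_nat_Suc)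
    qed
    have q: "\<bar>q (Suc k) s i\<bar> \<le> m * L * M k s" if "s \<in> {0..t}" for s
    proof -
      have s: "s \<in> {0..T}" using that Suc.prems by auto
      have "\<bar>\<Sum>j<m. B s i j * ?p k s j\<bar> \<le> (\<Sum>j<m. L * M k s)"
        using L s Suc.prems Suc.IH[OF s]
        by (intro order_trans[OF sum_abs] sum_mono) (auto simp: abs_mult bounded_coeff_def intro!: mult_mono)
      then show ?thesis by (simp add: q_def)
    qed
    have sub: "{0..t} \<subseteq> {0..T}" using Suc.prems by auto
    have p: "((\<lambda>t. ?p (Suc k) t i) has_real_derivative q (Suc k) s i) (at s within {0..t})"
      if "s \<in> {0..t}" for s
      by (rule has_real_derivative_subinterval[OF deriv sub]) (use that Suc.prems in auto)
    have "?p (Suc k) t i - ?p (Suc k) 0 i \<le> M (Suc k) t - M (Suc k) 0"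
      by (rule le_of_deriv_le[OF _ p d]) (use q Suc.prems in \<open>auto simp: abs_le_iff\<close>)
    moreover have "- ?p (Suc k) t i - - ?p (Suc k) 0 i \<le> M (Suc k) t - M (Suc k) 0"
      by (rule le_of_deriv_le[OF _ DERIV_minus[OF p] d]) (use q Suc.prems in \<open>auto simp: abs_le_iff\<close>)
    ultimately show ?case by (simp add: M_def)
  qed (use C in \<open>auto simp: M_def\<close>)
  have MT: "M k t \<le> M k T" if "t \<in> {0..T}" for k t
    using that C L unfolding M_def
    by (intro mult_left_mono divide_right_mono power_mono) auto
  have sM: "summable (\<lambda>k. M k T)"
  proof -
    have "summable (\<lambda>k. C * ((m * L * T) ^ k /\<^sub>R fact k))"
      by (intro summable_mult summable_exp_generic)
    then show ?thesis by (simp add: M_def power_mult_distrib field_simps)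
  qed
  have sp: "summable (\<lambda>k. ?p k t i)" if "t \<in> {0..T}" "i < m" for t i
    by (rule summable_comparison_test'[OF sM, of 0]) (use bound[OF that] MT[OF that(1)] in \<open>auto intro: order_trans\<close>)
  define y where "y t i = (\<Sum>k. ?p k t i)" for t i
  have "((\<lambda>t. y t i) has_real_derivative (\<Sum>j<m. B t i j * y t j)) (at t within {0..T})"
    if ti: "t \<in> {0..T}" "i < m" for t i
  proof -
    define g' where "g' t = (\<Sum>k. q k t i)" for t
    have qM: "norm (q k t i) \<le> (case k of 0 \<Rightarrow> 0 | Suc k \<Rightarrow> m * L * M k T)" if "t \<in> {0..T}" for k t
    proof (cases k)
      case (Suc k')
      have "\<bar>\<Sum>j<m. B t i j * ?p k' t j\<bar> \<le> (\<Sum>j<m. L * M k' T)"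
        using L that ti order_trans[OF bound[OF that] MT[OF that]]
        by (intro order_trans[OF sum_abs] sum_mono) (auto simp: abs_mult bounded_coeff_def intro!: mult_mono)
      then show ?thesis by (simp add: Suc q_def)
    qed (simp add: q_def)
    have sq: "summable (\<lambda>k. case k of 0 \<Rightarrow> 0 | Suc k \<Rightarrow> m * L * M k T)"
      by (subst summable_Suc_iff[symmetric]) (simp add: sM summable_mult)
    have "uniform_limit {0..T} (\<lambda>n t. \<Sum>k<n. q k t i) g' sequentially"
      unfolding g'_def by (rule Weierstrass_m_test[OF qM sq])
    from has_field_derivative_series[OF _ _ this, of "\<lambda>k t. ?p k t i" t]
    have "\<exists>g. \<forall>t\<in>{0..T}. (\<lambda>k. ?p k t i) sums g t \<and> (g has_real_derivative g' t) (at t within {0..T})"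
      using deriv ti sp[OF ti] by simp
    then obtain g where g: "\<And>t. t \<in> {0..T} \<Longrightarrow> (\<lambda>k. ?p k t i) sums g t"
      "\<And>t. t \<in> {0..T} \<Longrightarrow> (g has_real_derivative g' t) (at t within {0..T})"
      by blast
    have gy: "g t = y t i" if "t \<in> {0..T}" for t using g(1)[OF that] by (simp add: y_def sums_iff)
    have "((\<lambda>t. y t i) has_real_derivative g' t) (at t within {0..T})"
      using g(2)[OF ti(1)] by (rule has_field_derivative_transform_within[where d = 1]) (use ti in \<open>auto simp: gy\<close>)
    also have "g' t = (\<Sum>j<m. B t i j * y t j)"
    proof -
      have "(\<lambda>k. q (Suc k) t i) sums (\<Sum>j<m. B t i j * y t j)"
        unfolding q_def y_def nat.case
        by (intro sums_sum sums_mult summable_sums sp ti) auto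
      then have "(\<lambda>k. q k t i) sums ((\<Sum>j<m. B t i j * y t j) + q 0 t i)"
        by (subst (asm) sums_Suc_iff) simp
      then show ?thesis by (simp add: g'_def q_def sums_iff)
    qed
    finally show ?thesis .
  qed
  moreover have "y 0 i = z i" for i
  proof -
    have "(\<lambda>k. ?p k 0 i) = (\<lambda>k. if k = 0 then z i else 0)"
    proof
      show "?p k 0 i = (if k = 0 then z i else 0)" for k by (cases k) auto
    qed
    then show ?thesis using sums_single[of 0 "\<lambda>_. z i"] by (simp add: y_def sums_iff)
  qed
  ultimately show ?thesis unfolding lin_sol_def by blast
qed

definition lin_flow ::
  "nat \<Rightarrow> real \<Rightarrow> (real \<Rightarrow> nat \<Rightarrow> nat \<Rightarrow> real) \<Rightarrow> (nat \<Rightarrow> real) \<Rightarrow> real \<Rightarrow> nat \<Rightarrow> real" where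
  "lin_flow m T B z = (SOME y. lin_sol m T B y \<and> (\<forall>i<m. y 0 i = z i))"

lemma lin_flow:
  assumes "T \<ge> 0" "\<And>i j. i < m \<Longrightarrow> j < m \<Longrightarrow> continuous_on {0..T} (\<lambda>t. B t i j)"
  shows "lin_sol m T B (lin_flow m T B z)" "i < m \<Longrightarrow> lin_flow m T B z 0 i = z i"
proof -
  have "\<exists>y. lin_sol m T B y \<and> (\<forall>i<m. y 0 i = z i)" using assms by (rule lin_sol_exists)
  from someI_ex[OF this]
  show "lin_sol m T B (lin_flow m T B z)" "i < m \<Longrightarrow> lin_flow m T B z 0 i = z i"
    by (simp_all add: lin_flow_def)
qed

lemma lin_flow_unique:
  assumes "T \<ge> 0" "\<And>i j. i < m \<Longrightarrow> j < m \<Longrightarrow> continuous_on {0..T} (\<lambda>t. B t i j)"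
    and "lin_sol m T B y" "\<And>i. i < m \<Longrightarrow> y 0 i = z i" "t \<in> {0..T}" "i < m"
  shows "lin_flow m T B z t i = y t i"
proof -
  obtain L where "bounded_coeff m T B L" using bounded_coeff_exists[OF assms(2)] .
  from lin_sol_unique[OF lin_flow(1)[OF assms(1,2)] assms(3) this] show ?thesis
    using assms lin_flow(2)[OF assms(1,2)] by auto
qed

text \<open>The difference of two flows solves the system with coefficients \<open>B p\<close> and
  with inhomogeneity \<open>B p - A\<close> applied to the limit flow, so
  \<open>energy_bound\<close> applies. The filter is arbitrary, so that one lemma covers continuity
  in \<open>\<tau>\<close>, \<open>s\<close> and \<open>l\<close> together.\<close>

lemma uniform_limit_lin_flow:
  fixes B :: "'p \<Rightarrow> real \<Rightarrow> nat \<Rightarrow> nat \<Rightarrow> real"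
  assumes T: "T \<ge> 0"
    and B: "\<And>p i j. i < m \<Longrightarrow> j < m \<Longrightarrow> continuous_on {0..T} (\<lambda>t. B p t i j)"
    and A: "\<And>i j. i < m \<Longrightarrow> j < m \<Longrightarrow> continuous_on {0..T} (\<lambda>t. A t i j)"
    and lim: "\<And>i j. i < m \<Longrightarrow> j < m \<Longrightarrow> uniform_limit {0..T} (\<lambda>p t. B p t i j) (\<lambda>t. A t i j) F"
    and i: "i < m"
  shows "uniform_limit {0..T} (\<lambda>p t. lin_flow m T (B p) z t i) (\<lambda>t. lin_flow m T A z t i) F"
proof (rule uniform_limitI)
  fix e :: real assume e: "e > 0"
  obtain L where L: "bounded_coeff m T A L" "L \<ge> 0" using bounded_coeff_exists[OF A] .
  let ?a = "lin_flow m T A z"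
  note a = lin_flow[where B = A and z = z, OF T A]
  have "continuous_on {0..T} (\<lambda>t. ?a t j)" if "j < m" for j
    using a(1) that by (rule lin_sol_continuous_on)
  from bounded_coeff_exists[of m T "\<lambda>t i j. ?a t j", OF this]
  obtain Y where Y: "\<And>t j. t \<in> {0..T} \<Longrightarrow> j < m \<Longrightarrow> \<bar>?a t j\<bar> \<le> Y" "Y \<ge> 0"
    unfolding bounded_coeff_def using i by metis
  define K where "K = m * T * exp ((2 * real m * \<bar>L + 1\<bar> + 1) * T)"
  have K: "K \<ge> 0" using T by (simp add: K_def)
  \<comment> \<open>\<open>\<epsilon>\<close> will bound the inhomogeneity, and
    \<open>K * \<epsilon>^2\<close> the squared error.\<close>
  have "\<exists>\<epsilon>>0. K * \<epsilon>\<^sup>2 < e\<^sup>2"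
  proof -
    let ?\<epsilon> = "e / sqrt (K + 1)"
    have "K * ?\<epsilon>\<^sup>2 = e\<^sup>2 * (K / (K + 1))" using K by (simp add: power_divide)
    also have "\<dots> < e\<^sup>2 * 1" using K e by (intro mult_strict_left_mono) auto
    finally show ?thesis using e K by (intro exI[of _ ?\<epsilon>]) auto
  qed
  then obtain \<epsilon> where \<epsilon>: "\<epsilon> > 0" "K * \<epsilon>\<^sup>2 < e\<^sup>2" by blast
  \<comment> \<open>The 1 keeps the entries of \<open>B p\<close> below \<open>L + 1\<close>; the
    other bound keeps the inhomogeneity below \<open>\<epsilon>\<close>.\<close>
  define \<delta> where "\<delta> = min 1 (\<epsilon> / (m * Y + 1))"
  have mY: "m * Y + 1 > 0" using Y(2) by (simp add: add_nonneg_pos)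
  have \<delta>: "\<delta> > 0" using \<epsilon> mY by (simp add: \<delta>_def)
  have "\<forall>\<^sub>F p in F. \<forall>i\<in>{..<m}. \<forall>j\<in>{..<m}. \<forall>t\<in>{0..T}. dist (B p t i j) (A t i j) < \<delta>"
  proof (rule eventually_ball_finite[OF finite_lessThan], intro ballI,
      rule eventually_ball_finite[OF finite_lessThan], intro ballI)
    fix i j assume "i \<in> {..<m}" "j \<in> {..<m}"
    then show "\<forall>\<^sub>F p in F. \<forall>t\<in>{0..T}. dist (B p t i j) (A t i j) < \<delta>"
      using uniform_limitD[OF lim \<delta>] by simp
  qed
  then show "\<forall>\<^sub>F p in F. \<forall>t\<in>{0..T}. dist (lin_flow m T (B p) z t i) (?a t i) < e"
  proof eventually_elim
    case (elim p)
    let ?b = "lin_flow m T (B p) z"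
    note b = lin_flow[where B = "B p" and z = z, OF T B]
    have d: "\<bar>B p t i j - A t i j\<bar> \<le> \<delta>" if "t \<in> {0..T}" "i < m" "j < m" for t i j
      using elim that by (force simp: dist_real_def)
    let ?w = "\<lambda>t i. ?b t i - ?a t i"
    show ?case
    proof
      fix t assume t: "t \<in> {0..T}"
      have "(\<Sum>i<m. (?w t i)\<^sup>2) \<le> m * \<epsilon>\<^sup>2 * T * exp ((2 * real m * \<bar>L + 1\<bar> + 1) * T)"
      proof (rule energy_bound)
        show "((\<lambda>t. ?w t i) has_real_derivative
            (\<Sum>j<m. B p t i j * ?w t j) + (\<Sum>j<m. (B p t i j - A t i j) * ?a t j)) (at t within {0..T})"
          if "t \<in> {0..T}" "i < m" for t i
          using DERIV_diff[OF lin_solD[OF b(1) that] lin_solD[OF a(1) that]]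
          by (simp add: algebra_simps sum_subtractf)
        show "\<bar>B p t i j\<bar> \<le> L + 1" if "t \<in> {0..T}" "i < m" "j < m" for t i j
        proof -
          have "\<bar>A t i j\<bar> \<le> L" using L(1) that by (simp add: bounded_coeff_def)
          moreover have "\<delta> \<le> 1" by (simp add: \<delta>_def)
          ultimately show ?thesis using d[OF that] by linarith
        qed
        show "\<bar>\<Sum>j<m. (B p t i j - A t i j) * ?a t j\<bar> \<le> \<epsilon>" if "t \<in> {0..T}" "i < m" for t i
        proof -
          have "\<bar>\<Sum>j<m. (B p t i j - A t i j) * ?a t j\<bar> \<le> (\<Sum>j<m. \<delta> * Y)"
            using d[OF that] Y that \<delta>
            by (intro order_trans[OF sum_abs] sum_mono) (auto simp: abs_mult intro!: mult_mono)
          also have "\<dots> \<le> \<delta> * (m * Y + 1)" using \<delta> by (simp add: algebra_simps)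
          also have "\<dots> \<le> \<epsilon>"
            using mY \<epsilon> by (simp add: \<delta>_def min_mult_distrib_right)
          finally show ?thesis .
        qed
      qed (use a(2) b(2) t in auto)
      also have "\<dots> = K * \<epsilon>\<^sup>2" by (simp add: K_def)
      finally have "(\<Sum>i<m. (?w t i)\<^sup>2) < e\<^sup>2" using \<epsilon>(2) by linarith
      moreover have "(?w t i)\<^sup>2 \<le> (\<Sum>i<m. (?w t i)\<^sup>2)"
        using i by (intro member_le_sum) auto
      ultimately have "(?w t i)\<^sup>2 < e\<^sup>2" by linarith
      then have "\<bar>?w t i\<bar> < e" using e power2_less_imp_less[of "\<bar>?w t i\<bar>" e] by simp
      then show "dist (?b t i) (?a t i) < e" by (simp add: dist_real_def)
    qed
  qed
qed

section \<open>The Evans function\<close>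

lemma sgn_eq_of_continuous_nonzero:
  fixes f :: "real \<Rightarrow> real"
  assumes "continuous_on {a..b} f" "\<And>x. x \<in> {a..b} \<Longrightarrow> f x \<noteq> 0" "x \<in> {a..b}" "y \<in> {a..b}"
  shows "sgn (f x) = sgn (f y)"
proof -
  have *: "sgn (f x) = sgn (f y)" if "x \<le> y" "x \<in> {a..b}" "y \<in> {a..b}" for x y
  proof (rule ccontr)
    assume ne: "sgn (f x) \<noteq> sgn (f y)"
    have c: "continuous_on {x..y} f" using assms(1) by (rule continuous_on_subset) (use that in auto)
    have nz: "f x \<noteq> 0" "f y \<noteq> 0" using assms(2) that by auto
    then consider "f x < 0" "f y > 0" | "f x > 0" "f y < 0"
      using ne by (metis linorder_neqE_linordered_idom sgn_pos sgn_neg)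
    then have "\<exists>z\<ge>x. z \<le> y \<and> f z = 0"
      by cases (use IVT'[of f x 0 y] IVT2'[of f y 0 x] c that in auto)
    then show False using assms(2) that by force
  qed
  show ?thesis
  proof (cases "x \<le> y")
    case True
    then show ?thesis using assms(3,4) by (rule *)
  next
    case False
    then show ?thesis by (intro *[symmetric] assms(3,4)) simp
  qed
qed

lemma vector_derivative_unique_Icc:
  fixes f :: "real \<Rightarrow> 'b::real_normed_vector"
  assumes "(f has_vector_derivative x) (at t within {a..b})"
    and "(f has_vector_derivative y) (at t within {a..b})" "a < b" "t \<in> {a..b}"
  shows "x = y"
  using vector_derivative_unique_within_closed_interval[of a b t f x y] assms by simp

lemma sig_simps [simp]: "sig n \<kappa> i * sig n \<kappa> i = 1" "sig n \<kappa> i * (sig n \<kappa> i * x) = x" "sig n \<kappa> i \<noteq> 0"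
  "\<bar>sig n \<kappa> i\<bar> = 1"
  by (auto simp: sig_def)

lemma sum_double:
  fixes f :: "nat \<Rightarrow> 'b::comm_monoid_add"
  shows "(\<Sum>i<2 * n. f i) = (\<Sum>i<n. f i) + (\<Sum>i<n. f (n + i))"
proof -
  have "(\<Sum>i<2 * n. f i) = (\<Sum>i<n. f i) + (\<Sum>i\<in>{n..<2 * n}. f i)"
    by (subst sum.union_disjoint[symmetric]) (auto intro: sum.cong)
  also have "(\<Sum>i\<in>{n..<2 * n}. f i) = (\<Sum>i<n. f (n + i))"
    by (rule sum.reindex_bij_witness[of _ "\<lambda>i. n + i" "\<lambda>i. i - n"]) auto
  finally show ?thesis .
qed

lemma all_double: "(\<forall>i<2 * n. Q i) \<longleftrightarrow> (\<forall>i<n. Q i) \<and> (\<forall>i<n. Q (n + i))" for n :: nat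
proof safe
  fix i assume "\<forall>i<n. Q i" "\<forall>i<n. Q (n + i)" "i < 2 * n"
  then show "Q i" by (cases "i < n") (auto dest: spec[of _ "i - n"])
qed auto

definition unitv :: "nat \<Rightarrow> nat \<Rightarrow> real" where
  "unitv j = (\<lambda>i. of_bool (i = j))"

lemma sum_unitv: "i < m \<Longrightarrow> (\<Sum>j<m. x j * unitv j i) = x i" "i < m \<Longrightarrow> (\<Sum>j<m. unitv j i * x j) = x i"
  "i < m \<Longrightarrow> (\<Sum>j<m. x j * unitv i j) = x i" "i < m \<Longrightarrow> (\<Sum>j<m. unitv i j * x j) = x i"
  by (auto simp: unitv_def of_bool_def if_distrib[where f = "\<lambda>a. _ * a"]
    if_distrib[where f = "\<lambda>a. a * _"] cong: if_cong)

lemma uniform_limit_sum: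
  fixes f :: "'i \<Rightarrow> 'p \<Rightarrow> 'a \<Rightarrow> 'b::real_normed_vector"
  assumes "\<And>i. i \<in> I \<Longrightarrow> uniform_limit S (f i) (g i) F"
  shows "uniform_limit S (\<lambda>p t. \<Sum>i\<in>I. f i p t) (\<lambda>t. \<Sum>i\<in>I. g i t) F"
  using assms by (induction I rule: infinite_finite_induct)
    (auto intro!: uniform_limit_add uniform_limit_const)

text \<open>The analytic data of a closed geodesic in a parallel frame. The last assumption is
  \<open>A^T G A = G\<close> in entries; it makes the return map symplectic.\<close>

locale index_problem =
  fixes n \<kappa> :: nat and T :: real and A :: "real mat" and R :: "real \<Rightarrow> nat \<Rightarrow> nat \<Rightarrow> real"
  assumes T: "T > 0"
    and R_cont: "i < n \<Longrightarrow> j < n \<Longrightarrow> continuous_on {0..T} (\<lambda>t. R t i j)"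
    and R_sym: "t \<in> {0..T} \<Longrightarrow> i < n \<Longrightarrow> j < n \<Longrightarrow> R t i j = R t j i"
    and A_iso: "i < n \<Longrightarrow> j < n \<Longrightarrow>
      (\<Sum>k<n. sig n \<kappa> k * A $$ (k, i) * A $$ (k, j)) = (if i = j then sig n \<kappa> i else 0)"
begin

abbreviation "eps \<equiv> sig n \<kappa>"

text \<open>Multiplying the eigenvalue equation by \<open>G\<close> and using \<open>G^2 = 1\<close>
  solves it for \<open>u''\<close>. Thereby \<open>R\<close> and \<open>l\<close> acquire a factor
  \<open>G\<close>, while the shift \<open>s G\<close> loses its own.\<close>

definition coef :: "real \<Rightarrow> real \<Rightarrow> real \<Rightarrow> real \<Rightarrow> nat \<Rightarrow> nat \<Rightarrow> real" where
  "coef \<tau> s l t i j = \<tau> * eps i * R t i j + (if i = j then s - l * eps i else 0)"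

text \<open>The eigenvalue equation \<open>- G u'' + \<tau> R u + s G u = l u\<close> as a first order system in phase
  space, positions having indices below \<open>n\<close>. The deformation parameter \<open>\<tau>\<close> leads from \<open>\<tau> = 1\<close> to the
  explicitly solvable case \<open>\<tau> = 0\<close>.\<close>

definition phase :: "real \<Rightarrow> real \<Rightarrow> real \<Rightarrow> real \<Rightarrow> nat \<Rightarrow> nat \<Rightarrow> real" where
  "phase \<tau> s l t i j =
     (if i < n then of_bool (j = n + i) else if j < n then coef \<tau> s l t (i - n) j else 0)"

abbreviation "sol \<tau> s l \<equiv> lin_sol (2 * n) T (phase \<tau> s l)"
abbreviation "flow \<tau> s l \<equiv> lin_flow (2 * n) T (phase \<tau> s l)"

lemma phase_sum:
  "i < n \<Longrightarrow> (\<Sum>j<2 * n. phase \<tau> s l t i j * y j) = y (n + i)"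
  "i < n \<Longrightarrow> (\<Sum>j<2 * n. phase \<tau> s l t (n + i) j * y j) = (\<Sum>j<n. coef \<tau> s l t i j * y j)"
  by (simp_all add: sum_double phase_def of_bool_def if_distrib[where f = "\<lambda>a. a * _"] cong: if_cong)

lemma coef_cont: "i < n \<Longrightarrow> j < n \<Longrightarrow> continuous_on {0..T} (\<lambda>t. coef \<tau> s l t i j)"
  unfolding coef_def by (intro continuous_intros R_cont) auto

lemma phase_cont: "i < 2 * n \<Longrightarrow> j < 2 * n \<Longrightarrow> continuous_on {0..T} (\<lambda>t. phase \<tau> s l t i j)"
  by (cases "i < n"; cases "j < n") (simp_all add: phase_def coef_cont)

lemma coef_sum:
  "i < n \<Longrightarrow> (\<Sum>j<n. coef \<tau> s l t i j * y j) = \<tau> * eps i * (\<Sum>j<n. R t i j * y j) + s * y i - l * eps i * y i"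
proof -
  assume i: "i < n"
  have "(\<Sum>j<n. coef \<tau> s l t i j * y j) =
      (\<Sum>j<n. \<tau> * eps i * (R t i j * y j) + (s - l * eps i) * (y j * unitv i j))"
    by (rule sum.cong) (auto simp: coef_def unitv_def algebra_simps)
  also have "\<dots> = \<tau> * eps i * (\<Sum>j<n. R t i j * y j) + (s - l * eps i) * y i"
    using i by (simp add: sum.distrib sum_distrib_left[symmetric] sum_unitv)
  finally show ?thesis by (simp add: algebra_simps)
qed

lemma sol_iff:
  "sol \<tau> s l y \<longleftrightarrow> (\<forall>t\<in>{0..T}. \<forall>i<n.
     ((\<lambda>t. y t i) has_real_derivative y t (n + i)) (at t within {0..T}) \<and>
     ((\<lambda>t. y t (n + i)) has_real_derivative
        \<tau> * eps i * (\<Sum>j<n. R t i j * y t j) + s * y t i - l * eps i * y t i) (at t within {0..T}))"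
  unfolding lin_sol_def all_double by (auto simp: phase_sum coef_sum)

lemma T0: "T \<ge> 0" using T by simp

lemma sol_flow: "sol \<tau> s l (flow \<tau> s l z)" by (rule lin_flow(1)[OF T0 phase_cont])
lemma flow_0: "i < 2 * n \<Longrightarrow> flow \<tau> s l z 0 i = z i" by (rule lin_flow(2)[OF T0 phase_cont])
lemma flow_unique:
  "sol \<tau> s l y \<Longrightarrow> (\<And>i. i < 2 * n \<Longrightarrow> y 0 i = z i) \<Longrightarrow> t \<in> {0..T} \<Longrightarrow> i < 2 * n \<Longrightarrow> flow \<tau> s l z t i = y t i"
  by (rule lin_flow_unique[OF T0 phase_cont])

lemma flow_cont: "i < 2 * n \<Longrightarrow> continuous_on {0..T} (\<lambda>t. flow \<tau> s l z t i)"
  by (rule lin_sol_continuous_on[OF sol_flow])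

lemma flow_lincomb:
  assumes "\<And>i. i < 2 * n \<Longrightarrow> z i = (\<Sum>k\<in>S. c k * x k i)" "t \<in> {0..T}" "i < 2 * n"
  shows "flow \<tau> s l z t i = (\<Sum>k\<in>S. c k * flow \<tau> s l (x k) t i)"
  by (rule flow_unique[OF lin_sol_lincomb[OF sol_flow]]) (use assms in \<open>auto simp: flow_0\<close>)

lemma uniform_limit_flow:
  assumes "((\<lambda>p. \<tau> p) \<longlongrightarrow> \<tau>0) F" "((\<lambda>p. s p) \<longlongrightarrow> s0) F" "((\<lambda>p. l p) \<longlongrightarrow> l0) F" "i < 2 * n"
  shows "uniform_limit {0..T} (\<lambda>p t. flow (\<tau> p) (s p) (l p) z t i) (\<lambda>t. flow \<tau>0 s0 l0 z t i) F"
proof (rule uniform_limit_lin_flow[OF T0 phase_cont phase_cont])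
  fix i j assume ij: "i < 2 * n" "j < 2 * n"
  have "uniform_limit {0..T} (\<lambda>p t. coef (\<tau> p) (s p) (l p) t i j) (\<lambda>t. coef \<tau>0 s0 l0 t i j) F"
    if "i < n" "j < n" for i j
  proof -
    have "bounded ((\<lambda>t. eps i * R t i j) ` {0..T})"
      by (intro compact_imp_bounded compact_continuous_image continuous_intros R_cont that compact_Icc)
    moreover have "uniform_limit {0..T} (\<lambda>p t. \<tau> p) (\<lambda>t. \<tau>0) F"
      "uniform_limit {0..T} (\<lambda>p t. if i = j then s p - l p * eps i else 0) (\<lambda>t. if i = j then s0 - l0 * eps i else 0) F"
      using assms by (auto simp: uniform_limit_iff intro!: tendstoD tendsto_intros)
    ultimately show ?thesis
      unfolding coef_def mult.assoc
      by (intro uniform_limit_intros) (auto simp: bounded_iff)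
  qed
  then show "uniform_limit {0..T} (\<lambda>p t. phase (\<tau> p) (s p) (l p) t i j) (\<lambda>t. phase \<tau>0 s0 l0 t i j) F"
    using ij by (cases "i < n"; cases "j < n") (simp_all add: phase_def uniform_limit_const)
qed (use assms in auto)

section \<open>The boundary conditions as a fixed point problem in phase space\<close>

definition A_phase :: "(nat \<Rightarrow> real) \<Rightarrow> nat \<Rightarrow> real" where
  "A_phase y i = (if i < n then \<Sum>j<n. A $$ (i, j) * y j else \<Sum>j<n. A $$ (i - n, j) * y (n + j))"

text \<open>A solution satisfies \<open>u(0) = A u(T)\<close> and \<open>u'(0) = A u'(T)\<close>
  exactly when its initial value in phase space is fixed by this map. For \<open>\<tau> = 1\<close>
  and \<open>s = l = 0\<close> it is the linearized Poincare map in frame coordinates.\<close>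

definition return_map :: "real \<Rightarrow> real \<Rightarrow> real \<Rightarrow> (nat \<Rightarrow> real) \<Rightarrow> nat \<Rightarrow> real" where
  "return_map \<tau> s l z = A_phase (flow \<tau> s l z T)"

definition return_fixed :: "real \<Rightarrow> real \<Rightarrow> real \<Rightarrow> (nat \<Rightarrow> real) \<Rightarrow> bool" where
  "return_fixed \<tau> s l z \<longleftrightarrow> (\<forall>i<2 * n. return_map \<tau> s l z i = z i)"

definition return_mat :: "real \<Rightarrow> real \<Rightarrow> real \<Rightarrow> nat \<Rightarrow> nat \<Rightarrow> real" where
  "return_mat \<tau> s l i j = return_map \<tau> s l (unitv j) i"

definition evans :: "real \<Rightarrow> real \<Rightarrow> real \<Rightarrow> real" where
  "evans \<tau> s l = fdet (2 * n) (\<lambda>i j. return_mat \<tau> s l i j - unitv j i)"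

lemma A_phase_cong: "(\<And>i. i < 2 * n \<Longrightarrow> y i = z i) \<Longrightarrow> i < 2 * n \<Longrightarrow> A_phase y i = A_phase z i"
  by (auto simp: A_phase_def intro!: sum.cong)

lemma A_phase_lincomb: "A_phase (\<lambda>i. \<Sum>k\<in>S. c k * x k i) i = (\<Sum>k\<in>S. c k * A_phase (x k) i)"
  by (simp add: A_phase_def sum_distrib_left sum.swap[of _ _ S] algebra_simps)

lemma return_map_lincomb:
  assumes "\<And>i. i < 2 * n \<Longrightarrow> z i = (\<Sum>k\<in>S. c k * x k i)" "i < 2 * n"
  shows "return_map \<tau> s l z i = (\<Sum>k\<in>S. c k * return_map \<tau> s l (x k) i)"
  unfolding return_map_def A_phase_lincomb[symmetric]
  by (rule A_phase_cong[OF flow_lincomb]) (use assms T in auto)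

lemma return_map_mat: "i < 2 * n \<Longrightarrow> return_map \<tau> s l z i = (\<Sum>j<2 * n. return_mat \<tau> s l i j * z j)"
  by (subst return_map_lincomb[where z = z and x = unitv and c = z and S = "{..<2 * n}"])
    (auto simp: sum_unitv return_mat_def mult.commute)

lemma return_mat_minus: "i < 2 * n \<Longrightarrow> (\<Sum>j<2 * n. (return_mat \<tau> s l i j - unitv j i) * z j) = return_map \<tau> s l z i - z i"
  by (simp add: return_map_mat left_diff_distrib sum_subtractf sum_unitv)

lemma evans_eq_0_iff: "evans \<tau> s l = 0 \<longleftrightarrow> (\<exists>z. (\<exists>i<2 * n. z i \<noteq> 0) \<and> return_fixed \<tau> s l z)"
  unfolding evans_def fdet_eq_0_iff return_fixed_def by (simp add: return_mat_minus)

lemma tendsto_return_map: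
  assumes "((\<lambda>p. \<tau> p) \<longlongrightarrow> \<tau>0) F" "((\<lambda>p. s p) \<longlongrightarrow> s0) F" "((\<lambda>p. l p) \<longlongrightarrow> l0) F" "i < 2 * n"
  shows "((\<lambda>p. return_map (\<tau> p) (s p) (l p) z i) \<longlongrightarrow> return_map \<tau>0 s0 l0 z i) F"
proof -
  have "((\<lambda>p. flow (\<tau> p) (s p) (l p) z T j) \<longlongrightarrow> flow \<tau>0 s0 l0 z T j) F" if "j < 2 * n" for j
    by (rule tendsto_uniform_limitI[OF uniform_limit_flow[OF assms(1-3) that]]) (use T0 in auto)
  then show ?thesis
    using assms(4) by (auto simp: return_map_def A_phase_def intro!: tendsto_intros)
qed

lemma tendsto_evans:
  assumes "((\<lambda>p. \<tau> p) \<longlongrightarrow> \<tau>0) F" "((\<lambda>p. s p) \<longlongrightarrow> s0) F" "((\<lambda>p. l p) \<longlongrightarrow> l0) F"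
  shows "((\<lambda>p. evans (\<tau> p) (s p) (l p)) \<longlongrightarrow> evans \<tau>0 s0 l0) F"
  unfolding evans_def return_mat_def by (intro tendsto_fdet tendsto_intros tendsto_return_map assms)

lemma continuous_on_evans [continuous_intros]:
  "continuous_on S f \<Longrightarrow> continuous_on S g \<Longrightarrow> continuous_on S h \<Longrightarrow>
    continuous_on S (\<lambda>x. evans (f x) (g x) (h x))"
  unfolding continuous_on_def by (blast intro: tendsto_evans)

section \<open>The symplectic form, which is the Wronskian twisted by \<open>G\<close>\<close>

definition omega :: "(nat \<Rightarrow> real) \<Rightarrow> (nat \<Rightarrow> real) \<Rightarrow> real" where
  "omega z w = (\<Sum>i<n. eps i * (z i * w (n + i) - z (n + i) * w i))"

lemma omega_cong:
  "(\<And>i. i < 2 * n \<Longrightarrow> z i = z' i) \<Longrightarrow> (\<And>i. i < 2 * n \<Longrightarrow> w i = w' i) \<Longrightarrow> omega z w = omega z' w'"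
  by (auto simp: omega_def intro!: sum.cong)

lemma omega_sum_left: "omega (\<lambda>i. \<Sum>k\<in>S. c k * x k i) w = (\<Sum>k\<in>S. c k * omega (x k) w)"
proof -
  have "eps i * ((\<Sum>k\<in>S. c k * x k i) * w (n + i) - (\<Sum>k\<in>S. c k * x k (n + i)) * w i) =
     (\<Sum>k\<in>S. c k * (eps i * (x k i * w (n + i) - x k (n + i) * w i)))" for i
    unfolding sum_distrib_right sum_subtractf[symmetric] sum_distrib_left
    by (rule sum.cong) (auto simp: algebra_simps)
  then show ?thesis
    by (simp only: omega_def sum_distrib_left) (rule sum.swap)
qed

lemma omega_skew: "omega w z = - omega z w"
  unfolding omega_def sum_negf[symmetric] by (rule sum.cong) (auto simp: algebra_simps)

lemma omega_sum_right: "omega w (\<lambda>i. \<Sum>k\<in>S. c k * x k i) = (\<Sum>k\<in>S. c k * omega w (x k))"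
  using omega_sum_left[of c x S w] by (simp add: omega_skew[of w] sum_negf)

lemma omega_diff_right: "omega w (\<lambda>i. x i - y i) = omega w x - omega w y"
  unfolding omega_def sum_subtractf[symmetric] by (rule sum.cong) (auto simp: algebra_simps)

lemma omega_scale_right: "omega w (\<lambda>i. c * x i) = c * omega w x"
  unfolding omega_def sum_distrib_left by (rule sum.cong) (auto simp: algebra_simps)

lemma omega_refl: "omega z z = 0"
  using omega_skew[of z z] by simp

lemma omega_unitv:
  "i < n \<Longrightarrow> omega (unitv i) x = eps i * x (n + i)"
  "i < n \<Longrightarrow> omega (unitv (n + i)) x = - eps i * x i"
proof -
  assume i: "i < n"
  have "omega (unitv i) x = (\<Sum>j<n. (eps j * x (n + j)) * unitv i j)"
    unfolding omega_def by (rule sum.cong) (use i in \<open>auto simp: unitv_def\<close>)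
  then show "omega (unitv i) x = eps i * x (n + i)" using i by (simp add: sum_unitv)
  have "omega (unitv (n + i)) x = (\<Sum>j<n. (- eps j * x j) * unitv i j)"
    unfolding omega_def by (rule sum.cong) (use i in \<open>auto simp: unitv_def\<close>)
  then show "omega (unitv (n + i)) x = - eps i * x i"
    using sum_unitv(3)[OF i, of "\<lambda>j. - eps j * x j"] by simp
qed

lemma omega_nondegenerate:
  assumes "\<And>i. i < 2 * n \<Longrightarrow> omega (unitv i) x = 0" "i < 2 * n"
  shows "x i = 0"
proof -
  have "\<forall>i<2 * n. x i = 0"
    unfolding all_double
  proof safe
    fix i assume i: "i < n"
    show "x i = 0" using assms(1)[of "n + i"] omega_unitv(2)[OF i, of x] i by simp
    show "x (n + i) = 0" using assms(1)[of i] omega_unitv(1)[OF i, of x] i by simp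
  qed
  then show ?thesis using assms(2) by blast
qed

text \<open>\<open>A\<close> preserves \<open>G\<close> and acts on positions and velocities by the
  same matrix, so it preserves their pairing through \<open>G\<close>.\<close>

lemma omega_A_phase: "omega (A_phase z) (A_phase w) = omega z w"
proof -
  have *: "(\<Sum>i<n. eps i * ((\<Sum>j<n. A $$ (i, j) * x j) * (\<Sum>k<n. A $$ (i, k) * y k))) = (\<Sum>j<n. eps j * (x j * y j))"
    for x y
  proof -
    have "(\<Sum>i<n. eps i * ((\<Sum>j<n. A $$ (i, j) * x j) * (\<Sum>k<n. A $$ (i, k) * y k))) =
      (\<Sum>i<n. \<Sum>j<n. \<Sum>k<n. eps i * A $$ (i, j) * A $$ (i, k) * (x j * y k))"
      by (simp only: sum_product, simp only: sum_distrib_left mult_ac)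
    also have "\<dots> = (\<Sum>j<n. \<Sum>k<n. \<Sum>i<n. eps i * A $$ (i, j) * A $$ (i, k) * (x j * y k))"
      by (subst sum.swap, rule sum.cong[OF refl], rule sum.swap)
    also have "\<dots> = (\<Sum>j<n. \<Sum>k<n. (if j = k then eps j else 0) * (x j * y k))"
      by (simp add: sum_distrib_right[symmetric] A_iso)
    also have "\<dots> = (\<Sum>j<n. eps j * (x j * y j))"
      by (simp add: if_distrib[where f = "\<lambda>a. a * _"] cong: if_cong)
    finally show ?thesis .
  qed
  have "omega (A_phase z) (A_phase w) = (\<Sum>i<n. eps i * ((\<Sum>j<n. A $$ (i, j) * z j) * (\<Sum>k<n. A $$ (i, k) * w (n + k)))) -
      (\<Sum>i<n. eps i * ((\<Sum>j<n. A $$ (i, j) * z (n + j)) * (\<Sum>k<n. A $$ (i, k) * w k)))"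
    by (simp add: omega_def A_phase_def right_diff_distrib sum_subtractf)
  also have "\<dots> = omega z w"
    unfolding *[of z "\<lambda>j. w (n + j)"] *[of "\<lambda>j. z (n + j)" w]
    by (simp add: omega_def right_diff_distrib sum_subtractf)
  finally show ?thesis .
qed

definition overlap :: "real \<Rightarrow> real \<Rightarrow> real \<Rightarrow> real \<Rightarrow> (nat \<Rightarrow> real) \<Rightarrow> (nat \<Rightarrow> real) \<Rightarrow> real" where
  "overlap \<tau> s l m z w = integral {0..T} (\<lambda>t. \<Sum>i<n. flow \<tau> s l z t i * flow \<tau> s m w t i)"

lemma overlap_integrand_cont:
  "continuous_on {0..T} (\<lambda>t. \<Sum>i<n. flow \<tau> s l z t i * flow \<tau> s m w t i)"
  by (intro continuous_intros flow_cont) auto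

text \<open>Differentiate the Wronskian of two solutions: the \<open>R\<close> terms cancel by
  symmetry and the \<open>s\<close> terms outright. The eigenvalue terms carry \<open>G\<close>
  twice, once from the equation and once from \<open>omega\<close>, so an untwisted product
  survives, which is definite although \<open>G\<close> need not be. For \<open>l = m\<close> the
  return map is symplectic.\<close>

lemma omega_return_map: "omega (return_map \<tau> s l z) (return_map \<tau> s m w) = omega z w + (l - m) * overlap \<tau> s l m z w"
proof -
  let ?u = "flow \<tau> s l z" and ?v = "flow \<tau> s m w"
  let ?f = "\<lambda>t. \<Sum>i<n. ?u t i * ?v t i"
  have "((\<lambda>t. omega (?u t) (?v t)) has_real_derivative (l - m) * ?f t) (at t within {0..T})"
    if t: "t \<in> {0..T}" for t
  proof -
    note u = sol_flow[of \<tau> s l z, unfolded sol_iff, rule_format, OF t]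
    note v = sol_flow[of \<tau> s m w, unfolded sol_iff, rule_format, OF t]
    define ru where "ru i = (\<Sum>j<n. R t i j * ?u t j)" for i
    define rv where "rv i = (\<Sum>j<n. R t i j * ?v t j)" for i
    have "((\<lambda>t. omega (?u t) (?v t)) has_real_derivative
       (\<Sum>i<n. eps i * ((?u t (n + i) * ?v t (n + i) + (\<tau> * eps i * rv i + s * ?v t i - m * eps i * ?v t i) * ?u t i)
         - (?u t (n + i) * ?v t (n + i) + (\<tau> * eps i * ru i + s * ?u t i - l * eps i * ?u t i) * ?v t i)))) (at t within {0..T})"
      unfolding omega_def
    proof (rule DERIV_sum)
      fix i assume "i \<in> {..<n}"
      then have i: "i < n" by simp
      note ui = conjunct1[OF u[OF i]] conjunct2[OF u[OF i], folded ru_def]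
      note vi = conjunct1[OF v[OF i]] conjunct2[OF v[OF i], folded rv_def]
      show "((\<lambda>t. eps i * (?u t i * ?v t (n + i) - ?u t (n + i) * ?v t i)) has_real_derivative
         eps i * ((?u t (n + i) * ?v t (n + i) + (\<tau> * eps i * rv i + s * ?v t i - m * eps i * ?v t i) * ?u t i)
         - (?u t (n + i) * ?v t (n + i) + (\<tau> * eps i * ru i + s * ?u t i - l * eps i * ?u t i) * ?v t i))) (at t within {0..T})"
        by (rule DERIV_cong[OF DERIV_cmult[OF DERIV_diff[OF DERIV_mult[OF ui(1) vi(2)] DERIV_mult[OF ui(2) vi(1)]]]])
          (simp add: algebra_simps)
    qed
    also have "(\<Sum>i<n. eps i * ((?u t (n + i) * ?v t (n + i) + (\<tau> * eps i * rv i + s * ?v t i - m * eps i * ?v t i) * ?u t i)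
         - (?u t (n + i) * ?v t (n + i) + (\<tau> * eps i * ru i + s * ?u t i - l * eps i * ?u t i) * ?v t i))) =
        (\<Sum>i<n. \<tau> * (rv i * ?u t i) - \<tau> * (ru i * ?v t i) + (l - m) * (?u t i * ?v t i))"
      by (rule sum.cong) (simp_all add: algebra_simps)
    also have "\<dots> = \<tau> * ((\<Sum>i<n. rv i * ?u t i) - (\<Sum>i<n. ru i * ?v t i)) + (l - m) * ?f t"
      by (simp add: sum.distrib sum_subtractf sum_distrib_left right_diff_distrib)
    also have "(\<Sum>i<n. rv i * ?u t i) = (\<Sum>i<n. ru i * ?v t i)"
    proof -
      have "(\<Sum>i<n. rv i * ?u t i) = (\<Sum>i<n. \<Sum>j<n. R t i j * ?v t j * ?u t i)"
        by (simp add: rv_def sum_distrib_right)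
      also have "\<dots> = (\<Sum>j<n. \<Sum>i<n. R t j i * ?v t j * ?u t i)"
        by (subst sum.swap) (auto intro!: sum.cong simp: R_sym[OF t])
      also have "\<dots> = (\<Sum>i<n. ru i * ?v t i)"
        unfolding ru_def sum_distrib_right by (intro sum.cong refl) (simp only: mult_ac)
      finally show ?thesis .
    qed
    finally show ?thesis by simp
  qed
  then have "((\<lambda>t. (l - m) * ?f t) has_integral (omega (?u T) (?v T) - omega (?u 0) (?v 0))) {0..T}"
    by (intro fundamental_theorem_of_calculus T0) (auto simp: has_real_derivative_iff_has_vector_derivative)
  then have "omega (?u T) (?v T) - omega (?u 0) (?v 0) = (l - m) * overlap \<tau> s l m z w"
    unfolding overlap_def integral_mult_right[symmetric] by (simp add: has_integral_integrable_integral)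
  moreover have "omega (?u 0) (?v 0) = omega z w" by (rule omega_cong) (auto simp: flow_0)
  ultimately show ?thesis by (simp add: return_map_def omega_A_phase)
qed

text \<open>Definiteness on all of phase space although only positions are integrated: if the
  positions vanish on \<open>[0,T]\<close>, so does their derivative, the velocity.\<close>

lemma overlap_pos:
  assumes "overlap \<tau> s l l z z = 0" "i < 2 * n"
  shows "z i = 0"
proof -
  let ?u = "flow \<tau> s l z"
  let ?f = "\<lambda>t. \<Sum>i<n. ?u t i * ?u t i"
  have "integral {0..T} ?f = 0" using assms(1) unfolding overlap_def .
  then have "(?f has_integral 0) (cbox 0 T)"
    using integrable_integral[OF integrable_continuous_real[OF overlap_integrand_cont[of \<tau> s l z l z]]]
    unfolding cbox_interval by (simp only:)
  note int0 = this
  have f0: "?f t = 0" if "t \<in> {0..T}" for t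
    by (rule has_integral_0_cbox_imp_0[OF _ _ int0])
      (use that overlap_integrand_cont T in \<open>auto intro: sum_nonneg\<close>)
  have u0: "?u t i = 0" if "t \<in> {0..T}" "i < n" for t i
    using f0[OF that(1)] that(2) by (subst (asm) sum_nonneg_eq_0_iff) auto
  have "?u 0 (n + i) = 0" if i: "i < n" for i
  proof -
    have 0: "0 \<in> {0..T}" using T by simp
    have "((\<lambda>t. ?u t i) has_real_derivative ?u 0 (n + i)) (at 0 within {0..T})"
      using sol_flow[of \<tau> s l z] 0 i unfolding sol_iff by blast
    moreover have "((\<lambda>t. ?u t i) has_real_derivative 0) (at 0 within {0..T})"
      using DERIV_const[of 0] by (rule has_field_derivative_transform_within[where d = 1]) (use u0 i 0 in auto)
    ultimately show ?thesis
      unfolding has_real_derivative_iff_has_vector_derivative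
      by (rule vector_derivative_unique_Icc[OF _ _ T 0])
  qed
  then have "\<forall>i<2 * n. ?u 0 i = 0" unfolding all_double using u0 T by auto
  then show ?thesis using assms(2) flow_0[of i \<tau> s l z] by simp
qed

lemma tendsto_overlap: "((\<lambda>m. overlap \<tau> s l m z w) \<longlongrightarrow> overlap \<tau> s l l z w) (at l within S)"
proof (cases "at l within S = bot")
  case False
  have "uniform_limit {0..T} (\<lambda>m t. \<Sum>i<n. flow \<tau> s l z t i * flow \<tau> s m w t i)
     (\<lambda>t. \<Sum>i<n. flow \<tau> s l z t i * flow \<tau> s l w t i) (at l within S)"
  proof (rule uniform_limit_sum)
    fix i assume "i \<in> {..<n}"
    then have i: "i < 2 * n" by simp
    have bd: "bounded ((\<lambda>t. flow \<tau> s l x t i) ` {0..T})" for x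
      using i by (intro compact_imp_bounded compact_continuous_image flow_cont compact_Icc)
    show "uniform_limit {0..T} (\<lambda>m t. flow \<tau> s l z t i * flow \<tau> s m w t i)
     (\<lambda>t. flow \<tau> s l z t i * flow \<tau> s l w t i) (at l within S)"
      by (intro uniform_lim_mult uniform_limit_const uniform_limit_flow tendsto_const tendsto_ident_at i bd)
  qed
  from uniform_limit_integral[OF this overlap_integrand_cont False]
  obtain I J where I: "\<And>m. ((\<lambda>t. \<Sum>i<n. flow \<tau> s l z t i * flow \<tau> s m w t i) has_integral I m) {0..T}"
    and J: "((\<lambda>t. \<Sum>i<n. flow \<tau> s l z t i * flow \<tau> s l w t i) has_integral J) {0..T}"
    and L: "(I \<longlongrightarrow> J) (at l within S)" by blast
  show ?thesis unfolding overlap_def integral_unique[OF I] using L has_integral_unique[OF J I] by simp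
qed simp

end

section \<open>Sign changes of the Evans function\<close>

lemma sgn_eq_of_tendsto:
  fixes f :: "'p \<Rightarrow> real"
  assumes "(f \<longlongrightarrow> L) F" "L \<noteq> 0"
  shows "\<forall>\<^sub>F x in F. sgn (f x) = sgn L"
proof (cases "L > 0")
  case True
  from order_tendstoD(1)[OF assms(1) this] show ?thesis
    by eventually_elim (use True in auto)
next
  case False
  then have L: "L < 0" using assms(2) by simp
  from order_tendstoD(2)[OF assms(1) this] show ?thesis
    by eventually_elim (use L in auto)
qed

text \<open>Dividing out the zeros makes \<open>F\<close> a continuous function without zeros.\<close>

lemma sign_change_count:
  fixes F :: "real \<Rightarrow> real" and k :: "real \<Rightarrow> nat"
  assumes cont: "continuous_on UNIV F" and a: "0 \<le> a" "F a \<noteq> 0"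
    and lim: "\<And>z. z \<in> {0..a} \<Longrightarrow> \<exists>L. L \<noteq> 0 \<and> ((\<lambda>l. F l / (z - l) ^ k z) \<longlongrightarrow> L) (at z)"
  shows "finite {z\<in>{0..a}. F z = 0}"
    and "\<forall>\<^sub>F l in at_left 0. sgn (F l) = sgn (F a) * (-1) ^ (\<Sum>z | z \<in> {0..a} \<and> F z = 0. k z)"
proof -
  define Z where "Z = {z\<in>{0..a}. F z = 0}"
  have ev: "\<forall>\<^sub>F l in at z. F l \<noteq> 0" if "z \<in> {0..a}" for z
  proof -
    obtain L where "L \<noteq> 0" and L: "((\<lambda>l. F l / (z - l) ^ k z) \<longlongrightarrow> L) (at z)"
      using lim[OF \<open>z \<in> {0..a}\<close>] by blast
    from tendsto_imp_eventually_ne[OF L \<open>L \<noteq> 0\<close>] show ?thesis by eventually_elim auto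
  qed
  have "finite ({0..a} \<inter> {z. F z = 0})"
    by (rule finite_not_islimpt_in_compact) (use ev in \<open>auto simp: islimpt_iff_eventually\<close>)
  moreover have "{0..a} \<inter> {z. F z = 0} = Z" by (auto simp: Z_def)
  ultimately have fin: "finite Z" by simp
  then show "finite {z\<in>{0..a}. F z = 0}" by (simp add: Z_def)
  obtain L where L: "\<And>z. z \<in> {0..a} \<Longrightarrow> L z \<noteq> 0 \<and> ((\<lambda>l. F l / (z - l) ^ k z) \<longlongrightarrow> L z) (at z)"
    using bchoice[of "{0..a}" "\<lambda>z L. L \<noteq> 0 \<and> ((\<lambda>l. F l / (z - l) ^ k z) \<longlongrightarrow> L) (at z)"] lim by blast
  have "\<forall>\<^sub>F l in at_left 0. F l \<noteq> 0"
    by (rule filter_leD[OF _ ev[of 0]]) (use a in \<open>auto simp: at_le\<close>)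
  then obtain b where b: "b < 0" "\<And>l. b < l \<Longrightarrow> l < 0 \<Longrightarrow> F l \<noteq> 0"
    by (auto simp: eventually_at_left_field)
  \<comment> \<open>At a zero of \<open>F\<close> the value is filled in by the limit, with the
    factor of that zero removed from the denominator.\<close>
  define G where "G l = (if l \<in> Z then L l / (\<Prod>z\<in>Z - {l}. (z - l) ^ k z) else F l / (\<Prod>z\<in>Z. (z - l) ^ k z))" for l
  have G0: "G l \<noteq> 0" if "b < l" "l \<le> a" for l
  proof (cases "l \<in> Z")
    case True
    then show ?thesis using L[of l] fin by (auto simp: G_def Z_def)
  next
    case False
    then have "F l \<noteq> 0" using b(2)[of l] that by (cases "l < 0") (auto simp: Z_def)
    then show ?thesis using False fin by (auto simp: G_def)
  qed
  have Gc: "isCont G l" if l: "b < l" "l \<le> a" for l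
  proof (cases "l \<in> Z")
    case True
    have "((\<lambda>x. F x / (l - x) ^ k l / (\<Prod>z\<in>Z - {l}. (z - x) ^ k z)) \<longlongrightarrow>
        L l / (\<Prod>z\<in>Z - {l}. (z - l) ^ k z)) (at l)"
      using L[of l] True fin by (intro tendsto_intros) (auto simp: Z_def)
    moreover have "\<forall>\<^sub>F x in at l. x \<notin> Z - {l}"
      using fin by (intro eventually_at_in_open'[of "- (Z - {l})", simplified, THEN eventually_mono] eventually_at_topological[THEN iffD2] exI[of _ "- (Z - {l})"] conjI open_Compl finite_imp_closed) auto
    then have "\<forall>\<^sub>F x in at l. F x / (l - x) ^ k l / (\<Prod>z\<in>Z - {l}. (z - x) ^ k z) = G x"
      using eventually_neq_at_within[of l]
      by eventually_elim (use True fin in \<open>auto simp: G_def prod.remove[of Z l]\<close>)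
    ultimately have "(G \<longlongrightarrow> L l / (\<Prod>z\<in>Z - {l}. (z - l) ^ k z)) (at l)"
      by (rule Lim_transform_eventually)
    then show ?thesis using True by (simp add: isCont_def G_def)
  next
    case False
    have "isCont F l" using cont by (simp add: continuous_on_eq_continuous_at)
    then have "((\<lambda>x. F x / (\<Prod>z\<in>Z. (z - x) ^ k z)) \<longlongrightarrow> F l / (\<Prod>z\<in>Z. (z - l) ^ k z)) (at l)"
      using False fin unfolding isCont_def by (intro tendsto_intros) auto
    moreover have "\<forall>\<^sub>F x in at l. x \<notin> Z"
      using fin False by (intro eventually_at_topological[THEN iffD2] exI[of _ "- Z"] conjI open_Compl finite_imp_closed) auto
    then have "\<forall>\<^sub>F x in at l. F x / (\<Prod>z\<in>Z. (z - x) ^ k z) = G x"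
      by eventually_elim (auto simp: G_def)
    ultimately have "(G \<longlongrightarrow> F l / (\<Prod>z\<in>Z. (z - l) ^ k z)) (at l)"
      by (rule Lim_transform_eventually)
    then show ?thesis using False by (simp add: isCont_def G_def)
  qed
  have "sgn (F l) = sgn (F a) * (-1) ^ (\<Sum>z\<in>Z. k z)" if l: "b < l" "l < 0" for l
  proof -
    have "sgn (G l) = sgn (G a)"
      by (rule sgn_eq_of_continuous_nonzero[of l a])
        (use l a G0 Gc in \<open>auto intro!: continuous_at_imp_continuous_on\<close>)
    moreover have "sgn (G l) = sgn (F l)"
    proof -
      have "(\<Prod>z\<in>Z. (z - l) ^ k z) > 0" using l by (intro prod_pos) (auto simp: Z_def)
      moreover have "l \<notin> Z" using l by (simp add: Z_def)
      ultimately show ?thesis by (simp add: G_def sgn_divide)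
    qed
    moreover have "sgn (G a) = sgn (F a) * (-1) ^ (\<Sum>z\<in>Z. k z)"
    proof -
      have "sgn (\<Prod>z\<in>Z. (z - a) ^ k z) = (-1) ^ (\<Sum>z\<in>Z. k z)"
      proof -
        have "sgn (\<Prod>z\<in>Z. (z - a) ^ k z) = (\<Prod>z\<in>Z. sgn ((z - a) ^ k z))"
          using fin by (induction rule: finite_induct) (auto simp: sgn_mult)
        also have "\<dots> = (\<Prod>z\<in>Z. (-1) ^ k z)"
        proof (rule prod.cong)
          fix z assume "z \<in> Z"
          \<comment> \<open>Strict because \<open>F a \<noteq> 0\<close>. Thus every factor
            \<open>z - a\<close> is negative, whereas to the left of 0 every factor is positive; the
            sign change comes from this difference.\<close>
          then have "z < a" using a by (auto simp: Z_def less_le)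
          then show "sgn ((z - a) ^ k z) = (-1) ^ k z" by (simp add: power_sgn[symmetric])
        qed simp
        also have "\<dots> = (-1) ^ (\<Sum>z\<in>Z. k z)" by (simp add: power_sum)
        finally show ?thesis .
      qed
      moreover have "a \<notin> Z" using a by (simp add: Z_def)
      ultimately show ?thesis by (simp add: G_def sgn_divide power_one_over[symmetric] divide_simps minus_one_power_iff)
    qed
    ultimately show ?thesis by simp
  qed
  then show "\<forall>\<^sub>F l in at_left 0. sgn (F l) = sgn (F a) * (-1) ^ (\<Sum>z | z \<in> {0..a} \<and> F z = 0. k z)"
    using b(1) unfolding eventually_at_left_field Z_def by blast
qed

context index_problem
begin

section \<open>Leading coefficients of the Evans function at an eigenvalue\<close>

definition col :: "(nat \<Rightarrow> nat \<Rightarrow> real) \<Rightarrow> nat \<Rightarrow> nat \<Rightarrow> real" where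
  "col Q k = (\<lambda>j. Q j k)"

definition omega_det :: real where
  "omega_det = fdet (2 * n) (\<lambda>i j. omega (unitv i) (unitv j))"

lemma omega_expand: "omega z w = (\<Sum>i<2 * n. z i * omega (unitv i) w)"
proof -
  have "omega z w = omega (\<lambda>i. \<Sum>k<2 * n. z k * unitv k i) w"
    by (rule omega_cong) (simp_all add: sum_unitv)
  then show ?thesis by (simp only: omega_sum_left)
qed

lemma omega_expand_right: "omega z w = (\<Sum>i<2 * n. w i * omega z (unitv i))"
  unfolding omega_skew[of z] by (subst omega_expand) (simp add: sum_negf)

lemma omega_expand_both:
  "omega z w = (\<Sum>a<2 * n. z a * (\<Sum>b<2 * n. omega (unitv a) (unitv b) * w b))"
  by (subst omega_expand, intro sum.cong refl arg_cong2[where f = times],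
      subst omega_expand_right, intro sum.cong refl) (rule mult.commute)

lemma omega_det_nonzero: "omega_det \<noteq> 0"
  unfolding omega_det_def
proof (rule fdet_nonzeroI)
  fix x i assume x: "\<And>i. i < 2 * n \<Longrightarrow> (\<Sum>j<2 * n. omega (unitv i) (unitv j) * x j) = 0" and i: "i < 2 * n"
  show "x i = 0"
  proof (rule omega_nondegenerate[OF _ i])
    fix i assume "i < 2 * n"
    then show "omega (unitv i) x = 0"
      using x[of i] by (subst omega_expand_right) (simp add: mult.commute)
  qed
qed

text \<open>The matrix factors as \<open>Q^T J M Q\<close> with \<open>J\<close> the matrix of
  \<open>omega\<close>. The determinant of \<open>Q\<close> enters squared, so the choice of basis
  does not affect signs.\<close>

lemma fdet_omega:
  "fdet (2 * n) (\<lambda>i j. omega (col Q i) (\<lambda>k. \<Sum>m<2 * n. M k m * Q m j)) =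
    (fdet (2 * n) Q)\<^sup>2 * omega_det * fdet (2 * n) M"
proof -
  have "fdet (2 * n) (\<lambda>i j. omega (col Q i) (\<lambda>k. \<Sum>m<2 * n. M k m * Q m j)) =
    fdet (2 * n) (\<lambda>i j. \<Sum>a<2 * n. Q a i * (\<Sum>b<2 * n. omega (unitv a) (unitv b) * (\<Sum>m<2 * n. M b m * Q m j)))"
    by (rule fdet_cong, subst omega_expand_both) (simp only: col_def)
  also have "\<dots> = fdet (2 * n) (\<lambda>i j. Q j i) * (omega_det * (fdet (2 * n) M * fdet (2 * n) Q))"
    by (simp only: fdet_mult omega_det_def fdet_mult[of "2 * n" "\<lambda>i a. Q a i"])
  finally show ?thesis 
    unfolding fdet_transpose[of "2 * n" Q] power2_eq_square by (simp only: mult_ac)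
qed

text \<open>The columns of \<open>Q\<close> in \<open>K\<close> form a basis of
  \<open>ker (P - 1)\<close> and the others complete it to a basis of phase space, so
  \<open>card K\<close> is the dimension of the kernel. The last clause expresses in coordinates
  that the columns in \<open>K\<close> span it.\<close>

definition adapted :: "real \<Rightarrow> real \<Rightarrow> (nat \<Rightarrow> nat \<Rightarrow> real) \<Rightarrow> nat set \<Rightarrow> bool" where
  "adapted s l Q K \<longleftrightarrow> K \<subseteq> {..<2 * n} \<and> fdet (2 * n) Q \<noteq> 0 \<and> (\<forall>k\<in>K. return_fixed 1 s l (col Q k)) \<and>
     (\<forall>x. return_fixed 1 s l (\<lambda>j. \<Sum>k<2 * n. Q j k * x k) \<longrightarrow> (\<forall>i<2 * n. i \<notin> K \<longrightarrow> x i = 0))"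

lemma return_fixed_mat:
  "return_fixed \<tau> s l z \<longleftrightarrow> (\<forall>i<2 * n. (\<Sum>j<2 * n. (return_mat \<tau> s l i j - unitv j i) * z j) = 0)"
  unfolding return_fixed_def by (simp add: return_mat_minus)

lemma adapted_exists: "\<exists>Q K. adapted s l Q K"
proof -
  obtain Q K where QK: "K \<subseteq> {..<2 * n}" "fdet (2 * n) Q \<noteq> 0"
    "\<And>i k. i < 2 * n \<Longrightarrow> k \<in> K \<Longrightarrow> (\<Sum>j<2 * n. (return_mat 1 s l i j - unitv j i) * Q j k) = 0"
    "\<And>x i. (\<And>i. i < 2 * n \<Longrightarrow> (\<Sum>j<2 * n. (return_mat 1 s l i j - unitv j i) * (\<Sum>k<2 * n. Q j k * x k)) = 0)
      \<Longrightarrow> i < 2 * n \<Longrightarrow> i \<notin> K \<Longrightarrow> x i = 0"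
    by (rule kernel_adapted_basis[of "2 * n" "\<lambda>i j. return_mat 1 s l i j - unitv j i"]) blast
  then have "adapted s l Q K"
    unfolding adapted_def return_fixed_mat col_def by blast
  then show ?thesis by blast
qed

lemma return_fixed_lincomb:
  assumes "\<And>k. k \<in> S \<Longrightarrow> return_fixed \<tau> s l (x k)" "\<And>i. i < 2 * n \<Longrightarrow> z i = (\<Sum>k\<in>S. c k * x k i)"
  shows "return_fixed \<tau> s l z"
  unfolding return_fixed_def
proof (intro allI impI)
  fix i assume i: "i < 2 * n"
  have "return_map \<tau> s l z i = (\<Sum>k\<in>S. c k * return_map \<tau> s l (x k) i)" by (rule return_map_lincomb[OF assms(2) i])
  also have "\<dots> = z i" using assms(1) i unfolding assms(2)[OF i] return_fixed_def by simp
  finally show "return_map \<tau> s l z i = z i" .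
qed

text \<open>Replace \<open>z\<close> by its image under the return map for \<open>l\<close> and use
  the Wronskian identity. Paired with a kernel vector, \<open>P - 1\<close> thus becomes of order
  \<open>l - m\<close>, and zero for \<open>m = l\<close>.\<close>

lemma omega_kernel:
  assumes "return_fixed \<tau> s l z"
  shows "omega z (\<lambda>i. return_map \<tau> s m w i - w i) = (l - m) * overlap \<tau> s l m z w"
proof -
  have "omega z (return_map \<tau> s m w) = omega (return_map \<tau> s l z) (return_map \<tau> s m w)"
    by (rule omega_cong) (use assms in \<open>auto simp: return_fixed_def\<close>)
  then show ?thesis by (simp add: omega_diff_right omega_return_map)
qed

text \<open>The limits of \<open>omega (col Q i) ((P - 1) (col Q j))\<close> after dividing the rows in \<open>K\<close> by the small
  parameter (\<open>c = 1\<close>), mixed with the form \<open>- omega\<close> that results from perturbing \<open>P\<close> to \<open>(1 - \<eta>) P\<close>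
  (\<open>c = 0\<close>).\<close>

definition limit_mat :: "real \<Rightarrow> real \<Rightarrow> (nat \<Rightarrow> nat \<Rightarrow> real) \<Rightarrow> nat set \<Rightarrow> real \<Rightarrow> nat \<Rightarrow> nat \<Rightarrow> real" where
  "limit_mat s l Q K c i j = (if i \<in> K
      then c * overlap 1 s l l (col Q i) (col Q j) - (1 - c) * omega (col Q i) (col Q j)
      else omega (col Q i) (\<lambda>k. return_map 1 s l (col Q j) k - col Q j k))"

lemma overlap_sum_left:
  assumes "finite S"
  shows "overlap \<tau> s l m (\<lambda>i. \<Sum>k\<in>S. c k * x k i) w = (\<Sum>k\<in>S. c k * overlap \<tau> s l m (x k) w)"
proof -
  have "((\<lambda>t. \<Sum>k\<in>S. c k * (\<Sum>i<n. flow \<tau> s l (x k) t i * flow \<tau> s m w t i)) has_integral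
      (\<Sum>k\<in>S. c k * overlap \<tau> s l m (x k) w)) {0..T}"
    unfolding overlap_def
    by (intro has_integral_sum assms has_integral_mult_right integrable_integral
        integrable_continuous_real overlap_integrand_cont)
  moreover have "(\<Sum>k\<in>S. c k * (\<Sum>i<n. flow \<tau> s l (x k) t i * flow \<tau> s m w t i)) =
     (\<Sum>i<n. flow \<tau> s l (\<lambda>i. \<Sum>k\<in>S. c k * x k i) t i * flow \<tau> s m w t i)" if "t \<in> {0..T}" for t
  proof -
    have "(\<Sum>i<n. flow \<tau> s l (\<lambda>i. \<Sum>k\<in>S. c k * x k i) t i * flow \<tau> s m w t i) =
       (\<Sum>i<n. (\<Sum>k\<in>S. c k * flow \<tau> s l (x k) t i) * flow \<tau> s m w t i)"
      by (rule sum.cong) (auto simp: flow_lincomb[OF refl that])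
    also have "\<dots> = (\<Sum>i<n. \<Sum>k\<in>S. c k * (flow \<tau> s l (x k) t i * flow \<tau> s m w t i))"
      by (simp only: sum_distrib_right mult.assoc)
    also have "\<dots> = (\<Sum>k\<in>S. \<Sum>i<n. c k * (flow \<tau> s l (x k) t i * flow \<tau> s m w t i))"
      by (rule sum.swap)
    finally show ?thesis by (simp only: sum_distrib_left)
  qed
  ultimately have "((\<lambda>t. \<Sum>i<n. flow \<tau> s l (\<lambda>i. \<Sum>k\<in>S. c k * x k i) t i * flow \<tau> s m w t i) has_integral
      (\<Sum>k\<in>S. c k * overlap \<tau> s l m (x k) w)) {0..T}"
    by (rule has_integral_eq[rotated]) auto
  then show ?thesis unfolding overlap_def by (rule integral_unique)
qed

lemma overlap_commute: "overlap \<tau> s l m z w = overlap \<tau> s m l w z"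
  unfolding overlap_def by (simp add: mult.commute)

text \<open>A null vector \<open>x\<close> gives \<open>v = Q x\<close>. The rows outside
  \<open>K\<close>, together with \<open>omega_kernel\<close> for the columns in \<open>K\<close>,
  force \<open>(P - 1) v = 0\<close>, so \<open>x\<close> is supported on \<open>K\<close>. For
  \<open>c > 0\<close>, pairing the rows in \<open>K\<close> with \<open>v\<close> itself removes
  the skew form and leaves \<open>c\<close> times the positive \<open>overlap\<close>; for
  \<open>c = 0\<close> the hypothesis \<open>nd\<close> applies.\<close>

lemma limit_mat_nonsingular:
  assumes ad: "adapted s l Q K" and c: "c \<in> {0..1}"
    and nd: "c = 0 \<Longrightarrow> (\<And>z i. return_fixed 1 s l z \<Longrightarrow>
      (\<And>w. return_fixed 1 s l w \<Longrightarrow> omega w z = 0) \<Longrightarrow> i < 2 * n \<Longrightarrow> z i = 0)"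
  shows "fdet (2 * n) (limit_mat s l Q K c) \<noteq> 0"
proof (rule fdet_nonzeroI)
  fix x i assume x: "\<And>i. i < 2 * n \<Longrightarrow> (\<Sum>j<2 * n. limit_mat s l Q K c i j * x j) = 0" and i: "i < 2 * n"
  have K: "K \<subseteq> {..<2 * n}" "fdet (2 * n) Q \<noteq> 0" and fin: "finite K"
    using ad finite_subset[of K "{..<2 * n}"] by (auto simp: adapted_def)
  have fx: "k \<in> K \<Longrightarrow> return_fixed 1 s l (col Q k)" for k using ad by (auto simp: adapted_def)
  define v where "v = (\<lambda>j. \<Sum>k<2 * n. x k * col Q k j)"
  have Pv: "return_map 1 s l v k - v k = (\<Sum>j<2 * n. x j * (return_map 1 s l (col Q j) k - col Q j k))" if "k < 2 * n" for k
    using return_map_lincomb[of v x "col Q" "{..<2 * n}" k 1 s l] that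
    by (simp add: v_def right_diff_distrib sum_subtractf)
  have omP: "omega w (\<lambda>k. return_map 1 s l v k - v k) =
      (\<Sum>j<2 * n. x j * omega w (\<lambda>k. return_map 1 s l (col Q j) k - col Q j k))" for w
    unfolding omega_sum_right[symmetric] by (rule omega_cong) (simp_all add: Pv)
  have "omega (col Q a) (\<lambda>k. return_map 1 s l v k - v k) = 0" if a: "a < 2 * n" for a
  proof (cases "a \<in> K")
    case True
    then show ?thesis using omega_kernel[OF fx[OF True], of l v] by simp
  next
    case False
    then show ?thesis unfolding omP using x[OF a] by (simp add: limit_mat_def mult.commute)
  qed
  then have 0: "(\<Sum>b<2 * n. Q b a * omega (unitv b) (\<lambda>k. return_map 1 s l v k - v k)) = 0" if "a < 2 * n" for a
    using that by (subst (asm) omega_expand) (simp add: col_def)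
  have u0: "omega (unitv b) (\<lambda>k. return_map 1 s l v k - v k) = 0" if "b < 2 * n" for b
    by (rule fdet_injD[of "2 * n" "\<lambda>i j. Q j i"]) (use 0 that K in \<open>auto simp: fdet_transpose[of "2 * n" Q]\<close>)
  have fv: "return_fixed 1 s l v"
    unfolding return_fixed_def using omega_nondegenerate[OF u0] by force
  have "v = (\<lambda>j. \<Sum>k<2 * n. Q j k * x k)" by (simp add: v_def col_def mult.commute)
  then have x0: "x k = 0" if "k < 2 * n" "k \<notin> K" for k
    using fv ad that by (simp add: adapted_def)
  have vK: "v j = (\<Sum>k\<in>K. x k * col Q k j)" for j
    unfolding v_def using K x0 by (intro sum.mono_neutral_right) auto
  have row: "c * overlap 1 s l l (col Q a) v - (1 - c) * omega (col Q a) v = 0" if a: "a \<in> K" for a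
  proof -
    have "overlap 1 s l l (col Q a) v = (\<Sum>j<2 * n. x j * overlap 1 s l l (col Q a) (col Q j))"
      unfolding overlap_commute[of 1 s l l "col Q a"] v_def by (rule overlap_sum_left) simp
    moreover have "omega (col Q a) v = (\<Sum>j<2 * n. x j * omega (col Q a) (col Q j))"
      unfolding v_def by (rule omega_sum_right)
    moreover have "(\<Sum>j<2 * n. limit_mat s l Q K c a j * x j) = 0" using x a K by blast
    moreover have "(\<Sum>j<2 * n. limit_mat s l Q K c a j * x j) = (\<Sum>j<2 * n.
        c * (x j * overlap 1 s l l (col Q a) (col Q j)) - (1 - c) * (x j * omega (col Q a) (col Q j)))"
      by (rule sum.cong) (use a in \<open>simp_all add: limit_mat_def algebra_simps\<close>)
    ultimately show ?thesis by (simp only: sum_subtractf sum_distrib_left)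
  qed
  have "v k = 0" if k: "k < 2 * n" for k
  proof (cases "c = 0")
    case True
    show ?thesis
    proof (rule nd[OF True fv _ k])
      fix w assume w: "return_fixed 1 s l w"
      obtain y where y: "\<And>i. i < 2 * n \<Longrightarrow> (\<Sum>j<2 * n. Q i j * y j) = w i"
        by (rule fdet_surj[OF K(2), of w]) blast
      have "return_fixed 1 s l (\<lambda>j. \<Sum>k<2 * n. Q j k * y k)"
        by (rule return_fixed_lincomb[where S = "{()}" and c = "\<lambda>_. 1" and x = "\<lambda>_. w"]) (use w y in auto)
      then have y0: "y k = 0" if "k < 2 * n" "k \<notin> K" for k
        using ad that by (simp add: adapted_def)
      have "omega w v = omega (\<lambda>i. \<Sum>k<2 * n. y k * col Q k i) v"
        by (rule omega_cong) (simp_all add: y[symmetric] col_def mult.commute)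
      also have "\<dots> = (\<Sum>k<2 * n. y k * omega (col Q k) v)" by (rule omega_sum_left)
      also have "\<dots> = 0"
        using row True y0 by (intro sum.neutral) force
      finally show "omega w v = 0" .
    qed
  next
    case False
    have "0 = (\<Sum>a\<in>K. x a * (c * overlap 1 s l l (col Q a) v - (1 - c) * omega (col Q a) v))"
      using row by simp
    also have "\<dots> = c * (\<Sum>a\<in>K. x a * overlap 1 s l l (col Q a) v) - (1 - c) * (\<Sum>a\<in>K. x a * omega (col Q a) v)"
      by (simp add: right_diff_distrib sum_subtractf sum_distrib_left mult_ac)
    also have "\<dots> = c * overlap 1 s l l v v - (1 - c) * omega v v"
      unfolding overlap_sum_left[OF fin, symmetric] omega_sum_left[symmetric] vK[symmetric] by simp
    finally have "overlap 1 s l l v v = 0" using False by (simp add: omega_refl)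
    then show ?thesis by (rule overlap_pos) (rule k)
  qed
  then show "x i = 0"
    using fdet_injD[OF K(2), of x i] i by (simp add: v_def col_def mult.commute)
qed

lemma return_mat_scaled_minus:
  "i < 2 * n \<Longrightarrow> (\<Sum>j<2 * n. (c * return_mat \<tau> s l i j - unitv j i) * z j) = c * return_map \<tau> s l z i - z i"
  by (simp add: return_map_mat left_diff_distrib sum_subtractf sum_unitv sum_distrib_left mult.assoc)

lemma evans_scaled:
  "fdet (2 * n) (\<lambda>i j. omega (col Q i) (\<lambda>k. return_map 1 s l (col Q j) k - col Q j k)) =
    (fdet (2 * n) Q)\<^sup>2 * omega_det * evans 1 s l"
  unfolding evans_def fdet_omega[symmetric]
proof (rule fdet_cong, rule omega_cong[OF refl])
  fix i j k assume "k < 2 * n"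
  then show "return_map 1 s l (col Q j) k - col Q j k = (\<Sum>m<2 * n. (return_mat 1 s l k m - unitv m k) * Q m j)"
    using return_mat_minus[of k 1 s l "col Q j"] by (simp add: col_def)
qed

text \<open>In the rows in \<open>K\<close> the factor \<open>l - m\<close> is explicit by
  \<open>omega_kernel\<close>; the other rows converge by continuity of the return map.\<close>

lemma evans_asymptotics_scaled:
  assumes ad: "adapted s l Q K"
  shows "((\<lambda>m. (fdet (2 * n) Q)\<^sup>2 * omega_det * evans 1 s m / (l - m) ^ card K) \<longlongrightarrow>
    fdet (2 * n) (limit_mat s l Q K 1)) (at l)"
  unfolding evans_scaled[symmetric]
proof (rule tendsto_fdet_scaled)
  show "K \<subseteq> {..<2 * n}" using ad by (simp add: adapted_def)
  show "\<forall>\<^sub>F m in at l. l - m \<noteq> 0" using eventually_neq_at_within[of l] by eventually_elim auto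
  fix i j assume ij: "i \<in> K" "j < 2 * n"
  have fx: "return_fixed 1 s l (col Q i)" using ad ij by (simp add: adapted_def)
  have "\<forall>\<^sub>F m in at l. overlap 1 s l m (col Q i) (col Q j) =
     omega (col Q i) (\<lambda>k. return_map 1 s m (col Q j) k - col Q j k) / (l - m)"
    using eventually_neq_at_within[of l] by eventually_elim (simp add: omega_kernel[OF fx])
  from Lim_transform_eventually[OF tendsto_overlap this]
  show "((\<lambda>m. omega (col Q i) (\<lambda>k. return_map 1 s m (col Q j) k - col Q j k) / (l - m)) \<longlongrightarrow>
     limit_mat s l Q K 1 i j) (at l)"
    using ij by (simp add: limit_mat_def)
next
  fix i j assume ij: "i < 2 * n" "i \<notin> K" "j < 2 * n"
  show "((\<lambda>m. omega (col Q i) (\<lambda>k. return_map 1 s m (col Q j) k - col Q j k)) \<longlongrightarrow> limit_mat s l Q K 1 i j) (at l)"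
    using ij unfolding limit_mat_def omega_def by (auto intro!: tendsto_intros tendsto_return_map)
qed

text \<open>Definiteness of \<open>overlap\<close> makes the leading coefficient nonzero, so the
  order of the zero in \<open>l\<close> is the dimension of the kernel even when \<open>P\<close>
  has Jordan blocks at 1.\<close>

lemma evans_asymptotics:
  assumes ad: "adapted s l Q K"
  shows "\<exists>L. L \<noteq> 0 \<and> ((\<lambda>m. evans 1 s m / (l - m) ^ card K) \<longlongrightarrow> L) (at l)"
proof -
  define D where "D = (fdet (2 * n) Q)\<^sup>2 * omega_det"
  have D: "D \<noteq> 0" using ad omega_det_nonzero by (simp add: D_def adapted_def)
  have "((\<lambda>m. inverse D * (D * evans 1 s m / (l - m) ^ card K)) \<longlongrightarrow>
     inverse D * fdet (2 * n) (limit_mat s l Q K 1)) (at l)"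
    using evans_asymptotics_scaled[OF ad] unfolding D_def by (rule tendsto_mult_left)
  also have "(\<lambda>m. inverse D * (D * evans 1 s m / (l - m) ^ card K)) = (\<lambda>m. evans 1 s m / (l - m) ^ card K)"
    using D by (simp add: fun_eq_iff)
  finally show ?thesis
    using limit_mat_nonsingular[OF ad, of 1] D
    by (intro exI[of _ "inverse D * fdet (2 * n) (limit_mat s l Q K 1)"]) auto
qed

text \<open>Moving \<open>l\<close> below \<open>0\<close> and shrinking \<open>P\<close> to \<open>(1 - \<eta>) P\<close> have the same effect on the sign of
  \<open>det (P - 1)\<close>, since the two leading coefficients are joined by nonzero ones. Shrinking gives the sign
  of \<open>det (- 1)\<close>, as \<open>P\<close> has no eigenvalue above \<open>1\<close>.\<close>

lemma evans_left_pos: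
  assumes S1: "\<And>c z. c > 1 \<Longrightarrow> (\<And>i. i < 2 * n \<Longrightarrow> return_map 1 0 0 z i = c * z i) \<Longrightarrow> (\<And>i. i < 2 * n \<Longrightarrow> z i = 0)"
    and S2: "\<And>z. return_fixed 1 0 0 z \<Longrightarrow> (\<And>w. return_fixed 1 0 0 w \<Longrightarrow> omega w z = 0) \<Longrightarrow> (\<And>i. i < 2 * n \<Longrightarrow> z i = 0)"
  shows "\<forall>\<^sub>F l in at_left 0. evans 1 0 l > 0"
proof -
  obtain Q K where ad: "adapted 0 0 Q K" using adapted_exists by blast
  define D where "D = (fdet (2 * n) Q)\<^sup>2 * omega_det"
  have D: "D \<noteq> 0" using ad omega_det_nonzero by (simp add: D_def adapted_def)
  define L where "L c = fdet (2 * n) (limit_mat 0 0 Q K c)" for c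
  have L0: "L c \<noteq> 0" if "c \<in> {0..1}" for c
    unfolding L_def by (rule limit_mat_nonsingular[OF ad that]) (use S2 in blast)
  have "continuous_on {0..1} L"
    unfolding L_def
  proof (rule continuous_on_fdet)
    fix i j
    show "continuous_on {0..1} (\<lambda>c. limit_mat 0 0 Q K c i j)"
      by (cases "i \<in> K") (auto simp: limit_mat_def intro!: continuous_intros)
  qed
  \<comment> \<open>\<open>L 0\<close> and \<open>L 1\<close> are the leading coefficients of the
    two perturbations: the rows in \<open>K\<close> contain \<open>- omega\<close> at
    \<open>c = 0\<close> and the \<open>L2\<close> product at \<open>c = 1\<close>.\<close>
  then have sgnL: "sgn (L 0) = sgn (L 1)"
    by (rule sgn_eq_of_continuous_nonzero) (use L0 in auto)
  \<comment> \<open>For \<open>0 < \<theta> < 1\<close> a null vector of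
    \<open>\<theta> P - 1\<close> would be an eigenvector of \<open>P\<close> with eigenvalue
    \<open>1 / \<theta> > 1\<close>.\<close>
  define f where "f \<theta> = fdet (2 * n) (\<lambda>i j. \<theta> * return_mat 1 0 0 i j - unitv j i)" for \<theta>
  have f_pos: "f \<theta> > 0" if \<theta>: "\<theta> \<in> {0..<1}" for \<theta>
  proof -
    have nz: "f x \<noteq> 0" if x: "x \<in> {0..\<theta>}" for x
      unfolding f_def
    proof (rule fdet_nonzeroI)
      fix z i assume z: "\<And>i. i < 2 * n \<Longrightarrow> (\<Sum>j<2 * n. (x * return_mat 1 0 0 i j - unitv j i) * z j) = 0" and i: "i < 2 * n"
      have eq: "x * return_map 1 0 0 z k = z k" if "k < 2 * n" for k
        using z[OF that] unfolding return_mat_scaled_minus[OF that] by simp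
      show "z i = 0"
      proof (cases "x = 0")
        case False
        show ?thesis
        proof (rule S1[of "1 / x"])
          show "1 / x > 1" using False x \<theta> by simp
          show "return_map 1 0 0 z k = 1 / x * z k" if "k < 2 * n" for k using eq[OF that] False by (simp add: field_simps)
        qed (rule i)
      qed (use eq[OF i] in simp)
    qed
    have "continuous_on {0..\<theta>} f"
      unfolding f_def by (rule continuous_on_fdet) (intro continuous_intros)
    then have "sgn (f \<theta>) = sgn (f 0)"
      by (rule sgn_eq_of_continuous_nonzero) (use nz \<theta> in auto)
    moreover have "f 0 = 1"
    proof -
      have "f 0 = fdet (2 * n) (\<lambda>i j. if i \<in> {..<2 * n} then -1 * of_bool (i = j) else of_bool (i = j))"
        unfolding f_def by (rule fdet_cong) (auto simp: unitv_def)
      also have "\<dots> = (-1) ^ (2 * n) * fdet (2 * n) (\<lambda>i j. of_bool (i = j))"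
        by (subst fdet_scale_rows) auto
      also have "fdet (2 * n) (\<lambda>i j. of_bool (i = j)) = 1" by (rule fdet_one)
      finally show ?thesis by simp
    qed
    ultimately show ?thesis by (simp add: sgn_1_pos)
  qed
  have "((\<lambda>\<eta>. D * f (1 - \<eta>) / \<eta> ^ card K) \<longlongrightarrow> L 0) (at_right 0)"
  proof -
    have Df: "D * f (1 - \<eta>) = fdet (2 * n) (\<lambda>i j. omega (col Q i) (\<lambda>k. (1 - \<eta>) * return_map 1 0 0 (col Q j) k - col Q j k))" for \<eta>
      unfolding D_def f_def fdet_omega[symmetric]
    proof (rule fdet_cong, rule omega_cong[OF refl])
      fix i j k assume "k < 2 * n"
      then show "(\<Sum>m<2 * n. ((1 - \<eta>) * return_mat 1 0 0 k m - unitv m k) * Q m j) =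
          (1 - \<eta>) * return_map 1 0 0 (col Q j) k - col Q j k"
        using return_mat_scaled_minus[of k "1 - \<eta>" 1 0 0 "col Q j"] by (simp add: col_def)
    qed
    show ?thesis
      unfolding Df L_def
    proof (rule tendsto_fdet_scaled)
      show "K \<subseteq> {..<2 * n}" using ad by (simp add: adapted_def)
      show "\<forall>\<^sub>F \<eta> in at_right 0. \<eta> \<noteq> (0::real)" by (simp add: eventually_at_filter)
      fix i j assume ij: "i \<in> K" "j < 2 * n"
      have fx: "return_fixed 1 0 0 (col Q i)" using ad ij by (simp add: adapted_def)
      \<comment> \<open>\<open>P\<close> is symplectic and fixes \<open>col Q i\<close>, so in these
        rows the perturbation contributes exactly \<open>- \<eta>\<close> times
        \<open>omega\<close>.\<close>
      have eq: "omega (col Q i) (return_map 1 0 0 (col Q j)) = omega (col Q i) (col Q j)"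
        using omega_kernel[OF fx, of 0 "col Q j"] by (simp add: omega_diff_right)
      have "\<forall>\<^sub>F \<eta> in at_right 0. - omega (col Q i) (col Q j) =
         omega (col Q i) (\<lambda>k. (1 - \<eta>) * return_map 1 0 0 (col Q j) k - col Q j k) / \<eta>"
        unfolding eventually_at_filter
        by (rule always_eventually) (simp only: omega_diff_right omega_scale_right eq, simp add: field_simps)
      from Lim_transform_eventually[OF tendsto_const this]
      show "((\<lambda>\<eta>. omega (col Q i) (\<lambda>k. (1 - \<eta>) * return_map 1 0 0 (col Q j) k - col Q j k) / \<eta>) \<longlongrightarrow>
         limit_mat 0 0 Q K 0 i j) (at_right 0)"
        using ij by (simp add: limit_mat_def)
    next
      fix i j assume ij: "i < 2 * n" "i \<notin> K" "j < 2 * n"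
      have "((\<lambda>\<eta>. (1 - \<eta>) * omega (col Q i) (return_map 1 0 0 (col Q j)) - omega (col Q i) (col Q j)) \<longlongrightarrow>
          (1 - 0) * omega (col Q i) (return_map 1 0 0 (col Q j)) - omega (col Q i) (col Q j)) (at_right 0)"
        by (intro tendsto_intros)
      then show "((\<lambda>\<eta>. omega (col Q i) (\<lambda>k. (1 - \<eta>) * return_map 1 0 0 (col Q j) k - col Q j k)) \<longlongrightarrow>
         limit_mat 0 0 Q K 0 i j) (at_right 0)"
        using ij by (simp add: limit_mat_def omega_diff_right omega_scale_right)
    qed
  qed
  from sgn_eq_of_tendsto[OF this] have "\<forall>\<^sub>F \<eta> in at_right 0. sgn (D * f (1 - \<eta>) / \<eta> ^ card K) = sgn (L 0)"
    using L0 by simp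
  moreover have "\<forall>\<^sub>F \<eta> in at_right 0. \<eta> < (1::real)" "\<forall>\<^sub>F \<eta> in at_right 0. \<eta> > (0::real)"
    by (auto simp: eventually_at_right_less intro: eventually_at_right_real[THEN eventually_mono])
      (use eventually_at_right_real[of 0 1] in \<open>auto elim: eventually_mono\<close>)
  \<comment> \<open>Both \<open>f (1 - \<eta>)\<close> and the power of \<open>\<eta>\<close> are
    positive, so the sign of \<open>L 0\<close> is that of \<open>D\<close>.\<close>
  ultimately have "\<forall>\<^sub>F \<eta>::real in at_right 0. sgn D = sgn (L 0)"
  proof eventually_elim
    case (elim \<eta>)
    then have "f (1 - \<eta>) > 0" by (intro f_pos) auto
    then show ?case using elim by (simp add: sgn_mult sgn_divide)
  qed
  then have D0: "sgn D = sgn (L 1)" using sgnL by (simp add: eventually_const)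
  have "((\<lambda>m. D * evans 1 0 m / (0 - m) ^ card K) \<longlongrightarrow> L 1) (at_left 0)"
    using evans_asymptotics_scaled[OF ad] unfolding D_def L_def by (rule tendsto_mono[rotated]) (simp add: at_le)
  from sgn_eq_of_tendsto[OF this] have "\<forall>\<^sub>F m in at_left 0. sgn (D * evans 1 0 m / (0 - m) ^ card K) = sgn (L 1)"
    using L0 by simp
  moreover have "\<forall>\<^sub>F m in at_left 0. m < (0::real)" by (simp add: eventually_at_filter)
  ultimately show ?thesis
  proof eventually_elim
    case (elim m)
    then have "sgn D * sgn (evans 1 0 m) = sgn D" by (simp add: sgn_mult sgn_divide D0)
    then show ?case using D by (simp add: sgn_1_pos sgn_0_0)
  qed
qed

end

section \<open>Large shifts\<close>

text \<open>Compare the derivatives of \<open>exp (r t) f t\<close> and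
  \<open>G / r * exp (r t)\<close>. The factor \<open>1 / r\<close> gained on the forcing term is
  what makes \<open>R\<close> negligible for large \<open>s\<close>.\<close>

lemma decay_bound:
  fixes f :: "real \<Rightarrow> real"
  assumes f: "\<And>t. t \<in> {0..T} \<Longrightarrow> (f has_real_derivative - r * f t + g t) (at t within {0..T})"
    and g: "\<And>t. t \<in> {0..T} \<Longrightarrow> \<bar>g t\<bar> \<le> G" and r: "r > 0" and t: "t \<in> {0..T}"
  shows "\<bar>f t\<bar> \<le> exp (- r * t) * \<bar>f 0\<bar> + G / r"
proof -
  have *: "f t \<le> exp (- r * t) * f 0 + G / r"
    if f: "\<And>t. t \<in> {0..T} \<Longrightarrow> (f has_real_derivative - r * f t + g t) (at t within {0..T})"
    and g: "\<And>t. t \<in> {0..T} \<Longrightarrow> \<bar>g t\<bar> \<le> G" for f g :: "real \<Rightarrow> real"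
  proof -
    have sub: "{0..t} \<subseteq> {0..T}" using t by auto
    have G: "G \<ge> 0" using g[OF t] by linarith
    have "exp (r * t) * f t - exp (r * 0) * f 0 \<le> G / r * exp (r * t) - G / r * exp (r * 0)"
    proof (rule le_of_deriv_le)
      fix u assume u: "u \<in> {0..t}"
      then have u': "u \<in> {0..T}" using sub by blast
      show "((\<lambda>u. exp (r * u) * f u) has_real_derivative exp (r * u) * g u) (at u within {0..t})"
        by (rule derivative_eq_intros has_real_derivative_subinterval[OF f[OF u'] sub] refl)+
          (simp add: algebra_simps)
      show "((\<lambda>u. G / r * exp (r * u)) has_real_derivative G * exp (r * u)) (at u within {0..t})"
        by (rule derivative_eq_intros refl)+ (use r in simp)
      show "exp (r * u) * g u \<le> G * exp (r * u)" using g[OF u'] by (simp add: mult.commute[of G] abs_le_iff)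
    qed (use t in auto)
    then have "exp (r * t) * f t \<le> f 0 + G / r * exp (r * t)"
      using G r by (simp add: algebra_simps) (smt (verit) divide_nonneg_pos)
    then have "exp (- (r * t)) * (exp (r * t) * f t) \<le> exp (- (r * t)) * (f 0 + G / r * exp (r * t))"
      by (rule mult_left_mono) simp
    then show ?thesis by (simp add: algebra_simps exp_minus)
  qed
  have 1: "f t \<le> exp (- r * t) * f 0 + G / r" using f g by (rule *)
  have "- f t \<le> exp (- r * t) * (- f 0) + G / r"
    by (rule *[where f = "\<lambda>t. - f t" and g = "\<lambda>t. - g t"]) (use DERIV_minus[OF f] g in auto)
  moreover have "exp (- r * t) * f 0 \<le> exp (- r * t) * \<bar>f 0\<bar>" "exp (- r * t) * (- f 0) \<le> exp (- r * t) * \<bar>f 0\<bar>"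
    by (intro mult_left_mono; simp)+
  ultimately show ?thesis using 1 by linarith
qed

lemma fdet_block_diag:
  "fdet (2 * n) (\<lambda>i j. if i < n \<and> j < n then U i j else if n \<le> i \<and> n \<le> j then V (i - n) (j - n) else 0) =
    fdet n U * fdet n V"
proof -
  let ?U = "Matrix.mat n n (\<lambda>(i, j). U i j)" and ?V = "Matrix.mat n n (\<lambda>(i, j). V i j)"
  have "Matrix.mat (2 * n) (2 * n) (\<lambda>(i, j). if i < n \<and> j < n then U i j
      else if n \<le> i \<and> n \<le> j then V (i - n) (j - n) else 0) = four_block_mat ?U (0\<^sub>m n n) (0\<^sub>m n n) ?V"
    by (rule eq_matI) auto
  then show ?thesis
    unfolding fdet_def
    using det_four_block_mat_upper_right_zero[of ?U n "0\<^sub>m n n" n "0\<^sub>m n n" ?V] by simp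
qed

lemma zero_of_halving:
  fixes P :: "real \<Rightarrow> bool"
  assumes "P K" "\<And>K. P K \<Longrightarrow> P (K / 2)" "\<And>K. P K \<Longrightarrow> \<bar>x\<bar> \<le> K"
  shows "x = (0::real)"
proof -
  have "P (K * (1 / 2) ^ k)" for k
  proof (induction k)
    case (Suc k)
    from assms(2)[OF this] show ?case by simp
  qed (use assms(1) in simp)
  then have "\<bar>x\<bar> \<le> K * (1 / 2) ^ k" for k using assms(3) by blast
  moreover have "(\<lambda>k. K * (1 / 2) ^ k) \<longlonglongrightarrow> K * 0"
    by (intro tendsto_intros LIMSEQ_power_zero) simp
  ultimately have "\<bar>x\<bar> \<le> K * 0" by (intro LIMSEQ_le_const) auto
  then show ?thesis by simp
qed

context index_problem
begin

section \<open>Trivial kernels for large \<open>s\<close>, uniformly in the deformation of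
  \<open>R\<close>\<close>

definition A_bound :: real where "A_bound = 1 + (\<Sum>i<n. \<Sum>j<n. \<bar>A $$ (i, j)\<bar>)"

text \<open>The second sum is, up to a sign, multiplication by the inverse \<open>G A^T G\<close> of
  \<open>A\<close>. One constant thus controls the boundary conditions in both directions of
  time.\<close>

lemma abs_A_mult_le:
  assumes "i < n" "\<And>j. j < n \<Longrightarrow> \<bar>x j\<bar> \<le> K"
  shows "\<bar>\<Sum>j<n. A $$ (i, j) * x j\<bar> \<le> A_bound * K" "\<bar>\<Sum>j<n. eps j * A $$ (j, i) * x j\<bar> \<le> A_bound * K"
proof -
  have K: "K \<ge> 0" using assms(2)[OF assms(1)] by linarith
  have "\<bar>\<Sum>j<n. A $$ (i, j) * x j\<bar> \<le> (\<Sum>j<n. \<bar>A $$ (i, j)\<bar> * K)"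
    using assms(2) by (intro order_trans[OF sum_abs] sum_mono) (auto simp: abs_mult intro!: mult_left_mono)
  also have "\<dots> = (\<Sum>j<n. \<bar>A $$ (i, j)\<bar>) * K" by (simp add: sum_distrib_right)
  also have "\<dots> \<le> A_bound * K"
  proof (rule mult_right_mono[OF _ K])
    have "(\<Sum>j<n. \<bar>A $$ (i, j)\<bar>) \<le> (\<Sum>i<n. \<Sum>j<n. \<bar>A $$ (i, j)\<bar>)"
      using assms(1) by (intro member_le_sum[of i _ "\<lambda>i. \<Sum>j<n. \<bar>A $$ (i, j)\<bar>"]) (auto intro: sum_nonneg)
    then show "(\<Sum>j<n. \<bar>A $$ (i, j)\<bar>) \<le> A_bound" by (simp add: A_bound_def)
  qed
  finally show "\<bar>\<Sum>j<n. A $$ (i, j) * x j\<bar> \<le> A_bound * K" .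
  have "\<bar>\<Sum>j<n. eps j * A $$ (j, i) * x j\<bar> \<le> (\<Sum>j<n. \<bar>A $$ (j, i)\<bar> * K)"
    using assms(2) by (intro order_trans[OF sum_abs] sum_mono) (auto simp: abs_mult intro!: mult_left_mono)
  also have "\<dots> = (\<Sum>j<n. \<bar>A $$ (j, i)\<bar>) * K" by (simp add: sum_distrib_right)
  also have "\<dots> \<le> A_bound * K"
  proof (rule mult_right_mono[OF _ K])
    have "(\<Sum>j<n. \<bar>A $$ (j, i)\<bar>) \<le> (\<Sum>i<n. \<Sum>j<n. \<bar>A $$ (j, i)\<bar>)"
      using assms(1) by (intro member_le_sum[of i _ "\<lambda>i. \<Sum>j<n. \<bar>A $$ (j, i)\<bar>"]) (auto intro: sum_nonneg)
    also have "\<dots> = (\<Sum>j<n. \<Sum>i<n. \<bar>A $$ (j, i)\<bar>)" by (rule sum.swap)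
    finally show "(\<Sum>j<n. \<bar>A $$ (j, i)\<bar>) \<le> A_bound" by (simp add: A_bound_def)
  qed
  finally show "\<bar>\<Sum>j<n. eps j * A $$ (j, i) * x j\<bar> \<le> A_bound * K" .
qed

lemma A_inverse:
  assumes "\<And>i. i < n \<Longrightarrow> y i = (\<Sum>j<n. A $$ (i, j) * x j)" "k < n"
  shows "(\<Sum>i<n. eps i * A $$ (i, k) * y i) = eps k * x k"
proof -
  have "(\<Sum>i<n. eps i * A $$ (i, k) * y i) = (\<Sum>i<n. \<Sum>j<n. eps i * A $$ (i, k) * A $$ (i, j) * x j)"
    by (rule sum.cong) (simp_all add: assms(1) sum_distrib_left mult_ac)
  also have "\<dots> = (\<Sum>j<n. (\<Sum>i<n. eps i * A $$ (i, k) * A $$ (i, j)) * x j)"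
    by (subst sum.swap) (simp add: sum_distrib_right)
  also have "\<dots> = (\<Sum>j<n. if j = k then eps k * x k else 0)"
    by (rule sum.cong) (use assms(2) in \<open>auto simp: A_iso\<close>)
  finally show ?thesis using assms(2) by simp
qed

text \<open>With \<open>r = sqrt s\<close>, the functions \<open>u + u' / r\<close> and \<open>u - u' / r\<close> satisfy equations with
  exponentially growing and decaying solutions, perturbed by terms of order \<open>1 / r\<close>. Hence for large \<open>s\<close>
  any bound on a solution of the boundary value problem can be halved.\<close>

lemma no_kernel_large:
  "\<exists>S. \<forall>s\<ge>S. \<forall>\<tau>\<in>{0..1}. evans \<tau> s 0 \<noteq> 0"
proof -
  obtain L where L: "bounded_coeff n T R L" "L \<ge> 0" using bounded_coeff_exists[OF R_cont] .
  have A_bound: "A_bound \<ge> 1" by (auto simp: A_bound_def intro!: sum_nonneg)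
  define C where "C = (A_bound + 1) * (n * L)"
  have C: "C \<ge> 0" using A_bound L by (simp add: C_def)
  \<comment> \<open>With \<open>exp (- x) <= 1 / x\<close> this makes the contraction factor
    \<open>A_bound * exp (- r * T) + C / s\<close> at most 1/2.\<close>
  define S where "S = max 1 ((2 * (A_bound / T + C))\<^sup>2)"
  have "evans \<tau> s 0 \<noteq> 0" if s: "s \<ge> S" and \<tau>: "\<tau> \<in> {0..1}" for s \<tau>
  proof
    assume "evans \<tau> s 0 = 0"
    then obtain z i0 where z: "i0 < 2 * n" "z i0 \<noteq> 0" "return_fixed \<tau> s 0 z"
      unfolding evans_eq_0_iff by blast
    have s1: "s \<ge> 1" "s \<ge> (2 * (A_bound / T + C))\<^sup>2" using s by (auto simp: S_def)
    define r where "r = sqrt s"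
    have r: "r \<ge> 1" "r * r = s" "r \<ge> 2 * (A_bound / T + C)"
      using s1 real_le_rsqrt[OF s1(2)] by (auto simp: r_def)
    have small: "A_bound * exp (- r * T) + C / s \<le> 1 / 2"
    proof -
      have "A_bound * exp (- r * T) \<le> A_bound * (1 / (r * T))"
      proof (rule mult_left_mono)
        have "r * T \<le> exp (r * T)" using exp_ge_add_one_self[of "r * T"] by linarith
        then show "exp (- r * T) \<le> 1 / (r * T)" using r(1) T by (simp add: exp_minus field_simps)
      qed (use A_bound in simp)
      moreover have "C / s \<le> C / r" using r C s1 T by (intro divide_left_mono) (auto simp flip: r(2))
      moreover have "A_bound * (1 / (r * T)) + C / r = (A_bound / T + C) / r" using r T by (simp add: field_simps)
      moreover have "(A_bound / T + C) / r \<le> 1 / 2" using r by (simp add: field_simps)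
      ultimately show ?thesis by linarith
    qed
    define y where "y = flow \<tau> s 0 z"
    have y: "((\<lambda>t. y t i) has_real_derivative y t (n + i)) (at t within {0..T})"
       "((\<lambda>t. y t (n + i)) has_real_derivative \<tau> * eps i * (\<Sum>j<n. R t i j * y t j) + s * y t i) (at t within {0..T})"
      if "t \<in> {0..T}" "i < n" for t i
      using sol_flow[of \<tau> s 0 z] that unfolding sol_iff y_def by auto
    have y0: "y 0 i = (\<Sum>j<n. A $$ (i, j) * y T j)" "y 0 (n + i) = (\<Sum>j<n. A $$ (i, j) * y T (n + j))" if "i < n" for i
      using z(3) that flow_0[of i \<tau> s 0 z] flow_0[of "n + i" \<tau> s 0 z]
      by (auto simp: return_fixed_def all_double return_map_def A_phase_def y_def)
    define p q where "p t i = y t i + y t (n + i) / r" and "q t i = y t i - y t (n + i) / r" for t i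
    define h where "h t i = \<tau> * eps i * (\<Sum>j<n. R t i j * y t j)" for t i
    have p': "((\<lambda>t. p t i) has_real_derivative r * p t i + h t i / r) (at t within {0..T})"
      and q': "((\<lambda>t. q t i) has_real_derivative - r * q t i + - (h t i / r)) (at t within {0..T})"
      if ti: "t \<in> {0..T}" "i < n" for t i
    proof -
      have sr: "s * y t i / r = r * y t i" using r by (simp flip: r(2))
      show "((\<lambda>t. p t i) has_real_derivative r * p t i + h t i / r) (at t within {0..T})"
        unfolding p_def using r
        by (intro DERIV_cong[OF DERIV_add[OF y(1)[OF ti] DERIV_cdivide[OF y(2)[OF ti]]]])
          (simp add: h_def add_divide_distrib sr algebra_simps)
      show "((\<lambda>t. q t i) has_real_derivative - r * q t i + - (h t i / r)) (at t within {0..T})"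
        unfolding q_def using r
        by (intro DERIV_cong[OF DERIV_diff[OF y(1)[OF ti] DERIV_cdivide[OF y(2)[OF ti]]]])
          (simp add: h_def add_divide_distrib sr algebra_simps)
    qed
    have p0: "p 0 i = (\<Sum>j<n. A $$ (i, j) * p T j)" and q0: "q 0 i = (\<Sum>j<n. A $$ (i, j) * q T j)" if "i < n" for i
      using y0[OF that]
      by (simp_all add: p_def q_def sum_divide_distrib sum.distrib[symmetric] sum_subtractf[symmetric] algebra_simps)
    define bd where "bd K \<longleftrightarrow> (\<forall>t\<in>{0..T}. \<forall>i<n. \<bar>p t i\<bar> \<le> K \<and> \<bar>q t i\<bar> \<le> K)" for K
    have step: "bd (K / 2)" if K: "bd K" for K
    proof (cases "n = 0")
      case False
      have K0: "K \<ge> 0"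
      proof -
        have "\<bar>p 0 0\<bar> \<le> K" using K False T by (simp add: bd_def)
        then show ?thesis by linarith
      qed
      have hb: "\<bar>h t i / r\<bar> \<le> n * L * K / r" if ti: "t \<in> {0..T}" "i < n" for t i
      proof -
        have "\<bar>y t j\<bar> \<le> K" if "j < n" for j
        proof -
          have "\<bar>y t j\<bar> = \<bar>p t j + q t j\<bar> / 2" by (simp add: p_def q_def)
          moreover have "\<bar>p t j\<bar> \<le> K" "\<bar>q t j\<bar> \<le> K" using K ti that by (auto simp: bd_def)
          ultimately show ?thesis using abs_triangle_ineq[of "p t j" "q t j"] by simp
        qed
        then have "\<bar>\<Sum>j<n. R t i j * y t j\<bar> \<le> (\<Sum>j<n. L * K)"
          using L ti by (intro order_trans[OF sum_abs] sum_mono) (auto simp: abs_mult bounded_coeff_def intro!: mult_mono)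
        then have "\<tau> * \<bar>\<Sum>j<n. R t i j * y t j\<bar> \<le> 1 * (\<Sum>j<n. L * K)"
          using \<tau> by (intro mult_mono) auto
        then have "\<bar>h t i\<bar> \<le> n * L * K" using \<tau> by (simp add: h_def abs_mult mult.assoc)
        then show ?thesis using r by (simp add: divide_right_mono)
      qed
      \<comment> \<open>This bounds the components after a full period of decay: \<open>q\<close> at
        \<open>T\<close> and, in reversed time, \<open>p\<close> at 0. The boundary conditions pass
        the bound on to \<open>q\<close> at 0 and to \<open>p\<close> at \<open>T\<close> at the
        cost of \<open>A_bound\<close>.\<close>
      define e where "e = exp (- r * T) * K + n * L * K / r / r"
      have e0: "e \<ge> 0"
        unfolding e_def using K0 L r(1) by (intro add_nonneg_nonneg mult_nonneg_nonneg divide_nonneg_nonneg) auto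
      have efin: "A_bound * e + n * L * K / r / r \<le> K / 2"
      proof -
        have "A_bound * e + n * L * K / r / r = K * (A_bound * exp (- r * T) + C / s)"
          by (simp add: e_def C_def algebra_simps add_divide_distrib flip: r(2))
        also have "\<dots> \<le> K * (1 / 2)" using small K0 by (rule mult_left_mono)
        finally show ?thesis by simp
      qed
      have ep: "exp (- r * t) * x \<le> x" if "x \<ge> 0" "t \<in> {0..T}" for t x
        using that r by (simp add: mult_left_le_one_le)
      have qT: "\<bar>q T j\<bar> \<le> e" if "j < n" for j
      proof -
        have "\<bar>q T j\<bar> \<le> exp (- r * T) * \<bar>q 0 j\<bar> + n * L * K / r / r"
          by (rule decay_bound[OF q']) (use that hb r T in auto)
        also have "exp (- r * T) * \<bar>q 0 j\<bar> \<le> exp (- r * T) * K"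
          using K that T by (intro mult_left_mono) (auto simp: bd_def)
        finally show ?thesis by (simp add: e_def)
      qed
      have qb: "\<bar>q t i\<bar> \<le> K / 2" if ti: "t \<in> {0..T}" "i < n" for t i
      proof -
        have "\<bar>q 0 i\<bar> \<le> A_bound * e" unfolding q0[OF ti(2)] by (rule abs_A_mult_le(1)[OF ti(2) qT])
        then have "exp (- r * t) * \<bar>q 0 i\<bar> \<le> A_bound * e" using ep[of "\<bar>q 0 i\<bar>" t] ti by simp
        moreover have "\<bar>q t i\<bar> \<le> exp (- r * t) * \<bar>q 0 i\<bar> + n * L * K / r / r"
          by (rule decay_bound[OF q']) (use ti hb r T in auto)
        ultimately show ?thesis using efin by linarith
      qed
      \<comment> \<open>Reversing time turns the growing component into a decaying one.\<close>
      have pr: "((\<lambda>t. p (T - t) i) has_real_derivative - r * p (T - t) i + - (h (T - t) i / r)) (at t within {0..T})"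
        if ti: "t \<in> {0..T}" "i < n" for t i
      proof -
        have "((\<lambda>t. p t i) \<circ> (\<lambda>t. T - t) has_real_derivative (r * p (T - t) i + h (T - t) i / r) * (0 - 1)) (at t within {0..T})"
        proof (rule DERIV_image_chain)
          have "(\<lambda>t. T - t) ` {0..T} = {0..T}" by (auto simp: image_iff intro!: bexI[of _ "T - _"])
          then show "((\<lambda>t. p t i) has_real_derivative (r * p (T - t) i + h (T - t) i / r)) (at (T - t) within (\<lambda>t. T - t) ` {0..T})"
            using p'[of "T - t" i] ti by simp
          show "((\<lambda>t. T - t) has_real_derivative 0 - 1) (at t within {0..T})"
            by (intro DERIV_diff DERIV_const DERIV_ident)
        qed
        then show ?thesis by (simp add: o_def)
      qed
      have hb': "\<bar>- (h (T - t) i / r)\<bar> \<le> n * L * K / r" if "t \<in> {0..T}" "i < n" for t i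
        using hb[of "T - t" i] that by simp
      have p0b: "\<bar>p 0 j\<bar> \<le> e" if "j < n" for j
      proof -
        have "\<bar>p (T - T) j\<bar> \<le> exp (- r * T) * \<bar>p (T - 0) j\<bar> + n * L * K / r / r"
          by (rule decay_bound[OF pr hb']) (use that r T in auto)
        also have "exp (- r * T) * \<bar>p (T - 0) j\<bar> \<le> exp (- r * T) * K"
          using K that T by (intro mult_left_mono) (auto simp: bd_def)
        finally show ?thesis by (simp add: e_def)
      qed
      have pb: "\<bar>p t i\<bar> \<le> K / 2" if ti: "t \<in> {0..T}" "i < n" for t i
      proof -
        have "\<bar>\<Sum>j<n. eps j * A $$ (j, i) * p 0 j\<bar> \<le> A_bound * e"
          by (rule abs_A_mult_le(2)[OF ti(2) p0b])
        moreover have "(\<Sum>j<n. eps j * A $$ (j, i) * p 0 j) = eps i * p T i"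
          by (rule A_inverse, erule p0, rule ti(2))
        ultimately have "\<bar>eps i * p T i\<bar> \<le> A_bound * e" by (simp only:)
        then have pT: "\<bar>p T i\<bar> \<le> A_bound * e" by (simp add: abs_mult)
        have "T - t \<in> {0..T}" using ti by auto
        then have "exp (- r * (T - t)) * \<bar>p T i\<bar> \<le> A_bound * e" using ep[of "\<bar>p T i\<bar>" "T - t"] pT by simp
        moreover have "\<bar>p (T - (T - t)) i\<bar> \<le> exp (- r * (T - t)) * \<bar>p (T - 0) i\<bar> + n * L * K / r / r"
          by (rule decay_bound[OF pr hb']) (use ti r T in auto)
        moreover have "T - (T - t) = t" "T - 0 = T" by simp_all
        ultimately have "\<bar>p t i\<bar> \<le> exp (- r * (T - t)) * \<bar>p T i\<bar> + n * L * K / r / r"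
          "exp (- r * (T - t)) * \<bar>p T i\<bar> \<le> A_bound * e" by (simp_all only:)
        then show ?thesis using efin by linarith
      qed
      show ?thesis unfolding bd_def using pb qb by blast
    qed (simp add: bd_def)
    have cont: "continuous_on {0..T} (\<lambda>t. p t i)" "continuous_on {0..T} (\<lambda>t. q t i)" if "i < n" for i
      using DERIV_continuous_on[OF p'] DERIV_continuous_on[OF q'] that by blast+
    obtain K1 where K1: "bounded_coeff n T (\<lambda>t i j. p t i) K1" "K1 \<ge> 0"
      using bounded_coeff_exists[of n T "\<lambda>t i j. p t i"] cont by blast
    obtain K2 where K2: "bounded_coeff n T (\<lambda>t i j. q t i) K2" "K2 \<ge> 0"
      using bounded_coeff_exists[of n T "\<lambda>t i j. q t i"] cont by blast
    have bd0: "bd (K1 + K2)"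
      using K1 K2 unfolding bounded_coeff_def bd_def by (metis add_increasing add_increasing2)
    have "p 0 i = 0" "q 0 i = 0" if "i < n" for i
      using zero_of_halving[of bd, OF bd0 step, of "p 0 i"] zero_of_halving[of bd, OF bd0 step, of "q 0 i"] that T
      by (auto simp: bd_def)
    then have "y 0 i = 0 \<and> y 0 (n + i) = 0" if "i < n" for i
      using that r by (auto simp: p_def q_def dest!: meta_spec[of _ i])
    then have "\<forall>i<2 * n. z i = 0"
      unfolding all_double using flow_0[of _ \<tau> s 0 z] by (auto simp: y_def)
    then show False using z by blast
  qed
  then show ?thesis by blast
qed

text \<open>Here the equation is \<open>u'' = s u\<close>. In the basis of its exponential solutions
  the return map is block diagonal, with \<open>A\<close> times a growing and a decaying factor as
  blocks.\<close>

lemma evans_free: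
  assumes "s > 0"
  shows "evans 0 s 0 = fdet n (\<lambda>i j. exp (sqrt s * T) * A $$ (i, j) - of_bool (i = j)) *
    fdet n (\<lambda>i j. exp (- sqrt s * T) * A $$ (i, j) - of_bool (i = j))"
proof -
  define r where "r = sqrt s"
  have r: "r > 0" "r * r = s" using assms by (auto simp: r_def)
  \<comment> \<open>The columns are the initial values of position and velocity of
    \<open>exp (r t) e_k\<close> for \<open>j = k < n\<close>, and of \<open>exp (- r t) e_k\<close>
    for \<open>j = n + k\<close>.\<close>
  define X where "X i j = (if i < n then of_bool (j = i \<or> j = n + i)
    else r * (of_bool (j = i - n) - of_bool (j = i)))" for i j :: nat
  have "fdet (2 * n) X \<noteq> 0"
  proof (rule fdet_nonzeroI)
    fix x i assume x: "\<And>i. i < 2 * n \<Longrightarrow> (\<Sum>j<2 * n. X i j * x j) = 0" and i: "i < 2 * n"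
    have "x k = 0 \<and> x (n + k) = 0" if k: "k < n" for k
    proof -
      have "(\<Sum>j<2 * n. X k j * x j) = (\<Sum>j<n. x j * unitv k j) + (\<Sum>j<n. x (n + j) * unitv k j)"
        unfolding sum_double
        by (intro arg_cong2[where f = plus] sum.cong) (use k in \<open>auto simp: X_def unitv_def\<close>)
      then have 1: "x k + x (n + k) = 0" using x[of k] k by (simp add: sum_unitv)
      have "(\<Sum>j<2 * n. X (n + k) j * x j) = (\<Sum>j<n. (r * x j) * unitv k j) + (\<Sum>j<n. (- r * x (n + j)) * unitv k j)"
        unfolding sum_double
        by (intro arg_cong2[where f = plus] sum.cong) (use k in \<open>auto simp: X_def unitv_def\<close>)
      also have "\<dots> = r * x k + - r * x (n + k)"
        by (simp only: sum_unitv(3)[OF k])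
      finally have eq: "(\<Sum>j<2 * n. X (n + k) j * x j) = r * x k + - r * x (n + k)" .
      have "(\<Sum>j<2 * n. X (n + k) j * x j) = 0" by (rule x) (use k in simp)
      then have "r * (x k - x (n + k)) = 0" unfolding eq by (simp add: right_diff_distrib)
      then show ?thesis using 1 r by auto
    qed
    then have "\<forall>i<2 * n. x i = 0" unfolding all_double by blast
    then show "x i = 0" using i by blast
  qed
  moreover have "evans 0 s 0 * fdet (2 * n) X = fdet (2 * n) X *
     (fdet n (\<lambda>i j. exp (r * T) * A $$ (i, j) - of_bool (i = j)) *
      fdet n (\<lambda>i j. exp (- r * T) * A $$ (i, j) - of_bool (i = j)))"
    unfolding evans_def fdet_block_diag[where n = n, symmetric] unfolding fdet_mult[symmetric]
  proof (rule fdet_cong)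
    fix i j assume i: "i < 2 * n" and j: "j < 2 * n"
    define \<rho> where "\<rho> = (if j < n then r else - r)"
    define k where "k = (if j < n then j else j - n)"
    have k: "k < n" using j by (auto simp: k_def)
    have Xj: "X a j = of_bool (a = k)" "X (n + a) j = \<rho> * of_bool (a = k)" if "a < n" for a
      using that j by (auto simp: X_def \<rho>_def k_def)
    have fl: "flow 0 s 0 (\<lambda>i. X i j) T a = exp (\<rho> * T) * X a j" if "a < 2 * n" for a
    proof (rule flow_unique[OF _ _ _ that, where y = "\<lambda>t a. exp (\<rho> * t) * X a j"])
      have \<rho>: "\<rho> * \<rho> = s" using r by (simp add: \<rho>_def)
      show "sol 0 s 0 (\<lambda>t a. exp (\<rho> * t) * X a j)"
        unfolding sol_iff
      proof (intro ballI allI impI conjI)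
        fix t a assume a: "a < n"
        show "((\<lambda>t. exp (\<rho> * t) * X a j) has_real_derivative exp (\<rho> * t) * X (n + a) j) (at t within {0..T})"
          unfolding Xj[OF a] by (auto intro!: derivative_eq_intros)
        show "((\<lambda>t. exp (\<rho> * t) * X (n + a) j) has_real_derivative
           0 * eps a * (\<Sum>b<n. R t a b * (exp (\<rho> * t) * X b j)) + s * (exp (\<rho> * t) * X a j)
             - 0 * eps a * (exp (\<rho> * t) * X a j)) (at t within {0..T})"
          unfolding Xj[OF a] by (auto intro!: derivative_eq_intros simp flip: \<rho>)
      qed
    qed (use T in auto)
    have bcX: "A_phase (\<lambda>a. exp (\<rho> * T) * X a j) i = (if i < n then exp (\<rho> * T) * A $$ (i, k) else \<rho> * (exp (\<rho> * T) * A $$ (i - n, k)))"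
    proof -
      have "(\<Sum>b<n. A $$ (a, b) * (exp (\<rho> * T) * of_bool (b = k))) = exp (\<rho> * T) * A $$ (a, k)"
        "(\<Sum>b<n. A $$ (a, b) * (exp (\<rho> * T) * (\<rho> * of_bool (b = k)))) = \<rho> * (exp (\<rho> * T) * A $$ (a, k))" for a
        using k by (simp_all add: of_bool_def if_distrib[where f = "\<lambda>x. _ * x"] cong: if_cong)
      then show ?thesis by (simp add: A_phase_def Xj)
    qed
    have "(\<Sum>m<2 * n. (return_mat 0 s 0 i m - unitv m i) * X m j) = return_map 0 s 0 (\<lambda>a. X a j) i - X i j"
      by (rule return_mat_minus[OF i])
    also have "return_map 0 s 0 (\<lambda>a. X a j) i = A_phase (\<lambda>a. exp (\<rho> * T) * X a j) i"
      unfolding return_map_def by (rule A_phase_cong[OF fl i])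
    also have "\<dots> - X i j = (\<Sum>m<n. X i m * (if j < n then exp (r * T) * A $$ (m, k) - of_bool (m = k) else 0)) +
       (\<Sum>m<n. X i (n + m) * (if j < n then 0 else exp (- r * T) * A $$ (m, k) - of_bool (m = k)))"
    proof (cases "i < n")
      case True
      have "(\<Sum>m<n. X i m * f m) = f i" "(\<Sum>m<n. X i (n + m) * f m) = f i" for f :: "nat \<Rightarrow> real"
      proof -
        have "(\<Sum>m<n. X i m * f m) = (\<Sum>m<n. unitv i m * f m)" "(\<Sum>m<n. X i (n + m) * f m) = (\<Sum>m<n. unitv i m * f m)"
          by (rule sum.cong; use True in \<open>auto simp: X_def unitv_def\<close>)+
        then show "(\<Sum>m<n. X i m * f m) = f i" "(\<Sum>m<n. X i (n + m) * f m) = f i"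
          using True by (simp_all add: sum_unitv)
      qed
      then show ?thesis using True unfolding bcX by (simp add: Xj \<rho>_def)
    next
      case False
      define a where "a = i - n"
      have a: "a < n" "i = n + a" using False i by (auto simp: a_def)
      have Xi: "X i j = \<rho> * of_bool (a = k)" unfolding a(2) by (rule Xj(2)[OF a(1)])
      have Xf: "(\<Sum>m<n. X i m * f m) = r * f a" "(\<Sum>m<n. X i (n + m) * f m) = - r * f a" for f :: "nat \<Rightarrow> real"
      proof -
        have "(\<Sum>m<n. X i m * f m) = (\<Sum>m<n. unitv a m * (r * f m))"
          "(\<Sum>m<n. X i (n + m) * f m) = (\<Sum>m<n. unitv a m * (- r * f m))"
          by (rule sum.cong; use a in \<open>auto simp: X_def unitv_def\<close>)+
        then show "(\<Sum>m<n. X i m * f m) = r * f a" "(\<Sum>m<n. X i (n + m) * f m) = - r * f a"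
          by (simp_all only: sum_unitv(4)[OF a(1)])
      qed
      show ?thesis unfolding bcX Xi Xf using False by (simp add: \<rho>_def a_def right_diff_distrib)
    qed
    also have "\<dots> = (\<Sum>m<2 * n. X i m * (if m < n \<and> j < n then exp (r * T) * A $$ (m, j) - of_bool (m = j)
       else if n \<le> m \<and> n \<le> j then exp (- r * T) * A $$ (m - n, j - n) - of_bool (m - n = j - n) else 0))"
      unfolding sum_double
      by (intro arg_cong2[where f = plus] sum.cong) (auto simp: k_def)
    finally show "(\<Sum>m<2 * n. (return_mat 0 s 0 i m - unitv m i) * X m j) = \<dots>" .
  qed
  ultimately show ?thesis by (simp add: r_def)
qed

text \<open>By \<open>no_kernel_large\<close> the sign is that of the case
  \<open>\<tau> = 0\<close>. In \<open>evans_free\<close> the first factor is a positive power times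
  the determinant of \<open>A - exp (- sqrt s * T)\<close>, which tends to that of \<open>A\<close>;
  the second factor tends to the determinant of \<open>- 1\<close>, which is
  \<open>(-1) ^ n\<close>.\<close>

lemma evans_large:
  assumes "fdet n (\<lambda>i j. A $$ (i, j)) \<noteq> 0"
  shows "\<forall>\<^sub>F s in at_top. sgn (evans 1 s 0) = (-1) ^ n * sgn (fdet n (\<lambda>i j. A $$ (i, j)))"
proof -
  obtain S where S: "\<And>s \<tau>. s \<ge> S \<Longrightarrow> \<tau> \<in> {0..1} \<Longrightarrow> evans \<tau> s 0 \<noteq> 0" using no_kernel_large by blast
  have e0: "((\<lambda>s. exp (- sqrt s * T)) \<longlongrightarrow> 0) at_top"
  proof -
    have "filterlim (\<lambda>s. T * sqrt s) at_top at_top"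
      by (rule filterlim_tendsto_pos_mult_at_top[OF tendsto_const T sqrt_at_top])
    then have "filterlim (\<lambda>s. - sqrt s * T) at_bot at_top"
      by (simp add: filterlim_uminus_at_bot mult.commute)
    then show ?thesis by (rule filterlim_compose[OF exp_at_bot])
  qed
  have "((\<lambda>s. fdet n (\<lambda>i j. A $$ (i, j) - exp (- sqrt s * T) * of_bool (i = j))) \<longlongrightarrow>
     fdet n (\<lambda>i j. A $$ (i, j) - 0 * of_bool (i = j))) at_top"
    by (intro tendsto_fdet tendsto_intros e0)
  from sgn_eq_of_tendsto[OF this] assms
  have 1: "\<forall>\<^sub>F s in at_top. sgn (fdet n (\<lambda>i j. A $$ (i, j) - exp (- sqrt s * T) * of_bool (i = j))) =
      sgn (fdet n (\<lambda>i j. A $$ (i, j)))"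
    by simp
  have m1: "fdet n (\<lambda>i j. 0 * A $$ (i, j) - of_bool (i = j)) = (-1) ^ n"
  proof -
    have "fdet n (\<lambda>i j. 0 * A $$ (i, j) - of_bool (i = j)) =
       fdet n (\<lambda>i j. if i \<in> {..<n} then -1 * of_bool (i = j) else of_bool (i = j))"
      by (rule fdet_cong) auto
    also have "\<dots> = (-1) ^ n * fdet n (\<lambda>i j. of_bool (i = j))" by (subst fdet_scale_rows) auto
    also have "fdet n (\<lambda>i j. of_bool (i = j)) = 1" by (rule fdet_one)
    finally show ?thesis by simp
  qed
  have "((\<lambda>s. fdet n (\<lambda>i j. exp (- sqrt s * T) * A $$ (i, j) - of_bool (i = j))) \<longlongrightarrow>
     fdet n (\<lambda>i j. 0 * A $$ (i, j) - of_bool (i = j))) at_top"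
    by (intro tendsto_fdet tendsto_intros e0)
  from sgn_eq_of_tendsto[OF this]
  have 2: "\<forall>\<^sub>F s in at_top. sgn (fdet n (\<lambda>i j. exp (- sqrt s * T) * A $$ (i, j) - of_bool (i = j))) = (-1) ^ n"
    unfolding m1 by (auto simp: minus_one_power_iff)
  show ?thesis
    using 1 2 eventually_ge_at_top[of S] eventually_gt_at_top[of 0]
  proof eventually_elim
    case (elim s)
    have "sgn (evans 1 s 0) = sgn (evans 0 s 0)"
      by (rule sgn_eq_of_continuous_nonzero[of 0 1 "\<lambda>\<tau>. evans \<tau> s 0"])
        (use S elim in \<open>auto intro!: continuous_intros\<close>)
    moreover have "fdet n (\<lambda>i j. exp (sqrt s * T) * A $$ (i, j) - of_bool (i = j)) =
       exp (sqrt s * T) ^ n * fdet n (\<lambda>i j. A $$ (i, j) - exp (- sqrt s * T) * of_bool (i = j))"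
    proof -
      have "fdet n (\<lambda>i j. exp (sqrt s * T) * A $$ (i, j) - of_bool (i = j)) =
         fdet n (\<lambda>i j. if i \<in> {..<n} then exp (sqrt s * T) * (A $$ (i, j) - exp (- sqrt s * T) * of_bool (i = j))
           else A $$ (i, j) - exp (- sqrt s * T) * of_bool (i = j))"
        by (rule fdet_cong) (simp add: right_diff_distrib mult.assoc[symmetric] exp_add[symmetric])
      also have "\<dots> = exp (sqrt s * T) ^ n * fdet n (\<lambda>i j. A $$ (i, j) - exp (- sqrt s * T) * of_bool (i = j))"
        by (subst fdet_scale_rows) auto
      finally show ?thesis .
    qed
    ultimately show ?case using elim by (simp add: evans_free sgn_mult mult.commute)
  qed
qed

end

section \<open>Spectral flow\<close>

lemma continuous_on_L2:
  fixes f :: "real \<Rightarrow> complex"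
  assumes "continuous_on {0..T} f"
  shows "f \<in> L2 T"
proof -
  have "f \<in> borel_measurable (lebesgue_on {0..T})"
    using assms by (rule continuous_imp_measurable_on_sets_lebesgue) simp
  moreover have "(\<lambda>t. (cmod (f t))\<^sup>2) absolutely_integrable_on {0..T}"
    using assms by (intro absolutely_integrable_continuous_real continuous_intros)
  ultimately show ?thesis
    unfolding L2_def by (simp add: set_integrable_def integrable_restrict_space)
qed

lemma L2_norm_square_zero:
  fixes f :: "real \<Rightarrow> complex"
  assumes "continuous_on {0..T} f" "0 < T" "integral\<^sup>L (lebesgue_on {0..T}) (\<lambda>t. (cmod (f t))\<^sup>2) = 0" "t \<in> {0..T}"
  shows "f t = 0"
proof -
  have c: "continuous_on {0..T} (\<lambda>t. (cmod (f t))\<^sup>2)" using assms(1) by (intro continuous_intros)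
  have "integral {0..T} (\<lambda>t. (cmod (f t))\<^sup>2) = 0"
    using continuous_on_L2[OF assms(1)] lebesgue_integral_eq_integral[of "{0..T}" "\<lambda>t. (cmod (f t))\<^sup>2"] assms(3)
    by (simp add: L2_def)
  then have "((\<lambda>t. (cmod (f t))\<^sup>2) has_integral 0) (cbox 0 T)"
    using integrable_integral[OF integrable_continuous_real[OF c]] by simp
  from has_integral_0_cbox_imp_0[OF _ _ this, of t] c assms(2,4) show ?thesis by simp
qed

text \<open>Multiplication of the eigenvalue equation by \<open>G\<close>, with \<open>e\<close> a
  diagonal entry of \<open>G\<close>: the passage between the operator and the equation solved for
  the second derivative \<open>w\<close>.\<close>

lemma square_one_identity:
  fixes e :: complex
  assumes "e * e = 1"
  shows "l * u = - e * w + S + s * e * u \<longleftrightarrow> e * S + (s - l * e) * u = w"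
proof
  assume u: "l * u = - e * w + S + s * e * u"
  have "e * S + (s - l * e) * u = e * S + s * u - e * (l * u)" by (simp add: algebra_simps)
  also have "\<dots> = e * S + s * u - e * (- e * w + S + s * e * u)" by (simp only: u)
  also have "\<dots> = (e * e) * w + s * u * (1 - e * e)" by (simp add: algebra_simps)
  finally show "e * S + (s - l * e) * u = w" using assms by simp
next
  assume w: "e * S + (s - l * e) * u = w"
  have "- e * w + S + s * e * u = S * (1 - e * e) + l * u * (e * e)"
    unfolding w[symmetric] by (simp add: algebra_simps)
  then show "l * u = - e * w + S + s * e * u" using assms by simp
qed

lemma AE_lebesgue_on_negligible:
  assumes "AE t in lebesgue_on S. P t" "S \<in> sets lebesgue"
  obtains N where "negligible N" "\<And>t. t \<in> S - N \<Longrightarrow> P t"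
proof -
  have "AE t in lebesgue. t \<in> S \<longrightarrow> P t"
    using assms by (subst (asm) AE_restrict_space_iff) auto
  then obtain N where N: "{t \<in> space lebesgue. \<not> (t \<in> S \<longrightarrow> P t)} \<subseteq> N" "emeasure lebesgue N = 0" "N \<in> sets lebesgue"
    by (rule AE_E)
  show ?thesis
  proof (rule that[of N])
    show "negligible N" unfolding negligible_iff_null_sets using N(2,3) by (rule null_setsI)
  qed (use N(1) in auto)
qed

context vector_space
begin

lemma independent_family:
  assumes fin: "finite I" and ind: "\<And>c i. (\<Sum>i\<in>I. scale (c i) (w i)) = 0 \<Longrightarrow> i \<in> I \<Longrightarrow> c i = 0"
  shows "inj_on w I" "independent (w ` I)"
proof -
  show inj: "inj_on w I"
  proof (rule inj_onI, rule ccontr)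
    fix i j assume ij: "i \<in> I" "j \<in> I" "w i = w j" "i \<noteq> j"
    let ?c = "\<lambda>k. if k = i then 1 else if k = j then -1 else 0"
    have "(\<Sum>k\<in>I. scale (?c k) (w k)) = scale (?c i) (w i) + (\<Sum>k\<in>I - {i}. scale (?c k) (w k))"
      using fin ij by (simp add: sum.remove)
    also have "(\<Sum>k\<in>I - {i}. scale (?c k) (w k)) = scale (?c j) (w j) + (\<Sum>k\<in>I - {i} - {j}. scale (?c k) (w k))"
      using fin ij by (subst sum.remove[of _ j]) auto
    also have "(\<Sum>k\<in>I - {i} - {j}. scale (?c k) (w k)) = 0" by (rule sum.neutral) auto
    finally have "(\<Sum>k\<in>I. scale (?c k) (w k)) = 0" using ij by simp
    from ind[OF this ij(1)] show False by simp
  qed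
  show "independent (w ` I)"
  proof (rule independent_if_scalars_zero)
    fix f x assume "(\<Sum>x\<in>w ` I. scale (f x) x) = 0" "x \<in> w ` I"
    then show "f x = 0" using ind[of "\<lambda>i. f (w i)"] by (auto simp: sum.reindex[OF inj])
  qed (use fin in simp)
qed

end

context index_problem
begin

section \<open>Classical eigenfunctions and the eigenspaces of the operator\<close>

definition eigeneq :: "real \<Rightarrow> real \<Rightarrow> cfun \<Rightarrow> real \<Rightarrow> nat \<Rightarrow> complex" where
  "eigeneq s l u t i = of_real (eps i) * (\<Sum>j<n. of_real (R t i j) * u t j) + of_real (s - l * eps i) * u t i"

definition eig_pair :: "real \<Rightarrow> real \<Rightarrow> cfun \<Rightarrow> cfun \<Rightarrow> bool" where
  "eig_pair s l u v \<longleftrightarrow> (\<forall>i<n.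
     (\<forall>t\<in>{0..T}. ((\<lambda>t. u t i) has_vector_derivative v t i) (at t within {0..T}) \<and>
       ((\<lambda>t. v t i) has_vector_derivative eigeneq s l u t i) (at t within {0..T})) \<and>
     u 0 i = (\<Sum>j<n. of_real (A $$ (i, j)) * u T j) \<and> v 0 i = (\<Sum>j<n. of_real (A $$ (i, j)) * v T j))"

text \<open>Classical derivatives replace weak ones, and the values at irrelevant arguments are zero
  as in the distinguished representatives of the operator domain. This makes eigenspaces literally
  equal as sets of functions.\<close>

definition eigenfunction :: "real \<Rightarrow> real \<Rightarrow> cfun \<Rightarrow> bool" where
  "eigenfunction s l u \<longleftrightarrow> (\<forall>t i. t \<notin> {0..T} \<or> i \<ge> n \<longrightarrow> u t i = 0) \<and> (\<exists>v. eig_pair s l u v)"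

lemma eig_pairD:
  assumes "eig_pair s l u v" "i < n"
  shows "t \<in> {0..T} \<Longrightarrow> ((\<lambda>t. u t i) has_vector_derivative v t i) (at t within {0..T})"
    and "t \<in> {0..T} \<Longrightarrow> ((\<lambda>t. v t i) has_vector_derivative eigeneq s l u t i) (at t within {0..T})"
    and "u 0 i = (\<Sum>j<n. of_real (A $$ (i, j)) * u T j)"
    and "v 0 i = (\<Sum>j<n. of_real (A $$ (i, j)) * v T j)"
  using assms by (auto simp: eig_pair_def)

lemma eigeneq_cont:
  assumes "\<And>i. i < n \<Longrightarrow> continuous_on {0..T} (\<lambda>t. u t i)" "i < n"
  shows "continuous_on {0..T} (\<lambda>t. eigeneq s l u t i)"
  unfolding eigeneq_def by (intro continuous_intros continuous_on_of_real R_cont assms) (use assms in auto)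

lemma eigenfunction_cont:
  assumes "eigenfunction s l u" "i < n"
  shows "continuous_on {0..T} (\<lambda>t. u t i)"
proof -
  obtain v where "eig_pair s l u v" using assms(1) by (auto simp: eigenfunction_def)
  from eig_pairD(1)[OF this assms(2)] show ?thesis by (rule continuous_on_vector_derivative)
qed

abbreviation "index_op \<equiv> index_operator n \<kappa> T A R"

lemma eigenfunction_imp_op_eigenspace:
  assumes u: "eigenfunction s l u"
  shows "u \<in> op_eigenspace (index_op s) (of_real l)"
proof -
  obtain v where "eig_pair s l u v" using u by (auto simp: eigenfunction_def)
  note v = eig_pairD(1,2)[OF this] and A_phase = eig_pairD(3,4)[OF this]
  have FTC: "(f' has_integral (f t - f 0)) {0..t}"
    if "\<And>t. t \<in> {0..T} \<Longrightarrow> (f has_vector_derivative f' t) (at t within {0..T})" "t \<in> {0..T}"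
    for f f' :: "real \<Rightarrow> complex" and t
    using that by (intro fundamental_theorem_of_calculus)
      (auto intro: has_vector_derivative_within_subset[of _ _ _ "{0..T}"])
  have "sobolev2 T (\<lambda>t. u t i) (\<lambda>t. v t i) (\<lambda>t. eigeneq s l u t i)" if "i < n" for i
  proof -
    have "continuous_on {0..T} (\<lambda>t. eigeneq s l u t i)" by (rule eigeneq_cont[OF eigenfunction_cont[OF u] that])
    from continuous_on_L2[OF this] show ?thesis
      unfolding sobolev2_def
      by (intro conjI ballI FTC[OF v(1)[OF that]] FTC[OF v(2)[OF that]])
  qed
  moreover have "cscale (of_real l) u t i = - of_real (eps i) * eigeneq s l u t i
     + (\<Sum>j<n. of_real (R t i j) * u t j) + of_real (s * eps i) * u t i" for t i
  proof -
    have e: "complex_of_real (eps i) * complex_of_real (eps i) = 1" by (simp flip: of_real_mult)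
    show ?thesis
      using square_one_identity[OF e] by (simp add: cscale_def eigeneq_def)
  qed
  moreover have "cscale (of_real l) u \<in> L2n n T"
    unfolding L2n_def cscale_def using eigenfunction_cont[OF u] by (auto intro!: continuous_on_L2 continuous_intros)
  moreover have "\<forall>t i. t \<notin> {0..T} \<or> i \<ge> n \<longrightarrow> u t i = 0" using u by (simp add: eigenfunction_def)
  ultimately show ?thesis
    unfolding op_eigenspace_def index_operator_def using A_phase by blast
qed

text \<open>Regularity in one dimension: \<open>u\<close> is continuous as an integral, hence the
  right-hand side of the equation is continuous and agrees almost everywhere with the weak second
  derivative. So \<open>u'\<close> is an integral of a continuous function, and the fundamental
  theorem of calculus applies twice.\<close>

lemma op_eigenspace_imp_eigenfunction:
  assumes "u \<in> op_eigenspace (index_op s) (of_real l)"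
  shows "eigenfunction s l u"
proof -
  obtain u' u'' :: cfun where supp: "\<And>t i. t \<notin> {0..T} \<or> i \<ge> n \<Longrightarrow> u t i = 0"
    and sob: "\<And>i. i < n \<Longrightarrow> sobolev2 T (\<lambda>t. u t i) (\<lambda>t. u' t i) (\<lambda>t. u'' t i)"
    and A_phase: "\<And>i. i < n \<Longrightarrow> u 0 i = (\<Sum>j<n. of_real (A $$ (i, j)) * u T j)"
    "\<And>i. i < n \<Longrightarrow> u' 0 i = (\<Sum>j<n. of_real (A $$ (i, j)) * u' T j)"
    and ae: "\<And>i. i < n \<Longrightarrow> AE t in lebesgue_on {0..T}. cscale (of_real l) u t i = - of_real (eps i) * u'' t i
        + (\<Sum>j<n. of_real (R t i j) * u t j) + of_real (s * eps i) * u t i"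
    using assms unfolding op_eigenspace_def index_operator_def by blast
  have u'int: "((\<lambda>t. u' t i) has_integral (u t i - u 0 i)) {0..t}" and
    u''int: "((\<lambda>t. u'' t i) has_integral (u' t i - u' 0 i)) {0..t}" if "i < n" "t \<in> {0..T}" for i t
    using sob[OF that(1)] that(2) by (auto simp: sobolev2_def)
  have FTC: "(f has_vector_derivative g t) (at t within {0..T})"
    if g: "continuous_on {0..T} g" and fg: "\<And>t. t \<in> {0..T} \<Longrightarrow> (g has_integral (f t - f 0)) {0..t}" and t: "t \<in> {0..T}"
    for f g :: "real \<Rightarrow> complex" and t
  proof -
    have "((\<lambda>u. f 0 + integral {0..u} g) has_vector_derivative 0 + g t) (at t within {0..T})"
      by (intro has_vector_derivative_add has_vector_derivative_const integral_has_vector_derivative g t)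
    then have "((\<lambda>u. f 0 + integral {0..u} g) has_vector_derivative g t) (at t within {0..T})" by simp
    then show ?thesis
      by (rule has_vector_derivative_transform[OF t, rotated])
        (simp add: integral_unique[OF fg])
  qed
  have cont_u: "continuous_on {0..T} (\<lambda>t. u t i)" if i: "i < n" for i
  proof -
    have "(\<lambda>t. u' t i) integrable_on {0..T}" using u'int[OF i, of T] T by auto
    then have "continuous_on {0..T} (\<lambda>t. u 0 i + integral {0..t} (\<lambda>t. u' t i))"
      by (intro continuous_intros indefinite_integral_continuous_1)
    then show ?thesis
      by (rule continuous_on_eq) (simp add: integral_unique[OF u'int[OF i]])
  qed
  have eq_cont: "continuous_on {0..T} (\<lambda>t. eigeneq s l u t i)" if "i < n" for i
    by (rule eigeneq_cont[OF cont_u that])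
  have eqint: "((\<lambda>t. eigeneq s l u t i) has_integral (u' t i - u' 0 i)) {0..t}" if i: "i < n" and t: "t \<in> {0..T}" for i t
  proof -
    obtain N where N: "negligible N" "\<And>t. t \<in> {0..T} - N \<Longrightarrow> cscale (of_real l) u t i = - of_real (eps i) * u'' t i
        + (\<Sum>j<n. of_real (R t i j) * u t j) + of_real (s * eps i) * u t i"
      using AE_lebesgue_on_negligible[OF ae[OF i]] by auto
    have e: "complex_of_real (eps i) * complex_of_real (eps i) = 1" by (simp flip: of_real_mult)
    have "eigeneq s l u x i = u'' x i" if "x \<in> {0..t} - N" for x
    proof -
      have "x \<in> {0..T} - N" using that t by auto
      from N(2)[OF this] show ?thesis
        using square_one_identity[OF e] by (simp add: cscale_def eigeneq_def)
    qed
    then show ?thesis by (rule has_integral_spike[OF N(1) _ u''int[OF i t]])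
  qed
  have d': "((\<lambda>t. u' t i) has_vector_derivative eigeneq s l u t i) (at t within {0..T})"
    if "i < n" "t \<in> {0..T}" for i t
    by (rule FTC[OF eq_cont[OF that(1)] _ that(2)]) (rule eqint[OF that(1)])
  have cont_u': "continuous_on {0..T} (\<lambda>t. u' t i)" if "i < n" for i
    by (rule continuous_on_vector_derivative) (rule d'[OF that])
  have d: "((\<lambda>t. u t i) has_vector_derivative u' t i) (at t within {0..T})" if "i < n" "t \<in> {0..T}" for i t
    by (rule FTC[OF cont_u'[OF that(1)] _ that(2)]) (rule u'int[OF that(1)])
  show ?thesis
    unfolding eigenfunction_def eig_pair_def using supp d d' A_phase by (intro conjI exI[of _ u'] allI impI ballI) blast+
qed

lemma op_eigenspace_eq: "op_eigenspace (index_op s) (of_real l) = {u. eigenfunction s l u}"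
  using eigenfunction_imp_op_eigenspace op_eigenspace_imp_eigenfunction by blast

lemma eigeneq_sum:
  "eigeneq s l (\<Sum>k\<in>S. cscale (c k) (u k)) t i = (\<Sum>k\<in>S. c k * eigeneq s l (u k) t i)"
proof -
  have *: "(\<Sum>k\<in>S. cscale (c k) (u k)) t j = (\<Sum>k\<in>S. c k * u k t j)" for j
    by (induction S rule: infinite_finite_induct) (auto simp: cscale_def)
  have "(\<Sum>k\<in>S. c k * eigeneq s l (u k) t i) = (\<Sum>k\<in>S. of_real (eps i) * (c k * (\<Sum>j<n. of_real (R t i j) * u k t j))
      + of_real (s - l * eps i) * (c k * u k t i))"
    by (rule sum.cong) (simp_all only: eigeneq_def distrib_left mult_ac)
  also have "\<dots> = of_real (eps i) * (\<Sum>k\<in>S. c k * (\<Sum>j<n. of_real (R t i j) * u k t j))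
      + of_real (s - l * eps i) * (\<Sum>k\<in>S. c k * u k t i)"
    by (simp only: sum.distrib sum_distrib_left)
  also have "(\<Sum>k\<in>S. c k * (\<Sum>j<n. of_real (R t i j) * u k t j)) = (\<Sum>j<n. of_real (R t i j) * (\<Sum>k\<in>S. c k * u k t j))"
    unfolding sum_distrib_left by (subst sum.swap) (simp add: mult_ac)
  finally show ?thesis unfolding eigeneq_def * by simp
qed

lemma cscale_sum_apply: "(\<Sum>k\<in>S. cscale (c k) (u k)) t j = (\<Sum>k\<in>S. c k * u k t j)"
  by (induction S rule: infinite_finite_induct) (auto simp: cscale_def)

lemma eig_pair_lincomb:
  assumes "\<And>k. k \<in> S \<Longrightarrow> eig_pair s l (u k) (v k)"
  shows "eig_pair s l (\<Sum>k\<in>S. cscale (c k) (u k)) (\<Sum>k\<in>S. cscale (c k) (v k))"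
proof -
  have swap: "(\<Sum>j<n. of_real (A $$ (i, j)) * (\<Sum>k\<in>S. c k * w k j)) =
      (\<Sum>k\<in>S. c k * (\<Sum>j<n. of_real (A $$ (i, j)) * w k j))" for w :: "_ \<Rightarrow> nat \<Rightarrow> complex" and i
    unfolding sum_distrib_left by (subst sum.swap) (simp add: mult_ac)
  show ?thesis
    unfolding eig_pair_def eigeneq_sum cscale_sum_apply swap
  proof (intro allI impI conjI ballI)
    fix i t assume i: "i < n" and t: "t \<in> {0..T}"
    show "((\<lambda>t. \<Sum>k\<in>S. c k * u k t i) has_vector_derivative (\<Sum>k\<in>S. c k * v k t i)) (at t within {0..T})"
      by (intro has_vector_derivative_sum has_vector_derivative_mult_right eig_pairD(1)[OF assms i t])
    show "((\<lambda>t. \<Sum>k\<in>S. c k * v k t i) has_vector_derivative (\<Sum>k\<in>S. c k * eigeneq s l (u k) t i)) (at t within {0..T})"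
      by (intro has_vector_derivative_sum has_vector_derivative_mult_right eig_pairD(2)[OF assms i t])
  next
    fix i assume i: "i < n"
    show "(\<Sum>k\<in>S. c k * u k 0 i) = (\<Sum>k\<in>S. c k * (\<Sum>j<n. of_real (A $$ (i, j)) * u k T j))"
      by (rule sum.cong) (use eig_pairD(3)[OF assms i] in auto)
    show "(\<Sum>k\<in>S. c k * v k 0 i) = (\<Sum>k\<in>S. c k * (\<Sum>j<n. of_real (A $$ (i, j)) * v k T j))"
      by (rule sum.cong) (use eig_pairD(4)[OF assms i] in auto)
  qed
qed

lemma eigenfunction_lincomb:
  assumes "\<And>k. k \<in> S \<Longrightarrow> eigenfunction s l (u k)"
  shows "eigenfunction s l (\<Sum>k\<in>S. cscale (c k) (u k))"
proof -
  have "\<forall>k\<in>S. \<exists>v. eig_pair s l (u k) v" using assms by (simp add: eigenfunction_def)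
  then obtain v where "\<forall>k\<in>S. eig_pair s l (u k) (v k)" by (rule bchoice[THEN exE])
  then have "eig_pair s l (\<Sum>k\<in>S. cscale (c k) (u k)) (\<Sum>k\<in>S. cscale (c k) (v k))"
    by (intro eig_pair_lincomb) blast
  moreover have "u k t i = 0" if "k \<in> S" "t \<notin> {0..T} \<or> i \<ge> n" for k t i
    using assms[OF that(1)] that(2) by (simp add: eigenfunction_def)
  then have "\<forall>t i. t \<notin> {0..T} \<or> i \<ge> n \<longrightarrow> (\<Sum>k\<in>S. cscale (c k) (u k)) t i = 0"
    unfolding cscale_sum_apply by (intro allI impI sum.neutral) simp
  ultimately show ?thesis unfolding eigenfunction_def by blast
qed

definition eigenfunction_of :: "real \<Rightarrow> real \<Rightarrow> (nat \<Rightarrow> real) \<Rightarrow> cfun" where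
  "eigenfunction_of s l z t i = (if t \<in> {0..T} \<and> i < n then of_real (flow 1 s l z t i) else 0)"

lemma eigenfunction_cx:
  assumes "return_fixed 1 s l z"
  shows "eigenfunction s l (eigenfunction_of s l z)"
proof -
  let ?y = "flow 1 s l z"
  have d: "((\<lambda>t. ?y t i) has_real_derivative ?y t (n + i)) (at t within {0..T})"
     "((\<lambda>t. ?y t (n + i)) has_real_derivative
        eps i * (\<Sum>j<n. R t i j * ?y t j) + s * ?y t i - l * eps i * ?y t i) (at t within {0..T})"
    if "t \<in> {0..T}" "i < n" for t i
    using sol_flow[of 1 s l z] that unfolding sol_iff by auto
  have b: "?y 0 i = (\<Sum>j<n. A $$ (i, j) * ?y T j)" "?y 0 (n + i) = (\<Sum>j<n. A $$ (i, j) * ?y T (n + j))" if "i < n" for i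
    using assms that flow_0[of i 1 s l z] flow_0[of "n + i" 1 s l z]
    by (auto simp: return_fixed_def all_double return_map_def A_phase_def)
  have eq: "eigeneq s l (eigenfunction_of s l z) t i =
      of_real (eps i * (\<Sum>j<n. R t i j * ?y t j) + s * ?y t i - l * eps i * ?y t i)" if "t \<in> {0..T}" "i < n" for t i
    using that by (simp add: eigeneq_def eigenfunction_of_def algebra_simps)
  have ofr: "((\<lambda>t. complex_of_real (f t)) has_vector_derivative of_real f') (at t within {0..T})"
    if "(f has_real_derivative f') (at t within {0..T})" for f f' t
    using that by (rule has_vector_derivative_of_real)
  have "((\<lambda>t. eigenfunction_of s l z t i) has_vector_derivative of_real (?y t (n + i))) (at t within {0..T})"
    if "t \<in> {0..T}" "i < n" for t i
    using ofr[OF d(1)[OF that]] by (rule has_vector_derivative_transform[OF that(1), rotated]) (use that in \<open>simp add: eigenfunction_of_def\<close>)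
  moreover have "((\<lambda>t. complex_of_real (?y t (n + i))) has_vector_derivative eigeneq s l (eigenfunction_of s l z) t i) (at t within {0..T})"
    if "t \<in> {0..T}" "i < n" for t i
    unfolding eq[OF that] by (rule ofr[OF d(2)[OF that]])
  moreover have "eigenfunction_of s l z 0 i = (\<Sum>j<n. of_real (A $$ (i, j)) * eigenfunction_of s l z T j)"
    "complex_of_real (?y 0 (n + i)) = (\<Sum>j<n. of_real (A $$ (i, j)) * of_real (?y T (n + j)))" if "i < n" for i
    using b[OF that] T that by (simp_all add: eigenfunction_of_def)
  moreover have "\<forall>t i. t \<notin> {0..T} \<or> i \<ge> n \<longrightarrow> eigenfunction_of s l z t i = 0" by (auto simp: eigenfunction_of_def)
  ultimately show ?thesis
    unfolding eigenfunction_def eig_pair_def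
    by (intro conjI exI[of _ "\<lambda>t i. of_real (?y t (n + i))"] allI impI ballI) blast+
qed

lemma eigenfunction_zero_of_L2norm:
  assumes "eigenfunction s l u" "L2norm n T u = 0"
  shows "u = 0"
proof -
  have "u t i = 0" for t i
  proof (cases "t \<in> {0..T} \<and> i < n")
    case True
    have "(\<Sum>i<n. integral\<^sup>L (lebesgue_on {0..T}) (\<lambda>t. (cmod (u t i))\<^sup>2)) = 0"
      using assms(2) by (simp add: L2norm_def)
    then have "integral\<^sup>L (lebesgue_on {0..T}) (\<lambda>t. (cmod (u t i))\<^sup>2) = 0"
      using True by (subst (asm) sum_nonneg_eq_0_iff) auto
    then show ?thesis using L2_norm_square_zero[OF eigenfunction_cont[OF assms(1)] T] True by blast
  next
    case False
    then show ?thesis using assms(1) by (auto simp: eigenfunction_def)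
  qed
  then show ?thesis by (simp add: fun_eq_iff)
qed

lemma eigenfunction_of_eq_0D:
  assumes "eigenfunction_of s l z = 0" "i < 2 * n"
  shows "z i = 0"
proof (rule overlap_pos[OF _ assms(2)])
  have "flow 1 s l z t i = 0" if "t \<in> {0..T}" "i < n" for t i
    using fun_cong[OF fun_cong[OF assms(1)], of t i] that by (simp add: eigenfunction_of_def)
  then show "overlap 1 s l l z z = 0"
    unfolding overlap_def by (subst integral_cong[where g = "\<lambda>_. 0"]) auto
qed

text \<open>At an eigenvalue the resolvent estimate would bound the norm of an eigenfunction by
  \<open>C\<close> times zero.\<close>

lemma evans_nonzero_of_resolvent:
  assumes "of_real a \<notin> op_spectrum n T (index_op s)"
  shows "evans 1 s a \<noteq> 0"
proof
  assume "evans 1 s a = 0"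
  then obtain z i where z: "i < 2 * n" "z i \<noteq> 0" "return_fixed 1 s a z" unfolding evans_eq_0_iff by blast
  let ?u = "eigenfunction_of s a z"
  have u: "eigenfunction s a ?u" using z(3) by (rule eigenfunction_cx)
  then have "(?u, cscale (of_real a) ?u) \<in> index_op s"
    using op_eigenspace_eq[of s a] by (auto simp: op_eigenspace_def)
  moreover obtain C where "\<forall>(u, h)\<in>index_op s. L2norm n T u \<le> C * L2norm n T (h - cscale (of_real a) u)"
    using assms unfolding op_spectrum_def by blast
  ultimately have "L2norm n T ?u \<le> C * L2norm n T (cscale (of_real a) ?u - cscale (of_real a) ?u)" by blast
  also have "\<dots> = 0" by (simp add: L2norm_def)
  finally have "L2norm n T ?u = 0" by (simp add: L2norm_def sum_nonneg antisym)
  then have "?u = 0" by (rule eigenfunction_zero_of_L2norm[OF u])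
  then show False using eigenfunction_of_eq_0D z by blast
qed

text \<open>The real and imaginary parts of the relation are real relations between real solutions.
  By uniqueness these pass to the initial values, where the columns of \<open>Q\<close> are
  independent.\<close>

lemma eigenfunction_of_lincomb_zero:
  assumes ad: "adapted s l Q K" and 0: "(\<Sum>k\<in>K. cscale (c k) (eigenfunction_of s l (col Q k))) = 0" and k: "k \<in> K"
  shows "c k = 0"
proof -
  have fin: "finite K" and K: "K \<subseteq> {..<2 * n}" and Q: "fdet (2 * n) Q \<noteq> 0"
    using ad finite_subset[of K "{..<2 * n}"] by (auto simp: adapted_def)
  have *: "d k = 0" if d: "\<And>t i. t \<in> {0..T} \<Longrightarrow> i < n \<Longrightarrow> (\<Sum>k\<in>K. d k * flow 1 s l (col Q k) t i) = 0" for d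
  proof -
    let ?z = "\<lambda>j. \<Sum>k\<in>K. d k * col Q k j"
    have "eigenfunction_of s l ?z = 0"
      using d flow_lincomb[of ?z d "col Q" K] by (auto simp: eigenfunction_of_def fun_eq_iff)
    then have "?z j = 0" if "j < 2 * n" for j using that by (rule eigenfunction_of_eq_0D)
    moreover have "?z j = (\<Sum>k<2 * n. Q j k * (if k \<in> K then d k else 0))" for j
      using K by (intro sum.mono_neutral_cong_left) (auto simp: col_def)
    ultimately have "(if k \<in> K then d k else 0) = 0"
      using fdet_injD[OF Q, of "\<lambda>k. if k \<in> K then d k else 0" k] k K by auto
    then show ?thesis using k by simp
  qed
  have eq: "(\<Sum>k\<in>K. c k * of_real (flow 1 s l (col Q k) t i)) = 0" if "t \<in> {0..T}" "i < n" for t i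
    using fun_cong[OF fun_cong[OF 0], of t i] that unfolding cscale_sum_apply by (simp add: eigenfunction_of_def)
  have "(\<Sum>k\<in>K. Re (c k) * flow 1 s l (col Q k) t i) = 0" "(\<Sum>k\<in>K. Im (c k) * flow 1 s l (col Q k) t i) = 0"
    if "t \<in> {0..T}" "i < n" for t i
    using arg_cong[OF eq[OF that], of Re] arg_cong[OF eq[OF that], of Im] by simp_all
  then have "Re (c k) = 0" "Im (c k) = 0" using *[of "\<lambda>k. Re (c k)"] *[of "\<lambda>k. Im (c k)"] by blast+
  then show ?thesis by (simp add: complex_eq_iff)
qed

text \<open>Equation and boundary conditions are real, so the real and imaginary parts of an
  eigenfunction are themselves solutions with fixed initial values, hence combinations of the
  columns in \<open>K\<close>. The complex multiplicity is therefore the real dimension of the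
  kernel.\<close>

lemma eigenfunction_repr:
  assumes u: "eigenfunction s l u" and ad: "adapted s l Q K"
  shows "\<exists>c. u = (\<Sum>k\<in>K. cscale (c k) (eigenfunction_of s l (col Q k)))"
proof -
  have fin: "finite K" and K: "K \<subseteq> {..<2 * n}" and Q: "fdet (2 * n) Q \<noteq> 0"
    using ad finite_subset[of K "{..<2 * n}"] by (auto simp: adapted_def)
  obtain v where "eig_pair s l u v" using u by (auto simp: eigenfunction_def)
  note v = eig_pairD(1,2)[OF this] and bcv = eig_pairD(3,4)[OF this]
  \<comment> \<open>To be applied with \<open>Re\<close> and \<open>Im\<close> in place of
    \<open>p\<close>.\<close>
  have part: "\<exists>x. \<forall>t\<in>{0..T}. \<forall>i<n. p (u t i) = (\<Sum>k\<in>K. x k * flow 1 s l (col Q k) t i)"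
    if p: "bounded_linear p" "\<And>a z. p (of_real a * z) = a * p z" for p :: "complex \<Rightarrow> real"
  proof -
    interpret p: bounded_linear p by (rule p)
    define y where "y t i = (if i < n then p (u t i) else p (v t (i - n)))" for t i
    have pe: "p (eigeneq s l u t i) = 1 * eps i * (\<Sum>j<n. R t i j * p (u t j)) + s * p (u t i) - l * eps i * p (u t i)" for t i
      by (simp only: eigeneq_def p.add p.sum p(2)) (simp add: algebra_simps)
    have "sol 1 s l y"
      unfolding sol_iff
    proof (intro ballI allI impI conjI)
      fix t i assume ti: "t \<in> {0..T}" "i < n"
      show "((\<lambda>t. y t i) has_real_derivative y t (n + i)) (at t within {0..T})"
        using p.has_vector_derivative[OF v(1)[OF ti(2,1)]] ti
        by (simp add: y_def has_real_derivative_iff_has_vector_derivative)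
      show "((\<lambda>t. y t (n + i)) has_real_derivative 1 * eps i * (\<Sum>j<n. R t i j * y t j) + s * y t i - l * eps i * y t i) (at t within {0..T})"
        using p.has_vector_derivative[OF v(2)[OF ti(2,1)]] ti
        unfolding pe by (simp add: y_def has_real_derivative_iff_has_vector_derivative)
    qed
    then have fl: "flow 1 s l (y 0) t i = y t i" if "t \<in> {0..T}" "i < 2 * n" for t i
      using that by (intro flow_unique) auto
    have "A_phase (y T) i = y 0 i" if "i < 2 * n" for i
    proof -
      have "\<forall>i<2 * n. A_phase (y T) i = y 0 i"
        unfolding all_double using bcv by (auto simp: A_phase_def y_def p.sum p(2))
      then show ?thesis using that by blast
    qed
    then have fy: "return_fixed 1 s l (y 0)"
      unfolding return_fixed_def return_map_def using A_phase_cong[of "flow 1 s l (y 0) T" "y T"] fl[of T] T by simp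
    obtain x where x: "\<And>i. i < 2 * n \<Longrightarrow> (\<Sum>j<2 * n. Q i j * x j) = y 0 i" by (rule fdet_surj[OF Q, of "y 0"]) blast
    have "return_fixed 1 s l (\<lambda>j. \<Sum>k<2 * n. Q j k * x k)"
      by (rule return_fixed_lincomb[where S = "{()}" and c = "\<lambda>_. 1" and x = "\<lambda>_. y 0"]) (use fy x in auto)
    then have x0: "x k = 0" if "k < 2 * n" "k \<notin> K" for k using ad that by (simp add: adapted_def)
    have y0: "y 0 i = (\<Sum>k\<in>K. x k * col Q k i)" if "i < 2 * n" for i
      unfolding x[OF that, symmetric] using K x0 by (intro sum.mono_neutral_cong_right) (auto simp: col_def)
    have "p (u t i) = (\<Sum>k\<in>K. x k * flow 1 s l (col Q k) t i)" if "t \<in> {0..T}" "i < n" for t i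
    proof -
      have "flow 1 s l (y 0) t i = (\<Sum>k\<in>K. x k * flow 1 s l (col Q k) t i)"
        by (rule flow_lincomb[where c = x and x = "col Q"]) (use y0 that in auto)
      then show ?thesis using fl[of t i] that by (simp add: y_def)
    qed
    then show ?thesis by blast
  qed
  obtain x where x: "\<And>t i. t \<in> {0..T} \<Longrightarrow> i < n \<Longrightarrow> Re (u t i) = (\<Sum>k\<in>K. x k * flow 1 s l (col Q k) t i)"
    using part[OF bounded_linear_Re] by auto
  obtain y where y: "\<And>t i. t \<in> {0..T} \<Longrightarrow> i < n \<Longrightarrow> Im (u t i) = (\<Sum>k\<in>K. y k * flow 1 s l (col Q k) t i)"
    using part[OF bounded_linear_Im] by auto
  have "u t i = (\<Sum>k\<in>K. cscale (Complex (x k) (y k)) (eigenfunction_of s l (col Q k))) t i" for t i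
  proof (cases "t \<in> {0..T} \<and> i < n")
    case True
    then show ?thesis unfolding cscale_sum_apply using x[of t i] y[of t i]
      by (auto simp: eigenfunction_of_def complex_eq_iff)
  next
    case False
    then have "u t i = 0" using u by (auto simp: eigenfunction_def)
    with False show ?thesis unfolding cscale_sum_apply by (auto simp: eigenfunction_of_def)
  qed
  then show ?thesis by (intro exI[of _ "\<lambda>k. Complex (x k) (y k)"]) (simp add: fun_eq_iff)
qed

text \<open>Differentiating a vanishing sum of eigenfunctions twice multiplies them by their eigenvalues.\<close>

lemma eigenfunction_independent:
  assumes "finite Z" "\<And>l. l \<in> Z \<Longrightarrow> eigenfunction s l (f l)" "(\<Sum>l\<in>Z. f l) = 0" "l \<in> Z"
  shows "f l = 0"
  using assms
proof (induction Z arbitrary: f l rule: finite_induct)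
  case (insert m Z)
  let ?Z = "insert m Z"
  have sum0: "(\<Sum>l\<in>?Z. f l t i) = 0" for t i
  proof -
    have "(\<Sum>l\<in>Z. f l) t i = (\<Sum>l\<in>Z. f l t i)" for Z
      by (induction Z rule: infinite_finite_induct) auto
    then have "(\<Sum>l\<in>?Z. f l t i) = (\<Sum>l\<in>?Z. f l) t i" by simp
    also have "\<dots> = 0" unfolding insert.prems(2) by simp
    finally show ?thesis .
  qed
  have "(\<Sum>l\<in>?Z. of_real l * f l t i) = 0" for t i
  proof (cases "t \<in> {0..T} \<and> i < n")
    case True
    have "\<forall>l\<in>?Z. \<exists>v. eig_pair s l (f l) v" using insert.prems(1) by (simp add: eigenfunction_def)
    then obtain v where "\<forall>l\<in>?Z. eig_pair s l (f l) (v l)" by (rule bchoice[THEN exE])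
    then have v: "\<And>l. l \<in> ?Z \<Longrightarrow> eig_pair s l (f l) (v l)" by blast
    have i: "i < n" using True by simp
    have v0: "(\<Sum>l\<in>?Z. v l t i) = 0" if t: "t \<in> {0..T}" for t
    proof (rule vector_derivative_unique_Icc[OF _ _ T t])
      show "((\<lambda>t. \<Sum>l\<in>?Z. f l t i) has_vector_derivative (\<Sum>l\<in>?Z. v l t i)) (at t within {0..T})"
        by (intro has_vector_derivative_sum eig_pairD(1)[OF v i t])
      show "((\<lambda>t. \<Sum>l\<in>?Z. f l t i) has_vector_derivative 0) (at t within {0..T})"
        unfolding sum0 by (rule has_vector_derivative_const)
    qed
    have "(\<Sum>l\<in>?Z. eigeneq s l (f l) t i) = 0"
    proof (rule vector_derivative_unique_Icc[OF _ _ T])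
      show t: "t \<in> {0..T}" using True by simp
      show "((\<lambda>t. \<Sum>l\<in>?Z. v l t i) has_vector_derivative (\<Sum>l\<in>?Z. eigeneq s l (f l) t i)) (at t within {0..T})"
        by (intro has_vector_derivative_sum eig_pairD(2)[OF v i t])
      show "((\<lambda>t. \<Sum>l\<in>?Z. v l t i) has_vector_derivative 0) (at t within {0..T})"
        by (rule has_vector_derivative_transform[where f = "\<lambda>_. 0", OF t _ has_vector_derivative_const]) (rule v0)
    qed
    also have "(\<Sum>l\<in>?Z. eigeneq s l (f l) t i) = of_real (eps i) * (\<Sum>j<n. of_real (R t i j) * (\<Sum>l\<in>?Z. f l t j))
       + of_real s * (\<Sum>l\<in>?Z. f l t i) - of_real (eps i) * (\<Sum>l\<in>?Z. of_real l * f l t i)"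
    proof -
      have "(\<Sum>j<n. of_real (R t i j) * (\<Sum>l\<in>?Z. f l t j)) = (\<Sum>l\<in>?Z. \<Sum>j<n. of_real (R t i j) * f l t j)"
        unfolding sum_distrib_left by (rule sum.swap)
      then show ?thesis
        unfolding eigeneq_def
        by (simp only: sum_distrib_left sum.distrib sum_subtractf[symmetric] of_real_diff of_real_mult left_diff_distrib)
          (auto simp: sum.distrib sum_subtractf algebra_simps sum_distrib_left)
    qed
    also have "\<dots> = - of_real (eps i) * (\<Sum>l\<in>?Z. of_real l * f l t i)" unfolding sum0 by simp
    finally show ?thesis by simp
  next
    case False
    have "f l t i = 0" if "l \<in> ?Z" for l using insert.prems(1)[OF that] False unfolding eigenfunction_def by auto
    then show ?thesis by (intro sum.neutral) auto
  qed
  \<comment> \<open>Subtracting \<open>m\<close> times the original relation removes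
    \<open>f m\<close>; the induction hypothesis applies to the remaining multiples by
    \<open>l - m\<close>.\<close>
  then have eq: "(\<Sum>l\<in>?Z. (of_real l - of_real m) * f l t i) = 0" for t i
    using sum0[of t i] by (simp only: left_diff_distrib sum_subtractf sum_distrib_left[symmetric]) simp
  have "cscale (of_real (l - m)) (f l) = 0" if "l \<in> Z" for l
  proof (rule insert.IH[where f = "\<lambda>l. cscale (of_real (l - m)) (f l)"])
    show "eigenfunction s l (cscale (of_real (l - m)) (f l))" if "l \<in> Z" for l
      using eigenfunction_lincomb[of "{()}" s l "\<lambda>_. f l" "\<lambda>_. of_real (l - m)"] insert.prems(1) that by simp
    show "(\<Sum>l\<in>Z. cscale (of_real (l - m)) (f l)) = 0"
    proof (intro ext)
      fix t i
      show "(\<Sum>l\<in>Z. cscale (of_real (l - m)) (f l)) t i = (0 :: cfun) t i"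
        unfolding cscale_sum_apply using eq[of t i] insert.hyps by simp
    qed
  qed (use that in auto)
  then have fz: "f l = 0" if "l \<in> Z" for l
    using that insert.hyps(2) by (auto simp: cscale_def fun_eq_iff)
  moreover have "f m = 0"
  proof -
    have "f m + (\<Sum>l\<in>Z. f l) = 0"
      unfolding insert.prems(2)[symmetric] using insert.hyps by (rule sum.insert[symmetric])
    moreover have "(\<Sum>l\<in>Z. f l) = 0" using fz by (rule sum.neutral[OF ballI])
    ultimately show ?thesis by (simp only: add_0_right)
  qed
  ultimately show ?case using insert.prems(3) by blast
qed simp

text \<open>The kernel bases at the finitely many zeros of \<open>evans 1 s\<close> in
  \<open>[0,a]\<close> together form a basis: independent across eigenvalues by
  \<open>eigenfunction_independent\<close>, and within one eigenvalue by
  \<open>eigenfunction_of_lincomb_zero\<close>.\<close>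

lemma eigen_sum_dim:
  assumes ad: "\<And>l. adapted s l (Q l) (K l)" and fin: "finite {l\<in>{0..a}. evans 1 s l = 0}"
  shows "cfun_dim (eigen_sum (index_op s) {0..a}) = (\<Sum>l | l \<in> {0..a} \<and> evans 1 s l = 0. card (K l))"
proof -
  define Z where "Z = {l\<in>{0..a}. evans 1 s l = 0}"
  define I where "I = (SIGMA l:Z. K l)"
  define w where "w = (\<lambda>(l, k). eigenfunction_of s l (col (Q l) k))"
  have finK: "finite (K l)" for l using ad[of l] finite_subset[of "K l" "{..<2 * n}"] by (auto simp: adapted_def)
  have fI: "finite I" using fin finK by (auto simp: I_def Z_def)
  have eigenfunction_w: "eigenfunction s l (eigenfunction_of s l (col (Q l) k))" if "k \<in> K l" for l k
    using ad[of l] that by (auto simp: adapted_def intro: eigenfunction_cx)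
  have ind: "c i = 0" if c: "(\<Sum>i\<in>I. cscale (c i) (w i)) = 0" and i: "i \<in> I" for c i
  proof -
    obtain l k where lk: "i = (l, k)" "l \<in> Z" "k \<in> K l" using i by (auto simp: I_def)
    have "(\<Sum>l\<in>Z. \<Sum>k\<in>K l. cscale (c (l, k)) (eigenfunction_of s l (col (Q l) k))) = 0"
    proof -
      have "(\<Sum>i\<in>I. cscale (c i) (w i)) = (\<Sum>l\<in>Z. \<Sum>k\<in>K l. cscale (c (l, k)) (w (l, k)))"
        unfolding I_def by (subst sum.Sigma) (use fin finK in \<open>auto simp: Z_def intro!: sum.cong\<close>)
      then show ?thesis using c by (simp add: w_def)
    qed
    then have "(\<Sum>k\<in>K l. cscale (c (l, k)) (eigenfunction_of s l (col (Q l) k))) = 0"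
      by (rule eigenfunction_independent[where s = s, rotated 2])
        (use fin eigenfunction_w lk(2) in \<open>auto simp: Z_def intro!: eigenfunction_lincomb\<close>)
    from eigenfunction_of_lincomb_zero[OF ad this lk(3)] show ?thesis using lk(1) by simp
  qed
  have inj: "inj_on w I" by (rule cfun.independent_family(1)[OF fI]) (rule ind)
  have indep: "\<not> cfun.dependent (w ` I)" by (rule cfun.independent_family(2)[OF fI]) (rule ind)
  \<comment> \<open>Where \<open>evans\<close> is nonzero the adapted set is empty, so indexing by
    the zeros alone loses no eigenfunction.\<close>
  have K0: "K l = {}" if "evans 1 s l \<noteq> 0" for l
  proof (rule ccontr)
    assume "K l \<noteq> {}"
    then obtain k where k: "k \<in> K l" by blast
    then have "return_fixed 1 s l (col (Q l) k)" using ad[of l] by (simp add: adapted_def)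
    then have "\<And>i. i < 2 * n \<Longrightarrow> col (Q l) k i = 0" using that unfolding evans_eq_0_iff by blast
    then have "eigenfunction_of s l (col (Q l) k) = 0"
      using flow_lincomb[of "col (Q l) k" "\<lambda>_. 0" "\<lambda>_. col (Q l) k" "{()}"] by (auto simp: eigenfunction_of_def fun_eq_iff)
    then have "(\<Sum>j\<in>K l. cscale (of_bool (j = k)) (eigenfunction_of s l (col (Q l) j))) = 0"
      by (intro sum.neutral) (auto simp: cscale_def fun_eq_iff)
    from eigenfunction_of_lincomb_zero[OF ad this k] show False by simp
  qed
  have "cfun_span (w ` I) = eigen_sum (index_op s) {0..a}"
  proof
    have "w ` I \<subseteq> (\<Union>l\<in>{0..a}. op_eigenspace (index_op s) (of_real l))"
      unfolding op_eigenspace_eq using eigenfunction_w by (auto simp: I_def Z_def w_def)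
    then show "cfun_span (w ` I) \<subseteq> eigen_sum (index_op s) {0..a}"
      unfolding eigen_sum_def by (rule cfun.span_mono)
    have "u \<in> cfun_span (w ` I)" if l: "l \<in> {0..a}" and u: "eigenfunction s l u" for l u
    proof -
      obtain c where c: "u = (\<Sum>k\<in>K l. cscale (c k) (eigenfunction_of s l (col (Q l) k)))" using eigenfunction_repr[OF u ad] by blast
      have "eigenfunction_of s l (col (Q l) k) \<in> w ` I" if "k \<in> K l" for k
        using K0[of l] that l by (force simp: I_def Z_def w_def image_iff)
      then show ?thesis unfolding c by (intro cfun.span_sum cfun.span_scale cfun.span_base)
    qed
    then have "(\<Union>l\<in>{0..a}. op_eigenspace (index_op s) (of_real l)) \<subseteq> cfun_span (w ` I)"
      unfolding op_eigenspace_eq by blast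
    then show "eigen_sum (index_op s) {0..a} \<subseteq> cfun_span (w ` I)"
      unfolding eigen_sum_def by (intro cfun.span_minimal cfun.subspace_span)
  qed
  then have "cfun_dim (eigen_sum (index_op s) {0..a}) = card (w ` I)"
    using cfun.dim_span_eq_card_independent[OF indep] by simp
  also have "\<dots> = card I" using inj by (rule card_image)
  also have "\<dots> = (\<Sum>l\<in>Z. card (K l))" using fin finK by (simp add: I_def Z_def card_SigmaI)
  finally show ?thesis by (simp add: Z_def)
qed

text \<open>The sign is taken from the left because the spectral flow counts eigenvalues in an
  interval closed at 0: an eigenvalue 0 is counted, so it has to be crossed.\<close>

definition sign_below :: "real \<Rightarrow> real" where
  "sign_below s = (SOME \<sigma>. \<sigma> \<in> {-1, 1} \<and> (\<forall>\<^sub>F l in at_left 0. sgn (evans 1 s l) = \<sigma>))"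

lemma sign_below: "sign_below s \<in> {-1, 1}" "\<forall>\<^sub>F l in at_left 0. sgn (evans 1 s l) = sign_below s"
proof -
  obtain Q K where "adapted s 0 Q K" using adapted_exists by blast
  from evans_asymptotics[OF this] obtain L where L: "L \<noteq> 0" "((\<lambda>m. evans 1 s m / (0 - m) ^ card K) \<longlongrightarrow> L) (at 0)"
    by blast
  from L(2) have "((\<lambda>m. evans 1 s m / (0 - m) ^ card K) \<longlongrightarrow> L) (at_left 0)"
    by (rule tendsto_mono[rotated]) (simp add: at_le)
  from sgn_eq_of_tendsto[OF this L(1)]
  have "\<forall>\<^sub>F m in at_left 0. sgn (evans 1 s m / (0 - m) ^ card K) = sgn L" .
  moreover have "\<forall>\<^sub>F m in at_left 0. m < (0::real)" by (simp add: eventually_at_filter)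
  ultimately have "\<forall>\<^sub>F m in at_left 0. sgn (evans 1 s m) = sgn L"
    by eventually_elim (auto simp: sgn_divide)
  moreover have "sgn L \<in> {-1, 1}" using L(1) by (auto simp: sgn_if)
  ultimately have "\<exists>\<sigma>. \<sigma> \<in> {-1, 1} \<and> (\<forall>\<^sub>F l in at_left 0. sgn (evans 1 s l) = \<sigma>)" by blast
  from someI_ex[OF this] show "sign_below s \<in> {-1, 1}" "\<forall>\<^sub>F l in at_left 0. sgn (evans 1 s l) = sign_below s"
    unfolding sign_below_def by blast+
qed

lemma sign_below_eqI:
  assumes "\<forall>\<^sub>F l in at_left 0. sgn (evans 1 s l) = \<sigma>"
  shows "sign_below s = \<sigma>"
proof -
  have "\<forall>\<^sub>F l::real in at_left 0. sign_below s = \<sigma>"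
    using assms sign_below(2)[of s] by eventually_elim simp
  then show ?thesis by (simp add: eventually_const)
qed

text \<open>On the way from \<open>a\<close> to just below 0, \<open>evans 1 s\<close> contributes
  one sign for each eigenvalue in \<open>[0,a]\<close>, counted with multiplicity, since zeros have
  the order of the multiplicity.\<close>

lemma sign_below_eigen_sum:
  assumes "0 \<le> a" "evans 1 s a \<noteq> 0"
  shows "sign_below s = sgn (evans 1 s a) * (-1) ^ cfun_dim (eigen_sum (index_op s) {0..a})"
proof -
  obtain Q K where ad: "\<And>l. adapted s l (Q l) (K l)" using adapted_exists[of s] by metis
  have c: "continuous_on UNIV (evans 1 s)" by (intro continuous_intros)
  note sc = sign_change_count[OF c assms, of "\<lambda>l. card (K l)", OF evans_asymptotics[OF ad]]
  show ?thesis
    unfolding eigen_sum_dim[OF ad sc(1)] by (rule sign_below_eqI[OF sc(2)])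
qed

text \<open>The edge \<open>a\<close> is not an eigenvalue for any \<open>s\<close> in
  \<open>[c,d]\<close>, so \<open>evans 1 s a\<close> keeps its sign and cancels from the
  product.\<close>

lemma sign_below_interval:
  assumes "spectral_gap n T index_op c d a" "c < d"
  shows "sign_below c * sign_below d = (-1) ^ (cfun_dim (eigen_sum (index_op d) {0..a}) + cfun_dim (eigen_sum (index_op c) {0..a}))"
proof -
  have a: "a > 0" using assms(1) by (simp add: spectral_gap_def)
  have nz: "evans 1 s a \<noteq> 0" if "s \<in> {c..d}" for s
    using assms(1) that by (intro evans_nonzero_of_resolvent) (auto simp: spectral_gap_def)
  have "sgn (evans 1 c a) = sgn (evans 1 d a)"
    by (rule sgn_eq_of_continuous_nonzero[of c d "\<lambda>s. evans 1 s a"])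
      (use nz assms(2) in \<open>auto intro!: continuous_intros\<close>)
  moreover have "sgn (evans 1 d a) * sgn (evans 1 d a) = 1" using nz[of d] assms(2) by (simp add: sgn_if)
  ultimately show ?thesis
    using sign_below_eigen_sum[of a c] sign_below_eigen_sum[of a d] nz assms(2) a by (simp add: power_add mult_ac)
qed

text \<open>A telescoping product: the sign at each inner node of the subdivision occurs twice, and
  a difference of dimensions has the parity of their sum.\<close>

lemma sign_below_spectral_flow:
  assumes "has_spectral_flow n T index_op c d k"
  shows "sign_below c * sign_below d = (if even k then 1 else -1)"
proof -
  obtain N :: nat and \<tau> a where \<tau>: "\<tau> 0 = c" "\<tau> N = d"
    and gap: "\<And>i. i < N \<Longrightarrow> \<tau> i < \<tau> (Suc i) \<and> spectral_gap n T index_op (\<tau> i) (\<tau> (Suc i)) (a i)"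
    and k: "k = (\<Sum>i<N. int (cfun_dim (eigen_sum (index_op (\<tau> (Suc i))) {0..a i})) - int (cfun_dim (eigen_sum (index_op (\<tau> i)) {0..a i})))"
    using assms unfolding has_spectral_flow_def by blast
  define f where "f i = int (cfun_dim (eigen_sum (index_op (\<tau> (Suc i))) {0..a i})) - int (cfun_dim (eigen_sum (index_op (\<tau> i)) {0..a i}))" for i
  have "sign_below (\<tau> 0) * sign_below (\<tau> m) = (if even (\<Sum>i<m. f i) then 1 else -1)" if "m \<le> N" for m
    using that
  proof (induction m)
    case 0
    then show ?case using sign_below(1)[of "\<tau> 0"] by auto
  next
    case (Suc m)
    have "sign_below (\<tau> m) * sign_below (\<tau> (Suc m)) = (if even (f m) then 1 else -1)"
      using sign_below_interval[of "\<tau> m" "\<tau> (Suc m)" "a m"] gap[of m] Suc.prems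
      by (simp add: f_def minus_one_power_iff)
    moreover have "sign_below (\<tau> m) * sign_below (\<tau> m) = 1" using sign_below(1)[of "\<tau> m"] by auto
    then have "sign_below (\<tau> 0) * sign_below (\<tau> (Suc m)) = (sign_below (\<tau> 0) * sign_below (\<tau> m)) * (sign_below (\<tau> m) * sign_below (\<tau> (Suc m)))"
      by (simp add: mult_ac)
    ultimately show ?case using Suc by (simp split: if_splits)
  qed
  from this[of N] show ?thesis using \<tau> k by (simp add: f_def)
qed

lemma sign_below_of_trivial_kernel:
  assumes "op_eigenspace (index_op s) 0 = {0}"
  shows "evans 1 s 0 \<noteq> 0" "sign_below s = sgn (evans 1 s 0)"
proof -
  show nz: "evans 1 s 0 \<noteq> 0"
  proof
    assume "evans 1 s 0 = 0"
    then obtain z i where z: "i < 2 * n" "z i \<noteq> 0" "return_fixed 1 s 0 z" unfolding evans_eq_0_iff by blast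
    have "eigenfunction_of s 0 z \<in> op_eigenspace (index_op s) (of_real 0)"
      using eigenfunction_cx[OF z(3)] unfolding op_eigenspace_eq by simp
    then have "eigenfunction_of s 0 z = 0" using assms by simp
    then show False using eigenfunction_of_eq_0D z by blast
  qed
  have "((\<lambda>l. evans 1 s l) \<longlongrightarrow> evans 1 s 0) (at_left 0)" by (intro tendsto_evans tendsto_intros)
  from sgn_eq_of_tendsto[OF this nz] show "sign_below s = sgn (evans 1 s 0)" by (rule sign_below_eqI)
qed

text \<open>\<open>S1\<close> and \<open>S2\<close> are the form in which stability enters: no real
  eigenvalue of \<open>P\<close> above 1, and a symplectic form nondegenerate on
  \<open>ker (P - 1)\<close>. They make the sign at \<open>s = 0\<close> equal to 1.\<close>

theorem stable_parity:
  assumes A: "A \<in> carrier_mat n n" "Determinant.det A \<in> {1, -1}"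
    and s0: "s0 > 0" "\<And>s. s \<ge> s0 \<Longrightarrow> op_eigenspace (index_op s) 0 = {0}"
    and k: "has_spectral_flow n T index_op 0 s0 k"
    and S1: "\<And>c z. c > 1 \<Longrightarrow> (\<And>i. i < 2 * n \<Longrightarrow> return_map 1 0 0 z i = c * z i) \<Longrightarrow> (\<And>i. i < 2 * n \<Longrightarrow> z i = 0)"
    and S2: "\<And>z. return_fixed 1 0 0 z \<Longrightarrow> (\<And>w. return_fixed 1 0 0 w \<Longrightarrow> omega w z = 0) \<Longrightarrow> (\<And>i. i < 2 * n \<Longrightarrow> z i = 0)"
  shows "(if even k then 1 else -1) = (-1) ^ n * Determinant.det A"
proof -
  have "Matrix.mat n n (\<lambda>(i, j). A $$ (i, j)) = A" using A(1) by (intro eq_matI) auto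
  then have det: "fdet n (\<lambda>i j. A $$ (i, j)) = Determinant.det A" by (simp add: fdet_def)
  have "\<forall>\<^sub>F l in at_left 0. evans 1 0 l > 0"
  proof (rule evans_left_pos)
    show "z i = 0" if "c > 1" "\<And>i. i < 2 * n \<Longrightarrow> return_map 1 0 0 z i = c * z i" "i < 2 * n" for c z i
      using that by (rule S1)
    show "z i = 0" if "return_fixed 1 0 0 z" "\<And>w. return_fixed 1 0 0 w \<Longrightarrow> omega w z = 0" "i < 2 * n" for z i
      using that by (rule S2)
  qed
  then have "\<forall>\<^sub>F l in at_left 0. sgn (evans 1 0 l) = 1" by eventually_elim auto
  then have c0: "sign_below 0 = 1" by (rule sign_below_eqI)
  have "\<forall>\<^sub>F s in at_top. sgn (evans 1 s 0) = (-1) ^ n * sgn (Determinant.det A)"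
    using evans_large A(2) unfolding det by auto
  then have "\<forall>\<^sub>F s in at_top. s \<ge> s0 \<and> sgn (evans 1 s 0) = (-1) ^ n * sgn (Determinant.det A)"
    using eventually_ge_at_top[of s0] by eventually_elim auto
  then obtain s where s: "s \<ge> s0" "sgn (evans 1 s 0) = (-1) ^ n * sgn (Determinant.det A)"
    unfolding eventually_at_top_linorder by auto
  \<comment> \<open>Trivial kernels from \<open>s0\<close> on connect the end \<open>s0\<close> of
    the path to an \<open>s\<close> that is large enough for \<open>evans_large\<close>.\<close>
  have "sgn (evans 1 s0 0) = sgn (evans 1 s 0)"
    by (rule sgn_eq_of_continuous_nonzero[of s0 s "\<lambda>s. evans 1 s 0"])
      (use s s0 sign_below_of_trivial_kernel in \<open>auto intro!: continuous_intros\<close>)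
  then have "sign_below s0 = (-1) ^ n * Determinant.det A"
    using sign_below_of_trivial_kernel(2)[OF s0(2)[OF order_refl]] s(2) A(2) by auto
  then show ?thesis using sign_below_spectral_flow[OF k] c0 by simp
qed

end

section \<open>Calculus on Euclidean spaces\<close>

abbreviation dd :: "('a::real_normed_vector \<Rightarrow> 'b::real_normed_vector) \<Rightarrow> 'a \<Rightarrow> 'a \<Rightarrow> 'b" where
  "dd f x \<equiv> frechet_derivative f (at x)"

lemma dd_works: "f differentiable at x \<Longrightarrow> (f has_derivative dd f x) (at x)"
  by (simp add: frechet_derivative_works)

lemma dd_eqI: "(f has_derivative f') (at x) \<Longrightarrow> dd f x = f'"
  by (rule frechet_derivative_at[symmetric])

lemma dd_linear: "f differentiable at x \<Longrightarrow> linear (dd f x)"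
  by (rule has_derivative_linear[OF dd_works])

lemma dd_cong:
  assumes "open S" "x \<in> S" "\<And>y. y \<in> S \<Longrightarrow> f y = g y"
  shows "dd f x = dd g x"
proof -
  have "(f has_derivative f') (at x) \<longleftrightarrow> (g has_derivative f') (at x)" for f'
    using assms has_derivative_transform_within_open[of f f' x UNIV S g]
      has_derivative_transform_within_open[of g f' x UNIV S f] by auto
  then show ?thesis by (simp add: frechet_derivative_def)
qed

lemma dd_add: "f differentiable at x \<Longrightarrow> g differentiable at x \<Longrightarrow> dd (\<lambda>y. f y + g y) x v = dd f x v + dd g x v"
  by (subst dd_eqI[OF has_derivative_add[OF dd_works dd_works]]) auto

lemma dd_scaleR: "f differentiable at x \<Longrightarrow> dd (\<lambda>y. c *\<^sub>R f y) x v = c *\<^sub>R dd f x v"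
  by (subst dd_eqI[OF has_derivative_scaleR_right[OF dd_works]]) auto

lemma dd_sum: "(\<And>i. i \<in> I \<Longrightarrow> f i differentiable at x) \<Longrightarrow> dd (\<lambda>y. \<Sum>i\<in>I. f i y) x v = (\<Sum>i\<in>I. dd (f i) x v)"
  by (subst dd_eqI[OF has_derivative_sum[OF dd_works]]) auto

lemma dd_expand:
  fixes f :: "'e::euclidean_space \<Rightarrow> 'b::real_normed_vector"
  assumes "f differentiable at x"
  shows "dd f x v = (\<Sum>b\<in>Basis. (inner v b) *\<^sub>R dd f x b)"
proof -
  interpret linear "dd f x" using assms by (rule dd_linear)
  show ?thesis by (subst euclidean_representation[of v, symmetric]) (simp only: sum scale)
qed

lemma Ck_on_cong:
  assumes "open S"
  shows "(\<And>x. x \<in> S \<Longrightarrow> f x = g x) \<Longrightarrow> Ck_on k S f \<Longrightarrow> Ck_on k S g"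
proof (induction k arbitrary: f g)
  case 0
  then show ?case by (auto cong: continuous_on_cong)
next
  case (Suc k)
  have "g differentiable_on S"
    using Suc.prems by (auto simp: differentiable_on_def intro: differentiable_transform_within[of _ _ _ 1])
  moreover have "dd f x = dd g x" if "x \<in> S" for x
    using assms that Suc.prems(1) by (rule dd_cong)
  moreover have "Ck_on k S (\<lambda>x. dd g x b)" if "b \<in> Basis" for b
    by (rule Suc.IH[where f = "\<lambda>x. dd f x b"]) (use Suc.prems(2) that calculation in auto)
  ultimately show ?case by simp
qed

lemma Ck_on_differentiable: "Ck_on (Suc k) S f \<Longrightarrow> open S \<Longrightarrow> x \<in> S \<Longrightarrow> f differentiable at x"
  by (simp add: differentiable_on_eq_differentiable_at)

lemma Ck_on_add:
  assumes "open S"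
  shows "Ck_on k S f \<Longrightarrow> Ck_on k S g \<Longrightarrow> Ck_on k S (\<lambda>x. f x + g x)"
proof (induction k arbitrary: f g)
  case (Suc k)
  have "Ck_on k S (\<lambda>x. dd (\<lambda>x. f x + g x) x b)" if b: "b \<in> Basis" for b
  proof (rule Ck_on_cong[OF assms])
    show "Ck_on k S (\<lambda>x. dd f x b + dd g x b)" using Suc b by simp
    show "dd f x b + dd g x b = dd (\<lambda>x. f x + g x) x b" if "x \<in> S" for x
      using Suc.prems[THEN Ck_on_differentiable, OF assms that] by (simp add: dd_add)
  qed
  then show ?case using Suc.prems by (simp add: differentiable_on_add)
qed (auto intro: continuous_intros)

lemma Ck_on_scaleR:
  assumes "open S"
  shows "Ck_on k S f \<Longrightarrow> Ck_on k S (\<lambda>x. c *\<^sub>R f x)"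
proof (induction k arbitrary: f)
  case (Suc k)
  have "Ck_on k S (\<lambda>x. dd (\<lambda>x. c *\<^sub>R f x) x b)" if b: "b \<in> Basis" for b
  proof (rule Ck_on_cong[OF assms])
    show "Ck_on k S (\<lambda>x. c *\<^sub>R dd f x b)" using Suc b by simp
    show "c *\<^sub>R dd f x b = dd (\<lambda>x. c *\<^sub>R f x) x b" if "x \<in> S" for x
      using Suc.prems[THEN Ck_on_differentiable, OF assms that] by (simp add: dd_scaleR)
  qed
  then show ?case using Suc.prems by (simp add: differentiable_on_def differentiable_scaleR)
qed (auto intro: continuous_intros)

lemma Ck_on_const: "Ck_on k S (\<lambda>x. c)"
proof (induction k arbitrary: c)
  case (Suc k)
  then show ?case by (simp add: frechet_derivative_const)
qed simp

lemma Ck_on_sum: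
  assumes "open S"
  shows "(\<And>i. i \<in> I \<Longrightarrow> Ck_on k S (f i)) \<Longrightarrow> Ck_on k S (\<lambda>x. \<Sum>i\<in>I. f i x)"
  by (induction I rule: infinite_finite_induct) (auto intro: Ck_on_const Ck_on_add[OF assms])

lemma smooth_on_differentiable: "smooth_on S f \<Longrightarrow> open S \<Longrightarrow> x \<in> S \<Longrightarrow> f differentiable at x"
  unfolding smooth_on_def using Ck_on_differentiable by blast

lemma smooth_on_continuous: "smooth_on S f \<Longrightarrow> continuous_on S f"
  unfolding smooth_on_def using Ck_on.simps(1) by blast

lemma smooth_on_cong: "open S \<Longrightarrow> (\<And>x. x \<in> S \<Longrightarrow> f x = g x) \<Longrightarrow> smooth_on S f \<Longrightarrow> smooth_on S g"
  unfolding smooth_on_def using Ck_on_cong by blast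

lemma smooth_on_add: "open S \<Longrightarrow> smooth_on S f \<Longrightarrow> smooth_on S g \<Longrightarrow> smooth_on S (\<lambda>x. f x + g x)"
  unfolding smooth_on_def by (auto intro: Ck_on_add)

lemma smooth_on_scaleR: "open S \<Longrightarrow> smooth_on S f \<Longrightarrow> smooth_on S (\<lambda>x. c *\<^sub>R f x)"
  unfolding smooth_on_def by (auto intro: Ck_on_scaleR)

text \<open>\<open>Ck_on\<close> speaks of directions in \<open>Basis\<close> only; any other
  direction is a constant combination of these.\<close>

lemma smooth_on_dd:
  assumes S: "open S" and f: "smooth_on S f"
  shows "smooth_on S (\<lambda>x. dd f x v)"
proof (rule smooth_on_cong[OF S])
  show "smooth_on S (\<lambda>x. \<Sum>b\<in>Basis. (inner v b) *\<^sub>R dd f x b)"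
    unfolding smooth_on_def
  proof (intro allI Ck_on_sum[OF S] Ck_on_scaleR[OF S])
    fix k and b :: 'a assume "b \<in> Basis"
    then show "Ck_on k S (\<lambda>x. dd f x b)" using f Ck_on.simps(2)[of k S f] unfolding smooth_on_def by blast
  qed
  show "(\<Sum>b\<in>Basis. (inner v b) *\<^sub>R dd f x b) = dd f x v" if "x \<in> S" for x
    by (rule dd_expand[OF smooth_on_differentiable[OF f S that], symmetric])
qed

text \<open>The mean value theorem is applied first along \<open>u\<close> and then along
  \<open>v\<close>. The quotient is symmetric in \<open>u\<close> and \<open>v\<close>, from which
  \<open>dd_commute_real\<close> obtains the symmetry of second derivatives.\<close>

lemma second_difference:
  fixes f :: "'e::euclidean_space \<Rightarrow> real"
  assumes S: "open S" "x \<in> S" and f: "smooth_on S f"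
  shows "((\<lambda>h. (f (x + h *\<^sub>R u + h *\<^sub>R v) - f (x + h *\<^sub>R u) - f (x + h *\<^sub>R v) + f x) / h\<^sup>2) \<longlongrightarrow>
    dd (\<lambda>y. dd f y u) x v) (at_right 0)"
proof (rule tendstoI)
  fix e :: real assume e: "e > 0"
  let ?F = "\<lambda>y. dd (\<lambda>y. dd f y u) y v"
  have fu: "smooth_on S (\<lambda>y. dd f y u)" by (rule smooth_on_dd[OF S(1) f])
  have "continuous_on S ?F" by (rule smooth_on_continuous[OF smooth_on_dd[OF S(1) fu]])
  then have "isCont ?F x" using S by (simp add: continuous_on_eq_continuous_at)
  then obtain \<delta>1 where \<delta>1: "\<delta>1 > 0" "\<And>y. dist y x < \<delta>1 \<Longrightarrow> dist (?F y) (?F x) < e"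
    using e unfolding continuous_at_eps_delta by blast
  obtain \<delta>2 where \<delta>2: "\<delta>2 > 0" "ball x \<delta>2 \<subseteq> S" using S open_contains_ball by blast
  define \<delta> where "\<delta> = min \<delta>1 \<delta>2"
  define C where "C = norm u + norm v + 1"
  have C: "C > 0" by (simp add: C_def add_nonneg_pos)
  have near: "dist (x + a *\<^sub>R u + b *\<^sub>R v) x < \<delta>"
    if "0 < h" "h < \<delta> / C" "0 \<le> a" "a \<le> h" "0 \<le> b" "b \<le> h" for a b h
  proof -
    have "norm (a *\<^sub>R u + b *\<^sub>R v) \<le> h * norm u + h * norm v"
      using that by (intro order_trans[OF norm_triangle_ineq] add_mono) (auto intro: mult_right_mono)
    also have "\<dots> < h * C" using that by (simp add: C_def algebra_simps)
    also have "\<dots> < \<delta>" using that C by (simp add: field_simps)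
    finally show ?thesis by (simp add: dist_norm add.assoc)
  qed
  have inS: "x + a *\<^sub>R u + b *\<^sub>R v \<in> S"
    if "0 < h" "h < \<delta> / C" "0 \<le> a" "a \<le> h" "0 \<le> b" "b \<le> h" for a b h
    using near[OF that] \<delta>2 by (auto simp: \<delta>_def dist_commute)
  have "dist ((f (x + h *\<^sub>R u + h *\<^sub>R v) - f (x + h *\<^sub>R u) - f (x + h *\<^sub>R v) + f x) / h\<^sup>2) (?F x) < e"
    if h: "0 < h" "h < \<delta> / C" for h
  proof -
    have line: "((\<lambda>s. F (x + s *\<^sub>R u + b *\<^sub>R v)) has_real_derivative dd F (x + s *\<^sub>R u + b *\<^sub>R v) u) (at s)"
      if "F differentiable at (x + s *\<^sub>R u + b *\<^sub>R v)" for F :: "'e \<Rightarrow> real" and s b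
    proof -
      have "((\<lambda>s. F (x + s *\<^sub>R u + b *\<^sub>R v)) has_derivative (\<lambda>t. dd F (x + s *\<^sub>R u + b *\<^sub>R v) (t *\<^sub>R u))) (at s)"
        by (rule has_derivative_compose[where g = F and f = "\<lambda>s. x + s *\<^sub>R u + b *\<^sub>R v", OF _ dd_works[OF that]])
          (auto intro!: derivative_eq_intros)
      moreover have "dd F (x + s *\<^sub>R u + b *\<^sub>R v) (t *\<^sub>R u) = t * dd F (x + s *\<^sub>R u + b *\<^sub>R v) u" for t
        using linear_scale[OF dd_linear[OF that], of t u] by simp
      ultimately show ?thesis by (simp add: has_field_derivative_def mult_commute_abs)
    qed
    have line': "((\<lambda>s. F (x + a *\<^sub>R u + s *\<^sub>R v)) has_real_derivative dd F (x + a *\<^sub>R u + s *\<^sub>R v) v) (at s)"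
      if "F differentiable at (x + a *\<^sub>R u + s *\<^sub>R v)" for F :: "'e \<Rightarrow> real" and s a
    proof -
      have "((\<lambda>s. F (x + a *\<^sub>R u + s *\<^sub>R v)) has_derivative (\<lambda>t. dd F (x + a *\<^sub>R u + s *\<^sub>R v) (t *\<^sub>R v))) (at s)"
        by (rule has_derivative_compose[where g = F and f = "\<lambda>s. x + a *\<^sub>R u + s *\<^sub>R v", OF _ dd_works[OF that]])
          (auto intro!: derivative_eq_intros)
      moreover have "dd F (x + a *\<^sub>R u + s *\<^sub>R v) (t *\<^sub>R v) = t * dd F (x + a *\<^sub>R u + s *\<^sub>R v) v" for t
        using linear_scale[OF dd_linear[OF that], of t v] by simp
      ultimately show ?thesis by (simp add: has_field_derivative_def mult_commute_abs)
    qed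
    have df: "f differentiable at (x + a *\<^sub>R u + b *\<^sub>R v)" "(\<lambda>y. dd f y u) differentiable at (x + a *\<^sub>R u + b *\<^sub>R v)"
      if "0 \<le> a" "a \<le> h" "0 \<le> b" "b \<le> h" for a b
      using smooth_on_differentiable[OF f S(1) inS[OF h that]] smooth_on_differentiable[OF fu S(1) inS[OF h that]] by auto
    define \<phi> where "\<phi> s = f (x + s *\<^sub>R u + h *\<^sub>R v) - f (x + s *\<^sub>R u + 0 *\<^sub>R v)" for s
    have "\<exists>z. 0 < z \<and> z < h \<and> \<phi> h - \<phi> 0 = (h - 0) * (dd f (x + z *\<^sub>R u + h *\<^sub>R v) u - dd f (x + z *\<^sub>R u + 0 *\<^sub>R v) u)"
      unfolding \<phi>_def using h by (intro MVT2 DERIV_diff line df) auto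
    then obtain z where z: "0 < z" "z < h" "\<phi> h - \<phi> 0 = h * (dd f (x + z *\<^sub>R u + h *\<^sub>R v) u - dd f (x + z *\<^sub>R u + 0 *\<^sub>R v) u)"
      by auto
    have "\<exists>w. 0 < w \<and> w < h \<and> dd f (x + z *\<^sub>R u + h *\<^sub>R v) u - dd f (x + z *\<^sub>R u + 0 *\<^sub>R v) u = (h - 0) * ?F (x + z *\<^sub>R u + w *\<^sub>R v)"
      using h z by (intro MVT2 line'[of "\<lambda>y. dd f y u"] df) auto
    then obtain w where w: "0 < w" "w < h" "dd f (x + z *\<^sub>R u + h *\<^sub>R v) u - dd f (x + z *\<^sub>R u + 0 *\<^sub>R v) u = h * ?F (x + z *\<^sub>R u + w *\<^sub>R v)"
      by auto
    have "f (x + h *\<^sub>R u + h *\<^sub>R v) - f (x + h *\<^sub>R u) - f (x + h *\<^sub>R v) + f x = \<phi> h - \<phi> 0"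
      by (simp add: \<phi>_def)
    also have "\<dots> = h\<^sup>2 * ?F (x + z *\<^sub>R u + w *\<^sub>R v)"
      unfolding z(3) w(3) by (simp add: power2_eq_square)
    finally have "(f (x + h *\<^sub>R u + h *\<^sub>R v) - f (x + h *\<^sub>R u) - f (x + h *\<^sub>R v) + f x) / h\<^sup>2 = ?F (x + z *\<^sub>R u + w *\<^sub>R v)"
      using h by simp
    moreover have "dist (x + z *\<^sub>R u + w *\<^sub>R v) x < \<delta>1"
      using near[OF h, of z w] z w by (simp add: \<delta>_def)
    ultimately show ?thesis using \<delta>1(2) by simp
  qed
  moreover have "\<delta> / C > 0" using C \<delta>1 \<delta>2 by (simp add: \<delta>_def)
  ultimately show "\<forall>\<^sub>F h in at_right 0. dist ((f (x + h *\<^sub>R u + h *\<^sub>R v) - f (x + h *\<^sub>R u) - f (x + h *\<^sub>R v) + f x) / h\<^sup>2) (?F x) < e"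
    unfolding eventually_at_right_field by blast
qed

lemma dd_commute_real:
  fixes f :: "'e::euclidean_space \<Rightarrow> real"
  assumes S: "open S" "x \<in> S" and f: "smooth_on S f"
  shows "dd (\<lambda>y. dd f y u) x v = dd (\<lambda>y. dd f y v) x u"
proof -
  have "(\<lambda>h. (f (x + h *\<^sub>R u + h *\<^sub>R v) - f (x + h *\<^sub>R u) - f (x + h *\<^sub>R v) + f x) / h\<^sup>2) =
     (\<lambda>h. (f (x + h *\<^sub>R v + h *\<^sub>R u) - f (x + h *\<^sub>R v) - f (x + h *\<^sub>R u) + f x) / h\<^sup>2)"
    by (simp add: fun_eq_iff algebra_simps)
  with second_difference[OF assms, of u v] second_difference[OF assms, of v u]
  show ?thesis by (metis (no_types, lifting) tendsto_unique trivial_limit_at_right_real)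
qed

lemma dd_inner:
  assumes "f differentiable at x"
  shows "dd (\<lambda>y. inner (f y) b) x v = inner (dd f x v) b"
  by (subst dd_eqI[OF has_derivative_inner_left[OF dd_works[OF assms]]]) simp

lemma smooth_on_inner:
  assumes "open S"
  shows "smooth_on S f \<Longrightarrow> smooth_on S (\<lambda>x. inner (f x) b)"
proof -
  have "Ck_on k S f \<Longrightarrow> Ck_on k S (\<lambda>x. inner (f x) b)" for k
  proof (induction k arbitrary: f)
    case (Suc k)
    have "Ck_on k S (\<lambda>x. dd (\<lambda>x. inner (f x) b) x c)" if c: "c \<in> Basis" for c
    proof (rule Ck_on_cong[OF assms])
      show "Ck_on k S (\<lambda>x. inner (dd f x c) b)" using Suc c by simp
      show "inner (dd f x c) b = dd (\<lambda>x. inner (f x) b) x c" if "x \<in> S" for x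
        using Suc.prems[THEN Ck_on_differentiable, OF assms that] by (simp add: dd_inner)
    qed
    then show ?case using Suc.prems by (auto simp: differentiable_on_def intro: differentiable_inner)
  qed (auto intro: continuous_intros)
  then show "smooth_on S f \<Longrightarrow> smooth_on S (\<lambda>x. inner (f x) b)" by (auto simp: smooth_on_def)
qed

lemma dd_commute:
  fixes f :: "'e::euclidean_space \<Rightarrow> 'b::euclidean_space"
  assumes S: "open S" "x \<in> S" and f: "smooth_on S f"
  shows "dd (\<lambda>y. dd f y u) x v = dd (\<lambda>y. dd f y v) x u"
proof (rule euclidean_eqI)
  fix b :: 'b
  have *: "dd (\<lambda>y. dd (\<lambda>y. inner (f y) b) y u) x v = inner (dd (\<lambda>y. dd f y u) x v) b" for u v
  proof -
    have "dd (\<lambda>y. dd (\<lambda>y. inner (f y) b) y u) x = dd (\<lambda>y. inner (dd f y u) b) x"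
      by (rule dd_cong[OF S]) (simp add: dd_inner smooth_on_differentiable[OF f S(1)])
    then show ?thesis
      using dd_inner[OF smooth_on_differentiable[OF smooth_on_dd[OF S(1) f] S]] by simp
  qed
  show "inner (dd (\<lambda>y. dd f y u) x v) b = inner (dd (\<lambda>y. dd f y v) x u) b"
    unfolding *[symmetric] by (rule dd_commute_real[OF S smooth_on_inner[OF S(1) f]])
qed

text \<open>Expanding the argument in \<open>Basis\<close> reduces the product rule to
  differentiability of \<open>L z p\<close> for each fixed \<open>p\<close>, without a norm on the
  space of linear maps. Metric and Christoffel symbols are differentiated in this way with moving
  arguments.\<close>

lemma has_derivative_linear_param:
  fixes L :: "'x::real_normed_vector \<Rightarrow> 'e::euclidean_space \<Rightarrow> 'b::real_normed_vector"
    and y :: "'k::real_normed_vector \<Rightarrow> 'x"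
  assumes S: "open S" "y t \<in> S" and L: "\<And>z. z \<in> S \<Longrightarrow> linear (L z)"
    and dL: "\<And>p. (\<lambda>z. L z p) differentiable at (y t)"
    and y: "(y has_derivative y') (at t within J)" and p: "(p has_derivative p') (at t within J)" and t: "t \<in> J"
  shows "((\<lambda>t. L (y t) (p t)) has_derivative (\<lambda>h. dd (\<lambda>z. L z (p t)) (y t) (y' h) + L (y t) (p' h))) (at t within J)"
proof -
  have exp: "L z q = (\<Sum>b\<in>Basis. (inner q b) *\<^sub>R L z b)" if "z \<in> S" for z q
  proof -
    interpret linear "L z" by (rule L[OF that])
    show ?thesis by (subst euclidean_representation[of q, symmetric]) (simp only: sum scale)
  qed
  have "((\<lambda>s. \<Sum>b\<in>Basis. (inner (p s) b) *\<^sub>R L (y s) b) has_derivative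
     (\<lambda>h. \<Sum>b\<in>Basis. (inner (p t) b) *\<^sub>R dd (\<lambda>z. L z b) (y t) (y' h) + (inner (p' h) b) *\<^sub>R L (y t) b)) (at t within J)"
    by (intro has_derivative_sum has_derivative_scaleR has_derivative_inner_left p
        has_derivative_compose[OF y dd_works[OF dL]])
  also have "(\<lambda>h. \<Sum>b\<in>Basis. (inner (p t) b) *\<^sub>R dd (\<lambda>z. L z b) (y t) (y' h) + (inner (p' h) b) *\<^sub>R L (y t) b) =
     (\<lambda>h. dd (\<lambda>z. L z (p t)) (y t) (y' h) + L (y t) (p' h))"
  proof
    fix h
    have "dd (\<lambda>z. L z (p t)) (y t) = dd (\<lambda>z. \<Sum>b\<in>Basis. (inner (p t) b) *\<^sub>R L z b) (y t)"
      by (rule dd_cong[OF S exp])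
    then have "dd (\<lambda>z. L z (p t)) (y t) (y' h) = (\<Sum>b\<in>Basis. (inner (p t) b) *\<^sub>R dd (\<lambda>z. L z b) (y t) (y' h))"
      by (simp add: dd_sum dd_scaleR dL differentiable_scaleR)
    then show "(\<Sum>b\<in>Basis. (inner (p t) b) *\<^sub>R dd (\<lambda>z. L z b) (y t) (y' h) + (inner (p' h) b) *\<^sub>R L (y t) b) =
      dd (\<lambda>z. L z (p t)) (y t) (y' h) + L (y t) (p' h)"
      using exp[OF S(2), of "p' h"] by (simp add: sum.distrib)
  qed
  finally have d: "((\<lambda>s. \<Sum>b\<in>Basis. (inner (p s) b) *\<^sub>R L (y s) b) has_derivative
     (\<lambda>h. dd (\<lambda>z. L z (p t)) (y t) (y' h) + L (y t) (p' h))) (at t within J)" .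
  have "continuous (at t within J) y" using y by (rule has_derivative_continuous)
  then have "\<forall>\<^sub>F s in at t within J. y s \<in> S"
    using S unfolding continuous_within by (intro topological_tendstoD)
  then have "\<forall>\<^sub>F s in at t within J. (\<Sum>b\<in>Basis. (inner (p s) b) *\<^sub>R L (y s) b) = L (y s) (p s)"
    by eventually_elim (rule exp[symmetric])
  then show ?thesis
    by (rule has_derivative_transform_eventually[OF d _ _ t]) (rule exp[OF S(2), symmetric])
qed

lemma bilinear_linear_left: "bilinear B \<Longrightarrow> linear (\<lambda>p. B p q)"
  by (simp add: bilinear_def)

lemma bilinear_linear_right: "bilinear B \<Longrightarrow> linear (B p)"
  by (simp add: bilinear_def)

lemma has_derivative_bilinear_param:
  fixes B :: "'x::real_normed_vector \<Rightarrow> 'e::euclidean_space \<Rightarrow> 'f::euclidean_space \<Rightarrow> 'b::real_normed_vector"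
    and y :: "'k::real_normed_vector \<Rightarrow> 'x"
  assumes S: "open S" "y t \<in> S" and B: "\<And>z. z \<in> S \<Longrightarrow> bilinear (B z)"
    and dB: "\<And>p q. (\<lambda>z. B z p q) differentiable at (y t)"
    and y: "(y has_derivative y') (at t within J)" and p: "(p has_derivative p') (at t within J)"
    and q: "(q has_derivative q') (at t within J)" and t: "t \<in> J"
  shows "((\<lambda>t. B (y t) (p t) (q t)) has_derivative
    (\<lambda>h. dd (\<lambda>z. B z (p t) (q t)) (y t) (y' h) + B (y t) (p' h) (q t) + B (y t) (p t) (q' h))) (at t within J)"
proof -
  have exp: "B z r q = (\<Sum>b\<in>Basis. (inner q b) *\<^sub>R B z r b)" if "z \<in> S" for z r q
  proof -
    interpret linear "B z r" by (rule bilinear_linear_right[OF B[OF that]])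
    show ?thesis by (subst euclidean_representation[of q, symmetric]) (simp only: sum scale)
  qed
  have "((\<lambda>s. \<Sum>b\<in>Basis. (inner (q s) b) *\<^sub>R B (y s) (p s) b) has_derivative
     (\<lambda>h. \<Sum>b\<in>Basis. (inner (q t) b) *\<^sub>R (dd (\<lambda>z. B z (p t) b) (y t) (y' h) + B (y t) (p' h) b)
        + (inner (q' h) b) *\<^sub>R B (y t) (p t) b)) (at t within J)"
    by (intro has_derivative_sum has_derivative_scaleR has_derivative_inner_left q
        has_derivative_linear_param[where L = "\<lambda>z p. B z p _", OF S bilinear_linear_left[OF B] dB y p t])
  also have "(\<lambda>h. \<Sum>b\<in>Basis. (inner (q t) b) *\<^sub>R (dd (\<lambda>z. B z (p t) b) (y t) (y' h) + B (y t) (p' h) b)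
        + (inner (q' h) b) *\<^sub>R B (y t) (p t) b) =
     (\<lambda>h. dd (\<lambda>z. B z (p t) (q t)) (y t) (y' h) + B (y t) (p' h) (q t) + B (y t) (p t) (q' h))"
  proof
    fix h
    have "dd (\<lambda>z. B z (p t) (q t)) (y t) = dd (\<lambda>z. \<Sum>b\<in>Basis. (inner (q t) b) *\<^sub>R B z (p t) b) (y t)"
      by (rule dd_cong[OF S exp])
    then have "dd (\<lambda>z. B z (p t) (q t)) (y t) (y' h) = (\<Sum>b\<in>Basis. (inner (q t) b) *\<^sub>R dd (\<lambda>z. B z (p t) b) (y t) (y' h))"
      by (simp add: dd_sum dd_scaleR dB differentiable_scaleR)
    then show "(\<Sum>b\<in>Basis. (inner (q t) b) *\<^sub>R (dd (\<lambda>z. B z (p t) b) (y t) (y' h) + B (y t) (p' h) b)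
        + (inner (q' h) b) *\<^sub>R B (y t) (p t) b) =
      dd (\<lambda>z. B z (p t) (q t)) (y t) (y' h) + B (y t) (p' h) (q t) + B (y t) (p t) (q' h)"
      using exp[OF S(2), of "p t" "q' h"] exp[OF S(2), of "p' h" "q t"] by (simp add: sum.distrib scaleR_right_distrib)
  qed
  finally have d: "((\<lambda>s. \<Sum>b\<in>Basis. (inner (q s) b) *\<^sub>R B (y s) (p s) b) has_derivative
     (\<lambda>h. dd (\<lambda>z. B z (p t) (q t)) (y t) (y' h) + B (y t) (p' h) (q t) + B (y t) (p t) (q' h))) (at t within J)" .
  have "continuous (at t within J) y" using y by (rule has_derivative_continuous)
  then have "\<forall>\<^sub>F s in at t within J. y s \<in> S"
    using S unfolding continuous_within by (intro topological_tendstoD)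
  then have "\<forall>\<^sub>F s in at t within J. (\<Sum>b\<in>Basis. (inner (q s) b) *\<^sub>R B (y s) (p s) b) = B (y s) (p s) (q s)"
    by eventually_elim (rule exp[symmetric])
  then show ?thesis
    by (rule has_derivative_transform_eventually[OF d _ _ t]) (rule exp[OF S(2), symmetric])
qed

lemma tendsto_linear_param:
  fixes L :: "'x::t2_space \<Rightarrow> 'e::euclidean_space \<Rightarrow> 'b::real_normed_vector"
  assumes S: "open S" "x \<in> S" and L: "\<And>z. z \<in> S \<Longrightarrow> linear (L z)"
    and cL: "\<And>p. isCont (\<lambda>z. L z p) x" and y: "(y \<longlongrightarrow> x) F" and p: "(p \<longlongrightarrow> q) F"
  shows "((\<lambda>t. L (y t) (p t)) \<longlongrightarrow> L x q) F"
proof -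
  have exp: "L z q = (\<Sum>b\<in>Basis. (inner q b) *\<^sub>R L z b)" if "z \<in> S" for z q
  proof -
    interpret linear "L z" by (rule L[OF that])
    show ?thesis by (subst euclidean_representation[of q, symmetric]) (simp only: sum scale)
  qed
  have "((\<lambda>t. \<Sum>b\<in>Basis. (inner (p t) b) *\<^sub>R L (y t) b) \<longlongrightarrow> (\<Sum>b\<in>Basis. (inner q b) *\<^sub>R L x b)) F"
    by (intro tendsto_intros p isCont_tendsto_compose[OF cL y])
  moreover have "\<forall>\<^sub>F t in F. y t \<in> S" using y S by (intro topological_tendstoD)
  then have "\<forall>\<^sub>F t in F. (\<Sum>b\<in>Basis. (inner (p t) b) *\<^sub>R L (y t) b) = L (y t) (p t)"
    by eventually_elim (rule exp[symmetric])
  ultimately show ?thesis unfolding exp[OF S(2), of q] by (rule Lim_transform_eventually)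
qed

text \<open>A product rule in which the factor \<open>f\<close> is only continuous: the missing
  derivative would be multiplied by \<open>g x = 0\<close>. In
  \<open>differentiable_solution\<close> the role of \<open>f\<close> is taken by the components of
  the unknown.\<close>

lemma has_derivative_scaleR_vanishing:
  fixes f :: "'k::real_normed_vector \<Rightarrow> real" and g :: "'k \<Rightarrow> 'b::real_normed_vector"
  assumes f: "isCont f x" and g: "(g has_derivative g') (at x)" and 0: "g x = 0"
  shows "((\<lambda>y. f y *\<^sub>R g y) has_derivative (\<lambda>h. f x *\<^sub>R g' h)) (at x)"
proof -
  interpret g': bounded_linear g' using g by (rule has_derivative_bounded_linear)
  obtain K where K: "\<And>h. norm (g' h) \<le> norm h * K" using g'.bounded by blast
  have 1: "((\<lambda>y. norm (g y - g' (y - x)) / norm (y - x)) \<longlongrightarrow> 0) (at x)"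
    using g 0 by (simp add: has_derivative_iff_norm)
  have 2: "((\<lambda>y. \<bar>f y\<bar> * (norm (g y - g' (y - x)) / norm (y - x)) + \<bar>f y - f x\<bar> * K) \<longlongrightarrow> \<bar>f x\<bar> * 0 + \<bar>f x - f x\<bar> * K) (at x)"
    using f unfolding isCont_def by (intro tendsto_intros 1)
  have "((\<lambda>y. norm (f y *\<^sub>R g y - f x *\<^sub>R g' (y - x)) / norm (y - x)) \<longlongrightarrow> 0) (at x)"
  proof (rule Lim_null_comparison)
    show "((\<lambda>y. \<bar>f y\<bar> * (norm (g y - g' (y - x)) / norm (y - x)) + \<bar>f y - f x\<bar> * K) \<longlongrightarrow> 0) (at x)"
      using 2 by simp
    show "\<forall>\<^sub>F y in at x. norm (norm (f y *\<^sub>R g y - f x *\<^sub>R g' (y - x)) / norm (y - x)) \<le>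
       \<bar>f y\<bar> * (norm (g y - g' (y - x)) / norm (y - x)) + \<bar>f y - f x\<bar> * K"
      using eventually_neq_at_within[of x]
    proof eventually_elim
      case (elim y)
      have "f y *\<^sub>R g y - f x *\<^sub>R g' (y - x) = f y *\<^sub>R (g y - g' (y - x)) + (f y - f x) *\<^sub>R g' (y - x)"
        by (simp add: algebra_simps)
      then have "norm (f y *\<^sub>R g y - f x *\<^sub>R g' (y - x)) \<le> \<bar>f y\<bar> * norm (g y - g' (y - x)) + \<bar>f y - f x\<bar> * norm (g' (y - x))"
        by (metis norm_scaleR norm_triangle_ineq)
      also have "\<dots> \<le> \<bar>f y\<bar> * norm (g y - g' (y - x)) + \<bar>f y - f x\<bar> * (norm (y - x) * K)"
        by (intro add_left_mono mult_left_mono K) auto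
      finally show ?case using elim by (simp add: field_simps)
    qed
  qed
  then show ?thesis
    unfolding has_derivative_iff_norm
    using 0 by (simp add: g'.bounded_linear_axioms bounded_linear_const_scaleR)
qed

section \<open>Nondegenerate bilinear forms\<close>

definition nondeg :: "('e::euclidean_space \<Rightarrow> 'e \<Rightarrow> real) \<Rightarrow> bool" where
  "nondeg G \<longleftrightarrow> (\<forall>v. (\<forall>w. G v w = 0) \<longrightarrow> v = 0)"

lemma nondegD: "nondeg G \<Longrightarrow> (\<And>w. G v w = 0) \<Longrightarrow> v = 0"
  by (simp add: nondeg_def)

lemma linear_eq_on_Basis:
  fixes f h :: "'e::euclidean_space \<Rightarrow> 'b::real_vector"
  assumes "linear f" "linear h" "\<And>b. b \<in> Basis \<Longrightarrow> f b = h b"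
  shows "f x = h x"
  by (rule linear_eq_on[OF assms(1,2), of _ Basis]) (use assms(3) in \<open>auto simp: span_Basis\<close>)

text \<open>Lowering an index, with covectors identified with vectors through the Euclidean inner
  product.\<close>

definition lower :: "('e::euclidean_space \<Rightarrow> 'e \<Rightarrow> real) \<Rightarrow> 'e \<Rightarrow> 'e" where
  "lower G v = (\<Sum>b\<in>Basis. G v b *\<^sub>R b)"

lemma lower_inner: "b \<in> Basis \<Longrightarrow> inner (lower G v) b = G v b"
  by (simp add: lower_def inner_sum_left inner_Basis if_distrib[where f = "\<lambda>a. _ * a"] cong: if_cong)

lemma linear_lower:
  assumes "bilinear G"
  shows "linear (lower G)"
  using bilinear_ladd[OF assms] bilinear_lmul[OF assms]
  by (auto simp: lower_def linear_iff sum.distrib scaleR_left_distrib scaleR_sum_right)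

lemma lower_inj:
  assumes "bilinear G" "nondeg G"
  shows "inj (lower G)"
proof -
  have "v = 0" if "lower G v = 0" for v
  proof (rule nondegD[OF assms(2)])
    fix w
    have "G v b = 0" if "b \<in> Basis" for b using lower_inner[OF that, of G v] \<open>lower G v = 0\<close> by simp
    then show "G v w = 0"
      using linear_eq_on_Basis[OF bilinear_linear_right[OF assms(1)], of "\<lambda>_. 0" v w] by (simp add: linear_zero)
  qed
  then show ?thesis using linear_injective_0[OF linear_lower[OF assms(1)]] by blast
qed

lemma nondeg_represents:
  assumes G: "bilinear G" "nondeg G" and \<phi>: "linear \<phi>"
  shows "\<exists>!y. \<forall>z. G y z = \<phi> z"
proof -
  obtain y where y: "lower G y = (\<Sum>b\<in>Basis. \<phi> b *\<^sub>R b)"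
    using linear_injective_imp_surjective[OF linear_lower[OF G(1)] lower_inj[OF G]] by (metis surjD)
  have "G y z = \<phi> z" for z
  proof (rule linear_eq_on_Basis[OF bilinear_linear_right[OF G(1)] \<phi>])
    fix b :: 'a assume b: "b \<in> Basis"
    have "G y b = inner (lower G y) b" using b by (simp add: lower_inner)
    also have "\<dots> = \<phi> b" unfolding y
      using b by (simp add: inner_sum_left inner_Basis if_distrib[where f = "\<lambda>a. _ * a"] cong: if_cong)
    finally show "G y b = \<phi> b" .
  qed
  moreover have "x = y" if "\<forall>z. G x z = \<phi> z" "\<forall>z. G y z = \<phi> z" for x y
    using nondegD[OF G(2), of "x - y"] that bilinear_lsub[OF G(1)] by simp
  ultimately show ?thesis by blast
qed

text \<open>Expand \<open>D v w z + D w v z - D z v w\<close> by the metric condition; by the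
  symmetries of \<open>G\<close> and \<open>\<Gamma>\<close> everything cancels except twice the
  left-hand side.\<close>

lemma koszul:
  fixes G :: "'e::euclidean_space \<Rightarrow> 'e \<Rightarrow> real"
  assumes G: "bilinear G" "\<And>v w. G v w = G w v"
    and \<Gamma>: "\<And>v w. \<Gamma> v w = \<Gamma> w v" "\<And>z v w. D z v w = G (\<Gamma> z v) w + G v (\<Gamma> z w)"
  shows "G (\<Gamma> v w) z = (D v w z + D w v z - D z v w) / 2"
proof -
  have "G w (\<Gamma> v z) = G (\<Gamma> z v) w" using G(2)[of w "\<Gamma> v z"] \<Gamma>(1)[of v z] by simp
  moreover have "G v (\<Gamma> w z) = G v (\<Gamma> z w)" using \<Gamma>(1)[of w z] by simp
  moreover have "G (\<Gamma> w v) z = G (\<Gamma> v w) z" using \<Gamma>(1)[of w v] by simp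
  ultimately show ?thesis
    using \<Gamma>(2)[of v w z] \<Gamma>(2)[of w v z] \<Gamma>(2)[of z v w] by simp
qed

text \<open>The fundamental lemma of semi-Riemannian geometry at a single point, with
  \<open>D\<close> as the derivative of the metric. Nondegeneracy turns the Koszul expression
  \<open>K\<close> into a vector \<open>\<Gamma> v w\<close>, and the Koszul formula gives
  uniqueness.\<close>

lemma levi_civita_form:
  fixes G :: "'e::euclidean_space \<Rightarrow> 'e \<Rightarrow> real"
  assumes G: "bilinear G" "nondeg G" "\<And>v w. G v w = G w v"
    and D: "\<And>v w. linear (\<lambda>z. D z v w)" "\<And>z w. linear (\<lambda>v. D z v w)" "\<And>z v w. D z v w = D z w v"
  shows "\<exists>!\<Gamma>. bilinear \<Gamma> \<and> (\<forall>v w. \<Gamma> v w = \<Gamma> w v) \<and> (\<forall>z v w. D z v w = G (\<Gamma> z v) w + G v (\<Gamma> z w))"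
proof -
  have D3: "linear (\<lambda>w. D z v w)" for z v using D(2)[of z v] unfolding D(3)[of z _ v] .
  define K where "K v w z = (D v w z + D w v z - D z v w) / 2" for v w z
  have linK: "linear (K v w)" for v w
    unfolding K_def using linear_add[OF D3] linear_add[OF D(1)] linear_scale[OF D3] linear_scale[OF D(1)]
    by (intro linearI) (auto simp: field_simps)
  define \<Gamma> where "\<Gamma> v w = (THE y. \<forall>z. G y z = K v w z)" for v w
  have \<Gamma>: "G (\<Gamma> v w) z = K v w z" for v w z
    using theI'[OF nondeg_represents[OF G(1,2) linK[of v w]]] by (simp add: \<Gamma>_def)
  have \<Gamma>_eqI: "y = \<Gamma> v w" if "\<And>z. G y z = K v w z" for y v w
    using nondeg_represents[OF G(1,2) linK[of v w]] \<Gamma> that by blast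
  have sym: "\<Gamma> v w = \<Gamma> w v" for v w
    by (rule \<Gamma>_eqI) (simp add: \<Gamma> K_def D(3)[of _ v w])
  have linl: "linear (\<lambda>v. \<Gamma> v w)" for w
  proof (rule linearI)
    fix a b
    show "\<Gamma> (a + b) w = \<Gamma> a w + \<Gamma> b w"
      by (rule \<Gamma>_eqI[symmetric])
        (simp add: bilinear_ladd[OF G(1)] \<Gamma> K_def linear_add[OF D(1)] linear_add[OF D(2)] linear_add[OF D3] field_simps)
  next
    fix r a
    show "\<Gamma> (r *\<^sub>R a) w = r *\<^sub>R \<Gamma> a w"
      by (rule \<Gamma>_eqI[symmetric])
        (simp add: bilinear_lmul[OF G(1)] \<Gamma> K_def linear_scale[OF D(1)] linear_scale[OF D(2)] linear_scale[OF D3] field_simps)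
  qed
  have "linear (\<Gamma> v)" for v using linl[of v] unfolding sym[of _ v] .
  with linl have "bilinear \<Gamma>" by (simp add: bilinear_def)
  moreover have "D z v w = G (\<Gamma> z v) w + G v (\<Gamma> z w)" for z v w
    unfolding G(3)[of v] \<Gamma> K_def using D(3)[of v z w] D(3)[of w v z] D(3)[of z v w] by (simp add: field_simps)
  moreover have "\<Gamma>1 = \<Gamma>2"
    if "\<forall>v w. \<Gamma>1 v w = \<Gamma>1 w v" "\<forall>z v w. D z v w = G (\<Gamma>1 z v) w + G v (\<Gamma>1 z w)"
      "\<forall>v w. \<Gamma>2 v w = \<Gamma>2 w v" "\<forall>z v w. D z v w = G (\<Gamma>2 z v) w + G v (\<Gamma>2 z w)" for \<Gamma>1 \<Gamma>2
  proof (intro ext)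
    fix v w
    have "G (\<Gamma>1 v w) z = K v w z" "G (\<Gamma>2 v w) z = K v w z" for z
      unfolding K_def by (rule koszul[OF G(1,3)]; use that in blast)+
    then show "\<Gamma>1 v w = \<Gamma>2 v w" using nondeg_represents[OF G(1,2) linK[of v w]] by blast
  qed
  ultimately show ?thesis using sym by blast
qed

context
  fixes G :: "'x::real_normed_vector \<Rightarrow> 'e::euclidean_space \<Rightarrow> 'e \<Rightarrow> real" and S x0
    and y :: "'x \<Rightarrow> 'e" and k :: "'x \<Rightarrow> 'e \<Rightarrow> real"
  assumes S: "open S" "x0 \<in> S" and G: "\<And>x. x \<in> S \<Longrightarrow> bilinear (G x)" "nondeg (G x0)"
    and eq: "\<And>x z. x \<in> S \<Longrightarrow> G x (y x) z = k x z"
begin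

text \<open>Smooth dependence of the solution \<open>y x\<close> of a nondegenerate linear system without a formula for
  the inverse: it is a fixed point of an affine map that is nearly constant for \<open>x\<close> near \<open>x0\<close>.\<close>

lemma solution_representation:
  obtains M where "bounded_linear M"
    "\<And>x. x \<in> S \<Longrightarrow> y x = M (\<Sum>b\<in>Basis. k x b *\<^sub>R b - (inner (y x) b) *\<^sub>R (lower (G x) b - lower (G x0) b))"
proof -
  obtain M where M: "linear M" "M \<circ> lower (G x0) = id"
    using linear_injective_left_inverse[OF linear_lower[OF G(1)[OF S(2)]] lower_inj[OF G(1)[OF S(2)] G(2)]] by blast
  show ?thesis
  proof (rule that[of M])
    show "bounded_linear M" using M(1) by (simp add: linear_conv_bounded_linear)
    fix x assume x: "x \<in> S"
    have ex: "lower (G z) (y x) = (\<Sum>b\<in>Basis. (inner (y x) b) *\<^sub>R lower (G z) b)" if "z \<in> S" for z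
    proof -
      interpret linear "lower (G z)" by (rule linear_lower[OF G(1)[OF that]])
      have "lower (G z) (\<Sum>b\<in>Basis. (inner (y x) b) *\<^sub>R b) = (\<Sum>b\<in>Basis. (inner (y x) b) *\<^sub>R lower (G z) b)"
        by (simp only: sum scale)
      then show ?thesis by (simp only: euclidean_representation)
    qed
    have "lower (G x) (y x) = (\<Sum>b\<in>Basis. k x b *\<^sub>R b)" by (simp add: lower_def eq[OF x])
    then have "lower (G x0) (y x) = (\<Sum>b\<in>Basis. k x b *\<^sub>R b) - (lower (G x) (y x) - lower (G x0) (y x))" by simp
    also have "\<dots> = (\<Sum>b\<in>Basis. k x b *\<^sub>R b - (inner (y x) b) *\<^sub>R (lower (G x) b - lower (G x0) b))"
      unfolding ex[OF x] ex[OF S(2)] by (simp add: sum_subtractf scaleR_right_diff_distrib)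
    finally show "y x = M (\<Sum>b\<in>Basis. k x b *\<^sub>R b - (inner (y x) b) *\<^sub>R (lower (G x) b - lower (G x0) b))"
      using fun_cong[OF M(2), of "y x"] by simp
  qed
qed

text \<open>The correction in \<open>solution_representation\<close> is at most
  \<open>norm (y x) * \<epsilon> x\<close> before \<open>M\<close> is applied, with
  \<open>\<epsilon>\<close> tending to 0. It is absorbed once to bound \<open>y\<close> near
  \<open>x0\<close>; given that bound, it tends to 0.\<close>

lemma isCont_solution:
  assumes cG: "\<And>v w. isCont (\<lambda>x. G x v w) x0" and ck: "\<And>z. isCont (\<lambda>x. k x z) x0"
  shows "isCont y x0"
proof -
  obtain M where M: "bounded_linear M"
    "\<And>x. x \<in> S \<Longrightarrow> y x = M (\<Sum>b\<in>Basis. k x b *\<^sub>R b - (inner (y x) b) *\<^sub>R (lower (G x) b - lower (G x0) b))"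
    by (rule solution_representation) blast
  interpret M: bounded_linear M by (rule M(1))
  obtain N where N: "N > 0" "\<And>v. norm (M v) \<le> norm v * N" using M.pos_bounded by blast
  define \<epsilon> where "\<epsilon> x = (\<Sum>b\<in>Basis. norm (lower (G x) b - lower (G x0) b))" for x
  define q where "q x = (\<Sum>b\<in>Basis. k x b *\<^sub>R b)" for x
  have cl: "isCont (\<lambda>x. lower (G x) b) x0" for b
    unfolding lower_def by (intro continuous_intros cG)
  have "isCont \<epsilon> x0" unfolding \<epsilon>_def by (intro continuous_intros cl)
  then have \<epsilon>0: "(\<epsilon> \<longlongrightarrow> 0) (at x0)" by (simp add: isCont_def \<epsilon>_def)
  have "isCont q x0" unfolding q_def by (intro continuous_intros ck)
  then have q0: "(q \<longlongrightarrow> q x0) (at x0)" by (simp add: isCont_def)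
  have err: "norm (\<Sum>b\<in>Basis. (inner (y x) b) *\<^sub>R (lower (G x) b - lower (G x0) b)) \<le> norm (y x) * \<epsilon> x" for x
    unfolding \<epsilon>_def sum_distrib_left
    by (rule order_trans[OF norm_sum]) (auto intro!: sum_mono mult_right_mono simp: Basis_le_norm)
  have yeq: "y x = M (q x - (\<Sum>b\<in>Basis. (inner (y x) b) *\<^sub>R (lower (G x) b - lower (G x0) b)))" if "x \<in> S" for x
    using M(2)[OF that] by (simp only: q_def sum_subtractf)
  have y0: "y x0 = M (q x0)" using yeq[OF S(2)] by simp
  \<comment> \<open>This results from
    \<open>norm (y x) <= (norm (q x0) + 1) * N + norm (y x) / 2\<close>, which holds once
    \<open>\<epsilon> x < 1 / (2 * N)\<close>.\<close>
  define C where "C = 2 * N * (norm (q x0) + 1)"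
  have evS: "\<forall>\<^sub>F x in at x0. x \<in> S" using S by (auto simp: eventually_at_topological)
  have "\<forall>\<^sub>F x in at x0. \<epsilon> x < 1 / (2 * N)" using order_tendstoD(2)[OF \<epsilon>0, of "1 / (2 * N)"] N by simp
  moreover have "\<forall>\<^sub>F x in at x0. norm (q x) < norm (q x0) + 1"
    by (rule order_tendstoD(2)[OF tendsto_norm[OF q0]]) simp
  ultimately have "\<forall>\<^sub>F x in at x0. norm (y x - y x0) \<le> (norm (q x - q x0) + C * \<epsilon> x) * N"
    using evS
  proof eventually_elim
    case (elim x)
    define s where "s = (\<Sum>b\<in>Basis. (inner (y x) b) *\<^sub>R (lower (G x) b - lower (G x0) b))"
    note yx = yeq[OF elim(3), folded s_def] and err' = err[of x, folded s_def]
    have e0: "\<epsilon> x \<ge> 0" by (simp add: \<epsilon>_def sum_nonneg)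
    have "norm (y x) \<le> norm (q x - s) * N" using N(2)[of "q x - s"] yx by simp
    also have "\<dots> \<le> (norm (q x) + norm (y x) * \<epsilon> x) * N"
      using N(1) err' norm_triangle_ineq4[of "q x" s] by (intro mult_right_mono) linarith+
    also have "\<dots> = norm (q x) * N + norm (y x) * (\<epsilon> x * N)" by (simp add: algebra_simps)
    also have "\<dots> \<le> (norm (q x0) + 1) * N + norm (y x) * (1 / 2)"
      using elim N(1) by (intro add_mono mult_right_mono mult_left_mono) (auto simp: field_simps)
    finally have yC: "norm (y x) \<le> C" by (simp add: C_def algebra_simps)
    have "y x - y x0 = M ((q x - q x0) - s)"
      using yx y0 by (simp add: M.diff M.add algebra_simps)
    then have "norm (y x - y x0) \<le> norm ((q x - q x0) - s) * N" using N(2)[of "(q x - q x0) - s"] by simp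
    also have "\<dots> \<le> (norm (q x - q x0) + C * \<epsilon> x) * N"
    proof (rule mult_right_mono)
      have "norm (y x) * \<epsilon> x \<le> C * \<epsilon> x" using yC e0 by (rule mult_right_mono)
      then show "norm ((q x - q x0) - s) \<le> norm (q x - q x0) + C * \<epsilon> x"
        using err' norm_triangle_ineq4[of "q x - q x0" s] by linarith
    qed (use N in simp)
    finally show ?case .
  qed
  then have "((\<lambda>x. y x - y x0) \<longlongrightarrow> 0) (at x0)"
  proof (rule Lim_null_comparison)
    have "((\<lambda>x. (norm (q x - q x0) + C * \<epsilon> x) * N) \<longlongrightarrow> (norm (q x0 - q x0) + C * 0) * N) (at x0)"
      by (intro tendsto_intros q0 \<epsilon>0)
    then show "((\<lambda>x. (norm (q x - q x0) + C * \<epsilon> x) * N) \<longlongrightarrow> 0) (at x0)" by simp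
  qed
  then show ?thesis unfolding isCont_def by (rule LIM_zero_cancel)
qed

text \<open>In the representation the unknown multiplies
  \<open>lower (G x) b - lower (G x0) b\<close>, which vanishes at \<open>x0\<close>, so its
  continuity suffices by \<open>has_derivative_scaleR_vanishing\<close>.\<close>

lemma differentiable_solution:
  assumes dG: "\<And>v w. (\<lambda>x. G x v w) differentiable at x0" and dk: "\<And>z. (\<lambda>x. k x z) differentiable at x0"
  shows "y differentiable at x0"
proof -
  obtain M where M: "bounded_linear M"
    "\<And>x. x \<in> S \<Longrightarrow> y x = M (\<Sum>b\<in>Basis. k x b *\<^sub>R b - (inner (y x) b) *\<^sub>R (lower (G x) b - lower (G x0) b))"
    by (rule solution_representation) blast
  have cy: "isCont y x0"
    by (rule isCont_solution) (use dG dk differentiable_imp_continuous_within in blast)+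
  have dl: "(\<lambda>x. lower (G x) b) differentiable at x0" for b
    unfolding lower_def by (rule differentiable_sum) (auto intro!: differentiable_scaleR dG)
  then have "((\<lambda>x. M (\<Sum>b\<in>Basis. k x b *\<^sub>R b - (inner (y x) b) *\<^sub>R (lower (G x) b - lower (G x0) b))) has_derivative
     (\<lambda>h. M (\<Sum>b\<in>Basis. dd (\<lambda>x. k x b) x0 h *\<^sub>R b - (inner (y x0) b) *\<^sub>R (dd (\<lambda>x. lower (G x) b) x0 h - 0)))) (at x0)"
    by (intro bounded_linear.has_derivative[OF M(1)] has_derivative_sum has_derivative_diff
        has_derivative_scaleR_left dd_works dk has_derivative_scaleR_vanishing has_derivative_const
        continuous_intros cy) auto
  then have "(y has_derivative (\<lambda>h. M (\<Sum>b\<in>Basis. dd (\<lambda>x. k x b) x0 h *\<^sub>R b -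
      (inner (y x0) b) *\<^sub>R (dd (\<lambda>x. lower (G x) b) x0 h - 0)))) (at x0)"
    by (rule has_derivative_transform_within_open[OF _ S]) (rule M(2)[symmetric])
  then show ?thesis by (auto simp: differentiable_def)
qed

text \<open>Differentiating \<open>G x (y x) z = k x z\<close> shows that the derivative of
  \<open>y\<close> solves a system with the same form \<open>G\<close>. So
  \<open>isCont_solution\<close> can be applied again, now to the derivative.\<close>

lemma dd_solution:
  assumes dG: "\<And>v w. (\<lambda>x. G x v w) differentiable at x0" and dk: "\<And>z. (\<lambda>x. k x z) differentiable at x0"
  shows "G x0 (dd y x0 v) z = dd (\<lambda>x. k x z) x0 v - dd (\<lambda>x. G x (y x0) z) x0 v"
proof -
  have "((\<lambda>x. G x (y x) z) has_derivative (\<lambda>h. dd (\<lambda>x. G x (y x0) z) x0 h + G x0 (dd y x0 h) z)) (at x0)"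
    by (rule has_derivative_linear_param[where L = "\<lambda>x p. G x p z" and y = "\<lambda>x. x" and t = x0 and y' = "\<lambda>h. h",
          OF S bilinear_linear_left[OF G(1)] dG has_derivative_ident dd_works[OF differentiable_solution[OF dG dk]] UNIV_I])
  from dd_eqI[OF this] have "dd (\<lambda>x. G x (y x) z) x0 v = dd (\<lambda>x. G x (y x0) z) x0 v + G x0 (dd y x0 v) z"
    by simp
  moreover have "dd (\<lambda>x. G x (y x) z) x0 = dd (\<lambda>x. k x z) x0" by (rule dd_cong[OF S eq])
  ultimately show ?thesis by simp
qed

end

section \<open>Curvature\<close>

locale semi_riemannian =
  fixes \<A> :: "('a::{t2_space,second_countable_topology}, 'e::euclidean_space) chart set"
    and g :: "'a \<Rightarrow> 'e \<Rightarrow> 'e \<Rightarrow> real" and \<nu> :: nat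
  assumes srm: "semi_riemannian_manifold \<A> g \<nu>"
begin

abbreviation "ch \<equiv> chart_at \<A>"
abbreviation "td \<equiv> transition_deriv"
abbreviation "met \<equiv> metric_in \<A> g"
abbreviation "chr \<equiv> christoffel \<A> g"

definition dom :: "('a, 'e) chart \<Rightarrow> 'e set" where "dom c = snd c ` fst c"
definition chart_overlap :: "('a, 'e) chart \<Rightarrow> ('a, 'e) chart \<Rightarrow> 'e set" where "chart_overlap c d = snd c ` (fst c \<inter> fst d)"
definition phi :: "('a, 'e) chart \<Rightarrow> ('a, 'e) chart \<Rightarrow> 'e \<Rightarrow> 'e" where "phi c d = snd d \<circ> chart_inv c"

lemma atlas: "smooth_atlas \<A>" using srm by (simp add: semi_riemannian_manifold_def)

lemma g_props: "bilinear (g p)" "g p v w = g p w v" "nondeg (g p)"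
  using srm by (auto simp: semi_riemannian_manifold_def nondeg_def)

lemma chart:
  assumes "c \<in> \<A>"
  shows "open (fst c)" "open (dom c)" "continuous_on (fst c) (snd c)" "continuous_on (dom c) (chart_inv c)"
    "p \<in> fst c \<Longrightarrow> chart_inv c (snd c p) = p" "x \<in> dom c \<Longrightarrow> snd c (chart_inv c x) = x"
    "x \<in> dom c \<Longrightarrow> chart_inv c x \<in> fst c" "p \<in> fst c \<Longrightarrow> snd c p \<in> dom c"
proof -
  have h: "open (fst c)" "open (snd c ` fst c)" "homeomorphism (fst c) (snd c ` fst c) (snd c) (chart_inv c)"
    using atlas assms by (auto simp: smooth_atlas_def)
  from h show "open (fst c)" "open (dom c)" "continuous_on (fst c) (snd c)" "continuous_on (dom c) (chart_inv c)"
    "p \<in> fst c \<Longrightarrow> chart_inv c (snd c p) = p" "x \<in> dom c \<Longrightarrow> snd c (chart_inv c x) = x"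
    "x \<in> dom c \<Longrightarrow> chart_inv c x \<in> fst c" "p \<in> fst c \<Longrightarrow> snd c p \<in> dom c"
    unfolding homeomorphism_def dom_def by auto
qed

lemma ch: "ch p \<in> \<A>" "p \<in> fst (ch p)"
proof -
  have "p \<in> (\<Union>c\<in>\<A>. fst c)" using atlas unfolding smooth_atlas_def by blast
  then have "\<exists>c. c \<in> \<A> \<and> p \<in> fst c" by blast
  from someI_ex[OF this] show "ch p \<in> \<A>" "p \<in> fst (ch p)" by (auto simp: chart_at_def)
qed

lemma dom_preimage_open: "c \<in> \<A> \<Longrightarrow> open U \<Longrightarrow> open (snd c ` (fst c \<inter> U))"
proof -
  assume c: "c \<in> \<A>" and U: "open U"
  have "snd c ` (fst c \<inter> U) = dom c \<inter> chart_inv c -` U"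
    using chart(5,6,7)[OF c] by (force simp: dom_def)
  then show ?thesis using continuous_open_preimage[OF chart(4)[OF c] chart(2)[OF c] U] by simp
qed

lemma chart_overlap: "c \<in> \<A> \<Longrightarrow> d \<in> \<A> \<Longrightarrow> open (chart_overlap c d)" "c \<in> \<A> \<Longrightarrow> chart_overlap c d \<subseteq> dom c"
  "p \<in> fst c \<Longrightarrow> p \<in> fst d \<Longrightarrow> snd c p \<in> chart_overlap c d"
  by (auto simp: chart_overlap_def dom_def intro: dom_preimage_open chart(1))

lemma chart_overlapE:
  assumes "x \<in> chart_overlap c d"
  obtains p where "x = snd c p" "p \<in> fst c" "p \<in> fst d"
  using assms by (auto simp: chart_overlap_def)

lemma phi_smooth: "c \<in> \<A> \<Longrightarrow> d \<in> \<A> \<Longrightarrow> smooth_on (chart_overlap c d) (phi c d)"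
  using atlas unfolding smooth_atlas_def chart_overlap_def phi_def by blast

lemma phi_differentiable: "c \<in> \<A> \<Longrightarrow> d \<in> \<A> \<Longrightarrow> x \<in> chart_overlap c d \<Longrightarrow> phi c d differentiable at x"
  by (rule smooth_on_differentiable[OF phi_smooth chart_overlap(1)])

lemma phi_at: "c \<in> \<A> \<Longrightarrow> p \<in> fst c \<Longrightarrow> phi c d (snd c p) = snd d p"
  by (simp add: phi_def chart(5))

lemma td_def: "td c d p = dd (phi c d) (snd c p)"
  by (simp add: transition_deriv_def phi_def)

lemma td_linear: "c \<in> \<A> \<Longrightarrow> d \<in> \<A> \<Longrightarrow> p \<in> fst c \<Longrightarrow> p \<in> fst d \<Longrightarrow> linear (td c d p)"
  unfolding td_def by (intro dd_linear phi_differentiable chart_overlap(3))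

lemma td_compose:
  assumes "c \<in> \<A>" "d \<in> \<A>" "f \<in> \<A>" "p \<in> fst c" "p \<in> fst d" "p \<in> fst f"
  shows "td d f p (td c d p v) = td c f p v"
proof -
  have d1: "(phi c d has_derivative td c d p) (at (snd c p))"
    unfolding td_def by (intro dd_works phi_differentiable chart_overlap(3) assms)
  have "(phi d f has_derivative td d f p) (at (phi c d (snd c p)))"
    unfolding td_def phi_at[OF assms(1,4)] by (intro dd_works phi_differentiable chart_overlap(3) assms)
  from diff_chain_at[OF d1 this]
  have "(phi d f \<circ> phi c d has_derivative td d f p \<circ> td c d p) (at (snd c p))" .
  from dd_eqI[OF this] have "dd (phi d f \<circ> phi c d) (snd c p) = td d f p \<circ> td c d p" .
  moreover have "dd (phi d f \<circ> phi c d) (snd c p) = dd (phi c f) (snd c p)"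
  proof (rule dd_cong)
    show "open (snd c ` (fst c \<inter> (fst d \<inter> fst f)))"
      using assms by (intro dom_preimage_open open_Int chart(1))
    show "snd c p \<in> snd c ` (fst c \<inter> (fst d \<inter> fst f))" using assms by auto
    show "(phi d f \<circ> phi c d) x = phi c f x" if "x \<in> snd c ` (fst c \<inter> (fst d \<inter> fst f))" for x
      using that assms by (auto simp: phi_at)
  qed
  ultimately show ?thesis unfolding td_def[of c f] by (metis comp_apply)
qed

lemma td_id: "c \<in> \<A> \<Longrightarrow> p \<in> fst c \<Longrightarrow> td c c p v = v"
proof -
  assume c: "c \<in> \<A>" "p \<in> fst c"
  have "dd (phi c c) (snd c p) = dd (\<lambda>x. x) (snd c p)"
    by (rule dd_cong[OF chart(2)[OF c(1)]]) (use c chart in \<open>auto simp: phi_def\<close>)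
  also have "\<dots> = (\<lambda>v. v)" by (rule dd_eqI) (rule has_derivative_ident)
  finally show ?thesis by (simp add: td_def)
qed

lemma td_inverse: "c \<in> \<A> \<Longrightarrow> d \<in> \<A> \<Longrightarrow> p \<in> fst c \<Longrightarrow> p \<in> fst d \<Longrightarrow> td d c p (td c d p v) = v"
  by (simp add: td_compose td_id)

lemma met_at: "c \<in> \<A> \<Longrightarrow> p \<in> fst c \<Longrightarrow> met c (snd c p) v w = g p (td c (ch p) p v) (td c (ch p) p w)"
  by (simp add: metric_in_def Let_def chart(5))

lemma met_transition:
  assumes "c \<in> \<A>" "d \<in> \<A>" "p \<in> fst c" "p \<in> fst d"
  shows "met c (snd c p) v w = met d (snd d p) (td c d p v) (td c d p w)"
  using assms ch[of p] by (simp add: met_at td_compose)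

lemma components_td: "components \<A> c p v = td (ch p) c p v"
  by (simp add: components_def)

lemma components_linear: "c \<in> \<A> \<Longrightarrow> p \<in> fst c \<Longrightarrow> linear (components \<A> c p)"
  unfolding components_def using ch by (intro td_linear)

lemma components_self: "components \<A> (ch p) p v = v"
  by (simp add: components_td td_id ch)

lemma met_components:
  "c \<in> \<A> \<Longrightarrow> p \<in> fst c \<Longrightarrow> met c (snd c p) (components \<A> c p v) (components \<A> c p w) = g p v w"
  by (simp add: met_at components_td td_compose td_id ch)

lemma met_props:
  assumes c: "c \<in> \<A>" and x: "x \<in> dom c"
  shows "bilinear (met c x)" "met c x v w = met c x w v" "nondeg (met c x)"
proof -
  obtain p where p: "x = snd c p" "p \<in> fst c" using x by (auto simp: dom_def)
  have lin: "linear (td c (ch p) p)" by (rule td_linear[OF c ch(1) p(2) ch(2)])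
  show "met c x v w = met c x w v" unfolding p(1) met_at[OF c p(2)] by (rule g_props)
  show "bilinear (met c x)"
    unfolding p(1) bilinear_def met_at[OF c p(2)]
    using bilinear_ladd[OF g_props(1)] bilinear_radd[OF g_props(1)] bilinear_lmul[OF g_props(1)]
      bilinear_rmul[OF g_props(1)] linear_add[OF lin] linear_scale[OF lin]
    by (auto intro!: linearI)
  show "nondeg (met c x)"
    unfolding nondeg_def
  proof (intro allI impI)
    fix v assume v: "\<forall>w. met c x v w = 0"
    have "g p (td c (ch p) p v) w = 0" for w
    proof -
      have "met c x v (components \<A> c p w) = 0" using v by blast
      then show ?thesis
        unfolding p(1) met_at[OF c p(2)] components_td using td_inverse[OF ch(1) c ch(2) p(2)] by simp
    qed
    then have "td c (ch p) p v = 0" by (rule nondegD[OF g_props(3)])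
    then have "td (ch p) c p (td c (ch p) p v) = 0"
      using linear_0[OF td_linear[OF ch(1) c ch(2) p(2)]] by simp
    then show "v = 0" using td_inverse[OF c ch(1) p(2) ch(2)] by simp
  qed
qed

lemma met_smooth: "c \<in> \<A> \<Longrightarrow> smooth_on (dom c) (\<lambda>x. met c x v w)"
  using srm unfolding semi_riemannian_manifold_def dom_def by blast

lemma met_differentiable: "c \<in> \<A> \<Longrightarrow> x \<in> dom c \<Longrightarrow> (\<lambda>x. met c x v w) differentiable at x"
  by (rule smooth_on_differentiable[OF met_smooth chart(2)])

section \<open>Christoffel symbols in a chart\<close>

definition dmet where "dmet c x z v w = dd (\<lambda>x. met c x v w) x z"

lemma dmet_props:
  assumes c: "c \<in> \<A>" and x: "x \<in> dom c"
  shows "linear (\<lambda>z. dmet c x z v w)" "linear (\<lambda>v. dmet c x z v w)" "dmet c x z v w = dmet c x z w v"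
proof -
  note dm = met_differentiable[OF c x]
  show "linear (\<lambda>z. dmet c x z v w)" unfolding dmet_def by (rule dd_linear[OF dm])
  show "linear (\<lambda>v. dmet c x z v w)"
  proof (rule linearI)
    fix a b
    have "dmet c x z (a + b) w = dd (\<lambda>x. met c x a w + met c x b w) x z"
      unfolding dmet_def
      by (rule fun_cong[OF dd_cong[OF chart(2)[OF c] x]]) (rule bilinear_ladd[OF met_props(1)[OF c]])
    then show "dmet c x z (a + b) w = dmet c x z a w + dmet c x z b w"
      by (simp add: dmet_def dd_add dm)
  next
    fix r a
    have "dmet c x z (r *\<^sub>R a) w = dd (\<lambda>x. r *\<^sub>R met c x a w) x z"
      unfolding dmet_def
      by (rule fun_cong[OF dd_cong[OF chart(2)[OF c] x]]) (simp add: bilinear_lmul[OF met_props(1)[OF c]])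
    then show "dmet c x z (r *\<^sub>R a) w = r *\<^sub>R dmet c x z a w"
      by (simp only: dmet_def dd_scaleR dm)
  qed
  show "dmet c x z v w = dmet c x z w v"
    unfolding dmet_def by (rule fun_cong[OF dd_cong[OF chart(2)[OF c] x]]) (rule met_props(2)[OF c])
qed

lemma chr_ex1:
  assumes c: "c \<in> \<A>" and x: "x \<in> dom c"
  shows "\<exists>!\<Gamma>. bilinear \<Gamma> \<and> (\<forall>v w. \<Gamma> v w = \<Gamma> w v) \<and>
    (\<forall>z v w. dmet c x z v w = met c x (\<Gamma> z v) w + met c x v (\<Gamma> z w))"
  by (rule levi_civita_form) (use met_props[OF c x] dmet_props[OF c x] in auto)

lemma chr_THE: "chr c x = (THE \<Gamma>. bilinear \<Gamma> \<and> (\<forall>v w. \<Gamma> v w = \<Gamma> w v) \<and>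
    (\<forall>z v w. dmet c x z v w = met c x (\<Gamma> z v) w + met c x v (\<Gamma> z w)))"
  by (simp add: christoffel_def dmet_def)

lemma chr:
  assumes c: "c \<in> \<A>" and x: "x \<in> dom c"
  shows "bilinear (chr c x)" "chr c x v w = chr c x w v"
    "dmet c x z v w = met c x (chr c x z v) w + met c x v (chr c x z w)"
  using theI'[OF chr_ex1[OF assms]] unfolding chr_THE by blast+

lemma chr_unique:
  assumes "c \<in> \<A>" "x \<in> dom c" "bilinear \<Gamma>" "\<And>v w. \<Gamma> v w = \<Gamma> w v"
    "\<And>z v w. dmet c x z v w = met c x (\<Gamma> z v) w + met c x v (\<Gamma> z w)"
  shows "chr c x = \<Gamma>"
  unfolding chr_THE by (rule the1_equality[OF chr_ex1[OF assms(1,2)]]) (use assms in blast)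

definition koszul_term where "koszul_term c x v w z = (dmet c x v w z + dmet c x w v z - dmet c x z v w) / 2"

lemma chr_koszul: "c \<in> \<A> \<Longrightarrow> x \<in> dom c \<Longrightarrow> met c x (chr c x v w) z = koszul_term c x v w z"
proof -
  assume c: "c \<in> \<A>" and x: "x \<in> dom c"
  show ?thesis
    unfolding koszul_term_def
    by (rule koszul[where G = "met c x" and \<Gamma> = "chr c x" and D = "dmet c x",
          OF met_props(1)[OF c x] met_props(2)[OF c x] chr(2)[OF c x] chr(3)[OF c x]])
qed

lemma dmet_smooth: "c \<in> \<A> \<Longrightarrow> smooth_on (dom c) (\<lambda>x. dmet c x z v w)"
  unfolding dmet_def by (rule smooth_on_dd[OF chart(2) met_smooth])

lemma koszul_term_smooth: "c \<in> \<A> \<Longrightarrow> smooth_on (dom c) (\<lambda>x. koszul_term c x v w z)"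
proof -
  assume c: "c \<in> \<A>"
  have "smooth_on (dom c) (\<lambda>x. (1 / 2) *\<^sub>R (dmet c x v w z + dmet c x w v z + (- 1) *\<^sub>R dmet c x z v w))"
    by (intro smooth_on_scaleR smooth_on_add dmet_smooth chart(2) c)
  then show ?thesis by (simp add: koszul_term_def)
qed

lemma chr_differentiable: "c \<in> \<A> \<Longrightarrow> x \<in> dom c \<Longrightarrow> (\<lambda>x. chr c x v w) differentiable at x"
  by (rule differentiable_solution[where G = "met c" and S = "dom c" and k = "\<lambda>x. koszul_term c x v w"])
    (auto simp: chart met_props(1,3) chr_koszul met_differentiable intro: smooth_on_differentiable[OF koszul_term_smooth chart(2)])

text \<open>By \<open>dd_solution\<close> the derivative of the Christoffel symbols solves a
  nondegenerate system with continuous data. Continuity of the curvature, and thereby of the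
  curvature matrix, rests on this.\<close>

lemma isCont_dd_chr:
  assumes c: "c \<in> \<A>" and x: "x \<in> dom c"
  shows "isCont (\<lambda>x. dd (\<lambda>x. chr c x v w) x u) x"
proof (rule isCont_solution[where G = "met c" and S = "dom c"
      and k = "\<lambda>x z. dd (\<lambda>x. koszul_term c x v w z) x u - dmet c x u (chr c x v w) z"])
  have isC: "isCont f x" if "smooth_on (dom c) f" for f :: "'e \<Rightarrow> real"
    using smooth_on_continuous[OF that] chart(2)[OF c] x by (simp add: continuous_on_eq_continuous_at)
  show "open (dom c)" "x \<in> dom c" by (rule chart(2)[OF c], rule x)
  show "bilinear (met c y)" if "y \<in> dom c" for y using met_props(1)[OF c that] .
  show "nondeg (met c x)" using met_props(3)[OF c x] .
  show "met c y (dd (\<lambda>x. chr c x v w) y u) z = dd (\<lambda>x. koszul_term c x v w z) y u - dmet c y u (chr c y v w) z"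
    if "y \<in> dom c" for y z
    unfolding dmet_def
    by (rule dd_solution[where S = "dom c"])
      (auto simp: chart that c met_props(1,3) chr_koszul met_differentiable intro: smooth_on_differentiable[OF koszul_term_smooth chart(2)])
  show "isCont (\<lambda>x. met c x v w) x" for v w by (rule isC[OF met_smooth[OF c]])
  have cdm: "isCont (\<lambda>x. dmet c x u (chr c x v w) z) x" for z
    unfolding isCont_def
  proof (rule tendsto_linear_param[where L = "\<lambda>x p. dmet c x u p z", OF chart(2)[OF c] x])
    show "linear (\<lambda>p. dmet c y u p z)" if "y \<in> dom c" for y by (rule dmet_props(2)[OF c that])
    show "isCont (\<lambda>y. dmet c y u p z) x" for p by (rule isC[OF dmet_smooth[OF c]])
    show "((\<lambda>x. chr c x v w) \<longlongrightarrow> chr c x v w) (at x)"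
      using differentiable_imp_continuous_within[OF chr_differentiable[OF c x]] by (simp add: isCont_def)
  qed (rule tendsto_ident_at)
  show "isCont (\<lambda>x. dd (\<lambda>x. koszul_term c x v w z) x u - dmet c x u (chr c x v w) z) x" for z
    by (rule continuous_diff[OF isC[OF smooth_on_dd[OF chart(2)[OF c] koszul_term_smooth[OF c]]] cdm])
qed

section \<open>Curvature in a chart: transformation law and symmetries\<close>

definition curv :: "('a, 'e) chart \<Rightarrow> 'e \<Rightarrow> 'e \<Rightarrow> 'e \<Rightarrow> 'e \<Rightarrow> 'e" where
  "curv c x v w z = dd (\<lambda>y. chr c y w z) x v - dd (\<lambda>y. chr c y v z) x w
     + chr c x v (chr c x w z) - chr c x w (chr c x v z)"

lemma curvature_curv: "curvature \<A> g p v w z = curv (ch p) (snd (ch p) p) v w z"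
  by (simp add: curvature_def curv_def Let_def)

text \<open>Pull the connection of \<open>d\<close> back to \<open>c\<close>. The result is metric,
  and symmetric because second derivatives of the transition map are, so uniqueness identifies it
  with \<open>chr c\<close>.\<close>

lemma chr_transform:
  assumes c: "c \<in> \<A>" and d: "d \<in> \<A>" and x: "x \<in> chart_overlap c d"
  shows "dd (phi c d) x (chr c x v w) =
    dd (\<lambda>y. dd (phi c d) y w) x v + chr d (phi c d x) (dd (phi c d) x v) (dd (phi c d) x w)"
proof -
  obtain p where p: "x = snd c p" "p \<in> fst c" "p \<in> fst d" using x by (rule chart_overlapE)
  have xc: "x \<in> dom c" using chart_overlap(2)[OF c] x by blast
  have px: "phi c d x = snd d p" using p phi_at[OF c] by simp
  have xd: "phi c d x \<in> dom d" unfolding px using chart(8)[OF d p(3)] .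
  define f where "f = dd (phi c d) x"
  define h where "h = td d c p"
  have f_td: "f = td c d p" by (simp add: f_def td_def p)
  have fh: "f (h v) = v" "h (f v) = v" for v
    unfolding f_td h_def using td_inverse[OF c d p(2,3)] td_inverse[OF d c p(3,2)] by auto
  have lf: "linear f" and lh: "linear h"
    unfolding f_td h_def by (rule td_linear[OF c d p(2,3)], rule td_linear[OF d c p(3,2)])
  define D2 where "D2 v w = dd (\<lambda>y. dd (phi c d) y w) x v" for v w
  have smd: "smooth_on (chart_overlap c d) (\<lambda>y. dd (phi c d) y w)" for w
    by (rule smooth_on_dd[OF chart_overlap(1)[OF c d] phi_smooth[OF c d]])
  have dphi: "(\<lambda>y. dd (phi c d) y w) differentiable at x" for w
    by (rule smooth_on_differentiable[OF smd chart_overlap(1)[OF c d] x])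
  have D2_sym: "D2 v w = D2 w v" for v w
    unfolding D2_def by (rule dd_commute[OF chart_overlap(1)[OF c d] x phi_smooth[OF c d]])
  have D2_lin: "linear (\<lambda>v. D2 v w)" for w unfolding D2_def by (rule dd_linear[OF dphi])
  have "D2 v = (\<lambda>w. D2 w v)" for v by (rule ext) (rule D2_sym)
  then have D2_bil: "bilinear D2"
    unfolding bilinear_def using D2_lin by metis
  \<comment> \<open>The claimed law solved for the symbol in \<open>c\<close>, with \<open>h\<close>
    the inverse of \<open>f\<close>.\<close>
  define \<Gamma> where "\<Gamma> v w = h (D2 v w + chr d (phi c d x) (f v) (f w))" for v w
  note cd = chr[OF d xd]
  have "chr c x = \<Gamma>"
  proof (rule chr_unique[OF c xc])
    show "bilinear \<Gamma>"
      unfolding bilinear_def \<Gamma>_def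
      using linear_add[OF lh] linear_scale[OF lh] linear_add[OF lf] linear_scale[OF lf]
        bilinear_ladd[OF D2_bil] bilinear_radd[OF D2_bil] bilinear_lmul[OF D2_bil] bilinear_rmul[OF D2_bil]
        bilinear_ladd[OF cd(1)] bilinear_radd[OF cd(1)] bilinear_lmul[OF cd(1)] bilinear_rmul[OF cd(1)]
      by (auto intro!: linearI simp: scaleR_right_distrib algebra_simps)
    show "\<Gamma> v w = \<Gamma> w v" for v w by (simp add: \<Gamma>_def D2_sym[of v] cd(2)[of "f v"])
    fix z v w
    have "dmet c x z v w = dd (\<lambda>y. met d (phi c d y) (dd (phi c d) y v) (dd (phi c d) y w)) x z"
      unfolding dmet_def
    proof (rule fun_cong[OF dd_cong[OF chart_overlap(1)[OF c d] x]])
      fix y assume "y \<in> chart_overlap c d"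
      then obtain q where q: "y = snd c q" "q \<in> fst c" "q \<in> fst d" by (rule chart_overlapE)
      show "met c y v w = met d (phi c d y) (dd (phi c d) y v) (dd (phi c d) y w)"
        using met_transition[OF c d q(2,3), of v w] by (simp add: q(1) phi_at[OF c q(2)] td_def)
    qed
    also have "\<dots> = dmet d (phi c d x) (f z) (f v) (f w) + met d (phi c d x) (D2 z v) (f w) + met d (phi c d x) (f v) (D2 z w)"
    proof -
      have "((\<lambda>y. met d (phi c d y) (dd (phi c d) y v) (dd (phi c d) y w)) has_derivative
        (\<lambda>z. dd (\<lambda>y. met d y (dd (phi c d) x v) (dd (phi c d) x w)) (phi c d x) (dd (phi c d) x z)
           + met d (phi c d x) (dd (\<lambda>y. dd (phi c d) y v) x z) (dd (phi c d) x w)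
           + met d (phi c d x) (dd (phi c d) x v) (dd (\<lambda>y. dd (phi c d) y w) x z))) (at x)"
        by (rule has_derivative_bilinear_param[where S = "dom d" and y = "phi c d" and t = x and B = "met d"])
          (auto simp: chart d xd met_props(1) met_differentiable intro!: dd_works dphi phi_differentiable c x)
      from dd_eqI[OF this] show ?thesis by (simp add: D2_def f_def dmet_def)
    qed
    also have "\<dots> = met d (phi c d x) (f (\<Gamma> z v)) (f w) + met d (phi c d x) (f v) (f (\<Gamma> z w))"
      unfolding \<Gamma>_def fh cd(3) using bilinear_ladd[OF met_props(1)[OF d xd]] bilinear_radd[OF met_props(1)[OF d xd]] by simp
    also have "\<dots> = met c x (\<Gamma> z v) w + met c x v (\<Gamma> z w)"
      using met_transition[OF c d p(2,3)] by (simp add: p(1) px f_td phi_at[OF c p(2)])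
    finally show "dmet c x z v w = met c x (\<Gamma> z v) w + met c x v (\<Gamma> z w)" .
  qed
  then have "f (chr c x v w) = D2 v w + chr d (phi c d x) (f v) (f w)" by (simp add: \<Gamma>_def fh)
  then show ?thesis by (simp add: f_def D2_def)
qed

text \<open>Differentiating the transformation law of the Christoffel symbols once more, all terms that are
  not tensorial are symmetric in the two directions in which the curvature is skew.\<close>

lemma curv_transform:
  assumes c: "c \<in> \<A>" and d: "d \<in> \<A>" and x: "x \<in> chart_overlap c d"
  shows "dd (phi c d) x (curv c x u v w) =
    curv d (phi c d x) (dd (phi c d) x u) (dd (phi c d) x v) (dd (phi c d) x w)"
proof -
  obtain p where p: "x = snd c p" "p \<in> fst c" "p \<in> fst d" using x by (rule chart_overlapE)
  have xc: "x \<in> dom c" using chart_overlap(2)[OF c] x by blast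
  have px: "phi c d x = snd d p" using p phi_at[OF c] by simp
  have xd: "phi c d x \<in> dom d" unfolding px using chart(8)[OF d p(3)] .
  note oo = chart_overlap(1)[OF c d]
  define F where "F y v = dd (phi c d) y v" for y v
  define F2 where "F2 y u v = dd (\<lambda>y. F y v) y u" for y u v
  define X where "X = phi c d x"
  have smF: "smooth_on (chart_overlap c d) (\<lambda>y. F y w)" for w
    unfolding F_def by (rule smooth_on_dd[OF oo phi_smooth[OF c d]])
  have smF2: "smooth_on (chart_overlap c d) (\<lambda>y. F2 y u w)" for u w
    unfolding F2_def by (rule smooth_on_dd[OF oo smF])
  have dF: "(\<lambda>y. F y w) differentiable at x" for w by (rule smooth_on_differentiable[OF smF oo x])
  have dF2: "(\<lambda>y. F2 y u w) differentiable at x" for u w by (rule smooth_on_differentiable[OF smF2 oo x])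
  have linF: "linear (F y)" if "y \<in> chart_overlap c d" for y
    unfolding F_def by (rule dd_linear[OF phi_differentiable[OF c d that]])
  have tr: "F y (chr c y v w) = F2 y v w + chr d (phi c d y) (F y v) (F y w)" if "y \<in> chart_overlap c d" for y v w
    using chr_transform[OF c d that] by (simp add: F_def F2_def)
  have F2_sym: "F2 y u v = F2 y v u" if "y \<in> chart_overlap c d" for y u v
    unfolding F2_def F_def by (rule dd_commute[OF oo that phi_smooth[OF c d]])
  define C where "C = chr d X"
  define dC where "dC a b e = dd (\<lambda>y. chr d y b e) X a" for a b e
  note bC = chr(1)[OF d xd, folded X_def C_def]
  define P where "P u v w = dd (\<lambda>y. F2 y v w) x u" for u v w
  have key: "F x (dd (\<lambda>y. chr c y v w) x u) = P u v w + dC (F x u) (F x v) (F x w)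
     + C (F2 x u v) (F x w) + C (F x v) (F2 x u w) - F2 x u (chr c x v w)" for u v w
  proof -
    have "((\<lambda>y. F y (chr c y v w)) has_derivative
        (\<lambda>u. dd (\<lambda>y. F y (chr c x v w)) x u + F x (dd (\<lambda>y. chr c y v w) x u))) (at x)"
      by (rule has_derivative_linear_param[where S = "chart_overlap c d" and y = "\<lambda>y. y" and t = x and y' = "\<lambda>u. u"])
        (auto simp: oo x linF dF intro!: dd_works chr_differentiable c xc)
    from dd_eqI[OF this]
    have 1: "dd (\<lambda>y. F y (chr c y v w)) x u = F2 x u (chr c x v w) + F x (dd (\<lambda>y. chr c y v w) x u)"
      by (simp add: F2_def)
    have 2: "((\<lambda>y. F2 y v w + chr d (phi c d y) (F y v) (F y w)) has_derivative
        (\<lambda>u. dd (\<lambda>y. F2 y v w) x u + (dd (\<lambda>y. chr d y (F x v) (F x w)) (phi c d x) (dd (phi c d) x u)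
          + chr d (phi c d x) (dd (\<lambda>y. F y v) x u) (F x w) + chr d (phi c d x) (F x v) (dd (\<lambda>y. F y w) x u)))) (at x)"
      by (intro has_derivative_add dd_works dF2
          has_derivative_bilinear_param[where S = "dom d" and y = "phi c d" and t = x and B = "chr d"])
        (auto simp: chart d xd chr(1) chr_differentiable intro!: dd_works dF phi_differentiable c x)
    have "dd (\<lambda>y. F y (chr c y v w)) x = dd (\<lambda>y. F2 y v w + chr d (phi c d y) (F y v) (F y w)) x"
      by (rule dd_cong[OF oo x tr])
    then have "dd (\<lambda>y. F y (chr c y v w)) x u = P u v w + dC (F x u) (F x v) (F x w)
       + C (F2 x u v) (F x w) + C (F x v) (F2 x u w)"
      unfolding dd_eqI[OF 2] by (simp add: P_def dC_def C_def X_def F2_def F_def add.assoc)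
    with 1 show ?thesis by (simp add: algebra_simps)
  qed
  have inner2: "F x (chr c x u (chr c x v w)) = F2 x u (chr c x v w) + C (F x u) (F2 x v w) + C (F x u) (C (F x v) (F x w))"
    for u v w
    unfolding tr[OF x] C_def X_def using bilinear_radd[OF chr(1)[OF d xd]] by simp
  have P_sym: "P u v w = P v u w" for u v w
    unfolding P_def F2_def by (rule dd_commute[OF oo x smF])
  have "F x (curv c x u v w) = F x (dd (\<lambda>y. chr c y v w) x u) - F x (dd (\<lambda>y. chr c y u w) x v)
      + F x (chr c x u (chr c x v w)) - F x (chr c x v (chr c x u w))"
    unfolding curv_def by (simp add: linear_add[OF linF[OF x]] linear_diff[OF linF[OF x]])
  \<comment> \<open>The terms with \<open>P\<close> and with \<open>F2 x u v\<close> cancel by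
    symmetry of second derivatives. The terms of \<open>key\<close> with \<open>F2\<close> applied
    to a Christoffel symbol, and those with \<open>F2 x u w\<close>, cancel against their
    counterparts in \<open>inner2\<close>.\<close>
  also have "\<dots> = dC (F x u) (F x v) (F x w) - dC (F x v) (F x u) (F x w)
      + C (F x u) (C (F x v) (F x w)) - C (F x v) (C (F x u) (F x w))"
    unfolding key inner2 using P_sym[of u v w] F2_sym[OF x, of u v] by simp
  also have "\<dots> = curv d X (F x u) (F x v) (F x w)"
    by (simp add: curv_def dC_def C_def)
  finally show ?thesis by (simp add: F_def X_def)
qed

lemma curv_linear2:
  assumes c: "c \<in> \<A>" and x: "x \<in> dom c"
  shows "linear (\<lambda>w. curv c x v w z)"
proof -
  note b = chr(1)[OF c x]
  have "linear (\<lambda>w. dd (\<lambda>y. chr c y w z) x v)"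
  proof (rule linearI)
    fix a b
    have "dd (\<lambda>y. chr c y (a + b) z) x = dd (\<lambda>y. chr c y a z + chr c y b z) x"
      by (rule dd_cong[OF chart(2)[OF c] x]) (rule bilinear_ladd[OF chr(1)[OF c]])
    then show "dd (\<lambda>y. chr c y (a + b) z) x v = dd (\<lambda>y. chr c y a z) x v + dd (\<lambda>y. chr c y b z) x v"
      by (simp add: dd_add chr_differentiable c x)
  next
    fix r a
    have "dd (\<lambda>y. chr c y (r *\<^sub>R a) z) x = dd (\<lambda>y. r *\<^sub>R chr c y a z) x"
      by (rule dd_cong[OF chart(2)[OF c] x]) (rule bilinear_lmul[OF chr(1)[OF c]])
    then show "dd (\<lambda>y. chr c y (r *\<^sub>R a) z) x v = r *\<^sub>R dd (\<lambda>y. chr c y a z) x v"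
      by (simp add: dd_scaleR chr_differentiable c x)
  qed
  moreover have "linear (\<lambda>w. dd (\<lambda>y. chr c y v z) x w)" by (rule dd_linear[OF chr_differentiable[OF c x]])
  moreover have "linear (\<lambda>w. chr c x v (chr c x w z))" "linear (\<lambda>w. chr c x w (chr c x v z))"
    using bilinear_ladd[OF b] bilinear_radd[OF b] bilinear_lmul[OF b] bilinear_rmul[OF b] by (auto intro!: linearI)
  ultimately show ?thesis unfolding curv_def by (intro linear_compose_add linear_compose_sub)
qed

lemma curv_skew12: "curv c x v w z = - curv c x w v z"
  by (simp add: curv_def)

text \<open>In the cyclic sum all terms cancel in pairs because the Christoffel symbols are
  symmetric.\<close>

lemma curv_bianchi:
  assumes c: "c \<in> \<A>" and x: "x \<in> dom c"
  shows "curv c x u v w + curv c x v w u + curv c x w u v = 0"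
proof -
  have s: "dd (\<lambda>y. chr c y v w) x = dd (\<lambda>y. chr c y w v) x" for v w
    by (rule dd_cong[OF chart(2)[OF c] x]) (rule chr(2)[OF c])
  show ?thesis
    unfolding curv_def using s[of u v] s[of v w] s[of w u] chr(2)[OF c x, of u v] chr(2)[OF c x, of v w] chr(2)[OF c x, of w u]
    by simp
qed

text \<open>Differentiate the metric condition once more. Second derivatives of the metric commute,
  and the difference of the two orders is the curvature symmetrised in its last two
  arguments.\<close>

lemma curv_skew34:
  assumes c: "c \<in> \<A>" and x: "x \<in> dom c"
  shows "met c x (curv c x u v w) z = - met c x w (curv c x u v z)"
proof -
  note oc = chart(2)[OF c]
  note bm = met_props(1)[OF c x]
  have key: "dd (\<lambda>y. dmet c y v w z) x u =
      met c x (chr c x u (chr c x v w)) z + met c x (chr c x v w) (chr c x u z) + met c x (dd (\<lambda>y. chr c y v w) x u) z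
      + met c x (chr c x u w) (chr c x v z) + met c x w (chr c x u (chr c x v z)) + met c x w (dd (\<lambda>y. chr c y v z) x u)"
    for u v
  proof -
    have 1: "((\<lambda>y. met c y (chr c y v w) z + met c y w (chr c y v z)) has_derivative
        (\<lambda>u. (dd (\<lambda>y. met c y (chr c x v w) z) x u + met c x (dd (\<lambda>y. chr c y v w) x u) z + met c x (chr c x v w) 0)
          + (dd (\<lambda>y. met c y w (chr c x v z)) x u + met c x 0 (chr c x v z) + met c x w (dd (\<lambda>y. chr c y v z) x u)))) (at x)"
      by (intro has_derivative_add
          has_derivative_bilinear_param[where S = "dom c" and y = "\<lambda>y. y" and t = x and B = "met c" and y' = "\<lambda>u. u"])
        (auto simp: oc c x met_props(1) met_differentiable intro!: dd_works chr_differentiable)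
    have 2: "dd (\<lambda>y. dmet c y v w z) x = dd (\<lambda>y. met c y (chr c y v w) z + met c y w (chr c y v z)) x"
      by (rule dd_cong[OF oc x]) (rule chr(3)[OF c])
    have "dd (\<lambda>y. dmet c y v w z) x u = (dmet c x u (chr c x v w) z + met c x (dd (\<lambda>y. chr c y v w) x u) z)
        + (dmet c x u w (chr c x v z) + met c x w (dd (\<lambda>y. chr c y v z) x u))"
      unfolding 2 dd_eqI[OF 1] by (simp add: dmet_def bilinear_lzero[OF bm] bilinear_rzero[OF bm])
    then show ?thesis by (simp only: chr(3)[OF c x] add.assoc)
  qed
  have "dd (\<lambda>y. dmet c y v w z) x u = dd (\<lambda>y. dmet c y u w z) x v"
    unfolding dmet_def by (rule dd_commute[OF oc x met_smooth[OF c]])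
  then show ?thesis
    unfolding key
    by (simp add: curv_def bilinear_ladd[OF bm] bilinear_radd[OF bm] bilinear_lsub[OF bm] bilinear_rsub[OF bm])
qed

end

section \<open>Parallel frames along geodesics\<close>

lemma smooth_curveD:
  assumes "smooth_curve_on J x"
  obtains D1 D2 where "\<And>t. t \<in> J \<Longrightarrow> (x has_vector_derivative D1 t) (at t within J)"
    "\<And>t. t \<in> J \<Longrightarrow> (D1 has_vector_derivative D2 t) (at t within J)"
proof -
  obtain D where D: "\<And>t. t \<in> J \<Longrightarrow> D 0 t = x t"
    "\<And>k t. t \<in> J \<Longrightarrow> (D k has_vector_derivative D (Suc k) t) (at t within J)"
    using assms unfolding smooth_curve_on_def by blast
  show ?thesis
  proof (rule that[of "D 1" "D 2"])
    show "(x has_vector_derivative D 1 t) (at t within J)" if t: "t \<in> J" for t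
      by (rule has_vector_derivative_transform[OF t D(1)[symmetric]]) (use D(2)[OF t, of 0] in simp_all)
    show "(D 1 has_vector_derivative D 2 t) (at t within J)" if t: "t \<in> J" for t
      using D(2)[OF t, of 1] by (simp add: numeral_2_eq_2)
  qed
qed

lemma tendsto_bilinear_param:
  fixes B :: "'x::t2_space \<Rightarrow> 'e::euclidean_space \<Rightarrow> 'f::euclidean_space \<Rightarrow> 'b::real_normed_vector"
  assumes S: "open S" "x \<in> S" and B: "\<And>z. z \<in> S \<Longrightarrow> bilinear (B z)"
    and cB: "\<And>p q. isCont (\<lambda>z. B z p q) x" and y: "(y \<longlongrightarrow> x) F" and p: "(p \<longlongrightarrow> a) F" and q: "(q \<longlongrightarrow> b) F"
  shows "((\<lambda>t. B (y t) (p t) (q t)) \<longlongrightarrow> B x a b) F"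
proof -
  let ?L = "\<lambda>z. B (fst z) (snd z)"
  have "((\<lambda>t. ?L (y t, p t) (q t)) \<longlongrightarrow> ?L (x, a) b) F"
  proof (rule tendsto_linear_param[where L = ?L and y = "\<lambda>t. (y t, p t)" and S = "S \<times> UNIV"])
    show "linear (?L z)" if "z \<in> S \<times> UNIV" for z
      using bilinear_linear_right[OF B] that by auto
    show "isCont (\<lambda>z. ?L z r) (x, a)" for r
      unfolding isCont_def fst_conv snd_conv
      by (rule tendsto_linear_param[where L = "\<lambda>z p. B z p r", OF S bilinear_linear_left[OF B] cB])
        (auto intro!: tendsto_eq_intros)
    show "((\<lambda>t. (y t, p t)) \<longlongrightarrow> (x, a)) F" using y p by (rule tendsto_Pair)
  qed (use S q in \<open>auto simp: open_Times\<close>)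
  then show ?thesis by simp
qed

lemma tendsto_trilinear_param:
  fixes K :: "'x::t2_space \<Rightarrow> 'e::euclidean_space \<Rightarrow> 'e \<Rightarrow> 'e \<Rightarrow> 'b::real_normed_vector"
  assumes S: "open S" "x \<in> S" and K: "\<And>y w z. y \<in> S \<Longrightarrow> linear (\<lambda>v. K y v w z)"
    "\<And>y v z. y \<in> S \<Longrightarrow> linear (\<lambda>w. K y v w z)" "\<And>y v w. y \<in> S \<Longrightarrow> linear (\<lambda>z. K y v w z)"
    and cK: "\<And>u v w. isCont (\<lambda>y. K y u v w) x"
    and lim: "(y \<longlongrightarrow> x) F" "(p \<longlongrightarrow> a) F" "(q \<longlongrightarrow> b) F" "(r \<longlongrightarrow> c) F"
  shows "((\<lambda>t. K (y t) (p t) (q t) (r t)) \<longlongrightarrow> K x a b c) F"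
proof -
  let ?L = "\<lambda>z. K (fst z) (fst (snd z)) (snd (snd z))"
  have "((\<lambda>t. ?L (y t, p t, q t) (r t)) \<longlongrightarrow> ?L (x, a, b) c) F"
  proof (rule tendsto_linear_param[where L = ?L and y = "\<lambda>t. (y t, p t, q t)" and S = "S \<times> UNIV"])
    show "linear (?L z)" if "z \<in> S \<times> UNIV" for z using K(3) that by auto
    show "isCont (\<lambda>z. ?L z w) (x, a, b)" for w
      unfolding isCont_def fst_conv snd_conv
    proof (rule tendsto_bilinear_param[where B = "\<lambda>z p q. K z p q w", OF S])
      show "bilinear (\<lambda>p q. K z p q w)" if "z \<in> S" for z using K(1,2)[OF that] by (simp add: bilinear_def)
    qed (use cK in \<open>auto intro!: tendsto_eq_intros\<close>)
    show "((\<lambda>t. (y t, p t, q t)) \<longlongrightarrow> (x, a, b)) F" using lim by (intro tendsto_Pair)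
  qed (use S lim in \<open>auto simp: open_Times\<close>)
  then show ?thesis by simp
qed

context semi_riemannian
begin

lemma curv_linear1: "c \<in> \<A> \<Longrightarrow> x \<in> dom c \<Longrightarrow> linear (\<lambda>v. curv c x v w z)"
  unfolding curv_skew12[of c x _ w] by (intro linear_compose_neg curv_linear2)

text \<open>The Bianchi identity moves the third argument into the first two slots, where linearity
  is known.\<close>

lemma curv_linear3:
  assumes "c \<in> \<A>" "x \<in> dom c"
  shows "linear (\<lambda>z. curv c x v w z)"
proof -
  have "curv c x v w z = - (curv c x w z v + curv c x z v w)" for z
    unfolding eq_neg_iff_add_eq_0 add.assoc[symmetric] by (rule curv_bianchi[OF assms])
  then show ?thesis
    by (simp only:) (intro linear_compose_neg linear_compose_add curv_linear1 curv_linear2 assms)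
qed

lemma isCont_curv:
  assumes c: "c \<in> \<A>" and x: "x \<in> dom c"
  shows "isCont (\<lambda>x. curv c x u v w) x"
proof -
  have cc: "isCont (\<lambda>x. chr c x v w) x" for v w
    using differentiable_imp_continuous_within[OF chr_differentiable[OF c x]] by simp
  have c2: "isCont (\<lambda>x. chr c x u (chr c x v w)) x" for u v w
    unfolding isCont_def
    by (rule tendsto_linear_param[where L = "\<lambda>x p. chr c x u p", OF chart(2)[OF c] x bilinear_linear_right[OF chr(1)[OF c]] cc])
      (use cc in \<open>auto simp: isCont_def\<close>)
  show ?thesis unfolding curv_def by (intro continuous_intros isCont_dd_chr c x c2)
qed

lemma g_self: "g p v w = met (ch p) (snd (ch p) p) v w"
  using met_components[OF ch(1) ch(2), of p v w] by (simp add: components_self)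

lemma components_curvature:
  assumes c: "c \<in> \<A>" and p: "p \<in> fst c"
  shows "components \<A> c p (curvature \<A> g p u v w) =
    curv c (snd c p) (components \<A> c p u) (components \<A> c p v) (components \<A> c p w)"
  using curv_transform[OF ch(1) c chart_overlap(3)[OF ch(2) p], of u v w]
  by (simp add: curvature_curv components_td td_def phi_at[OF ch(1) ch(2)])

lemma curvature_linear2: "linear (\<lambda>w. curvature \<A> g p v w z)"
  unfolding curvature_curv by (rule curv_linear2[OF ch(1) chart(8)[OF ch]])

lemma curvature_skew34: "g p (curvature \<A> g p u v w) z = - g p (curvature \<A> g p u v z) w"
proof -
  let ?c = "ch p" and ?x = "snd (ch p) p"
  have 1: "met ?c ?x (curv ?c ?x u v w) z = - met ?c ?x w (curv ?c ?x u v z)"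
    by (rule curv_skew34[OF ch(1) chart(8)[OF ch]])
  have 2: "met ?c ?x w (curv ?c ?x u v z) = met ?c ?x (curv ?c ?x u v z) w"
    by (rule met_props(2)[OF ch(1) chart(8)[OF ch]])
  show ?thesis
    unfolding curvature_curv g_self[of p _ z] g_self[of p _ w] 1 2 ..
qed

lemma curvature_skew34_refl: "g p (curvature \<A> g p u v w) w = 0"
  using curvature_skew34[of p u v w w] by simp

text \<open>Pair the Bianchi identity with \<open>x\<close>: the term having \<open>x\<close> in the
  third slot vanishes by skewness, and the other two give the claim. It provides the symmetry of the
  curvature matrix.\<close>

lemma curvature_symmetric: "g p (curvature \<A> g p x y x) z = g p (curvature \<A> g p x z x) y"
proof -
  let ?R = "curvature \<A> g p"
  note ab = g_props(1)[of p]
  have b: "?R x y z + ?R y z x + ?R z x y = 0"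
    unfolding curvature_curv by (rule curv_bianchi[OF ch(1) chart(8)[OF ch]])
  have s: "?R z x y = - ?R x z y"
    unfolding curvature_curv by (rule curv_skew12)
  have "g p (?R x y z) x + g p (?R y z x) x + g p (?R z x y) x = 0"
    using arg_cong[OF b, of "\<lambda>v. g p v x"] by (simp add: bilinear_ladd[OF ab] bilinear_lzero[OF ab])
  then have "g p (?R x y z) x = g p (?R x z y) x"
    unfolding s curvature_skew34_refl by (simp add: bilinear_lneg[OF ab])
  then show ?thesis using curvature_skew34[of p x y x z] curvature_skew34[of p x z x y] by simp
qed

end

locale geodesic_frame = semi_riemannian +
  fixes n \<kappa> :: nat and T :: real and \<gamma> :: "real \<Rightarrow> 'a" and e :: "nat \<Rightarrow> real \<Rightarrow> 'b" and A :: "real mat"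
  assumes cg: "closed_geodesic \<A> g T \<gamma>" and nl: "non_lightlike \<A> g T \<gamma>"
    and fr: "parallel_orthonormal_frame \<A> g n \<kappa> T \<gamma> e" and hol: "holonomy_matrix n T e A"
begin

abbreviation "vel \<equiv> velocity \<A> T \<gamma>"
abbreviation "cov \<equiv> cov_deriv \<A> g T \<gamma>"
abbreviation cpt :: "('a, 'b) chart \<Rightarrow> real \<Rightarrow> 'b \<Rightarrow> 'b" where "cpt c s \<equiv> components \<A> c (\<gamma> s)"
abbreviation pos :: "('a, 'b) chart \<Rightarrow> real \<Rightarrow> 'b" where "pos c s \<equiv> snd c (\<gamma> s)"
abbreviation "Rm \<equiv> curvature_matrix \<A> g T \<gamma> e"

lemma T: "T > 0" and \<gamma>_cont: "continuous_on {0..T} \<gamma>" and periodic: "\<gamma> T = \<gamma> 0" "vel T = vel 0"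
  and vel_parallel: "t \<in> {0..T} \<Longrightarrow> cov vel t = 0"
  using cg unfolding closed_geodesic_def smooth_path_def by auto

text \<open>Smoothness is defined by derivatives within the times spent in one chart domain. These
  times are relatively open in \<open>[0,T]\<close>, so derivatives within \<open>[0,T]\<close> are
  the same.\<close>

lemma within_chart_domain:
  assumes c: "c \<in> \<A>" and t: "t \<in> {0..T}" "\<gamma> t \<in> fst c"
  shows "at t within {t\<in>{0..T}. \<gamma> t \<in> fst c} = at t within {0..T}"
    and "\<forall>\<^sub>F s in at t within {0..T}. s \<in> {0..T} \<and> \<gamma> s \<in> fst c"
proof -
  obtain U where U: "open U" "U \<inter> {0..T} = \<gamma> -` fst c \<inter> {0..T}"
    using \<gamma>_cont chart(1)[OF c] unfolding continuous_on_open_invariant by blast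
  have tU: "t \<in> U" using U(2) t by blast
  show "at t within {t\<in>{0..T}. \<gamma> t \<in> fst c} = at t within {0..T}"
    by (rule at_within_nhd[OF tU U(1)]) (use U(2) in blast)
  show "\<forall>\<^sub>F s in at t within {0..T}. s \<in> {0..T} \<and> \<gamma> s \<in> fst c"
    using U tU unfolding eventually_at_topological by blast
qed

lemma vector_derivative_eq:
  "(f has_vector_derivative f') (at t within {0..T}) \<Longrightarrow> t \<in> {0..T} \<Longrightarrow> vector_derivative f (at t within {0..T}) = f'"
  using vector_derivative_within_cbox[of 0 T t f f'] T by simp

text \<open>At each time \<open>velocity\<close> is computed in the chart preferred there; the chain
  rule for the transition map carries it to the fixed chart \<open>c\<close>.\<close>

lemma pos_has_derivative:
  assumes c: "c \<in> \<A>" and t: "t \<in> {0..T}" "\<gamma> t \<in> fst c"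
  shows "(pos c has_vector_derivative cpt c t (vel t)) (at t within {0..T})"
proof -
  let ?d = "ch (\<gamma> t)"
  have d: "?d \<in> \<A>" "\<gamma> t \<in> fst ?d" by (rule ch)+
  have "smooth_curve_on {t\<in>{0..T}. \<gamma> t \<in> fst ?d} (pos ?d)"
    using cg d(1) unfolding closed_geodesic_def smooth_path_def by blast
  then obtain D1 where "\<And>t. t \<in> {t\<in>{0..T}. \<gamma> t \<in> fst ?d} \<Longrightarrow>
      (pos ?d has_vector_derivative D1 t) (at t within {t\<in>{0..T}. \<gamma> t \<in> fst ?d})"
    by (rule smooth_curveD) blast
  then have D1: "(pos ?d has_vector_derivative D1 t) (at t within {0..T})"
    using within_chart_domain(1)[OF d(1) t(1) d(2)] t d(2) by fastforce
  then have v: "vel t = D1 t" unfolding velocity_def by (rule vector_derivative_eq) (rule t)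
  have "(phi ?d c has_derivative td ?d c (\<gamma> t)) (at (pos ?d t))"
    unfolding td_def by (intro dd_works phi_differentiable d c chart_overlap(3) t)
  then have "((\<lambda>s. phi ?d c (pos ?d s)) has_derivative (\<lambda>h. td ?d c (\<gamma> t) (h *\<^sub>R D1 t))) (at t within {0..T})"
    using D1 unfolding has_vector_derivative_def by (rule has_derivative_compose[rotated])
  then have "((\<lambda>s. phi ?d c (pos ?d s)) has_vector_derivative td ?d c (\<gamma> t) (D1 t)) (at t within {0..T})"
    by (simp add: has_vector_derivative_def linear_scale[OF td_linear[OF d(1) c d(2) t(2)]])
  moreover have "\<forall>\<^sub>F s in at t within {0..T}. phi ?d c (pos ?d s) = pos c s"
    using within_chart_domain(2)[OF d(1) t(1) d(2)] by eventually_elim (simp add: phi_at[OF d(1)])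
  ultimately have "(pos c has_vector_derivative td ?d c (\<gamma> t) (D1 t)) (at t within {0..T})"
    unfolding has_vector_derivative_def
    by (rule has_derivative_transform_eventually) (use t in \<open>auto simp: phi_at[OF d]\<close>)
  then show ?thesis by (simp add: components_td v)
qed

lemma comp_differentiable_of_smooth:
  assumes s: "smooth_curve_on {t\<in>{0..T}. \<gamma> t \<in> fst c} f" and c: "c \<in> \<A>" and t: "t \<in> {0..T}" "\<gamma> t \<in> fst c"
  shows "f differentiable (at t within {0..T})"
proof -
  obtain D1 where "\<And>t. t \<in> {t\<in>{0..T}. \<gamma> t \<in> fst c} \<Longrightarrow>
      (f has_vector_derivative D1 t) (at t within {t\<in>{0..T}. \<gamma> t \<in> fst c})"
    using s by (rule smooth_curveD) blast
  then have "(f has_vector_derivative D1 t) (at t within {0..T})"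
    using within_chart_domain(1)[OF c t] t by fastforce
  then show ?thesis by (auto simp: differentiable_def has_vector_derivative_def)
qed

lemma e_comp_differentiable:
  "i < n \<Longrightarrow> c \<in> \<A> \<Longrightarrow> t \<in> {0..T} \<Longrightarrow> \<gamma> t \<in> fst c \<Longrightarrow>
    (\<lambda>s. cpt c s (e i s)) differentiable (at t within {0..T})"
  using fr unfolding parallel_orthonormal_frame_def smooth_along_def
  by (intro comp_differentiable_of_smooth[where c = c]) auto

text \<open>By \<open>pos_has_derivative\<close> the components are the first derivative of the
  coordinate curve at all times in the chart domain, and that derivative is differentiable
  again.\<close>

lemma vel_comp_differentiable:
  assumes c: "c \<in> \<A>" and t: "t \<in> {0..T}" "\<gamma> t \<in> fst c"
  shows "(\<lambda>s. cpt c s (vel s)) differentiable (at t within {0..T})"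
proof -
  let ?J = "{t\<in>{0..T}. \<gamma> t \<in> fst c}"
  have "smooth_curve_on ?J (pos c)" using cg c by (auto simp: closed_geodesic_def smooth_path_def)
  then obtain D1 D2 where D: "\<And>t. t \<in> ?J \<Longrightarrow> (pos c has_vector_derivative D1 t) (at t within ?J)"
    "\<And>t. t \<in> ?J \<Longrightarrow> (D1 has_vector_derivative D2 t) (at t within ?J)"
    by (rule smooth_curveD) blast
  have D1: "D1 s = cpt c s (vel s)" if s: "s \<in> ?J" for s
  proof -
    have s': "s \<in> {0..T}" "\<gamma> s \<in> fst c" using s by auto
    have "(pos c has_vector_derivative D1 s) (at s within {0..T})" using D(1)[OF s] within_chart_domain(1)[OF c s'] by simp
    with pos_has_derivative[OF c s'] show ?thesis
      using vector_derivative_unique_within_closed_interval[of 0 T s "pos c"] T s' by (metis cbox_interval)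
  qed
  have tJ: "t \<in> ?J" using t by simp
  have "((\<lambda>s. cpt c s (vel s)) has_vector_derivative D2 t) (at t within ?J)"
    by (rule has_vector_derivative_transform[OF tJ D1[symmetric] D(2)[OF tJ]])
  then have "((\<lambda>s. cpt c s (vel s)) has_vector_derivative D2 t) (at t within {0..T})"
    unfolding within_chart_domain(1)[OF c t] .
  then show ?thesis by (auto simp: differentiable_def has_vector_derivative_def)
qed

section \<open>Coordinates in the frame completed by the velocity\<close>

definition frame_vec :: "nat \<Rightarrow> real \<Rightarrow> 'b" where "frame_vec i = (if i < n then e i else vel)"
definition frame_sq :: "nat \<Rightarrow> real \<Rightarrow> real" where "frame_sq i t = g (\<gamma> t) (frame_vec i t) (frame_vec i t)"
text \<open>The completed frame is orthogonal with nonzero squares, so this extracts coefficients.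
  For index \<open>n\<close>, the velocity, the square is nonzero because the geodesic is not
  lightlike.\<close>

definition frame_coord :: "nat \<Rightarrow> real \<Rightarrow> 'b \<Rightarrow> real" where "frame_coord i t v = g (\<gamma> t) v (frame_vec i t) / frame_sq i t"

abbreviation "along \<equiv> differentiable_along \<A> T \<gamma>"

lemma along_frame_vec: "along (frame_vec i)"
  unfolding differentiable_along_def frame_vec_def
  using e_comp_differentiable vel_comp_differentiable ch by auto

lemma cov_frame_vec: "t \<in> {0..T} \<Longrightarrow> cov (frame_vec i) t = 0"
  using vel_parallel fr by (auto simp: frame_vec_def parallel_orthonormal_frame_def)

lemma e_orthonormal: "t \<in> {0..T} \<Longrightarrow> i < n \<Longrightarrow> j < n \<Longrightarrow> g (\<gamma> t) (e i t) (e j t) = (if i = j then sig n \<kappa> i else 0)"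
  and e_span: "t \<in> {0..T} \<Longrightarrow> span ((\<lambda>i. e i t) ` {..<n}) = {v. g (\<gamma> t) v (vel t) = 0}"
  using fr by (auto simp: parallel_orthonormal_frame_def)

lemma e_vel: "t \<in> {0..T} \<Longrightarrow> i < n \<Longrightarrow> g (\<gamma> t) (e i t) (vel t) = 0"
  using e_span[of t] span_base[of "e i t" "(\<lambda>i. e i t) ` {..<n}"] by auto

lemma frame_vec_orthogonal:
  assumes "t \<in> {0..T}" "i \<le> n" "j \<le> n" "i \<noteq> j"
  shows "g (\<gamma> t) (frame_vec i t) (frame_vec j t) = 0"
  using assms e_orthonormal[of t i j] e_vel[of t i] e_vel[of t j] g_props(2)[of "\<gamma> t" "vel t"]
  by (auto simp: frame_vec_def)

lemma frame_sq_nonzero: "t \<in> {0..T} \<Longrightarrow> frame_sq i t \<noteq> 0"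
  using nl e_orthonormal[of t i i] by (auto simp: frame_sq_def frame_vec_def non_lightlike_def speed_square_def sig_def)

lemma frame_sq_e: "t \<in> {0..T} \<Longrightarrow> i < n \<Longrightarrow> frame_sq i t = sig n \<kappa> i"
  using e_orthonormal[of t i i] by (simp add: frame_sq_def frame_vec_def)

lemma frame_coord_e: "t \<in> {0..T} \<Longrightarrow> i < n \<Longrightarrow> frame_coord i t v = sig n \<kappa> i * g (\<gamma> t) v (e i t)"
  by (simp add: frame_coord_def frame_sq_e frame_vec_def sig_def)

lemma frame_coord_linear: "linear (frame_coord i t)"
  unfolding frame_coord_def using bilinear_ladd[OF g_props(1)] bilinear_lmul[OF g_props(1)]
  by (auto intro!: linearI simp: add_divide_distrib)

lemma frame_coord_frame_vec: "t \<in> {0..T} \<Longrightarrow> i \<le> n \<Longrightarrow> j \<le> n \<Longrightarrow> frame_coord i t (frame_vec j t) = of_bool (i = j)"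
  using frame_sq_nonzero[of t i] frame_vec_orthogonal[of t j i] by (auto simp: frame_coord_def frame_sq_def)

text \<open>\<open>v\<close> is orthogonal to the frame and to the velocity. An arbitrary
  \<open>w\<close> minus its velocity part lies in the span of the frame, so \<open>v\<close> is
  orthogonal to every vector.\<close>

lemma frame_coord_zero:
  assumes t: "t \<in> {0..T}" and 0: "\<And>i. i \<le> n \<Longrightarrow> frame_coord i t v = 0"
  shows "v = 0"
proof -
  have gv: "g (\<gamma> t) v (frame_vec i t) = 0" if "i \<le> n" for i using 0[OF that] frame_sq_nonzero[OF t] by (simp add: frame_coord_def)
  have "v \<in> span ((\<lambda>i. e i t) ` {..<n})" using e_span[OF t] gv[of n] by (simp add: frame_vec_def)
  then have "g (\<gamma> t) v v = 0 \<and> (\<forall>w \<in> span ((\<lambda>i. e i t) ` {..<n}). g (\<gamma> t) v w = 0)"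
  proof -
    have "g (\<gamma> t) v w = 0" if "w \<in> span ((\<lambda>i. e i t) ` {..<n})" for w
      using that
    proof (induction rule: span_induct)
      case base
      show ?case
        unfolding subspace_def using bilinear_radd[OF g_props(1)] bilinear_rmul[OF g_props(1)] bilinear_rzero[OF g_props(1)]
        by auto
    next
      case (step w)
      then obtain i where "i < n" "w = e i t" by auto
      then show ?case using gv[of i] by (simp add: frame_vec_def)
    qed
    then show ?thesis using \<open>v \<in> span _\<close> by blast
  qed
  moreover have "g (\<gamma> t) v w = 0" for w
  proof -
    let ?c = "g (\<gamma> t) w (vel t) / frame_sq n t"
    have "g (\<gamma> t) (w - ?c *\<^sub>R vel t) (vel t) = 0"
      using frame_sq_nonzero[OF t, of n] bilinear_lsub[OF g_props(1)] bilinear_lmul[OF g_props(1)]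
      by (simp add: frame_sq_def frame_vec_def)
    then have "w - ?c *\<^sub>R vel t \<in> span ((\<lambda>i. e i t) ` {..<n})" using e_span[OF t] by simp
    then have "g (\<gamma> t) v (w - ?c *\<^sub>R vel t) = 0" using calculation by blast
    moreover have "g (\<gamma> t) v (vel t) = 0" using gv[of n] by (simp add: frame_vec_def)
    ultimately show ?thesis
      using bilinear_rsub[OF g_props(1)] bilinear_rmul[OF g_props(1)] by simp
  qed
  ultimately show ?thesis using nondegD[OF g_props(3)] by blast
qed

lemma frame_coord_eqI: "t \<in> {0..T} \<Longrightarrow> (\<And>i. i \<le> n \<Longrightarrow> frame_coord i t v = frame_coord i t w) \<Longrightarrow> v = w"
  using frame_coord_zero[of t "v - w"] linear_diff[OF frame_coord_linear] by simp

lemma frame_coord_sum_e: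
  "t \<in> {0..T} \<Longrightarrow> i \<le> n \<Longrightarrow> frame_coord i t (\<Sum>j<n. c j *\<^sub>R e j t) = (if i < n then c i else 0)"
proof -
  assume t: "t \<in> {0..T}" and i: "i \<le> n"
  have "frame_coord i t (\<Sum>j<n. c j *\<^sub>R e j t) = (\<Sum>j<n. c j * frame_coord i t (e j t))"
    by (simp add: linear_sum[OF frame_coord_linear] linear_scale[OF frame_coord_linear])
  also have "\<dots> = (\<Sum>j<n. if j = i then c j else 0)"
  proof (rule sum.cong[OF refl])
    fix j assume "j \<in> {..<n}"
    then show "c j * frame_coord i t (e j t) = (if j = i then c j else 0)"
      using frame_coord_frame_vec[OF t i, of j] by (auto simp: frame_vec_def)
  qed
  finally show ?thesis using i by simp
qed

section \<open>Covariant derivatives in frame coordinates\<close>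

lemma comp_near:
  assumes "t \<in> {0..T}"
  shows "\<forall>\<^sub>F s in at t within {0..T}. s \<in> {0..T} \<and> \<gamma> s \<in> fst (ch (\<gamma> t))"
  by (rule within_chart_domain(2)[OF ch(1) assms ch(2)])

lemma along_deriv:
  assumes "along \<xi>" "t \<in> {0..T}"
  shows "((\<lambda>s. cpt (ch (\<gamma> t)) s (\<xi> s)) has_vector_derivative
     cov \<xi> t - chr (ch (\<gamma> t)) (pos (ch (\<gamma> t)) t) (vel t) (\<xi> t)) (at t within {0..T})"
  using assms unfolding differentiable_along_def
  by (auto simp: cov_deriv_def Let_def vector_derivative_works)

lemma cov_eqI:
  assumes "((\<lambda>s. cpt (ch (\<gamma> t)) s (\<xi> s)) has_vector_derivative
     v - chr (ch (\<gamma> t)) (pos (ch (\<gamma> t)) t) (vel t) (\<xi> t)) (at t within {0..T})" "t \<in> {0..T}"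
  shows "cov \<xi> t = v"
  using vector_derivative_eq[OF assms] by (simp add: cov_deriv_def Let_def)

text \<open>In the chart preferred at \<open>\<gamma> t\<close>, the derivative of the metric along
  the velocity consists of the Christoffel terms by which the covariant derivatives differ from the
  derivatives of components.\<close>

lemma g_has_derivative:
  assumes \<xi>: "along \<xi>" and \<eta>: "along \<eta>" and t: "t \<in> {0..T}"
  shows "((\<lambda>s. g (\<gamma> s) (\<xi> s) (\<eta> s)) has_real_derivative
    g (\<gamma> t) (cov \<xi> t) (\<eta> t) + g (\<gamma> t) (\<xi> t) (cov \<eta> t)) (at t within {0..T})"
proof -
  let ?c = "ch (\<gamma> t)"
  have c: "?c \<in> \<A>" "\<gamma> t \<in> fst ?c" by (rule ch)+
  have xd: "pos ?c t \<in> dom ?c" by (rule chart(8)[OF c])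
  let ?X = "chr ?c (pos ?c t) (vel t)"
  note bm = met_props(1)[OF c(1) xd]
  have "((\<lambda>s. met ?c (pos ?c s) (cpt ?c s (\<xi> s)) (cpt ?c s (\<eta> s))) has_derivative
     (\<lambda>h. dd (\<lambda>z. met ?c z (cpt ?c t (\<xi> t)) (cpt ?c t (\<eta> t))) (pos ?c t) (h *\<^sub>R vel t)
        + met ?c (pos ?c t) (h *\<^sub>R (cov \<xi> t - ?X (\<xi> t))) (cpt ?c t (\<eta> t))
        + met ?c (pos ?c t) (cpt ?c t (\<xi> t)) (h *\<^sub>R (cov \<eta> t - ?X (\<eta> t))))) (at t within {0..T})"
  proof (rule has_derivative_bilinear_param[where S = "dom ?c" and B = "met ?c" and y = "pos ?c"])
    show "(pos ?c has_derivative (\<lambda>h. h *\<^sub>R vel t)) (at t within {0..T})"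
      using pos_has_derivative[OF c(1) t c(2)] by (simp add: components_self has_vector_derivative_def)
    show "((\<lambda>s. cpt ?c s (\<xi> s)) has_derivative (\<lambda>h. h *\<^sub>R (cov \<xi> t - ?X (\<xi> t)))) (at t within {0..T})"
      using along_deriv[OF \<xi> t] by (simp add: has_vector_derivative_def)
    show "((\<lambda>s. cpt ?c s (\<eta> s)) has_derivative (\<lambda>h. h *\<^sub>R (cov \<eta> t - ?X (\<eta> t)))) (at t within {0..T})"
      using along_deriv[OF \<eta> t] by (simp add: has_vector_derivative_def)
  qed (use chart(2)[OF c(1)] met_props(1)[OF c(1)] met_differentiable[OF c(1) xd] xd t in auto)
  also have "(\<lambda>h. dd (\<lambda>z. met ?c z (cpt ?c t (\<xi> t)) (cpt ?c t (\<eta> t))) (pos ?c t) (h *\<^sub>R vel t)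
        + met ?c (pos ?c t) (h *\<^sub>R (cov \<xi> t - ?X (\<xi> t))) (cpt ?c t (\<eta> t))
        + met ?c (pos ?c t) (cpt ?c t (\<xi> t)) (h *\<^sub>R (cov \<eta> t - ?X (\<eta> t)))) =
     (\<lambda>h. h * (g (\<gamma> t) (cov \<xi> t) (\<eta> t) + g (\<gamma> t) (\<xi> t) (cov \<eta> t)))"
  proof
    fix h
    let ?B = "met ?c (pos ?c t)"
    have "dd (\<lambda>z. met ?c z (\<xi> t) (\<eta> t)) (pos ?c t) (h *\<^sub>R vel t) = h * dmet ?c (pos ?c t) (vel t) (\<xi> t) (\<eta> t)"
      using linear_scale[OF dd_linear[OF met_differentiable[OF c(1) xd]]] by (simp add: dmet_def)
    then have 1: "dd (\<lambda>z. met ?c z (\<xi> t) (\<eta> t)) (pos ?c t) (h *\<^sub>R vel t) = h * (?B (?X (\<xi> t)) (\<eta> t) + ?B (\<xi> t) (?X (\<eta> t)))"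
      by (simp only: chr(3)[OF c(1) xd])
    have 2: "?B (h *\<^sub>R (a - a')) w = h * (?B a w - ?B a' w)" for a a' w
      by (simp only: bilinear_lmul[OF bm] bilinear_lsub[OF bm] real_scaleR_def)
    have 3: "?B w (h *\<^sub>R (a - a')) = h * (?B w a - ?B w a')" for a a' w
      by (simp only: bilinear_rmul[OF bm] bilinear_rsub[OF bm] real_scaleR_def)
    have gs: "g (\<gamma> t) v w = ?B v w" for v w by (rule g_self)
    show "dd (\<lambda>z. met ?c z (cpt ?c t (\<xi> t)) (cpt ?c t (\<eta> t))) (pos ?c t) (h *\<^sub>R vel t)
        + met ?c (pos ?c t) (h *\<^sub>R (cov \<xi> t - ?X (\<xi> t))) (cpt ?c t (\<eta> t))
        + met ?c (pos ?c t) (cpt ?c t (\<xi> t)) (h *\<^sub>R (cov \<eta> t - ?X (\<eta> t))) =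
        h * (g (\<gamma> t) (cov \<xi> t) (\<eta> t) + g (\<gamma> t) (\<xi> t) (cov \<eta> t))"
      unfolding components_self gs 1 2 3 by (simp only: distrib_left right_diff_distrib)
  qed
  finally have d: "((\<lambda>s. met ?c (pos ?c s) (cpt ?c s (\<xi> s)) (cpt ?c s (\<eta> s))) has_derivative
     (\<lambda>h. h * (g (\<gamma> t) (cov \<xi> t) (\<eta> t) + g (\<gamma> t) (\<xi> t) (cov \<eta> t)))) (at t within {0..T})" .
  have ev: "\<forall>\<^sub>F s in at t within {0..T}. met ?c (pos ?c s) (cpt ?c s (\<xi> s)) (cpt ?c s (\<eta> s)) = g (\<gamma> s) (\<xi> s) (\<eta> s)"
    using comp_near[OF t] by eventually_elim (simp add: met_components[OF c(1)])
  show ?thesis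
    unfolding has_field_derivative_def
    using has_derivative_transform_eventually[OF d ev met_components[OF c] t]
    by (simp add: mult_commute_abs)
qed

text \<open>The frame is parallel, so by metric compatibility covariant differentiation is ordinary
  differentiation of coordinates. This turns the Jacobi equation into a linear system.\<close>

lemma frame_coord_has_derivative:
  assumes \<xi>: "along \<xi>" and t: "t \<in> {0..T}"
  shows "((\<lambda>s. frame_coord i s (\<xi> s)) has_real_derivative frame_coord i t (cov \<xi> t)) (at t within {0..T})"
proof -
  have 1: "((\<lambda>s. g (\<gamma> s) (\<xi> s) (frame_vec i s)) has_real_derivative g (\<gamma> t) (cov \<xi> t) (frame_vec i t)) (at t within {0..T})"
    using g_has_derivative[OF \<xi> along_frame_vec t, of i] by (simp add: cov_frame_vec[OF t] bilinear_rzero[OF g_props(1)])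
  have 2: "(frame_sq i has_real_derivative 0) (at t within {0..T})"
    using g_has_derivative[OF along_frame_vec along_frame_vec t, of i i]
    by (simp add: frame_sq_def[abs_def] cov_frame_vec[OF t] bilinear_rzero[OF g_props(1)] bilinear_lzero[OF g_props(1)])
  show ?thesis
    unfolding frame_coord_def using DERIV_divide[OF 1 2 frame_sq_nonzero[OF t]] frame_sq_nonzero[OF t, of i] by simp
qed

text \<open>The converse passage, from coordinates to fields; \<open>jacobi_exists\<close> uses it
  to build Jacobi fields from solutions of the system.\<close>

lemma cov_frame_sum:
  assumes \<xi>: "\<And>s. s \<in> {0..T} \<Longrightarrow> \<xi> s = (\<Sum>i<n. u s i *\<^sub>R e i s)"
    and u: "\<And>s i. s \<in> {0..T} \<Longrightarrow> i < n \<Longrightarrow> ((\<lambda>s. u s i) has_real_derivative u' s i) (at s within {0..T})"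
  shows "along \<xi>" "t \<in> {0..T} \<Longrightarrow> cov \<xi> t = (\<Sum>i<n. u' t i *\<^sub>R e i t)"
proof -
  have main: "((\<lambda>s. cpt (ch (\<gamma> t)) s (\<xi> s)) has_vector_derivative
     (\<Sum>i<n. u' t i *\<^sub>R e i t) - chr (ch (\<gamma> t)) (pos (ch (\<gamma> t)) t) (vel t) (\<xi> t)) (at t within {0..T})"
    if t: "t \<in> {0..T}" for t
  proof -
    let ?c = "ch (\<gamma> t)"
    let ?X = "chr ?c (pos ?c t) (vel t)"
    have c: "?c \<in> \<A>" "\<gamma> t \<in> fst ?c" by (rule ch)+
    have lX: "linear ?X" by (rule bilinear_linear_right[OF chr(1)[OF c(1) chart(8)[OF c]]])
    have de: "((\<lambda>s. cpt ?c s (e i s)) has_vector_derivative - ?X (e i t)) (at t within {0..T})" if "i < n" for i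
      using along_deriv[OF along_frame_vec t, of i] cov_frame_vec[OF t, of i] that by (simp add: frame_vec_def)
    have "((\<lambda>s. \<Sum>i<n. u s i *\<^sub>R cpt ?c s (e i s)) has_vector_derivative
        (\<Sum>i<n. u t i *\<^sub>R (- ?X (e i t)) + u' t i *\<^sub>R cpt ?c t (e i t))) (at t within {0..T})"
      by (intro has_vector_derivative_sum has_vector_derivative_scaleR u[OF t] de) auto
    also have "(\<Sum>i<n. u t i *\<^sub>R (- ?X (e i t)) + u' t i *\<^sub>R cpt ?c t (e i t)) =
        (\<Sum>i<n. u' t i *\<^sub>R e i t) - ?X (\<xi> t)"
      unfolding \<xi>[OF t] components_self by (simp add: sum_subtractf linear_sum[OF lX] linear_scale[OF lX])
    finally have d: "((\<lambda>s. \<Sum>i<n. u s i *\<^sub>R cpt ?c s (e i s)) has_vector_derivative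
        (\<Sum>i<n. u' t i *\<^sub>R e i t) - ?X (\<xi> t)) (at t within {0..T})" .
    have eq: "(\<Sum>i<n. u s i *\<^sub>R cpt ?c s (e i s)) = cpt ?c s (\<xi> s)" if "s \<in> {0..T} \<and> \<gamma> s \<in> fst ?c" for s
    proof -
      have "linear (components \<A> ?c (\<gamma> s))" using that by (intro components_linear c) simp
      then show ?thesis using that by (simp add: \<xi> linear_sum linear_scale)
    qed
    have "\<forall>\<^sub>F s in at t within {0..T}. (\<Sum>i<n. u s i *\<^sub>R cpt ?c s (e i s)) = cpt ?c s (\<xi> s)"
      using comp_near[OF t] by eventually_elim (rule eq)
    with d show ?thesis
      unfolding has_vector_derivative_def by (rule has_derivative_transform_eventually) (use eq t c in auto)
  qed
  show "along \<xi>"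
    unfolding differentiable_along_def differentiable_def using main unfolding has_vector_derivative_def by blast
  show "t \<in> {0..T} \<Longrightarrow> cov \<xi> t = (\<Sum>i<n. u' t i *\<^sub>R e i t)" using cov_eqI[OF main] by blast
qed

section \<open>The curvature matrix and the holonomy\<close>

lemma Rm_sym: "Rm t i j = Rm t j i"
  unfolding curvature_matrix_def by (rule curvature_symmetric)

text \<open>The second part is skewness of the curvature: the curvature term of the Jacobi equation
  is orthogonal to the velocity, so normal and tangential parts separate.\<close>

lemma frame_coord_curvature:
  assumes t: "t \<in> {0..T}" and v: "v = (\<Sum>j<n. u j *\<^sub>R e j t)"
  shows "i < n \<Longrightarrow> frame_coord i t (curvature \<A> g (\<gamma> t) (vel t) v (vel t)) = sig n \<kappa> i * (\<Sum>j<n. Rm t i j * u j)"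
    and "frame_coord n t (curvature \<A> g (\<gamma> t) (vel t) w (vel t)) = 0"
proof -
  assume i: "i < n"
  note lin = curvature_linear2[of "\<gamma> t" "vel t" "vel t"] and lg = bilinear_linear_left[OF g_props(1)]
  have "g (\<gamma> t) (curvature \<A> g (\<gamma> t) (vel t) v (vel t)) (e i t) = (\<Sum>j<n. u j * Rm t j i)"
    unfolding v linear_sum[OF lin] linear_sum[OF lg] linear_scale[OF lin] linear_scale[OF lg] curvature_matrix_def
    by simp
  then show "frame_coord i t (curvature \<A> g (\<gamma> t) (vel t) v (vel t)) = sig n \<kappa> i * (\<Sum>j<n. Rm t i j * u j)"
    by (simp add: frame_coord_e[OF t i] Rm_sym[of t i] mult.commute)
next
  show "frame_coord n t (curvature \<A> g (\<gamma> t) (vel t) w (vel t)) = 0"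
    by (simp add: frame_coord_def frame_vec_def curvature_skew34_refl)
qed

text \<open>\<open>curvature\<close> uses a different chart at each point. Near \<open>t\<close> it
  is rewritten by \<open>components_curvature\<close> in the single chart preferred at
  \<open>\<gamma> t\<close>, where all ingredients are continuous.\<close>

lemma Rm_cont:
  assumes ij: "i < n" "j < n"
  shows "continuous_on {0..T} (\<lambda>t. Rm t i j)"
  unfolding continuous_on_eq_continuous_within
proof
  fix t assume t: "t \<in> {0..T}"
  let ?c = "ch (\<gamma> t)"
  have c: "?c \<in> \<A>" "\<gamma> t \<in> fst ?c" by (rule ch)+
  have xd: "pos ?c t \<in> dom ?c" by (rule chart(8)[OF c])
  have lim: "((\<lambda>s. cpt ?c s (vel s)) \<longlongrightarrow> cpt ?c t (vel t)) (at t within {0..T})"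
    "((\<lambda>s. cpt ?c s (e i s)) \<longlongrightarrow> cpt ?c t (e i t)) (at t within {0..T})"
    "((\<lambda>s. cpt ?c s (e j s)) \<longlongrightarrow> cpt ?c t (e j t)) (at t within {0..T})"
    using vel_comp_differentiable[OF c(1) t c(2)] e_comp_differentiable[OF ij(1) c(1) t c(2)]
      e_comp_differentiable[OF ij(2) c(1) t c(2)] differentiable_imp_continuous_within
    unfolding continuous_within by blast+
  have limx: "(pos ?c \<longlongrightarrow> pos ?c t) (at t within {0..T})"
    using has_vector_derivative_continuous[OF pos_has_derivative[OF c(1) t c(2)]] by (simp add: continuous_within)
  have "((\<lambda>s. curv ?c (pos ?c s) (cpt ?c s (vel s)) (cpt ?c s (e i s)) (cpt ?c s (vel s))) \<longlongrightarrow>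
     curv ?c (pos ?c t) (cpt ?c t (vel t)) (cpt ?c t (e i t)) (cpt ?c t (vel t))) (at t within {0..T})"
    by (rule tendsto_trilinear_param[where K = "curv ?c", OF chart(2)[OF c(1)] xd curv_linear1[OF c(1)] curv_linear2[OF c(1)]
          curv_linear3[OF c(1)] isCont_curv[OF c(1) xd] limx lim(1,2,1)])
  moreover have "isCont (\<lambda>z. met ?c z p r) (pos ?c t)" for p r
    using differentiable_imp_continuous_within[OF met_differentiable[OF c(1) xd]] by simp
  ultimately have "((\<lambda>s. met ?c (pos ?c s) (curv ?c (pos ?c s) (cpt ?c s (vel s)) (cpt ?c s (e i s)) (cpt ?c s (vel s)))
      (cpt ?c s (e j s))) \<longlongrightarrow> met ?c (pos ?c t) (curv ?c (pos ?c t) (cpt ?c t (vel t)) (cpt ?c t (e i t)) (cpt ?c t (vel t)))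
      (cpt ?c t (e j t))) (at t within {0..T})"
    by (intro tendsto_bilinear_param[where B = "met ?c", OF chart(2)[OF c(1)] xd met_props(1)[OF c(1)] _ limx _ lim(3)])
  moreover have eq: "met ?c (pos ?c s) (curv ?c (pos ?c s) (cpt ?c s (vel s)) (cpt ?c s (e i s)) (cpt ?c s (vel s)))
      (cpt ?c s (e j s)) = Rm s i j" if "\<gamma> s \<in> fst ?c" for s
    using that by (simp add: curvature_matrix_def components_curvature[OF c(1), symmetric] met_components[OF c(1)])
  have "\<forall>\<^sub>F s in at t within {0..T}. met ?c (pos ?c s) (curv ?c (pos ?c s) (cpt ?c s (vel s)) (cpt ?c s (e i s)) (cpt ?c s (vel s)))
      (cpt ?c s (e j s)) = Rm s i j"
    using comp_near[OF t] by eventually_elim (simp add: eq)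
  ultimately show "continuous (at t within {0..T}) (\<lambda>t. Rm t i j)"
    unfolding continuous_within eq[OF c(2)] by (rule Lim_transform_eventually)
qed

text \<open>The frames at 0 and at \<open>T\<close> are orthonormal for the same form with the same
  signs, because \<open>\<gamma> T = \<gamma> 0\<close>.\<close>

lemma holonomy_isometry:
  assumes ij: "i < n" "j < n"
  shows "(\<Sum>k<n. sig n \<kappa> k * A $$ (k, i) * A $$ (k, j)) = (if i = j then sig n \<kappa> i else 0)"
proof -
  have T0: "T \<in> {0..T}" "0 \<in> {0..T}" using T by auto
  have eT: "e j T = (\<Sum>i<n. A $$ (i, j) *\<^sub>R e i 0)" if "j < n" for j
    using hol that by (simp add: holonomy_matrix_def)
  have "g (\<gamma> 0) (e i T) (e j T) = (\<Sum>k<n. A $$ (k, i) * (\<Sum>l<n. A $$ (l, j) * g (\<gamma> 0) (e k 0) (e l 0)))"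
    unfolding eT[OF ij(1)] eT[OF ij(2)]
    by (simp only: linear_sum[OF bilinear_linear_left[OF g_props(1)]] linear_scale[OF bilinear_linear_left[OF g_props(1)]],
        simp add: linear_sum[OF bilinear_linear_right[OF g_props(1)]] linear_scale[OF bilinear_linear_right[OF g_props(1)]])
  also have "\<dots> = (\<Sum>k<n. A $$ (k, i) * (\<Sum>l<n. if l = k then A $$ (k, j) * sig n \<kappa> k else 0))"
    by (intro sum.cong arg_cong2[where f = times] refl) (auto simp: e_orthonormal[OF T0(2)])
  also have "\<dots> = (\<Sum>k<n. sig n \<kappa> k * A $$ (k, i) * A $$ (k, j))"
    by (rule sum.cong) auto
  finally show ?thesis using e_orthonormal[OF T0(1) ij] periodic by simp
qed

section \<open>The linearized Poincare map\<close>

abbreviation "N \<equiv> {v. g (\<gamma> 0) v (vel 0) = 0}"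

text \<open>Identifies phase space with \<open>N \<times> N\<close> through the frame at time
  0.\<close>

definition emb :: "(nat \<Rightarrow> real) \<Rightarrow> 'b \<times> 'b" where
  "emb z = (\<Sum>i<n. z i *\<^sub>R e i 0, \<Sum>i<n. z (n + i) *\<^sub>R e i 0)"

lemma index_problem: "index_problem n \<kappa> T A Rm"
  by unfold_locales (use T Rm_cont Rm_sym holonomy_isometry in auto)

sublocale index_problem n \<kappa> T A Rm by (rule index_problem)

lemma T_mem: "0 \<in> {0..T}" "T \<in> {0..T}" using T by auto

lemma emb_cong: "(\<And>i. i < 2 * n \<Longrightarrow> z i = w i) \<Longrightarrow> emb z = emb w"
  by (simp add: emb_def)

lemma emb_linear: "emb (\<lambda>i. a * z i + b * w i) = a *\<^sub>R emb z + b *\<^sub>R emb w"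
  by (simp add: emb_def scaleR_left_distrib sum.distrib scaleR_sum_right)

lemma emb_in_N: "emb z \<in> N \<times> N"
proof -
  have "(\<Sum>i<n. c i *\<^sub>R e i 0) \<in> span ((\<lambda>i. e i 0) ` {..<n})" for c
    by (intro span_sum span_scale span_base) auto
  then show ?thesis unfolding e_span[OF T_mem(1)] emb_def by simp
qed

definition coord :: "'b \<times> 'b \<Rightarrow> nat \<Rightarrow> real" where
  "coord v i = (if i < n then frame_coord i 0 (fst v) else frame_coord (i - n) 0 (snd v))"

lemma coord_emb: "i < 2 * n \<Longrightarrow> coord (emb z) i = z i"
  using frame_coord_sum_e[OF T_mem(1)] by (auto simp: coord_def emb_def)

lemma emb_coord: "v \<in> N \<times> N \<Longrightarrow> emb (coord v) = v"
proof -
  assume v: "v \<in> N \<times> N"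
  have *: "(\<Sum>i<n. frame_coord i 0 w *\<^sub>R e i 0) = w" if "w \<in> N" for w
  proof (rule frame_coord_eqI[OF T_mem(1)])
    fix i assume "i \<le> n"
    then show "frame_coord i 0 (\<Sum>i<n. frame_coord i 0 w *\<^sub>R e i 0) = frame_coord i 0 w"
      using frame_coord_sum_e[OF T_mem(1), of i "\<lambda>i. frame_coord i 0 w"] that by (auto simp: frame_coord_def frame_vec_def)
  qed
  show ?thesis using *[of "fst v"] *[of "snd v"] v by (auto simp: emb_def coord_def mem_Times_iff prod_eq_iff)
qed

lemma emb_inj: "emb z = emb w \<Longrightarrow> i < 2 * n \<Longrightarrow> z i = w i"
  using coord_emb by metis

text \<open>The frame at \<open>T\<close> is re-expanded in the frame at 0; here the holonomy enters
  the return map.\<close>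

lemma holonomy_emb: "(\<Sum>j<n. y j *\<^sub>R e j T, \<Sum>j<n. y (n + j) *\<^sub>R e j T) = emb (A_phase y)"
proof -
  have *: "(\<Sum>j<n. c j *\<^sub>R e j T) = (\<Sum>i<n. (\<Sum>j<n. A $$ (i, j) * c j) *\<^sub>R e i 0)" for c
  proof -
    have "(\<Sum>j<n. c j *\<^sub>R e j T) = (\<Sum>j<n. \<Sum>i<n. (A $$ (i, j) * c j) *\<^sub>R e i 0)"
      using hol by (intro sum.cong refl) (simp add: holonomy_matrix_def scaleR_sum_right mult.commute)
    also have "\<dots> = (\<Sum>i<n. \<Sum>j<n. (A $$ (i, j) * c j) *\<^sub>R e i 0)" by (rule sum.swap)
    finally show ?thesis by (simp add: scaleR_sum_left)
  qed
  show ?thesis unfolding * by (simp add: emb_def A_phase_def)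
qed

text \<open>In frame coordinates the Jacobi equation is the phase system with
  \<open>\<tau> = 1\<close> and \<open>s = l = 0\<close>, and re-expanding the end value in the
  frame at 0 supplies the action of \<open>A\<close>.\<close>

lemma jacobi_phase:
  assumes \<xi>: "jacobi_field \<A> g T \<gamma> \<xi>" and init: "(\<xi> 0, cov \<xi> 0) = emb z"
  shows "(\<xi> T, cov \<xi> T) = emb (return_map 1 0 0 z)"
proof -
  define u where "u t i = (if i < n then frame_coord i t (\<xi> t) else frame_coord (i - n) t (cov \<xi> t))" for t i
  have d: "along \<xi>" "along (cov \<xi>)" and eq: "\<And>t. t \<in> {0..T} \<Longrightarrow> cov (cov \<xi>) t = curvature \<A> g (\<gamma> t) (vel t) (\<xi> t) (vel t)"
    using \<xi> by (auto simp: jacobi_field_def)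
  \<comment> \<open>The curvature term is normal, so the tangential coordinate of
    \<open>cov \<xi>\<close> is constant and stays 0; then the same holds for that of
    \<open>\<xi>\<close>.\<close>
  have tang: "frame_coord n t (\<xi> t) = 0 \<and> frame_coord n t (cov \<xi> t) = 0" if t: "t \<in> {0..T}" for t
  proof -
    have i0: "frame_coord n 0 (\<xi> 0) = 0" "frame_coord n 0 (cov \<xi> 0) = 0"
      using init frame_coord_sum_e[OF T_mem(1), of n] by (simp_all add: emb_def)
    have const: "f t = f 0" if "\<And>s. s \<in> {0..T} \<Longrightarrow> (f has_real_derivative 0) (at s within {0..T})" "t \<in> {0..T}" for f t
      by (rule has_field_derivative_zero_constant[of "{0..T}" f, THEN exE])
        (use that T_mem in auto)
    have "frame_coord n s (cov \<xi> s) = 0" if s: "s \<in> {0..T}" for s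
      using const[of "\<lambda>s. frame_coord n s (cov \<xi> s)", OF _ s] frame_coord_has_derivative[OF d(2), of _ n] eq frame_coord_curvature(2) i0 by simp
    moreover from this have "frame_coord n t (\<xi> t) = 0"
      using const[of "\<lambda>s. frame_coord n s (\<xi> s)", OF _ t] frame_coord_has_derivative[OF d(1), of _ n] i0 by simp
    ultimately show ?thesis using t by blast
  qed
  have repr: "\<xi> t = (\<Sum>j<n. u t j *\<^sub>R e j t)" "cov \<xi> t = (\<Sum>j<n. u t (n + j) *\<^sub>R e j t)" if t: "t \<in> {0..T}" for t
  proof -
    show "\<xi> t = (\<Sum>j<n. u t j *\<^sub>R e j t)"
    proof (rule frame_coord_eqI[OF t])
      fix i assume "i \<le> n"
      then show "frame_coord i t (\<xi> t) = frame_coord i t (\<Sum>j<n. u t j *\<^sub>R e j t)"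
        using tang[OF t] by (auto simp: frame_coord_sum_e[OF t] u_def le_less)
    qed
    show "cov \<xi> t = (\<Sum>j<n. u t (n + j) *\<^sub>R e j t)"
    proof (rule frame_coord_eqI[OF t])
      fix i assume "i \<le> n"
      then show "frame_coord i t (cov \<xi> t) = frame_coord i t (\<Sum>j<n. u t (n + j) *\<^sub>R e j t)"
        using tang[OF t] by (auto simp: frame_coord_sum_e[OF t] u_def le_less)
    qed
  qed
  have "sol 1 0 0 u"
    unfolding sol_iff
  proof (intro ballI allI impI conjI)
    fix t i assume t: "t \<in> {0..T}" and i: "i < n"
    show "((\<lambda>t. u t i) has_real_derivative u t (n + i)) (at t within {0..T})"
      using frame_coord_has_derivative[OF d(1) t, of i] i by (simp add: u_def)
    have "((\<lambda>t. u t (n + i)) has_real_derivative frame_coord i t (cov (cov \<xi>) t)) (at t within {0..T})"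
      using frame_coord_has_derivative[OF d(2) t, of i] i by (simp add: u_def)
    also have "frame_coord i t (cov (cov \<xi>) t) = sig n \<kappa> i * (\<Sum>j<n. Rm t i j * u t j)"
      unfolding eq[OF t] by (rule frame_coord_curvature(1)[OF t repr(1)[OF t] i])
    finally show "((\<lambda>t. u t (n + i)) has_real_derivative
        1 * sig n \<kappa> i * (\<Sum>j<n. Rm t i j * u t j) + 0 * u t i - 0 * sig n \<kappa> i * u t i) (at t within {0..T})"
      by simp
  qed
  moreover have "u 0 i = z i" if "i < 2 * n" for i
  proof -
    have "u 0 = coord (\<xi> 0, cov \<xi> 0)" by (simp add: u_def coord_def fun_eq_iff)
    then show ?thesis using coord_emb[OF that, of z] init by simp
  qed
  ultimately have fl: "flow 1 0 0 z T i = u T i" if "i < 2 * n" for i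
    using flow_unique[of 1 0 0 u z T i] T_mem(2) that by blast
  have "(\<xi> T, cov \<xi> T) = emb (A_phase (u T))"
    unfolding repr(1)[OF T_mem(2)] repr(2)[OF T_mem(2)] by (rule holonomy_emb)
  also have "\<dots> = emb (return_map 1 0 0 z)"
    unfolding return_map_def by (rule emb_cong, rule A_phase_cong) (simp_all add: fl)
  finally show ?thesis .
qed

lemma jacobi_exists: "\<exists>\<xi>. jacobi_field \<A> g T \<gamma> \<xi> \<and> (\<xi> 0, cov \<xi> 0) = emb z"
proof -
  let ?y = "flow 1 0 0 z"
  define \<xi> where "\<xi> t = (\<Sum>i<n. ?y t i *\<^sub>R e i t)" for t
  note y = sol_flow[of 1 0 0 z, unfolded sol_iff, rule_format]
  have c1: "along \<xi>" "\<And>t. t \<in> {0..T} \<Longrightarrow> cov \<xi> t = (\<Sum>i<n. ?y t (n + i) *\<^sub>R e i t)"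
    using cov_frame_sum[of \<xi> ?y "\<lambda>t i. ?y t (n + i)"] y by (auto simp: \<xi>_def)
  have c2: "along (cov \<xi>)" "\<And>t. t \<in> {0..T} \<Longrightarrow> cov (cov \<xi>) t = (\<Sum>i<n. (sig n \<kappa> i * (\<Sum>j<n. Rm t i j * ?y t j)) *\<^sub>R e i t)"
    using cov_frame_sum[of "cov \<xi>" "\<lambda>t i. ?y t (n + i)" "\<lambda>t i. sig n \<kappa> i * (\<Sum>j<n. Rm t i j * ?y t j)"] y c1(2) by auto
  have "cov (cov \<xi>) t = curvature \<A> g (\<gamma> t) (vel t) (\<xi> t) (vel t)" if t: "t \<in> {0..T}" for t
  proof (rule frame_coord_eqI[OF t])
    fix i assume "i \<le> n"
    then show "frame_coord i t (cov (cov \<xi>) t) = frame_coord i t (curvature \<A> g (\<gamma> t) (vel t) (\<xi> t) (vel t))"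
      using frame_coord_curvature[OF t \<xi>_def] unfolding c2(2)[OF t] by (auto simp: frame_coord_sum_e[OF t] le_less)
  qed
  then have "jacobi_field \<A> g T \<gamma> \<xi>" unfolding jacobi_field_def using c1(1) c2(1) by simp
  moreover have "(\<xi> 0, cov \<xi> 0) = emb z"
    unfolding c1(2)[OF T_mem(1)] by (simp add: \<xi>_def emb_def flow_0)
  ultimately show ?thesis by blast
qed

text \<open>\<open>jacobi_exists\<close> provides a value for the definite description, and
  \<open>jacobi_phase\<close> its uniqueness, as it determines the end values from
  \<open>z\<close>.\<close>

lemma poincare_map_emb: "poincare_map \<A> g T \<gamma> (emb z) = emb (return_map 1 0 0 z)"
  unfolding poincare_map_def
proof (rule the_equality)
  obtain \<xi> where \<xi>: "jacobi_field \<A> g T \<gamma> \<xi>" "(\<xi> 0, cov \<xi> 0) = emb z" using jacobi_exists by blast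
  then show "\<exists>\<xi>. jacobi_field \<A> g T \<gamma> \<xi> \<and> emb z = (\<xi> 0, cov \<xi> 0) \<and> emb (return_map 1 0 0 z) = (\<xi> T, cov \<xi> T)"
    using jacobi_phase[OF \<xi>] by metis
  show "r = emb (return_map 1 0 0 z)"
    if "\<exists>\<xi>. jacobi_field \<A> g T \<gamma> \<xi> \<and> emb z = (\<xi> 0, cov \<xi> 0) \<and> r = (\<xi> T, cov \<xi> T)" for r
    using that jacobi_phase by metis
qed

lemma stable_no_large_eigenvalue:
  assumes st: "linearly_stable \<A> g T \<gamma>" and c: "c > 1"
    and z: "\<And>i. i < 2 * n \<Longrightarrow> return_map 1 0 0 z i = c * z i" and i: "i < 2 * n"
  shows "z i = 0"
proof (rule ccontr)
  assume zi: "z i \<noteq> 0"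
  have e0: "emb (\<lambda>_. 0) = 0" by (simp add: emb_def zero_prod_def)
  have ne: "emb z \<noteq> 0"
  proof
    assume "emb z = 0"
    then have "emb z = emb (\<lambda>_. 0)" using e0 by simp
    from emb_inj[OF this i] show False using zi by simp
  qed
  have "poincare_map \<A> g T \<gamma> (emb z) = emb (\<lambda>i. c * z i + 0 * z i)"
    unfolding poincare_map_emb by (rule emb_cong) (simp add: z)
  then have P: "poincare_map \<A> g T \<gamma> (emb z) = c *\<^sub>R emb z" unfolding emb_linear by simp
  have "poincare_map \<A> g T \<gamma> (emb (\<lambda>_. 0)) = emb (\<lambda>_. 0)"
    unfolding poincare_map_emb by (rule emb_cong) (simp add: return_map_lincomb[where S = "{}"])
  \<comment> \<open>In the encoding of complex vectors by pairs a real eigenvector has imaginary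
    part 0, which the map has to send to 0.\<close>
  then have "(emb z, 0) \<in> cplx_eigenspace (poincare_map \<A> g T \<gamma>) (N \<times> N) (of_real c)"
    using emb_in_N[of z] emb_in_N[of "\<lambda>_. 0"] P unfolding cplx_eigenspace_def e0 by simp
  then have "of_real c \<in> cplx_spectrum (poincare_map \<A> g T \<gamma>) (N \<times> N)"
    unfolding cplx_spectrum_def using ne by (auto intro!: bexI[of _ "(emb z, 0)"] simp: zero_prod_def)
  then have "of_real c \<in> sphere (0 :: complex) 1"
    using st unfolding linearly_stable_def Let_def by blast
  then show False using c by simp
qed

text \<open>\<open>P\<close> is symplectic and fixes \<open>z\<close>, so an eigenvector
  \<open>w\<close> for \<open>\<mu>\<close> satisfies \<open>omega z w = \<mu> * omega z w\<close>.
  Eigenvectors for \<open>\<mu> \<noteq> 1\<close> are thus orthogonal to \<open>z\<close>, and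
  those for 1 are so by \<open>om\<close>. Since \<open>P\<close> is semisimple, eigenvectors span,
  and \<open>z\<close> lies in the radical of \<open>omega\<close>.\<close>

lemma stable_nondegenerate:
  assumes st: "linearly_stable \<A> g T \<gamma>" and z: "return_fixed 1 0 0 z"
    and om: "\<And>w. return_fixed 1 0 0 w \<Longrightarrow> omega w z = 0" and i: "i < 2 * n"
  shows "z i = 0"
proof -
  define lf where "lf v = omega z (coord v)" for v
  have lin: "linear lf"
  proof (rule linearI)
    have ca: "coord (u + v) i = coord u i + coord v i" "coord (r *\<^sub>R u) i = r * coord u i" for u v r i
      by (simp_all add: coord_def linear_add[OF frame_coord_linear] linear_scale[OF frame_coord_linear])
    show "lf (u + v) = lf u + lf v" for u v
      unfolding lf_def omega_def ca sum.distrib[symmetric] by (rule sum.cong) (auto simp: algebra_simps)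
    show "lf (r *\<^sub>R u) = r *\<^sub>R lf u" for r u
      unfolding lf_def omega_def ca real_scaleR_def sum_distrib_left by (rule sum.cong) (auto simp: algebra_simps)
  qed
  have lf_emb: "lf (emb w) = omega z w" for w
    unfolding lf_def by (rule omega_cong) (simp_all add: coord_emb)
  have eig: "lf p = 0 \<and> lf q = 0" if pq: "(p, q) \<in> cplx_eigenspace (poincare_map \<A> g T \<gamma>) (N \<times> N) \<mu>" for p q \<mu>
  proof -
    have N: "p \<in> N \<times> N" "q \<in> N \<times> N" and eq: "poincare_map \<A> g T \<gamma> p = Re \<mu> *\<^sub>R p - Im \<mu> *\<^sub>R q"
      "poincare_map \<A> g T \<gamma> q = Im \<mu> *\<^sub>R p + Re \<mu> *\<^sub>R q"
      using pq by (auto simp: cplx_eigenspace_def)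
    define a b where "a = coord p" and "b = coord q"
    have p: "p = emb a" and q: "q = emb b" using emb_coord N by (simp_all add: a_def b_def)
    have "emb (return_map 1 0 0 a) = emb (\<lambda>i. Re \<mu> * a i + (- Im \<mu>) * b i)"
      using eq(1) unfolding p q poincare_map_emb emb_linear by simp
    note pa = emb_inj[OF this]
    have "emb (return_map 1 0 0 b) = emb (\<lambda>i. Im \<mu> * a i + Re \<mu> * b i)"
      using eq(2) unfolding p q poincare_map_emb emb_linear by simp
    note pb = emb_inj[OF this]
    have inv: "omega z (return_map 1 0 0 w) = omega z w" for w
      using omega_kernel[OF z, of 0 w] by (simp add: omega_diff_right)
    have omlin: "omega z (\<lambda>i. c * a i + d * b i) = c * omega z a + d * omega z b" for c d
      unfolding omega_def sum_distrib_left sum.distrib[symmetric] by (rule sum.cong) (auto simp: algebra_simps)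
    have "omega z a = omega z (\<lambda>i. Re \<mu> * a i + (- Im \<mu>) * b i)"
      unfolding inv[of a, symmetric] by (rule omega_cong) (simp_all add: pa)
    then have 1: "omega z a = Re \<mu> * omega z a - Im \<mu> * omega z b" unfolding omlin by simp
    have "omega z b = omega z (\<lambda>i. Im \<mu> * a i + Re \<mu> * b i)"
      unfolding inv[of b, symmetric] by (rule omega_cong) (simp_all add: pb)
    then have 2: "omega z b = Im \<mu> * omega z a + Re \<mu> * omega z b" unfolding omlin by simp
    have "omega z a = 0 \<and> omega z b = 0"
    proof (cases "\<mu> = 1")
      case True
      have "return_fixed 1 0 0 a" "return_fixed 1 0 0 b" using pa pb True by (simp_all add: return_fixed_def)
      then show ?thesis using om omega_skew[of z] by simp
    next
      case False
      let ?\<alpha> = "omega z a" and ?\<beta> = "omega z b"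
      have z1: "?\<alpha> - Re \<mu> * ?\<alpha> + Im \<mu> * ?\<beta> = 0" and z2: "?\<beta> - Im \<mu> * ?\<alpha> - Re \<mu> * ?\<beta> = 0"
        using 1 2 by linarith+
      \<comment> \<open>\<open>z1\<close> and \<open>z2\<close> are the real and imaginary parts of
        \<open>(1 - \<mu>) * omega z w = 0\<close> with \<open>w = a + i b\<close>. Eliminating
        either unknown multiplies the other by the determinant of the system, the squared modulus of
        \<open>1 - \<mu>\<close>.\<close>
      have "((1 - Re \<mu>)\<^sup>2 + (Im \<mu>)\<^sup>2) * ?\<alpha> = (1 - Re \<mu>) * (?\<alpha> - Re \<mu> * ?\<alpha> + Im \<mu> * ?\<beta>)
           - Im \<mu> * (?\<beta> - Im \<mu> * ?\<alpha> - Re \<mu> * ?\<beta>)"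
        by (simp add: power2_eq_square algebra_simps)
      also have "\<dots> = 0" unfolding z1 z2 by simp
      finally have \<alpha>: "((1 - Re \<mu>)\<^sup>2 + (Im \<mu>)\<^sup>2) * ?\<alpha> = 0" .
      have "((1 - Re \<mu>)\<^sup>2 + (Im \<mu>)\<^sup>2) * ?\<beta> = (1 - Re \<mu>) * (?\<beta> - Im \<mu> * ?\<alpha> - Re \<mu> * ?\<beta>)
           + Im \<mu> * (?\<alpha> - Re \<mu> * ?\<alpha> + Im \<mu> * ?\<beta>)"
        by (simp add: power2_eq_square algebra_simps)
      also have "\<dots> = 0" unfolding z1 z2 by simp
      finally have \<beta>: "((1 - Re \<mu>)\<^sup>2 + (Im \<mu>)\<^sup>2) * ?\<beta> = 0" .
      have "(1 - Re \<mu>)\<^sup>2 + (Im \<mu>)\<^sup>2 \<noteq> 0" using False by (auto simp: sum_power2_eq_zero_iff complex_eq_iff)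
      then show ?thesis using \<alpha> \<beta> mult_eq_0_iff by metis
    qed
    then show ?thesis by (simp add: p q lf_emb)
  qed
  have "span (\<Union>\<mu>. cplx_eigenspace (poincare_map \<A> g T \<gamma>) (N \<times> N) \<mu>) \<subseteq> {(p, q). lf p = 0 \<and> lf q = 0}"
  proof (rule span_minimal)
    show "(\<Union>\<mu>. cplx_eigenspace (poincare_map \<A> g T \<gamma>) (N \<times> N) \<mu>) \<subseteq> {(p, q). lf p = 0 \<and> lf q = 0}"
      using eig by auto
    show "subspace {(p, q). lf p = 0 \<and> lf q = 0}"
      unfolding subspace_def using linear_0[OF lin] linear_add[OF lin] linear_scale[OF lin]
      by (auto simp: zero_prod_def)
  qed
  moreover have "span (\<Union>\<mu>. cplx_eigenspace (poincare_map \<A> g T \<gamma>) (N \<times> N) \<mu>) = (N \<times> N) \<times> (N \<times> N)"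
    using st unfolding linearly_stable_def Let_def cplx_diagonalizable_def by blast
  ultimately have "lf v = 0" if "v \<in> N \<times> N" for v using that by blast
  then have "omega z w = 0" for w using lf_emb[of w] emb_in_N[of w] by simp
  then have "omega (unitv j) z = 0" for j using omega_skew[of "unitv j" z] by simp
  then show ?thesis using omega_nondegenerate i by blast
qed

lemma unstable:
  assumes ind: "has_spectral_index \<A> g n \<kappa> T \<gamma> e A \<iota>"
    and par: "(oriented A \<and> odd (\<iota> + int n)) \<or> (non_oriented A \<and> even (\<iota> + int n))"
  shows "\<not> linearly_stable \<A> g T \<gamma>"
proof
  assume st: "linearly_stable \<A> g T \<gamma>"
  obtain s0 where s0: "s0 > 0" "\<And>s. s \<ge> s0 \<Longrightarrow> op_eigenspace (index_op s) 0 = {0}" "has_spectral_flow n T index_op 0 s0 \<iota>"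
    using ind unfolding has_spectral_index_def Let_def by blast
  have "(if even \<iota> then 1 else -1) = (-1) ^ n * Determinant.det A"
  proof (rule stable_parity[OF _ _ s0])
    show "A \<in> carrier_mat n n" using hol by (simp add: holonomy_matrix_def)
    show "Determinant.det A \<in> {1, -1}" using par by (auto simp: oriented_def non_oriented_def)
    show "z i = 0" if "c > 1" "\<And>i. i < 2 * n \<Longrightarrow> return_map 1 0 0 z i = c * z i" "i < 2 * n" for c z i
      using st that by (rule stable_no_large_eigenvalue)
    show "z i = 0" if "return_fixed 1 0 0 z" "\<And>w. return_fixed 1 0 0 w \<Longrightarrow> omega w z = 0" "i < 2 * n" for z i
      using st that by (rule stable_nondegenerate)
  qed
  then show False using par by (auto simp: oriented_def non_oriented_def minus_one_power_iff split: if_splits)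
qed

end

theorem theorem3:
  fixes \<A> :: "('a::{t2_space,second_countable_topology}, 'e::euclidean_space) chart set"
    and g :: "'a \<Rightarrow> 'e \<Rightarrow> 'e \<Rightarrow> real"
    and n \<nu> \<kappa> :: nat
    and T :: real
    and \<gamma> :: "real \<Rightarrow> 'a"
    and e :: "nat \<Rightarrow> real \<Rightarrow> 'e"
    and A :: "real mat"
    and \<iota> :: int
  assumes "DIM('e) = n + 1"
    and "semi_riemannian_manifold \<A> g \<nu>"
    and "closed_geodesic \<A> g T \<gamma>"
    and "non_lightlike \<A> g T \<gamma>"
    and "\<kappa> = normal_index \<A> g \<nu> T \<gamma>"
    and "parallel_orthonormal_frame \<A> g n \<kappa> T \<gamma> e"
    and "holonomy_matrix n T e A"
    and "has_spectral_index \<A> g n \<kappa> T \<gamma> e A \<iota>"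
    and "(oriented A \<and> odd (\<iota> + int n)) \<or> (non_oriented A \<and> even (\<iota> + int n))"
  shows "\<not> linearly_stable \<A> g T \<gamma>"
proof -
  interpret geodesic_frame \<A> g \<nu> n \<kappa> T \<gamma> e A
    using assms by unfold_locales
  show ?thesis using assms(8,9) by (rule unstable)
qed

end
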